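(* Let $S$ be a graded quotient algebra of a right noetherian connected graded regular algebra, $f\in S_d$ a regular normal element with $d\geq 1$, and $A=S/(f)$. Then the factor category $\operatorname{NMF}^{\mathbb Z}_S(f)/\mathcal F$ is equivalent to $\operatorname{TR}^{\mathbb Z}_S(A)$. Moreover, the factor category $\operatorname{NMF}^{\mathbb Z}_S(f)/\mathcal G$ is equivalent to the factor category $\operatorname{TR}^{\mathbb Z}_S(A)/\mathcal P$.
   Context: $k$ is a fixed field; graded algebras are $\mathbb N$-graded $k$-algebras; connected graded means degree-zero part equals $k$; regular means finite global dimension. $\operatorname{GrMod}$ (resp. $\operatorname{grmod}$) denotes graded right modules (resp. finitely generated ones) with degree-preserving homomorphisms; $M(n)_i=M_{n+i}$. An element $f\in S$ is regular if $af=0$ or $fa=0$ implies $a=0$, and normal if $Sf=fS$. A noncommutative graded right matrix factorization of $f\in S_d$ over $S$ is a sequence $\{\phi^i:F^{i+1}\to F^i\}_{i\in\mathbb Z}$ of graded right $S$-module homomorphisms, where for some $r\in\mathbb N$ all $F^i$ are graded free right $S$-modules of rank $r$, such that for every $i$ there are isomorphisms $F^{i+2}\cong\bigoplus_{s=1}^rS(-m_{i+2,s})=\bigoplus_{s=1}^rS(-m_{is}-d)$ and $F^i\cong\bigoplus_{s=1}^rS(-m_{is})$ under which $\phi^i\phi^{i+1}$ corresponds to left multiplication by $f$. A morphism $\{\phi^i:F^{i+1}\to F^i\}\to\{\psi^i:G^{i+1}\to G^i\}$ is a sequence of graded homomorphisms $\mu^i:F^i\to G^i$ with $\mu^i\phi^i=\psi^i\mu^{i+1}$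 for all $i$. The category is $\operatorname{NMF}^{\mathbb Z}_S(f)$. By convention one works with the equivalent full subcategory of objects with $F^i=\bigoplus_sS(-m_{is})$, $m_{i+2,s}=m_{is}+d$, and $\phi^i\phi^{i+1}=f\cdot$ exactly. For a graded free right $S$-module $F$ (of finite rank), $\phi_F,{}_F\phi\in\operatorname{NMF}^{\mathbb Z}_S(f)$ are: $\phi_F^{2i}=\operatorname{id}_F:F(-id)\to F(-id)$, $\phi_F^{2i+1}=f\cdot:F(-id-d)\to F(-id)$; ${}_F\phi^{2i}=f\cdot:F(-id-d)\to F(-id)$, ${}_F\phi^{2i+1}=\operatorname{id}_F:F(-id-d)\to F(-id-d)$. Set $\mathcal F=\{\phi_F\mid F\in\operatorname{grmod}S\text{ free}\}$, $\mathcal G=\{\phi_F\oplus{}_G\phi\mid F,G\in\operatorname{grmod}S\text{ free}\}$, $\mathcal P=\{P\in\operatorname{grmod}A\mid P\text{ free}\}$. A graded right $A$-module $M$ is totally reflexive if $\operatorname{Ext}^i_A(M,A)=0$ and $\operatorname{Ext}^i_{A^o}(\operatorname{Hom}_A(M,A),A)=0$ for all $i\geq1$ and the natural map $M\to\operatorname{Hom}_{A^o}(\operatorname{Hom}_A(M,A),A)$ is an isomorphism ($A^o$ is the opposite ring). $\operatorname{TR}^{\mathbb Z}(A)\subset\operatorname{grmod}A$ is the full subcategory of graded totally reflexive modules and $\operatorname{TR}^{\mathbb Z}_S(A)=\{M\in\operatorname{TR}^{\mathbb Z}(A)\mid\operatorname{projdim}_S(M)<\infty\}$. For an additive category $\mathcal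 C$ and a set $\mathcal X$ of objects closed under direct sums, the factor category $\mathcal C/\mathcal X$ has the same objects and $\operatorname{Hom}_{\mathcal C/\mathcal X}(M,N)=\operatorname{Hom}_{\mathcal C}(M,N)/\mathcal X(M,N)$, where $\mathcal X(M,N)$ is the subgroup of morphisms factoring through objects of $\mathcal X$. *)

theory Defs
  imports
    "HOL-Algebra.Module"
    "HOL-Algebra.QuotRing"
    "HOL-Algebra.Elementary_Groups"
    "HOL-Library.FuncSet"
    "HOL-Library.Extended_Nat"
begin

section \<open>Right modules over a not necessarily commutative ring\<close>

text \<open>
  Right modules reuse the record \<^type>\<open>module\<close>; the term \<open>smult M a x\<close> stands for the
  product \<open>x \<cdot> a\<close>.  As in any module of the library, the fields \<open>mult\<close> and \<open>one\<close> carry no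
  information.  All homomorphisms are extensional functions, so that equality of functions is
  equality of morphisms.  A left \<open>R\<close>-module is a right module over the opposite ring.
\<close>

definition right_module :: "('a, 'c) ring_scheme \<Rightarrow> ('a, 'm, 'e) module_scheme \<Rightarrow> bool" where
  "right_module R M \<longleftrightarrow> ring R \<and> abelian_group M \<and>
     (\<forall>a\<in>carrier R. \<forall>x\<in>carrier M. a \<odot>\<^bsub>M\<^esub> x \<in> carrier M) \<and>
     (\<forall>a\<in>carrier R. \<forall>b\<in>carrier R. \<forall>x\<in>carrier M.
        (a \<oplus>\<^bsub>R\<^esub> b) \<odot>\<^bsub>M\<^esub> x = a \<odot>\<^bsub>M\<^esub> x \<oplus>\<^bsub>M\<^esub> b \<odot>\<^bsub>M\<^esub> x) \<and>
     (\<forall>a\<in>carrier R. \<forall>x\<in>carrier M. \<forall>y\<in>carrier M.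
        a \<odot>\<^bsub>M\<^esub> (x \<oplus>\<^bsub>M\<^esub> y) = a \<odot>\<^bsub>M\<^esub> x \<oplus>\<^bsub>M\<^esub> a \<odot>\<^bsub>M\<^esub> y) \<and>
     (\<forall>a\<in>carrier R. \<forall>b\<in>carrier R. \<forall>x\<in>carrier M.
        (a \<otimes>\<^bsub>R\<^esub> b) \<odot>\<^bsub>M\<^esub> x = b \<odot>\<^bsub>M\<^esub> (a \<odot>\<^bsub>M\<^esub> x)) \<and>
     (\<forall>x\<in>carrier M. \<one>\<^bsub>R\<^esub> \<odot>\<^bsub>M\<^esub> x = x)"

definition opposite_ring :: "('a, 'c) ring_scheme \<Rightarrow> ('a, 'c) ring_scheme" where
  "opposite_ring R = R\<lparr>mult := \<lambda>x y. y \<otimes>\<^bsub>R\<^esub> x\<rparr>"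

definition regular_module :: "('a, 'c) ring_scheme \<Rightarrow> ('a, 'a) module" where
  "regular_module R =
     \<lparr>carrier = carrier R, mult = undefined, one = undefined,
      zero = \<zero>\<^bsub>R\<^esub>, add = (\<oplus>\<^bsub>R\<^esub>), smult = \<lambda>a x. x \<otimes>\<^bsub>R\<^esub> a\<rparr>"

definition submodule_span ::
  "('a, 'c) ring_scheme \<Rightarrow> ('a, 'm, 'e) module_scheme \<Rightarrow> 'm set \<Rightarrow> 'm set" where
  "submodule_span R M X = \<Inter>{N. submodule N R M \<and> X \<subseteq> N}"

definition finitely_generated ::
  "('a, 'c) ring_scheme \<Rightarrow> ('a, 'm, 'e) module_scheme \<Rightarrow> bool" where
  "finitely_generated R M \<longleftrightarrow>
     (\<exists>X. finite X \<and> X \<subseteq> carrier M \<and> submodule_span R M X = carrier M)"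

text \<open>The submodules of \<open>regular_module R\<close> are the right ideals of \<open>R\<close>.\<close>

definition right_noetherian :: "('a, 'c) ring_scheme \<Rightarrow> bool" where
  "right_noetherian R \<longleftrightarrow> ring R \<and>
     (\<forall>I. submodule I R (regular_module R) \<longrightarrow>
        (\<exists>X. finite X \<and> X \<subseteq> I \<and> submodule_span R (regular_module R) X = I))"

definition module_hom ::
  "('a, 'c) ring_scheme \<Rightarrow> ('a, 'm, 'e) module_scheme \<Rightarrow> ('a, 'n, 'g) module_scheme
     \<Rightarrow> ('m \<Rightarrow> 'n) set" where
  "module_hom R M N = {h \<in> carrier M \<rightarrow>\<^sub>E carrier N.
     (\<forall>x\<in>carrier M. \<forall>y\<in>carrier M. h (x \<oplus>\<^bsub>M\<^esub> y) = h x \<oplus>\<^bsub>N\<^esub> h y) \<and>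
     (\<forall>a\<in>carrier R. \<forall>x\<in>carrier M. h (a \<odot>\<^bsub>M\<^esub> x) = a \<odot>\<^bsub>N\<^esub> h x)}"

text \<open>The abelian group \<open>Hom\<^sub>R(M, N)\<close>, written multiplicatively.\<close>

definition hom_group ::
  "('a, 'c) ring_scheme \<Rightarrow> ('a, 'm, 'e) module_scheme \<Rightarrow> ('a, 'n, 'g) module_scheme
     \<Rightarrow> ('m \<Rightarrow> 'n) monoid" where
  "hom_group R M N =
     \<lparr>carrier = module_hom R M N,
      mult = \<lambda>g h. \<lambda>x\<in>carrier M. g x \<oplus>\<^bsub>N\<^esub> h x,
      one = \<lambda>x\<in>carrier M. \<zero>\<^bsub>N\<^esub>\<rparr>"

definition direct_sum ::
  "'i set \<Rightarrow> ('i \<Rightarrow> ('a, 'm, 'e) module_scheme) \<Rightarrow> ('a, 'i \<Rightarrow> 'm) module" where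
  "direct_sum I M =
     \<lparr>carrier = {x \<in> (\<Pi>\<^sub>E i\<in>I. carrier (M i)). finite {i \<in> I. x i \<noteq> \<zero>\<^bsub>M i\<^esub>}},
      mult = undefined, one = undefined,
      zero = \<lambda>i\<in>I. \<zero>\<^bsub>M i\<^esub>,
      add = \<lambda>x y. \<lambda>i\<in>I. x i \<oplus>\<^bsub>M i\<^esub> y i,
      smult = \<lambda>a x. \<lambda>i\<in>I. a \<odot>\<^bsub>M i\<^esub> x i\<rparr>"

definition free_module :: "('a, 'c) ring_scheme \<Rightarrow> 'i set \<Rightarrow> ('a, 'i \<Rightarrow> 'a) module" where
  "free_module R I = direct_sum I (\<lambda>_. regular_module R)"

text \<open>
  A module is projective if it is a direct summand of a free module.  A basis indexed by a subset
  of the module is always sufficient.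
\<close>

definition projective_module ::
  "('a, 'c) ring_scheme \<Rightarrow> ('a, 'm, 'e) module_scheme \<Rightarrow> bool" where
  "projective_module R P \<longleftrightarrow> right_module R P \<and>
     (\<exists>B :: 'm set. \<exists>i \<in> module_hom R P (free_module R B). \<exists>p \<in> module_hom R (free_module R B) P.
        \<forall>x\<in>carrier P. p (i x) = x)"

definition restrict_scalars ::
  "('s \<Rightarrow> 'a) \<Rightarrow> ('a, 'm, 'e) module_scheme \<Rightarrow> ('s, 'm) module" where
  "restrict_scalars p M =
     \<lparr>carrier = carrier M, mult = undefined, one = undefined,
      zero = \<zero>\<^bsub>M\<^esub>, add = (\<oplus>\<^bsub>M\<^esub>), smult = \<lambda>s x. p s \<odot>\<^bsub>M\<^esub> x\<rparr>"

section \<open>Projective resolutions, projective dimension and Ext\<close>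

definition projective_resolution ::
  "('a, 'c) ring_scheme \<Rightarrow> ('a, 'm, 'e) module_scheme \<Rightarrow> (nat \<Rightarrow> ('a, 'u) module)
     \<Rightarrow> (nat \<Rightarrow> 'u \<Rightarrow> 'u) \<Rightarrow> ('u \<Rightarrow> 'm) \<Rightarrow> bool" where
  "projective_resolution R M P \<delta> \<epsilon> \<longleftrightarrow>
     (\<forall>n. projective_module R (P n)) \<and>
     (\<forall>n. \<delta> n \<in> module_hom R (P (Suc n)) (P n)) \<and>
     \<epsilon> \<in> module_hom R (P 0) M \<and>
     \<epsilon> ` carrier (P 0) = carrier M \<and>
     {x \<in> carrier (P 0). \<epsilon> x = \<zero>\<^bsub>M\<^esub>} = \<delta> 0 ` carrier (P 1) \<and>
     (\<forall>n. {x \<in> carrier (P (Suc n)). \<delta> n x = \<zero>\<^bsub>P n\<^esub>} = \<delta> (Suc n) ` carrier (P (Suc (Suc n))))"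

text \<open>
  HOL has no quantification over types inside a formula, so the modules in a resolution of
  \<open>M :: ('a, 'm) module\<close> over \<open>R :: 'a ring\<close> need a fixed carrier type.  Free modules with a basis
  in \<open>('a + 'm) list\<close> are large enough: this index type is infinite and at least as big as \<open>R\<close> and
  \<open>M\<close>, hence every submodule of such a free module is again generated by a family indexed by it.
  So every module has a resolution of this kind, and one of length \<open>n\<close> whenever it has a projective
  resolution of length \<open>n\<close> at all.
\<close>

type_synonym ('a, 'm) resolution_elem = "('a + 'm) list \<Rightarrow> 'a"

definition projective_dim ::
  "('a, 'c) ring_scheme \<Rightarrow> ('a, 'm, 'e) module_scheme \<Rightarrow> enat" where
  "projective_dim R M = Inf {enat n | n.
     \<exists>(P :: nat \<Rightarrow> ('a, ('a, 'm) resolution_elem) module) \<delta> \<epsilon>.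
       projective_resolution R M P \<delta> \<epsilon> \<and> (\<forall>i>n. carrier (P i) = {\<zero>\<^bsub>P i\<^esub>})}"

text \<open>
  The supremum is over the modules with elements in \<open>'a set\<close>.  This includes all
  cyclic modules \<open>R/I\<close>, which by Auslander's theorem determine the global dimension.
\<close>

definition right_global_dim :: "('a, 'c) ring_scheme \<Rightarrow> enat" where
  "right_global_dim R =
     (SUP M \<in> {M :: ('a, 'a set) module. right_module R M}. projective_dim R M)"

definition chosen_resolution ::
  "('a, 'c) ring_scheme \<Rightarrow> ('a, 'm, 'e) module_scheme \<Rightarrow>
     (nat \<Rightarrow> ('a, ('a, 'm) resolution_elem) module) \<times>
     (nat \<Rightarrow> ('a, 'm) resolution_elem \<Rightarrow> ('a, 'm) resolution_elem) \<times>
     (('a, 'm) resolution_elem \<Rightarrow> 'm)" where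
  "chosen_resolution R M = (SOME (P, \<delta>, \<epsilon>). projective_resolution R M P \<delta> \<epsilon>)"

definition cocycles ::
  "('a, 'c) ring_scheme \<Rightarrow> (nat \<Rightarrow> ('a, 'u) module) \<Rightarrow> (nat \<Rightarrow> 'u \<Rightarrow> 'u)
     \<Rightarrow> ('a, 'n, 'g) module_scheme \<Rightarrow> nat \<Rightarrow> ('u \<Rightarrow> 'n) set" where
  "cocycles R P \<delta> N i = {h \<in> module_hom R (P i) N. \<forall>x\<in>carrier (P (Suc i)). h (\<delta> i x) = \<zero>\<^bsub>N\<^esub>}"

fun coboundaries ::
  "('a, 'c) ring_scheme \<Rightarrow> (nat \<Rightarrow> ('a, 'u) module) \<Rightarrow> (nat \<Rightarrow> 'u \<Rightarrow> 'u)
     \<Rightarrow> ('a, 'n, 'g) module_scheme \<Rightarrow> nat \<Rightarrow> ('u \<Rightarrow> 'n) set" where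
  "coboundaries R P \<delta> N 0 = {\<lambda>x\<in>carrier (P 0). \<zero>\<^bsub>N\<^esub>}"
| "coboundaries R P \<delta> N (Suc i) =
     (\<lambda>h. compose (carrier (P (Suc i))) h (\<delta> i)) ` module_hom R (P i) N"

definition Ext ::
  "('a, 'c) ring_scheme \<Rightarrow> nat \<Rightarrow> ('a, 'm, 'e) module_scheme \<Rightarrow> ('a, 'n, 'g) module_scheme
     \<Rightarrow> (('a, 'm) resolution_elem \<Rightarrow> 'n) set monoid" where
  "Ext R i M N = (case chosen_resolution R M of (P, \<delta>, \<epsilon>) \<Rightarrow>
     (hom_group R (P i) N)\<lparr>carrier := cocycles R P \<delta> N i\<rparr> Mod coboundaries R P \<delta> N i)"

section \<open>Totally reflexive modules\<close>

text \<open>\<open>Hom\<^sub>R(M, R)\<close> with the left action \<open>(a \<cdot> h)(x) = a h(x)\<close>, a right module over the opposite ring.\<close>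

definition dual_module ::
  "('a, 'c) ring_scheme \<Rightarrow> ('a, 'm, 'e) module_scheme \<Rightarrow> ('a, 'm \<Rightarrow> 'a) module" where
  "dual_module R M =
     \<lparr>carrier = module_hom R M (regular_module R), mult = undefined, one = undefined,
      zero = \<lambda>x\<in>carrier M. \<zero>\<^bsub>R\<^esub>,
      add = \<lambda>g h. \<lambda>x\<in>carrier M. g x \<oplus>\<^bsub>R\<^esub> h x,
      smult = \<lambda>a h. \<lambda>x\<in>carrier M. a \<otimes>\<^bsub>R\<^esub> h x\<rparr>"

definition evaluation_map ::
  "('a, 'c) ring_scheme \<Rightarrow> ('a, 'm, 'e) module_scheme \<Rightarrow> 'm \<Rightarrow> ('m \<Rightarrow> 'a) \<Rightarrow> 'a" where
  "evaluation_map R M = (\<lambda>x\<in>carrier M. \<lambda>h\<in>carrier (dual_module R M). h x)"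

definition totally_reflexive ::
  "('a, 'c) ring_scheme \<Rightarrow> ('a, 'm, 'e) module_scheme \<Rightarrow> bool" where
  "totally_reflexive R M \<longleftrightarrow>
     (\<forall>i\<ge>1. trivial_group (Ext R i M (regular_module R))) \<and>
     (\<forall>i\<ge>1. trivial_group
        (Ext (opposite_ring R) i (dual_module R M) (regular_module (opposite_ring R)))) \<and>
     evaluation_map R M \<in> module_hom R M (dual_module (opposite_ring R) (dual_module R M)) \<and>
     bij_betw (evaluation_map R M) (carrier M)
       (carrier (dual_module (opposite_ring R) (dual_module R M)))"

section \<open>Graded algebras and graded modules\<close>

text \<open>
  The same record serves for \<open>\<nat>\<close>-graded \<open>k\<close>-algebras (\<open>'i = nat\<close>, with \<open>smult\<close> the action of
  \<open>k\<close>) and for \<open>\<int>\<close>-graded right modules (\<open>'i = int\<close>).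
\<close>

record ('a, 'm, 'i) graded_module = "('a, 'm) module" +
  part :: "'i \<Rightarrow> 'm set"

definition internally_graded :: "('a, 'm, 'i) graded_module \<Rightarrow> bool" where
  "internally_graded M \<longleftrightarrow>
     (\<forall>i. subgroup (part M i) (add_monoid M)) \<and>
     (\<forall>x\<in>carrier M. \<exists>!c. (\<forall>i. c i \<in> part M i) \<and> finite {i. c i \<noteq> \<zero>\<^bsub>M\<^esub>} \<and>
        x = finsum M c {i. c i \<noteq> \<zero>\<^bsub>M\<^esub>})"

definition graded_algebra ::
  "('k, 'x) ring_scheme \<Rightarrow> ('k, 'a, nat) graded_module \<Rightarrow> bool" where
  "graded_algebra K R \<longleftrightarrow> Ring.field K \<and> ring R \<and> Module.module K R \<and>
     (\<forall>c\<in>carrier K. \<forall>x\<in>carrier R. \<forall>y\<in>carrier R.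
        (c \<odot>\<^bsub>R\<^esub> x) \<otimes>\<^bsub>R\<^esub> y = c \<odot>\<^bsub>R\<^esub> (x \<otimes>\<^bsub>R\<^esub> y) \<and> x \<otimes>\<^bsub>R\<^esub> (c \<odot>\<^bsub>R\<^esub> y) = c \<odot>\<^bsub>R\<^esub> (x \<otimes>\<^bsub>R\<^esub> y)) \<and>
     internally_graded R \<and>
     (\<forall>i. submodule (part R i) K R) \<and>
     \<one>\<^bsub>R\<^esub> \<in> part R 0 \<and>
     (\<forall>i j. \<forall>x\<in>part R i. \<forall>y\<in>part R j. x \<otimes>\<^bsub>R\<^esub> y \<in> part R (i + j))"

definition connected_graded_algebra ::
  "('k, 'x) ring_scheme \<Rightarrow> ('k, 'a, nat) graded_module \<Rightarrow> bool" where
  "connected_graded_algebra K R \<longleftrightarrow> graded_algebra K R \<and>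
     bij_betw (\<lambda>c. c \<odot>\<^bsub>R\<^esub> \<one>\<^bsub>R\<^esub>) (carrier K) (part R 0)"

definition graded_algebra_hom ::
  "('k, 'x) ring_scheme \<Rightarrow> ('k, 'a, nat) graded_module \<Rightarrow> ('k, 'b, nat) graded_module
     \<Rightarrow> ('a \<Rightarrow> 'b) set" where
  "graded_algebra_hom K R S = {h \<in> ring_hom R S.
     (\<forall>c\<in>carrier K. \<forall>x\<in>carrier R. h (c \<odot>\<^bsub>R\<^esub> x) = c \<odot>\<^bsub>S\<^esub> h x) \<and>
     (\<forall>i. h ` part R i \<subseteq> part S i)}"

definition regular_element :: "('a, 'c) ring_scheme \<Rightarrow> 'a \<Rightarrow> bool" where
  "regular_element R f \<longleftrightarrow> f \<in> carrier R \<and>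
     (\<forall>a\<in>carrier R. a \<otimes>\<^bsub>R\<^esub> f = \<zero>\<^bsub>R\<^esub> \<or> f \<otimes>\<^bsub>R\<^esub> a = \<zero>\<^bsub>R\<^esub> \<longrightarrow> a = \<zero>\<^bsub>R\<^esub>)"

definition normal_element :: "('a, 'c) ring_scheme \<Rightarrow> 'a \<Rightarrow> bool" where
  "normal_element R f \<longleftrightarrow> f \<in> carrier R \<and>
     (\<lambda>a. a \<otimes>\<^bsub>R\<^esub> f) ` carrier R = (\<lambda>a. f \<otimes>\<^bsub>R\<^esub> a) ` carrier R"

definition quotient_algebra ::
  "('k, 'a, 'i) graded_module \<Rightarrow> 'a set \<Rightarrow> ('k, 'a set, 'i) graded_module" where
  "quotient_algebra R I =
     ring.extend (R Quot I)
       \<lparr>smult = \<lambda>c X. \<Union>x\<in>X. I +>\<^bsub>R\<^esub> (c \<odot>\<^bsub>R\<^esub> x),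
        part = \<lambda>n. (\<lambda>x. I +>\<^bsub>R\<^esub> x) ` part R n\<rparr>"

text \<open>The algebra \<open>A = S/(f)\<close>.\<close>

definition hypersurface ::
  "('k, 's, nat) graded_module \<Rightarrow> 's \<Rightarrow> ('k, 's set, nat) graded_module" where
  "hypersurface S f = quotient_algebra S (Idl\<^bsub>S\<^esub> {f})"

definition graded_right_module ::
  "('k, 'a, nat) graded_module \<Rightarrow> ('a, 'm, int) graded_module \<Rightarrow> bool" where
  "graded_right_module R M \<longleftrightarrow> right_module R M \<and> internally_graded M \<and>
     (\<forall>i j. \<forall>x\<in>part M i. \<forall>a\<in>part R j. a \<odot>\<^bsub>M\<^esub> x \<in> part M (i + int j))"

definition graded_hom ::
  "('k, 'a, nat) graded_module \<Rightarrow> ('a, 'm, int) graded_module \<Rightarrow> ('a, 'n, int) graded_module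
     \<Rightarrow> ('m \<Rightarrow> 'n) set" where
  "graded_hom R M N = {h \<in> module_hom R M N. \<forall>i. h ` part M i \<subseteq> part N i}"

definition graded_isomorphic ::
  "('k, 'a, nat) graded_module \<Rightarrow> ('a, 'm, int) graded_module \<Rightarrow> ('a, 'n, int) graded_module
     \<Rightarrow> bool" where
  "graded_isomorphic R M N \<longleftrightarrow> (\<exists>h\<in>graded_hom R M N. bij_betw h (carrier M) (carrier N))"

text \<open>The algebra \<open>R\<close> as a graded right module over itself, with zero parts in negative degrees.\<close>

definition graded_regular_module ::
  "('k, 'a, nat) graded_module \<Rightarrow> ('a, 'a, int) graded_module" where
  "graded_regular_module R =
     module.extend (regular_module R)
       \<lparr>part = \<lambda>i. if 0 \<le> i then part R (nat i) else {\<zero>\<^bsub>R\<^esub>}\<rparr>"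

definition shift :: "('a, 'm, int) graded_module \<Rightarrow> int \<Rightarrow> ('a, 'm, int) graded_module" where
  "shift M n = M\<lparr>part := \<lambda>i. part M (n + i)\<rparr>"

definition graded_direct_sum ::
  "'i set \<Rightarrow> ('i \<Rightarrow> ('a, 'm, int) graded_module) \<Rightarrow> ('a, 'i \<Rightarrow> 'm, int) graded_module" where
  "graded_direct_sum I M =
     module.extend (direct_sum I M)
       \<lparr>part = \<lambda>n. {x \<in> carrier (direct_sum I M). \<forall>i\<in>I. x i \<in> part (M i) n}\<rparr>"

text \<open>The graded free module \<open>\<Oplus>\<^sub>s R(-m\<^sub>s)\<close> for a list \<open>m\<close> of generator degrees.\<close>

definition graded_free ::
  "('k, 'a, nat) graded_module \<Rightarrow> int list \<Rightarrow> ('a, nat \<Rightarrow> 'a, int) graded_module" where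
  "graded_free R m =
     graded_direct_sum {..<length m} (\<lambda>s. shift (graded_regular_module R) (- (m ! s)))"

section \<open>Categories\<close>

text \<open>
  Categories whose hom-sets are groups (written multiplicatively).  Since a morphism does
  not determine its domain and codomain, these are arguments of composition: for \<open>h : X \<rightarrow> Y\<close>
  and \<open>g : Y \<rightarrow> Z\<close> the composite \<open>g h\<close> is \<open>Comp C X Y Z g h\<close>.
\<close>

record ('o, 'h) precategory =
  Obj :: "'o set"
  Hom :: "'o \<Rightarrow> 'o \<Rightarrow> 'h monoid"
  Comp :: "'o \<Rightarrow> 'o \<Rightarrow> 'o \<Rightarrow> 'h \<Rightarrow> 'h \<Rightarrow> 'h"
  Ident :: "'o \<Rightarrow> 'h"

definition preadditive_category :: "('o, 'h) precategory \<Rightarrow> bool" where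
  "preadditive_category C \<longleftrightarrow>
     (\<forall>X\<in>Obj C. \<forall>Y\<in>Obj C. comm_group (Hom C X Y)) \<and>
     (\<forall>X\<in>Obj C. Ident C X \<in> carrier (Hom C X X)) \<and>
     (\<forall>X\<in>Obj C. \<forall>Y\<in>Obj C. \<forall>Z\<in>Obj C.
        \<forall>g\<in>carrier (Hom C Y Z). \<forall>h\<in>carrier (Hom C X Y). Comp C X Y Z g h \<in> carrier (Hom C X Z)) \<and>
     (\<forall>X\<in>Obj C. \<forall>Y\<in>Obj C. \<forall>h\<in>carrier (Hom C X Y).
        Comp C X X Y h (Ident C X) = h \<and> Comp C X Y Y (Ident C Y) h = h) \<and>
     (\<forall>W\<in>Obj C. \<forall>X\<in>Obj C. \<forall>Y\<in>Obj C. \<forall>Z\<in>Obj C.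
        \<forall>k\<in>carrier (Hom C Y Z). \<forall>g\<in>carrier (Hom C X Y). \<forall>h\<in>carrier (Hom C W X).
          Comp C W Y Z k (Comp C W X Y g h) = Comp C W X Z (Comp C X Y Z k g) h) \<and>
     (\<forall>X\<in>Obj C. \<forall>Y\<in>Obj C. \<forall>Z\<in>Obj C. \<forall>g\<in>carrier (Hom C Y Z). \<forall>g'\<in>carrier (Hom C Y Z).
        \<forall>h\<in>carrier (Hom C X Y). \<forall>h'\<in>carrier (Hom C X Y).
          Comp C X Y Z (g \<otimes>\<^bsub>Hom C Y Z\<^esub> g') h
            = Comp C X Y Z g h \<otimes>\<^bsub>Hom C X Z\<^esub> Comp C X Y Z g' h \<and>
          Comp C X Y Z g (h \<otimes>\<^bsub>Hom C X Y\<^esub> h')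
            = Comp C X Y Z g h \<otimes>\<^bsub>Hom C X Z\<^esub> Comp C X Y Z g h')"

definition full_subcategory ::
  "('o, 'h) precategory \<Rightarrow> 'o set \<Rightarrow> ('o, 'h) precategory" where
  "full_subcategory C X = C\<lparr>Obj := Obj C \<inter> X\<rparr>"

definition factoring_morphisms ::
  "('o, 'h) precategory \<Rightarrow> 'o set \<Rightarrow> 'o \<Rightarrow> 'o \<Rightarrow> 'h set" where
  "factoring_morphisms C X M N = {Comp C M P N g h | P g h.
     P \<in> X \<and> h \<in> carrier (Hom C M P) \<and> g \<in> carrier (Hom C P N)}"

definition factor_category ::
  "('o, 'h) precategory \<Rightarrow> 'o set \<Rightarrow> ('o, 'h set) precategory" where
  "factor_category C X =
     \<lparr>Obj = Obj C,
      Hom = \<lambda>M N. Hom C M N Mod factoring_morphisms C X M N,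
      Comp = \<lambda>L M N G H. \<Union>g\<in>G. \<Union>h\<in>H.
        factoring_morphisms C X L N #>\<^bsub>Hom C L N\<^esub> Comp C L M N g h,
      Ident = \<lambda>M. factoring_morphisms C X M M #>\<^bsub>Hom C M M\<^esub> Ident C M\<rparr>"

definition is_functor ::
  "('o, 'h) precategory \<Rightarrow> ('p, 'l) precategory \<Rightarrow> ('o \<Rightarrow> 'p) \<Rightarrow> ('o \<Rightarrow> 'o \<Rightarrow> 'h \<Rightarrow> 'l) \<Rightarrow> bool" where
  "is_functor C D F F' \<longleftrightarrow>
     (\<forall>X\<in>Obj C. F X \<in> Obj D) \<and>
     (\<forall>X\<in>Obj C. \<forall>Y\<in>Obj C. \<forall>h\<in>carrier (Hom C X Y). F' X Y h \<in> carrier (Hom D (F X) (F Y))) \<and>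
     (\<forall>X\<in>Obj C. F' X X (Ident C X) = Ident D (F X)) \<and>
     (\<forall>X\<in>Obj C. \<forall>Y\<in>Obj C. \<forall>Z\<in>Obj C.
        \<forall>g\<in>carrier (Hom C Y Z). \<forall>h\<in>carrier (Hom C X Y).
          F' X Z (Comp C X Y Z g h) = Comp D (F X) (F Y) (F Z) (F' Y Z g) (F' X Y h))"

definition isomorphisms :: "('o, 'h) precategory \<Rightarrow> 'o \<Rightarrow> 'o \<Rightarrow> 'h set" where
  "isomorphisms C X Y = {h \<in> carrier (Hom C X Y). \<exists>g\<in>carrier (Hom C Y X).
     Comp C X Y X g h = Ident C X \<and> Comp C Y X Y h g = Ident C Y}"

definition naturally_isomorphic ::
  "('o, 'h) precategory \<Rightarrow> ('p, 'l) precategory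
     \<Rightarrow> ('o \<Rightarrow> 'p) \<Rightarrow> ('o \<Rightarrow> 'o \<Rightarrow> 'h \<Rightarrow> 'l)
     \<Rightarrow> ('o \<Rightarrow> 'p) \<Rightarrow> ('o \<Rightarrow> 'o \<Rightarrow> 'h \<Rightarrow> 'l) \<Rightarrow> bool" where
  "naturally_isomorphic C D F F' G G' \<longleftrightarrow> (\<exists>\<eta>.
     (\<forall>X\<in>Obj C. \<eta> X \<in> isomorphisms D (F X) (G X)) \<and>
     (\<forall>X\<in>Obj C. \<forall>Y\<in>Obj C. \<forall>h\<in>carrier (Hom C X Y).
        Comp D (F X) (F Y) (G Y) (\<eta> Y) (F' X Y h) = Comp D (F X) (G X) (G Y) (G' X Y h) (\<eta> X)))"

definition equivalent_categories ::
  "('o, 'h) precategory \<Rightarrow> ('p, 'l) precategory \<Rightarrow> bool" where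
  "equivalent_categories C D \<longleftrightarrow> preadditive_category C \<and> preadditive_category D \<and>
     (\<exists>F F' G G'. is_functor C D F F' \<and> is_functor D C G G' \<and>
        naturally_isomorphic C C
          (\<lambda>X. G (F X)) (\<lambda>X Y h. G' (F X) (F Y) (F' X Y h)) (\<lambda>X. X) (\<lambda>X Y h. h) \<and>
        naturally_isomorphic D D
          (\<lambda>X. F (G X)) (\<lambda>X Y h. F' (G X) (G Y) (G' X Y h)) (\<lambda>X. X) (\<lambda>X Y h. h))"

section \<open>Graded totally reflexive modules\<close>

text \<open>
  Finitely generated graded right \<open>R\<close>-modules with elements in the type \<open>'m\<close>.  When \<open>'m\<close> is large
  enough to contain every finitely generated module up to isomorphism, this is \<open>grmod R\<close>.
\<close>

definition grmod ::
  "('k, 'a, nat) graded_module \<Rightarrow> (('a, 'm, int) graded_module, 'm \<Rightarrow> 'm) precategory" where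
  "grmod R =
     \<lparr>Obj = {M. graded_right_module R M \<and> finitely_generated R M},
      Hom = \<lambda>M N. (hom_group R M N)\<lparr>carrier := graded_hom R M N\<rparr>,
      Comp = \<lambda>L M N g h. compose (carrier L) g h,
      Ident = \<lambda>M. \<lambda>x\<in>carrier M. x\<rparr>"

text \<open>Here \<open>S\<close> acts on modules over \<open>A = S/(f)\<close> through the projection \<open>x \<mapsto> (f) + x\<close>.\<close>

definition TR ::
  "('k, 's, nat) graded_module \<Rightarrow> 's
     \<Rightarrow> (('s set, 'm, int) graded_module, 'm \<Rightarrow> 'm) precategory" where
  "TR S f = full_subcategory (grmod (hypersurface S f))
     {M. totally_reflexive (hypersurface S f) M \<and>
         projective_dim S (restrict_scalars (\<lambda>x. Idl\<^bsub>S\<^esub> {f} +>\<^bsub>S\<^esub> x) M) < \<infinity>}"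

definition free_objects ::
  "('k, 'a, nat) graded_module \<Rightarrow> ('a, 'm, int) graded_module set" where
  "free_objects R = {P \<in> Obj (grmod R). \<exists>m. graded_isomorphic R (graded_free R m) P}"

section \<open>Noncommutative graded matrix factorizations\<close>

text \<open>
  The object with \<open>gen_degs i = [m\<^sub>i\<^sub>1, \<dots>, m\<^sub>i\<^sub>r]\<close> has \<open>F\<^sup>i = \<Oplus>\<^sub>s S(-m\<^sub>i\<^sub>s)\<close>, and \<open>diff i\<close> is
  the map \<open>\<phi>\<^sup>i : F\<^sup>i\<^sup>+\<^sup>1 \<rightarrow> F\<^sup>i\<close>.
\<close>

record 's factorization =
  gen_degs :: "int \<Rightarrow> int list"
  diff :: "int \<Rightarrow> (nat \<Rightarrow> 's) \<Rightarrow> nat \<Rightarrow> 's"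

abbreviation mf_term ::
  "('k, 's, nat) graded_module \<Rightarrow> 's factorization \<Rightarrow> int \<Rightarrow> ('s, nat \<Rightarrow> 's, int) graded_module" where
  "mf_term S X i \<equiv> graded_free S (gen_degs X i)"

text \<open>Left multiplication by \<open>f\<close> on a graded free module of rank \<open>r\<close>.\<close>

definition left_mult ::
  "('k, 's, nat) graded_module \<Rightarrow> 's \<Rightarrow> nat \<Rightarrow> (nat \<Rightarrow> 's) \<Rightarrow> nat \<Rightarrow> 's" where
  "left_mult S f r = (\<lambda>x \<in> {..<r} \<rightarrow>\<^sub>E carrier S. \<lambda>s\<in>{..<r}. f \<otimes>\<^bsub>S\<^esub> x s)"

definition is_factorization ::
  "('k, 's, nat) graded_module \<Rightarrow> 's \<Rightarrow> nat \<Rightarrow> 's factorization \<Rightarrow> bool" where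
  "is_factorization S f d X \<longleftrightarrow> (\<exists>r. \<forall>i.
     length (gen_degs X i) = r \<and>
     gen_degs X (i + 2) = map (\<lambda>m. m + int d) (gen_degs X i) \<and>
     diff X i \<in> graded_hom S (mf_term S X (i + 1)) (mf_term S X i) \<and>
     compose (carrier (mf_term S X (i + 2))) (diff X i) (diff X (i + 1)) = left_mult S f r)"

definition NMF ::
  "('k, 's, nat) graded_module \<Rightarrow> 's \<Rightarrow> nat
     \<Rightarrow> ('s factorization, int \<Rightarrow> (nat \<Rightarrow> 's) \<Rightarrow> nat \<Rightarrow> 's) precategory" where
  "NMF S f d =
     \<lparr>Obj = {X. is_factorization S f d X},
      Hom = \<lambda>X Y.
        \<lparr>carrier = {\<mu>. \<forall>i. \<mu> i \<in> graded_hom S (mf_term S X i) (mf_term S Y i) \<and>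
           compose (carrier (mf_term S X (i + 1))) (\<mu> i) (diff X i)
             = compose (carrier (mf_term S X (i + 1))) (diff Y i) (\<mu> (i + 1))},
         mult = \<lambda>\<mu> \<nu> i. \<mu> i \<otimes>\<^bsub>hom_group S (mf_term S X i) (mf_term S Y i)\<^esub> \<nu> i,
         one = \<lambda>i. \<one>\<^bsub>hom_group S (mf_term S X i) (mf_term S Y i)\<^esub>\<rparr>,
      Comp = \<lambda>X Y Z \<mu> \<nu> i. compose (carrier (mf_term S X i)) (\<mu> i) (\<nu> i),
      Ident = \<lambda>X i. \<lambda>x\<in>carrier (mf_term S X i). x\<rparr>"

text \<open>
  The factorizations \<open>\<phi>\<^sub>F\<close> and \<open>\<^sub>F\<phi>\<close> for \<open>F = \<Oplus>\<^sub>s S(-m\<^sub>s)\<close>.  The \<open>i\<close>-th term is \<open>F(-(i div 2)d)\<close>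
  in the first case and \<open>F(-((i + 1) div 2)d)\<close> in the second (\<open>div\<close> rounds downwards).
\<close>

definition phi_left ::
  "('k, 's, nat) graded_module \<Rightarrow> 's \<Rightarrow> nat \<Rightarrow> int list \<Rightarrow> 's factorization" where
  "phi_left S f d m =
     \<lparr>gen_degs = \<lambda>i. map (\<lambda>n. n + (i div 2) * int d) m,
      diff = \<lambda>i. if even i then (\<lambda>x\<in>carrier (graded_free S m). x) else left_mult S f (length m)\<rparr>"

definition phi_right ::
  "('k, 's, nat) graded_module \<Rightarrow> 's \<Rightarrow> nat \<Rightarrow> int list \<Rightarrow> 's factorization" where
  "phi_right S f d m =
     \<lparr>gen_degs = \<lambda>i. map (\<lambda>n. n + ((i + 1) div 2) * int d) m,
      diff = \<lambda>i. if even i then left_mult S f (length m) else (\<lambda>x\<in>carrier (graded_free S m). x)\<rparr>"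

text \<open>An element of \<open>F \<oplus> G\<close> with \<open>F\<close> of rank \<open>r\<close> has its \<open>G\<close>-coordinates at the indices \<open>r, r + 1, \<dots>\<close>.\<close>

definition factorization_sum ::
  "('k, 's, nat) graded_module \<Rightarrow> 's factorization \<Rightarrow> 's factorization \<Rightarrow> 's factorization" where
  "factorization_sum S X Y =
     \<lparr>gen_degs = \<lambda>i. gen_degs X i @ gen_degs Y i,
      diff = \<lambda>i. \<lambda>x\<in>carrier (graded_free S (gen_degs X (i + 1) @ gen_degs Y (i + 1))).
        let r = length (gen_degs X i); q = length (gen_degs Y i) in
        (\<lambda>s\<in>{..<r + q}.
           if s < r then diff X i (\<lambda>t\<in>{..<r}. x t) s
           else diff Y i (\<lambda>t\<in>{..<q}. x (r + t)) (s - r))\<rparr>"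

definition calF :: "('k, 's, nat) graded_module \<Rightarrow> 's \<Rightarrow> nat \<Rightarrow> 's factorization set" where
  "calF S f d = range (phi_left S f d)"

definition calG :: "('k, 's, nat) graded_module \<Rightarrow> 's \<Rightarrow> nat \<Rightarrow> 's factorization set" where
  "calG S f d = {factorization_sum S (phi_left S f d m) (phi_right S f d n) | m n. True}"

end

theory Submission
 imports Defs
begin

text \<open>
 The functor sends a factorization to the cokernel of \<open>\<phi>\<^sup>0\<close>.  A morphism is determined by its component in degree
 \<open>0\<close>, and every map of cokernels lifts to a morphism because \<open>f\<close> is regular and normal.  The lifts of \<open>0\<close>
 are the morphisms through some \<open>\<phi>\<^sub>F\<close>, whose cokernel vanishes, while \<open>\<^sub>F\<phi>\<close> has the free cokernel \<open>F/fF\<close>.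
 Conversely let \<open>M\<close> be totally reflexive with finite projective dimension over \<open>S\<close>.  A free resolution of \<open>M\<close>
 over \<open>A\<close> lifts to \<open>S\<close>, and its cone by \<open>f\<close> resolves \<open>M\<close> over \<open>S\<close>.  As \<open>Ext\<^sub>A(M, A) = 0\<close>, the cone is acyclic in
 positive degrees after dualizing, so the finite projective dimension splits it from the right down to the
 first syzygy of \<open>M\<close>.  This syzygy is thus projective, hence free by Nakayama's lemma, and \<open>f M = 0\<close> turns
 the resulting presentation into a factorization.
\<close>

text \<open>Noncommutativity shapes the proof. Left multiplication by \<open>f\<close> is linear for
  right modules, but a linear map \<open>h\<close> commutes with it only up to a twist,
  \<open>h f = f h'\<close>; the twist exists because \<open>S f = f S\<close>, and regularity lets
  \<open>f\<close> be cancelled on both sides. Maps are therefore kept over \<open>S\<close>, where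
  they can be divided by \<open>f\<close>, and vanishing over \<open>A\<close> is expressed as
  having values in \<open>f F\<close>. The acyclicity of the dual cone is Rees' change of rings,
  Ext_S^(i+1)(M, S) = Ext_A^i(M, A) for i >= 1. The splitting deduced from it ignores the grading,
  since Ext is computed by ungraded resolutions; so Nakayama's lemma has to work with orders of
  elements instead of degrees. That both maps of the factorization have the same rank is a separate
  matter: the presentation \<open>g\<close> and the map \<open>h\<close> with \<open>g h = f\<close>
  are both injective, and a nonzero noetherian ring satisfies the strong rank condition. The dual of
  a cokernel is the cokernel of the transposed factorization over the opposite ring, so one
  vanishing lemma serves both halves of total reflexivity.\<close>

abbreviation free where "free \<equiv> free_module"
abbreviation res where "res \<equiv> restrict_scalars"
abbreviation reg where "reg \<equiv> regular_module"
abbreviation opp where "opp \<equiv> opposite_ring"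

notation (input) carrier ("$_" [1000] 1000)
 and zero ("\<zero>\<^sub>_" [1000] 1000)
 and one ("\<one>\<^sub>_" [1000] 1000)
 and a_inv ("\<ominus>\<^sub>_ _" [1000, 81] 80)

abbreviation (input) add_of ("_ \<oplus>\<^sub>_ _" [65, 1000, 66] 65) where "x \<oplus>\<^sub>M y \<equiv> x \<oplus>\<^bsub>M\<^esub> y"
abbreviation (input) diff_of ("_ \<ominus>\<^sub>_ _" [65, 1000, 66] 65) where "x \<ominus>\<^sub>M y \<equiv> x \<ominus>\<^bsub>M\<^esub> y"
abbreviation (input) mult_of ("_ \<otimes>\<^sub>_ _" [70, 1000, 71] 70) where "x \<otimes>\<^sub>M y \<equiv> x \<otimes>\<^bsub>M\<^esub> y"
abbreviation (input) smult_of ("_ \<odot>\<^sub>_ _" [71, 1000, 70] 70) where "a \<odot>\<^sub>M x \<equiv> a \<odot>\<^bsub>M\<^esub> x"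

section \<open>Right modules and linear maps\<close>

locale rmodule = R?: ring R + M?: abelian_group M for R (structure) and M (structure) +
 assumes smult_closed [simp, intro]:
   "[|a : $R; x : $M|] ==> a \<odot>\<^sub>M x : $M"
  and smult_l_distr:
   "[|a : $R; b : $R; x : $M|] ==>
   (a \<oplus> b) \<odot>\<^sub>M x = a \<odot>\<^sub>M x \<oplus>\<^sub>M b \<odot>\<^sub>M x"
  and smult_r_distr:
   "[|a : $R; x : $M; y : $M|] ==>
   a \<odot>\<^sub>M (x \<oplus>\<^sub>M y) = a \<odot>\<^sub>M x \<oplus>\<^sub>M a \<odot>\<^sub>M y"
  and smult_assoc:
   "[|a : $R; b : $R; x : $M|] ==>
   (a \<otimes> b) \<odot>\<^sub>M x = b \<odot>\<^sub>M (a \<odot>\<^sub>M x)"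
  and smult_one [simp]: "x : $M ==> \<one> \<odot>\<^sub>M x = x"

lemma right_module_iff: "right_module R M \<longleftrightarrow> rmodule R M" unfolding right_module_def rmodule_def rmodule_axioms_def by auto

context rmodule
begin

lemma smult_l_null [simp]: "x : $M ==> \<zero> \<odot>\<^sub>M x = \<zero>\<^sub>M"
 using smult_l_distr[of \<zero> \<zero> x] M.add.r_cancel_one' by force

lemma smult_r_null [simp]: "a : $R ==> a \<odot>\<^sub>M \<zero>\<^sub>M = \<zero>\<^sub>M"
 using smult_r_distr[of a "\<zero>\<^sub>M" "\<zero>\<^sub>M"] M.add.r_cancel_one' by force

lemma smult_l_minus: "[|a : $R; x : $M|] ==> (\<ominus> a) \<odot>\<^sub>M x = \<ominus>\<^sub>M (a \<odot>\<^sub>M x)"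
 by (metis M.minus_equality R.a_inv_closed R.l_neg smult_closed smult_l_distr smult_l_null)

lemma smult_r_minus: "[|a : $R; x : $M|] ==> a \<odot>\<^sub>M (\<ominus>\<^sub>M x) = \<ominus>\<^sub>M (a \<odot>\<^sub>M x)"
 by (metis M.minus_equality M.a_inv_closed M.l_neg smult_closed smult_r_distr smult_r_null)

end

section \<open>Arithmetic of differences in abelian groups\<close>

lemma (in abelian_group) minus_zero_iff:
 "[|x : $G; y : $G|] ==> x \<ominus> y = \<zero> \<longleftrightarrow> x = y"
 by (metis a_inv_closed minus_eq minus_equality minus_minus r_neg)

lemma (in abelian_group) minus_add_cancel [simp]:
 "[|x : $G; y : $G|] ==> (x \<ominus> y) \<oplus> y = x" by (simp add: minus_eq a_assoc l_neg)

lemma (in abelian_group) add_minus_cancel [simp]: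
 "[|x : $G; y : $G|] ==> y \<oplus> (x \<ominus> y) = x"
 using minus_add_cancel[of x y] a_comm[of "x \<ominus> y" y] by simp

lemma (in abelian_group) add_diff_cancel [simp]:
 "[|x : $G; y : $G|] ==> (x \<oplus> y) \<ominus> y = x" by (simp add: minus_eq a_assoc r_neg)

lemma (in abelian_group) diff_eq_iff:
 "[|x : $G; y : $G; z : $G|] ==> x \<ominus> y = z \<longleftrightarrow> x = z \<oplus> y"
 by (metis add_diff_cancel minus_add_cancel minus_closed)

lemma (in abelian_group) diff_add_swap:
 "[|x : $G; y : $G; z : $G; w : $G|] ==>
   (x \<oplus> y) \<ominus> (z \<oplus> w) = (x \<ominus> z) \<oplus> (y \<ominus> w)" by (simp add: minus_eq minus_add a_ac)

lemma (in abelian_group) diff_diff_swap: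
 "[|x : $G; y : $G|] ==> \<ominus> (x \<ominus> y) = y \<ominus> x" by (simp add: minus_eq minus_add a_comm)

lemma (in abelian_group) a_inv_zero [simp]: "\<ominus> \<zero> = \<zero>" using minus_equality by force

lemma (in abelian_group) diff_self [simp]: "x : $G ==> x \<ominus> x = \<zero>" by (simp add: minus_eq r_neg)

lemma (in abelian_group) diff_zero [simp]: "x : $G ==> x \<ominus> \<zero> = x" by (simp add: minus_eq)

lemma (in abelian_group) diff_trans:
 "[|x : $G; y : $G; z : $G|] ==> (x \<ominus> y) \<oplus> (y \<ominus> z) = x \<ominus> z"
 by (simp add: minus_eq a_assoc r_neg1 r_neg2)

text \<open>Unlike \<open>module_hom\<close>, this says nothing about values outside the carrier, so
  composites and sums are plain lambda terms; \<open>restrict_module_hom\<close> leads back to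
  extensional maps.\<close>

definition rlin ::
 "('a, 'c) ring_scheme => ('a, 'm, 'e) module_scheme => ('a, 'n, 'g) module_scheme
   => ('m => 'n) => bool" where
 "rlin R M N h \<longleftrightarrow> h : $M \<rightarrow> $N &
   (\<forall>x\<in>$M. \<forall>y\<in>$M. h (x \<oplus>\<^sub>M y) = h x \<oplus>\<^sub>N h y) &
   (\<forall>a\<in>$R. \<forall>x\<in>$M. h (a \<odot>\<^sub>M x) = a \<odot>\<^sub>N h x)"

lemma rlinI:
 assumes "!!x. x : $M ==> h x : $N"
  and "!!x y. [|x : $M; y : $M|] ==> h (x \<oplus>\<^sub>M y) = h x \<oplus>\<^sub>N h y"
  and "!!a x. [|a : $R; x : $M|] ==> h (a \<odot>\<^sub>M x) = a \<odot>\<^sub>N h x" shows "rlin R M N h"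
 using assms unfolding rlin_def by auto

lemma rlin_closed: "rlin R M N h ==> x : $M ==> h x : $N" unfolding rlin_def by auto

lemma rlin_add: "rlin R M N h ==> x : $M ==> y : $M ==> h (x \<oplus>\<^sub>M y) = h x \<oplus>\<^sub>N h y"
 unfolding rlin_def by auto

lemma rlin_smult: "rlin R M N h ==> a : $R ==> x : $M ==> h (a \<odot>\<^sub>M x) = a \<odot>\<^sub>N h x"
 unfolding rlin_def by auto

lemma module_hom_iff: "h : module_hom R M N \<longleftrightarrow> rlin R M N h & h : extensional ($M)"
 unfolding module_hom_def rlin_def by (auto simp: PiE_def)

lemma module_hom_rlin: "h : module_hom R M N ==> rlin R M N h" by (simp add: module_hom_iff)

lemma rlin_cong:
 assumes "rmodule R M" "!!x. x : $M ==> h x = g x" shows "rlin R M N h \<longleftrightarrow> rlin R M N g"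
proof -
 interpret rmodule R M by fact
 show ?thesis unfolding rlin_def using assms(2) by (auto simp: Pi_def)
qed

lemma restrict_module_hom:
 assumes "rmodule R M" "rlin R M N h" shows "restrict h ($M) : module_hom R M N"
 using assms rlin_cong[of R M "restrict h ($M)" h N] by (simp add: module_hom_iff)

lemma additive_zero:
 assumes "abelian_group M" "abelian_group N" "h : $M \<rightarrow> $N"
  and "!!x y. [|x : $M; y : $M|] ==> h (x \<oplus>\<^sub>M y) = h x \<oplus>\<^sub>N h y"
 shows "h \<zero>\<^sub>M = \<zero>\<^sub>N"
proof -
 interpret M: abelian_group M by fact
 interpret N: abelian_group N by fact
 have c: "h \<zero>\<^sub>M : $N" using assms(3) by auto
 have "h \<zero>\<^sub>M \<oplus>\<^sub>N h \<zero>\<^sub>M = h \<zero>\<^sub>M" using assms(4)[of "\<zero>\<^sub>M" "\<zero>\<^sub>M"] by simp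
 then show ?thesis using c N.add.r_cancel_one' by auto
qed

lemma additive_minus:
 assumes "abelian_group M" "abelian_group N" "h : $M \<rightarrow> $N"
  and "!!x y. [|x : $M; y : $M|] ==> h (x \<oplus>\<^sub>M y) = h x \<oplus>\<^sub>N h y"
  and "x : $M" shows "h (\<ominus>\<^sub>M x) = \<ominus>\<^sub>N h x"
proof -
 interpret M: abelian_group M by fact
 interpret N: abelian_group N by fact
 have c: "h x : $N" "h (\<ominus>\<^sub>M x) : $N" using assms(3,5) by auto
 have "h (\<ominus>\<^sub>M x) \<oplus>\<^sub>N h x = \<zero>\<^sub>N"
  using assms(4)[of "\<ominus>\<^sub>M x" x] additive_zero[OF assms(1-4)] assms(5) by (simp add: M.l_neg)
 then show ?thesis using c N.minus_equality by metis
qed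

lemma rlin_zero:
 assumes "rmodule R M" "rmodule R N" "rlin R M N h" shows "h \<zero>\<^sub>M = \<zero>\<^sub>N"
 by (rule additive_zero) (use assms in \<open>auto simp: rlin_def rmodule_def\<close>)

lemma rlin_minus:
 assumes "rmodule R M" "rmodule R N" "rlin R M N h" "x : $M" shows "h (\<ominus>\<^sub>M x) = \<ominus>\<^sub>N h x"
 by (rule additive_minus) (use assms in \<open>auto simp: rlin_def rmodule_def\<close>)

lemma rlin_diff:
 assumes "rmodule R M" "rmodule R N" "rlin R M N h" "x : $M" "y : $M" shows "h (x \<ominus>\<^sub>M y) = h x \<ominus>\<^sub>N h y"
proof -
 interpret M: rmodule R M by fact
 show ?thesis using rlin_add[OF assms(3), of x "\<ominus>\<^sub>M y"] rlin_minus[OF assms(1-3,5)] assms(4,5) by (simp add: a_minus_def)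
qed

lemma rlin_comp: "rlin R L M g ==> rlin R M N h ==> rlin R L N (%x. h (g x))"
 unfolding rlin_def by (auto simp: Pi_def)

lemma rlin_id: "rlin R M M (%x. x)" unfolding rlin_def by auto

lemma rlin_const_zero:
 assumes "rmodule R N" shows "rlin R M N (%x. \<zero>\<^sub>N)"
proof -
 interpret N: rmodule R N by fact
 show ?thesis unfolding rlin_def by simp
qed

lemma rlin_sum:
 assumes "rmodule R N" "rlin R M N g" "rlin R M N h" shows "rlin R M N (%x. g x \<oplus>\<^sub>N h x)"
proof -
 interpret N: rmodule R N by fact
 show ?thesis by (rule rlinI) (simp_all add: rlin_add[OF assms(2)] rlin_add[OF assms(3)] rlin_smult[OF assms(2)]
    rlin_smult[OF assms(3)] rlin_closed[OF assms(2)] rlin_closed[OF assms(3)] N.M.a_ac N.smult_r_distr)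
qed

lemma rlin_neg:
 assumes "rmodule R N" "rlin R M N g" shows "rlin R M N (%x. \<ominus>\<^sub>N g x)"
proof -
 interpret N: rmodule R N by fact
 show ?thesis by (rule rlinI) (simp_all add: rlin_add[OF assms(2)] rlin_smult[OF assms(2)] rlin_closed[OF assms(2)]
    N.M.minus_add N.smult_r_minus)
qed

lemma rlin_sub:
 assumes "rmodule R N" "rlin R M N g" "rlin R M N h" shows "rlin R M N (%x. g x \<ominus>\<^sub>N h x)"
 using rlin_sum[OF assms(1,2) rlin_neg[OF assms(1,3)]] by (simp add: a_minus_def)

lemma additive_finsum:
 assumes M: "abelian_group M" and N: "abelian_group N" and h: "h : $M \<rightarrow> $N"
  and a: "!!x y. [|x : $M; y : $M|] ==> h (x \<oplus>\<^sub>M y) = h x \<oplus>\<^sub>N h y"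
  and "g : A \<rightarrow> $M" shows "h (finsum M g A) = finsum N (%i. h (g i)) A"
proof -
 interpret M: abelian_group M by fact
 interpret N: abelian_group N by fact
 have 0: "h \<zero>\<^sub>M = \<zero>\<^sub>N" by (rule additive_zero[OF M N h a])
 show ?thesis using assms(5)
 proof (induction A rule: infinite_finite_induct)
  case (infinite A)
  then show ?case using 0 by (simp add: M.finsum_infinite N.finsum_infinite)
 next
  case empty then show ?case using 0 by simp
 next
  case (insert x F)
  then have "g : F \<rightarrow> $M" "g x : $M" "(%i. h (g i)) : F \<rightarrow> $N" "h (g x) : $N" using h by auto
  then show ?case using insert a by (simp add: M.finsum_insert N.finsum_insert)
 qed
qed

lemma rlin_finsum:
 assumes "rmodule R M" "rmodule R N" "rlin R M N h" "g : A \<rightarrow> $M" shows "h (finsum M g A) = finsum N (%i. h (g i)) A"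
 by (rule additive_finsum) (use assms in \<open>auto simp: rlin_def rmodule_def\<close>)

text \<open>The factorization of \<open>h\<close> through a surjection \<open>q\<close>, by choosing
  preimages. It replaces quotient modules: any surjection with the right kernel will do.\<close>

definition descend :: "'x set => ('x => 'y) => ('x => 'z) => 'y => 'z" where
 "descend X q h = (%y. h (inv_into X q y))"

lemma descend_eq:
 assumes "!!x y. [|x : X; y : X; q x = q y|] ==> h x = h y" "x : X" shows "descend X q h (q x) = h x"
 unfolding descend_def using assms by (metis f_inv_into_f image_eqI inv_into_into)

lemma descend_rlin:
 assumes F: "rmodule R F" and M: "rmodule R M" and N: "rmodule R N"
  and q: "rlin R F M q" "q ` $F = $M" and h: "rlin R F N h"
  and ker: "!!x. [|x : $F; q x = \<zero>\<^sub>M|] ==> h x = \<zero>\<^sub>N"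
 shows "rlin R M N (descend ($F) q h)"
  and "!!x. x : $F ==> descend ($F) q h (q x) = h x"
proof -
 interpret F: rmodule R F by fact
 interpret M: rmodule R M by fact
 interpret N: rmodule R N by fact
 show e: "descend ($F) q h (q x) = h x" if "x : $F" for x
 proof (rule descend_eq)
  fix x y assume xy: "x : $F" "y : $F" "q x = q y"
  then have "q (x \<ominus>\<^sub>F y) = \<zero>\<^sub>M" by (simp add: rlin_diff[OF F M q(1)] rlin_closed[OF q(1)])
  then have "h (x \<ominus>\<^sub>F y) = \<zero>\<^sub>N" using ker xy by simp
  then show "h x = h y" using xy by (simp add: rlin_diff[OF F N h] rlin_closed[OF h] N.M.minus_zero_iff)
 qed fact
 show "rlin R M N (descend ($F) q h)"
 proof (rule rlinI)
  fix x assume "x : $M"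
  then obtain x' where "x' : $F" "x = q x'" using q(2) by auto
  then show "descend ($F) q h x : $N" using e rlin_closed[OF h] by simp
 next
  fix x y assume "x : $M" "y : $M"
  then obtain x' y' where "x' : $F" "x = q x'" "y' : $F" "y = q y'" using q(2) by blast
  then show "descend ($F) q h (x \<oplus>\<^sub>M y) =
    descend ($F) q h x \<oplus>\<^sub>N descend ($F) q h y" by (simp add: e flip: rlin_add[OF q(1)]) (simp add: rlin_add[OF h])
 next
  fix a x assume "a : $R" "x : $M"
  then obtain x' where "x' : $F" "x = q x'" using q(2) by auto
  then show "descend ($F) q h (a \<odot>\<^sub>M x) = a \<odot>\<^sub>N descend ($F) q h x"
   using \<open>a : $R\<close> by (simp add: e flip: rlin_smult[OF q(1)]) (simp add: rlin_smult[OF h])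
 qed
qed

section \<open>Free and projective modules\<close>

lemma rmodule_regular:
 fixes R (structure)
 assumes "ring R" shows "rmodule R (reg R)"
proof -
 interpret ring R by fact
 have "abelian_group (reg R)" by (rule abelian_groupI) (auto simp: regular_module_def a_ac intro: l_neg bexI[of _ "\<ominus> _"])
 then interpret abelian_group "reg R" .
 show ?thesis by unfold_locales (auto simp: regular_module_def l_distr r_distr m_assoc)
qed

lemma regular_module_simps [simp]:
 "$(reg R) = $R" "\<zero>\<^bsub>reg R\<^esub> = \<zero>\<^sub>R"
 "x \<oplus>\<^bsub>reg R\<^esub> y = x \<oplus>\<^sub>R y" "a \<odot>\<^bsub>reg R\<^esub> x = x \<otimes>\<^sub>R a"
 by (simp_all add: regular_module_def)

lemma regular_minus:
 fixes R (structure)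
 assumes a: "ring R" "x : $R" shows "\<ominus>\<^bsub>reg R\<^esub> x = \<ominus> x"
proof -
 interpret ring R by fact
 interpret M: rmodule R "reg R" by (rule rmodule_regular) fact
 show ?thesis using a(2) M.M.minus_equality[of "\<ominus> x" x] by (simp add: l_neg)
qed

lemma regular_diff: "ring R ==> x : $R ==> y : $R ==> x \<ominus>\<^bsub>reg R\<^esub> y = x \<ominus>\<^sub>R y"
 by (simp add: a_minus_def regular_minus)

lemma regular_finsum: "finsum (reg R) g A = finsum R g A" by (simp add: finsum_def finprod_def regular_module_def)

lemma free_simps:
 "$(free R B) = {x : B \<rightarrow>\<^sub>E $R. finite {i : B. x i ~= \<zero>\<^sub>R}}"
 "\<zero>\<^bsub>free R B\<^esub> = (\<lambda>i\<in>B. \<zero>\<^sub>R)"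
 "x \<oplus>\<^bsub>free R B\<^esub> y = (\<lambda>i\<in>B. x i \<oplus>\<^sub>R y i)"
 "a \<odot>\<^bsub>free R B\<^esub> x = (\<lambda>i\<in>B. x i \<otimes>\<^sub>R a)" by (simp_all add: free_module_def direct_sum_def)

lemma free_coord: "x : $(free R B) ==> i : B ==> x i : $R" by (auto simp: free_simps)

lemma rmodule_free:
 fixes R (structure)
 assumes "ring R" shows "rmodule R (free R B)"
proof -
 interpret ring R by fact
 have "abelian_group (free R B)"
 proof (rule abelian_groupI)
  fix x y assume xy: "x : $(free R B)" "y : $(free R B)"
  have "finite {i. (i : B \<longrightarrow> x i \<oplus> y i ~= \<zero>) & i : B}"
   by (rule finite_subset[OF _ finite_UnI[of "{i : B. x i ~= \<zero>}" "{i : B. y i ~= \<zero>}"]])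
    (use xy in \<open>auto simp: free_simps\<close>)
  then show "x \<oplus>\<^bsub>free R B\<^esub> y : $(free R B)" using xy by (auto simp: free_simps conj_commute)
 next
  fix x assume x: "x : $(free R B)"
  have "(\<lambda>i\<in>B. \<ominus> x i) : $(free R B)" using x by (auto simp: free_simps elim!: rev_finite_subset)
  moreover have "(\<lambda>i\<in>B. \<ominus> x i) \<oplus>\<^bsub>free R B\<^esub> x = \<zero>\<^bsub>free R B\<^esub>"
   using free_coord[OF x] by (simp add: free_simps l_neg cong: restrict_cong)
  ultimately show "\<exists>y\<in>$(free R B). y \<oplus>\<^bsub>free R B\<^esub> x = \<zero>\<^bsub>free R B\<^esub>" by blast
 qed (auto simp: free_simps a_ac PiE_def extensional_def restrict_def Pi_def intro!: ext)
 then interpret M: abelian_group "free R B" .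
 show ?thesis
 proof unfold_locales
  fix a x assume "a : $R" "x : $(free R B)"
  then show "a \<odot>\<^bsub>free R B\<^esub> x : $(free R B)" by (auto simp: free_simps elim!: rev_finite_subset)
 qed (auto simp: free_simps l_distr r_distr m_assoc PiE_def extensional_def restrict_def Pi_def
   intro!: ext)
qed

lemma free_module_minus:
 fixes R (structure)
 assumes "ring R" "x : $(free R B)" shows "\<ominus>\<^bsub>free R B\<^esub> x = (\<lambda>i\<in>B. \<ominus>\<^sub>R x i)"
proof -
 interpret ring R by fact
 interpret M: rmodule R "free R B" by (rule rmodule_free) fact
 have "(\<lambda>i\<in>B. \<ominus> x i) : $(free R B)" using assms(2) by (auto simp: free_simps elim!: rev_finite_subset)
 moreover have "(\<lambda>i\<in>B. \<ominus> x i) \<oplus>\<^bsub>free R B\<^esub> x = \<zero>\<^bsub>free R B\<^esub>"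
  using free_coord[OF assms(2)] by (simp add: free_simps l_neg cong: restrict_cong)
 ultimately show ?thesis using M.M.minus_equality assms(2) by blast
qed

lemma free_module_diff:
 assumes "ring R" "x : $(free R B)" "y : $(free R B)" "i : B"
 shows "(x \<ominus>\<^bsub>free R B\<^esub> y) i = x i \<ominus>\<^sub>R y i"
 using assms by (simp add: a_minus_def free_module_minus free_simps(3))

lemma free_eqI:
 assumes "x : $(free R B)" "y : $(free R B)" "!!i. i : B ==> x i = y i" shows "x = y"
 using assms by (auto simp: free_simps intro: PiE_ext)

lemma free_coord_rlin:
 assumes "ring R" "i : B" shows "rlin R (free R B) (reg R) (%x. x i)" using assms by (auto intro!: rlinI simp: free_simps)

definition unitv :: "('a, 'c) ring_scheme => 'i set => 'i => 'i => 'a" where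
 "unitv R B b = (\<lambda>i\<in>B. if i = b then \<one>\<^sub>R else \<zero>\<^sub>R)"

lemma unitv_closed:
 assumes "ring R" shows "unitv R B b : $(free R B)"
proof -
 interpret ring R by fact
 have "{i : B. unitv R B b i ~= \<zero>\<^sub>R} \<subseteq> {b}" by (auto simp: unitv_def)
 then show ?thesis by (auto simp: free_simps unitv_def intro: finite_subset)
qed

text \<open>The sum runs over the support only, because \<open>B\<close> may be infinite and
  \<open>finsum\<close> over an infinite set is zero by convention.\<close>

definition lcomb :: "('a, 'c) ring_scheme => ('a, 'm, 'e) module_scheme => 'i set => ('i => 'm) => ('i => 'a) => 'm" where
 "lcomb R M B v x = finsum M (%i. x i \<odot>\<^sub>M v i) {i : B. x i ~= \<zero>\<^sub>R}"

context rmodule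
begin

lemma lcomb_superset:
 assumes "x : $(free R B)" "v : B \<rightarrow> $M" "finite C" "{i : B. x i ~= \<zero>} \<subseteq> C" "C \<subseteq> B"
 shows "lcomb R M B v x = finsum M (%i. x i \<odot>\<^sub>M v i) C" unfolding lcomb_def
proof (rule M.add.finprod_mono_neutral_cong_left)
 show "x i \<odot>\<^sub>M v i = \<zero>\<^sub>M" if "i : C - {i : B. x i ~= \<zero>}" for i using assms that by (auto simp: Pi_def)
 show "(%i. x i \<odot>\<^sub>M v i) : C \<rightarrow> $M" using assms free_coord[OF assms(1)] by (auto simp: Pi_def)
qed (use assms in auto)

lemma lcomb_rlin:
 assumes v: "v : B \<rightarrow> $M" shows "rlin R (free R B) M (lcomb R M B v)"
proof -
 interpret F: rmodule R "free R B" by (rule rmodule_free) (rule R.ring_axioms)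
 have fin: "finite {i : B. x i ~= \<zero>}" if "x : $(free R B)" for x using that by (simp add: free_simps)
 have cl: "x i : $R" if "x : $(free R B)" "i : B" for x i using that by (rule free_coord)
 have vi: "v i : $M" if "i : B" for i using v that by auto
 show ?thesis
 proof (rule rlinI)
  fix x assume x: "x : $(free R B)"
  show "lcomb R M B v x : $M" unfolding lcomb_def by (rule M.finsum_closed) (auto simp: cl[OF x] vi)
 next
  fix x y assume x: "x : $(free R B)" and y: "y : $(free R B)"
  let ?C = "{i : B. x i ~= \<zero>} \<union> {i : B. y i ~= \<zero>}"
  have xy: "x \<oplus>\<^bsub>free R B\<^esub> y : $(free R B)" using x y by simp
  have C: "finite ?C" "?C \<subseteq> B" using fin x y by auto
  have "lcomb R M B v (x \<oplus>\<^bsub>free R B\<^esub> y) =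
    finsum M (%i. (x \<oplus>\<^bsub>free R B\<^esub> y) i \<odot>\<^sub>M v i) ?C"
   by (rule lcomb_superset[OF xy v]) (use C in \<open>auto simp: free_simps\<close>)
  also have "\<dots> = finsum M (%i. x i \<odot>\<^sub>M v i \<oplus>\<^sub>M y i \<odot>\<^sub>M v i) ?C"
   by (rule M.finsum_cong') (auto simp: free_simps(3) cl[OF x] cl[OF y] vi smult_l_distr)
  also have "\<dots> = finsum M (%i. x i \<odot>\<^sub>M v i) ?C \<oplus>\<^sub>M finsum M (%i. y i \<odot>\<^sub>M v i) ?C"
   by (rule M.finsum_addf) (auto simp: cl[OF x] cl[OF y] vi)
  also have "\<dots> = lcomb R M B v x \<oplus>\<^sub>M lcomb R M B v y" using lcomb_superset[OF x v, of ?C] lcomb_superset[OF y v, of ?C] C by simp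
  finally show "lcomb R M B v (x \<oplus>\<^bsub>free R B\<^esub> y) = lcomb R M B v x \<oplus>\<^sub>M lcomb R M B v y" .
 next
  fix a x assume a: "a : $R" and x: "x : $(free R B)"
  let ?C = "{i : B. x i ~= \<zero>}"
  have C: "finite ?C" "?C \<subseteq> B" using fin x by auto
  have ax: "a \<odot>\<^bsub>free R B\<^esub> x : $(free R B)" using a x by simp
  have "lcomb R M B v (a \<odot>\<^bsub>free R B\<^esub> x) = finsum M (%i. (a \<odot>\<^bsub>free R B\<^esub> x) i \<odot>\<^sub>M v i) ?C"
   by (rule lcomb_superset[OF ax v]) (use C a in \<open>auto simp: free_simps\<close>)
  also have "\<dots> = finsum M (%i. a \<odot>\<^sub>M (x i \<odot>\<^sub>M v i)) ?C"
   by (rule M.finsum_cong') (auto simp: free_simps(4) cl[OF x] vi a smult_assoc)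
  also have "\<dots> = a \<odot>\<^sub>M lcomb R M B v x" unfolding lcomb_def
   by (rule additive_finsum[OF M.abelian_group_axioms M.abelian_group_axioms, symmetric])
    (auto simp: cl[OF x] vi a smult_r_distr)
  finally show "lcomb R M B v (a \<odot>\<^bsub>free R B\<^esub> x) = a \<odot>\<^sub>M lcomb R M B v x" .
 qed
qed

lemma lcomb_unitv:
 assumes v: "v : B \<rightarrow> $M" and b: "b : B" shows "lcomb R M B v (unitv R B b) = v b"
proof -
 have "lcomb R M B v (unitv R B b) = finsum M (%i. unitv R B b i \<odot>\<^sub>M v i) {b}"
  by (rule lcomb_superset[OF unitv_closed[OF R.ring_axioms] v])
   (use b in \<open>auto simp: unitv_def\<close>)
 also have "\<dots> = \<one> \<odot>\<^sub>M v b"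
  using M.finsum_insert[of "{}" b "%i. unitv R B b i \<odot>\<^sub>M v i"] v b by (auto simp: unitv_def Pi_def)
 finally show ?thesis using funcset_mem[OF v b] by simp
qed

end

lemma free_finsum_coord:
 assumes R: "ring R" and "g : A \<rightarrow> $(free R B)" "i : B" shows "finsum (free R B) g A i = finsum R (%a. g a i) A"
 using rlin_finsum[OF rmodule_free[OF R] rmodule_regular[OF R] free_coord_rlin[OF R assms(3)] assms(2)] by (simp add: regular_finsum)

lemma lcomb_unitv_id:
 fixes R (structure)
 assumes R: "ring R" and x: "x : $(free R B)" shows "lcomb R (free R B) B (unitv R B) x = x"
proof -
 interpret ring R by fact
 interpret F: rmodule R "free R B" by (rule rmodule_free) fact
 have u: "unitv R B : B \<rightarrow> $(free R B)" by (simp add: unitv_closed[OF R])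
 show ?thesis
 proof (rule free_eqI[OF _ x])
  show "lcomb R (free R B) B (unitv R B) x : $(free R B)" using F.lcomb_rlin[OF u] x by (rule rlin_closed)
  fix i assume i: "i : B"
  have xi: "!!j. j : B ==> x j : $R" using x by (rule free_coord)
  have "finite ({j : B. x j ~= \<zero>} \<union> {i})" using x by (simp add: free_simps)
  then have f: "finite {j : B. x j ~= \<zero>}" by simp
  have "lcomb R (free R B) B (unitv R B) x i
   = finsum (free R B) (%j. x j \<odot>\<^bsub>free R B\<^esub> unitv R B j) ({j : B. x j ~= \<zero>} \<union> {i}) i"
   by (subst F.lcomb_superset[OF x u, where C = "{j : B. x j ~= \<zero>} \<union> {i}"]) (use f i in auto)
  also have "\<dots> = finsum R (%j. (x j \<odot>\<^bsub>free R B\<^esub> unitv R B j) i) ({j : B. x j ~= \<zero>} \<union> {i})"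
   by (rule free_finsum_coord[OF R _ i]) (auto simp: xi i unitv_closed[OF R])
  also have "\<dots> = finsum R (%j. if i = j then x j else \<zero>) ({j : B. x j ~= \<zero>} \<union> {i})"
   by (rule finsum_cong') (use xi i in \<open>auto simp: free_simps unitv_def\<close>)
  also have "\<dots> = x i" by (rule add.finprod_singleton) (use f xi i in auto)
  finally show "lcomb R (free R B) B (unitv R B) x i = x i" .
 qed
qed

lemma rlin_free_eq_lcomb:
 assumes N: "rmodule R N" and h: "rlin R (free R B) N h" and x: "x : $(free R B)" shows "h x = lcomb R N B (%b. h (unitv R B b)) x"
proof -
 interpret N: rmodule R N by fact
 have R: "ring R" by (rule N.R.ring_axioms)
 interpret F: rmodule R "free R B" by (rule rmodule_free[OF R])
 have xi: "!!j. j : B ==> x j : $R" using x by (rule free_coord)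
 have "h x = h (lcomb R (free R B) B (unitv R B) x)" by (simp add: lcomb_unitv_id[OF R x])
 also have "\<dots> = lcomb R N B (%b. h (unitv R B b)) x" unfolding lcomb_def
  by (subst rlin_finsum[OF F.rmodule_axioms N h], (auto simp: xi unitv_closed[OF R])[1],
    rule N.M.finsum_cong')
   (auto simp: rlin_smult[OF h] xi unitv_closed[OF R] rlin_closed[OF h])
 finally show ?thesis .
qed

lemma rlin_free_eqI:
 assumes N: "rmodule R N" and h: "rlin R (free R B) N h" and g: "rlin R (free R B) N g"
  and e: "!!b. b : B ==> h (unitv R B b) = g (unitv R B b)" and x: "x : $(free R B)" shows "h x = g x"
proof -
 interpret N: rmodule R N by fact
 show ?thesis unfolding rlin_free_eq_lcomb[OF N h x] rlin_free_eq_lcomb[OF N g x] lcomb_def by (rule N.M.finsum_cong')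
   (auto simp: e intro!: N.smult_closed free_coord[OF x] rlin_closed[OF g] unitv_closed N.R.ring_axioms)
qed

text \<open>Preimages have to be chosen only for the images of the unit vectors, so \<open>g\<close>
  may fail to be surjective.\<close>

lemma free_lift:
 assumes X: "rmodule R X" and Y: "rmodule R Y" and g: "rlin R X Y g"
  and h: "rlin R (free R B) Y h" and im: "!!b. b : B ==> h (unitv R B b) : g ` $X"
 obtains k where "rlin R (free R B) X k" "!!x. x : $(free R B) ==> g (k x) = h x"
proof -
 interpret X: rmodule R X by fact
 define v where "v b = inv_into ($X) g (h (unitv R B b))" for b
 have v: "v b : $X" "g (v b) = h (unitv R B b)" if "b : B" for b using im[OF that] unfolding v_def by (auto intro: inv_into_into f_inv_into_f)
 then have vB: "v : B \<rightarrow> $X" by auto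
 have k: "rlin R (free R B) X (lcomb R X B v)" by (rule X.lcomb_rlin[OF vB])
 show ?thesis
 proof (rule that[OF k])
  fix x assume "x : $(free R B)"
  then show "g (lcomb R X B v x) = h x" by (rule rlin_free_eqI[OF Y rlin_comp[OF k g] h, rotated]) (auto simp: X.lcomb_unitv[OF vB] v)
 qed
qed

lemma projective_rmodule: "projective_module R P ==> rmodule R P" by (simp add: projective_module_def right_module_iff)

text \<open>Lift \<open>h p\<close> from the free module of which \<open>P\<close> is a summand, and
  precompose with the section \<open>i\<close>. The hypothesis asks for values in the image of
  \<open>g\<close> instead of surjectivity, as this is what exactness of a resolution
  provides.\<close>

lemma projective_lift:
 fixes P :: "('a, 'm, 'e) module_scheme"
 assumes P: "projective_module R P" and X: "rmodule R X" and Y: "rmodule R Y" and g: "rlin R X Y g"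
  and h: "rlin R P Y h" and im: "!!x. x : $P ==> h x : g ` $X"
 obtains k where "rlin R P X k" "!!x. x : $P ==> g (k x) = h x"
proof -
 interpret X: rmodule R X by fact
 from P obtain B :: "'m set" and i p where i: "i : module_hom R P (free R B)"
  and p: "p : module_hom R (free R B) P" and pi: "\<forall>x\<in>$P. p (i x) = x" unfolding projective_module_def by blast
 note i = module_hom_rlin[OF i] and p = module_hom_rlin[OF p]
 obtain k where k: "rlin R (free R B) X k" "!!x. x : $(free R B) ==> g (k x) = h (p x)"
  using free_lift[OF X Y g rlin_comp[OF p h]] im rlin_closed[OF p] unitv_closed[OF X.R.ring_axioms] by metis
 show ?thesis by (rule that[OF rlin_comp[OF i k(1)]]) (simp add: k(2) rlin_closed[OF i] pi)
qed

text \<open>The index type of the free module is arbitrary here, unlike in the definition.\<close>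

lemma projective_moduleI:
 assumes P: "rmodule R P" and i: "rlin R P (free R B) i" and p: "rlin R (free R B) P p"
  and pi: "!!x. x : $P ==> p (i x) = x" shows "projective_module R P"
proof -
 interpret P: rmodule R P by fact
 let ?G = "free R ($P)"
 have R: "ring R" by (rule P.R.ring_axioms)
 have G: "rmodule R ?G" by (rule rmodule_free[OF R])
 define c where "c = lcomb R P ($P) (%x. x)"
 have c: "rlin R ?G P c" unfolding c_def by (rule P.lcomb_rlin) simp
 have cu: "c (unitv R ($P) x) = x" if "x : $P" for x unfolding c_def by (rule P.lcomb_unitv) (use that in auto)
 have "x : c ` $?G" if "x : $P" for x using cu[OF that] unitv_closed[OF R] by (metis image_eqI)
 then obtain k where k: "rlin R (free R B) ?G k" "!!x. x : $(free R B) ==> c (k x) = p x"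
  using free_lift[OF G P c p] rlin_closed[OF p] unitv_closed[OF R] by metis
 have "restrict (%x. k (i x)) ($P) : module_hom R P ?G" by (rule restrict_module_hom[OF P rlin_comp[OF i k(1)]])
 moreover have "restrict c ($?G) : module_hom R ?G P" by (rule restrict_module_hom[OF G c])
 moreover have "restrict c ($?G) (restrict (%x. k (i x)) ($P) x) = x" if "x : $P" for x
  using that rlin_closed[OF k(1) rlin_closed[OF i that]] by (simp add: k(2) rlin_closed[OF i] pi)
 ultimately show ?thesis unfolding projective_module_def right_module_iff using P by blast
qed

lemma projective_free: "ring R ==> projective_module R (free R B)" by (rule projective_moduleI[OF rmodule_free rlin_id rlin_id]) auto

text \<open>The terms of the mapping cone below are products of two free modules; pairs keep the
  blocks of its differential apart.\<close>

definition prod_module :: "('a, 'm, 'e) module_scheme => ('a, 'n, 'g) module_scheme => ('a, 'm \<times> 'n) module" where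
 "prod_module M N = \<lparr>carrier = $M \<times> $N, mult = undefined, one = undefined,
   zero = (\<zero>\<^sub>M, \<zero>\<^sub>N), add = %x y. (fst x \<oplus>\<^sub>M fst y, snd x \<oplus>\<^sub>N snd y),
   smult = %a x. (a \<odot>\<^sub>M fst x, a \<odot>\<^sub>N snd x)\<rparr>"

lemma prod_module_simps [simp]:
 "$(prod_module M N) = $M \<times> $N" "\<zero>\<^bsub>prod_module M N\<^esub> = (\<zero>\<^sub>M, \<zero>\<^sub>N)"
 "x \<oplus>\<^bsub>prod_module M N\<^esub> y = (fst x \<oplus>\<^sub>M fst y, snd x \<oplus>\<^sub>N snd y)"
 "a \<odot>\<^bsub>prod_module M N\<^esub> x = (a \<odot>\<^sub>M fst x, a \<odot>\<^sub>N snd x)" by (simp_all add: prod_module_def)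

lemma rmodule_prod:
 assumes "rmodule R M" "rmodule R N" shows "rmodule R (prod_module M N)"
proof -
 interpret M: rmodule R M by fact
 interpret N: rmodule R N by fact
 have "abelian_group (prod_module M N)"
 proof (rule abelian_groupI)
  fix x assume "x : $(prod_module M N)"
  then show "\<exists>y\<in>$(prod_module M N). y \<oplus>\<^bsub>prod_module M N\<^esub> x = \<zero>\<^bsub>prod_module M N\<^esub>"
   by (intro bexI[of _ "(\<ominus>\<^sub>M fst x, \<ominus>\<^sub>N snd x)"]) (auto simp: M.M.l_neg N.M.l_neg)
 qed (auto simp: M.M.a_ac N.M.a_ac)
 then interpret abelian_group "prod_module M N" .
 show ?thesis by unfold_locales (auto simp: M.smult_l_distr N.smult_l_distr M.smult_r_distr N.smult_r_distr
    M.smult_assoc N.smult_assoc)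
qed

text \<open>The product is free on the disjoint union of the two bases.\<close>

lemma projective_prod:
 fixes R (structure)
 assumes R: "ring R" shows "projective_module R (prod_module (free R A) (free R B))"
proof -
 interpret ring R by fact
 have fin: "finite {i : A <+> B. case_sum x y i ~= \<zero>}"
  if "finite {i : A. x i ~= \<zero>}" "finite {i : B. y i ~= \<zero>}" for x y
 proof -
  have "{i : A <+> B. case_sum x y i ~= \<zero>} \<subseteq> {i : A. x i ~= \<zero>} <+> {i : B. y i ~= \<zero>}" by auto
  then show ?thesis using that by (meson finite_Plus finite_subset)
 qed
 have fin1: "finite {i : A. z (Inl i) ~= \<zero>}" if "finite {i : A <+> B. z i ~= \<zero>}" for z
  by (rule finite_imageD[OF finite_subset[OF _ that], of Inl]) auto
 have fin2: "finite {i : B. z (Inr i) ~= \<zero>}" if "finite {i : A <+> B. z i ~= \<zero>}" for z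
  by (rule finite_imageD[OF finite_subset[OF _ that], of Inr]) auto
 have cs: "restrict (case_sum x y) (A <+> B) : $(free R (A <+> B))"
  if "x : $(free R A)" "y : $(free R B)" for x y
 proof -
  have "finite {i : A <+> B. restrict (case_sum x y) (A <+> B) i ~= \<zero>}"
   by (rule finite_subset[OF _ fin[of x y]]) (use that in \<open>auto simp: free_simps\<close>)
  then show ?thesis using that by (auto simp: free_simps)
 qed
 show ?thesis
 proof (rule projective_moduleI)
  show "rmodule R (prod_module (free R A) (free R B))" by (intro rmodule_prod rmodule_free R)
  show "rlin R (prod_module (free R A) (free R B)) (free R (A <+> B))
    (%z. restrict (case_sum (fst z) (snd z)) (A <+> B))"
  proof (rule rlinI)
   fix x assume "x : $(prod_module (free R A) (free R B))"
   then show "restrict (case_sum (fst x) (snd x)) (A <+> B) : $(free R (A <+> B))" by (intro cs) auto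
  qed (auto simp: free_simps restrict_def split: sum.splits intro!: ext)
  show "rlin R (free R (A <+> B)) (prod_module (free R A) (free R B))
    (%z. (restrict (%i. z (Inl i)) A, restrict (%i. z (Inr i)) B))"
   by (rule rlinI) (auto simp: free_simps fin1 fin2 cong: conj_cong)
 qed (auto simp: free_simps PiE_def extensional_def restrict_def Pi_def intro!: ext)
qed

section \<open>Comparison of projective resolutions\<close>

text \<open>A projective resolution with carriers of any type and with maps that are merely linear,
  so that free modules on initial segments of the natural numbers qualify. Exactness is phrased
  pointwise.\<close>

definition resol ::
 "('a, 'c) ring_scheme => ('a, 'm, 'e) module_scheme => (nat => ('a, 'u, 'f) module_scheme)
   => (nat => 'u => 'u) => ('u => 'm) => bool" where
 "resol R M P d e \<longleftrightarrow>
   (\<forall>n. projective_module R (P n)) & (\<forall>n. rlin R (P (Suc n)) (P n) (d n)) & rlin R (P 0) M e &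
   e ` $(P 0) = $M &
   (\<forall>x\<in>$(P 0). e x = \<zero>\<^sub>M \<longleftrightarrow> x : d 0 ` $(P 1)) &
   (\<forall>n. \<forall>x\<in>$(P (Suc n)). d n x = \<zero>\<^bsub>P n\<^esub> \<longleftrightarrow> x : d (Suc n) ` $(P (Suc (Suc n))))"

lemma projective_resolution_resol: "projective_resolution R M P d e ==> resol R M P d e"
proof -
 assume "projective_resolution R M P d e"
 then have a: "\<forall>n. projective_module R (P n)" "\<forall>n. d n : module_hom R (P (Suc n)) (P n)"
   "e : module_hom R (P 0) M" "e ` $(P 0) = $M"
   "{x : $(P 0). e x = \<zero>\<^sub>M} = d 0 ` $(P 1)"
   "{x : $(P (Suc n)). d n x = \<zero>\<^bsub>P n\<^esub>} = d (Suc n) ` $(P (Suc (Suc n)))" for n unfolding projective_resolution_def by simp_all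
 show ?thesis unfolding resol_def using a(1-4) a(5)[symmetric] a(6)[symmetric] by (simp add: module_hom_iff)
qed

lemma resolD:
 assumes "resol R M P d e" shows "projective_module R (P n)" "rmodule R (P n)" "rlin R (P (Suc n)) (P n) (d n)" "rlin R (P 0) M e"
  "e ` $(P 0) = $M"
  "x : $(P 0) ==> e x = \<zero>\<^sub>M \<longleftrightarrow> x : d 0 ` $(P (Suc 0))"
  "x : $(P (Suc n)) ==> d n x = \<zero>\<^bsub>P n\<^esub> \<longleftrightarrow> x : d (Suc n) ` $(P (Suc (Suc n)))"
 using assms unfolding resol_def by (auto simp: projective_rmodule)

lemma resol_complex:
 assumes "resol R M P d e" shows "x : $(P (Suc (Suc n))) ==> d n (d (Suc n) x) = \<zero>\<^bsub>P n\<^esub>"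
  and "y : $(P (Suc 0)) ==> e (d 0 y) = \<zero>\<^sub>M" using resolD(6,7)[OF assms] rlin_closed[OF resolD(3)[OF assms]] by blast+

lemma resol_lift:
 assumes M: "rmodule R M" and P: "resol R M P d e" and Q: "resol R M Q d' e'"
 obtains \<alpha> where "!!n. rlin R (P n) (Q n) (\<alpha> n)" "!!x. x : $(P 0) ==> e' (\<alpha> 0 x) = e x"
  "!!n x. x : $(P (Suc n)) ==> d' n (\<alpha> (Suc n) x) = \<alpha> n (d n x)"
proof -
 \<comment> \<open>Beyond linearity the invariant records what the next lift needs: \<open>a\<close>
   sends the image of \<open>d n\<close> into the image of \<open>d' n\<close>.\<close>
 define I where "I n a \<longleftrightarrow> rlin R (P n) (Q n) a & (\<forall>x\<in>$(P (Suc n)). a (d n x) : d' n ` $(Q (Suc n)))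
  & (n = 0 \<longrightarrow> (\<forall>x\<in>$(P 0). e' (a x) = e x))" for n a
 have base: "\<exists>a. I 0 a"
 proof -
  obtain a where a: "rlin R (P 0) (Q 0) a" "!!x. x : $(P 0) ==> e' (a x) = e x"
   using projective_lift[OF resolD(1)[OF P] resolD(2)[OF Q] M resolD(4)[OF Q] resolD(4)[OF P]]
    resolD(5)[OF Q] rlin_closed[OF resolD(4)[OF P]] by metis
  moreover have "a (d 0 x) : d' 0 ` $(Q (Suc 0))" if "x : $(P (Suc 0))" for x
   using resolD(6)[OF Q, of "a (d 0 x)"] rlin_closed[OF a(1)] rlin_closed[OF resolD(3)[OF P]]
    a(2) resol_complex(2)[OF P] that by metis
  ultimately show ?thesis unfolding I_def by blast
 qed
 have step: "\<exists>b. I (Suc n) b & (\<forall>x\<in>$(P (Suc n)). d' n (b x) = a (d n x))" if "I n a" for n a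
 proof -
  have a: "rlin R (P n) (Q n) a" "!!x. x : $(P (Suc n)) ==> a (d n x) : d' n ` $(Q (Suc n))"
   using that unfolding I_def by auto
  obtain b where b: "rlin R (P (Suc n)) (Q (Suc n)) b" "!!x. x : $(P (Suc n)) ==> d' n (b x) = a (d n x)"
   using projective_lift[OF resolD(1)[OF P] resolD(2)[OF Q] resolD(2)[OF Q] resolD(3)[OF Q]
     rlin_comp[OF resolD(3)[OF P] a(1)] a(2)] by metis
  moreover have "b (d (Suc n) x) : d' (Suc n) ` $(Q (Suc (Suc n)))"
   if x: "x : $(P (Suc (Suc n)))" for x
  proof -
   have c: "d (Suc n) x : $(P (Suc n))" using x rlin_closed[OF resolD(3)[OF P]] by blast
   have "d' n (b (d (Suc n) x)) = \<zero>\<^bsub>Q n\<^esub>"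
    using b(2)[OF c] resol_complex(1)[OF P x] rlin_zero[OF resolD(2)[OF P] resolD(2)[OF Q] a(1)] by simp
   then show ?thesis using resolD(7)[OF Q rlin_closed[OF b(1) c]] by blast
  qed
  ultimately show ?thesis unfolding I_def by blast
 qed
 obtain \<alpha> where \<alpha>: "!!n. I n (\<alpha> n)" "!!n. \<forall>x\<in>$(P (Suc n)). d' n (\<alpha> (Suc n) x) = \<alpha> n (d n x)"
  using dependent_nat_choice[of I "%n a b. \<forall>x\<in>$(P (Suc n)). d' n (b x) = a (d n x)"] base step by metis
 show ?thesis by (rule that[of \<alpha>]) (use \<alpha> in \<open>auto simp: I_def\<close>)
qed

lemma resol_null_homotopic:
 assumes M: "rmodule R M" and P: "resol R M P d e" and Q: "resol R M Q d' e'"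
  and \<gamma>: "!!n. rlin R (P n) (Q n) (\<gamma> n)" and \<gamma>0: "!!x. x : $(P 0) ==> e' (\<gamma> 0 x) = \<zero>\<^sub>M"
  and \<gamma>S: "!!n x. x : $(P (Suc n)) ==> d' n (\<gamma> (Suc n) x) = \<gamma> n (d n x)"
 obtains s where "!!n. rlin R (P n) (Q (Suc n)) (s n)"
  "!!n x. x : $(P (Suc n)) ==> \<gamma> (Suc n) x = d' (Suc n) (s (Suc n) x) \<oplus>\<^bsub>Q (Suc n)\<^esub> s n (d n x)"
proof -
 \<comment> \<open>The equation \<open>d' s = \<gamma>\<close> on boundaries is what makes
   \<open>\<gamma> - s d\<close> a cycle one degree higher.\<close>
 define I where "I n s \<longleftrightarrow> rlin R (P n) (Q (Suc n)) s &
  (\<forall>x\<in>$(P (Suc n)). d' n (s (d n x)) = \<gamma> n (d n x))" for n s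
 note dP = rlin_closed[OF resolD(3)[OF P]] and dQ = rlin_closed[OF resolD(3)[OF Q]]
 have base: "\<exists>s. I 0 s"
 proof -
  have "\<gamma> 0 x : d' 0 ` $(Q (Suc 0))" if "x : $(P 0)" for x
   using resolD(6)[OF Q rlin_closed[OF \<gamma> that]] \<gamma>0[OF that] by blast
  then obtain s where "rlin R (P 0) (Q (Suc 0)) s" "!!x. x : $(P 0) ==> d' 0 (s x) = \<gamma> 0 x"
   using projective_lift[OF resolD(1)[OF P] resolD(2)[OF Q] resolD(2)[OF Q] resolD(3)[OF Q] \<gamma>] by metis
  then show ?thesis unfolding I_def using dP by blast
 qed
 have step: "\<exists>t. I (Suc n) t & (\<forall>x\<in>$(P (Suc n)). \<gamma> (Suc n) x = d' (Suc n) (t x) \<oplus>\<^bsub>Q (Suc n)\<^esub> s (d n x))"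
  if "I n s" for n s
 proof -
  interpret Q: rmodule R "Q (Suc n)" by (rule resolD(2)[OF Q])
  interpret Qn: rmodule R "Q n" by (rule resolD(2)[OF Q])
  have s: "rlin R (P n) (Q (Suc n)) s" "!!x. x : $(P (Suc n)) ==> d' n (s (d n x)) = \<gamma> n (d n x)"
   using that unfolding I_def by auto
  define g where "g x = \<gamma> (Suc n) x \<ominus>\<^bsub>Q (Suc n)\<^esub> s (d n x)" for x
  have g: "rlin R (P (Suc n)) (Q (Suc n)) g" unfolding g_def by (rule rlin_sub[OF Q.rmodule_axioms \<gamma> rlin_comp[OF resolD(3)[OF P] s(1)]])
  have "g x : d' (Suc n) ` $(Q (Suc (Suc n)))" if x: "x : $(P (Suc n))" for x
  proof -
   have c: "\<gamma> (Suc n) x : $(Q (Suc n))" "s (d n x) : $(Q (Suc n))" using rlin_closed[OF \<gamma> x] rlin_closed[OF s(1) dP[OF x]] .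
   have "d' n (g x) = d' n (\<gamma> (Suc n) x) \<ominus>\<^bsub>Q n\<^esub> d' n (s (d n x))"
    unfolding g_def by (rule rlin_diff[OF resolD(2)[OF Q] resolD(2)[OF Q] resolD(3)[OF Q] c])
   also have "\<dots> = \<zero>\<^bsub>Q n\<^esub>" using \<gamma>S[OF x] s(2)[OF x] rlin_closed[OF \<gamma> dP[OF x]] by simp
   finally show ?thesis using resolD(7)[OF Q rlin_closed[OF g x]] by blast
  qed
  then obtain t where t: "rlin R (P (Suc n)) (Q (Suc (Suc n))) t"
    "!!x. x : $(P (Suc n)) ==> d' (Suc n) (t x) = g x"
   using projective_lift[OF resolD(1)[OF P] resolD(2)[OF Q] resolD(2)[OF Q] resolD(3)[OF Q] g] by metis
  have e: "\<gamma> (Suc n) x = d' (Suc n) (t x) \<oplus>\<^bsub>Q (Suc n)\<^esub> s (d n x)" if x: "x : $(P (Suc n))" for x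
   using t(2)[OF x] rlin_closed[OF \<gamma> x] rlin_closed[OF s(1) dP[OF x]] by (simp add: g_def)
  have "d' (Suc n) (t (d (Suc n) x)) = \<gamma> (Suc n) (d (Suc n) x)" if x: "x : $(P (Suc (Suc n)))" for x
   using e[OF dP[OF x]] resol_complex(1)[OF P x] rlin_zero[OF resolD(2)[OF P] Q.rmodule_axioms s(1)]
    dQ[OF rlin_closed[OF t(1) dP[OF x]]] by simp
  then show ?thesis using t(1) e unfolding I_def by blast
 qed
 obtain s where s: "!!n. I n (s n)"
   "!!n. \<forall>x\<in>$(P (Suc n)). \<gamma> (Suc n) x = d' (Suc n) (s (Suc n) x) \<oplus>\<^bsub>Q (Suc n)\<^esub> s n (d n x)"
  using dependent_nat_choice[of I "%n s t. \<forall>x\<in>$(P (Suc n)).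
   \<gamma> (Suc n) x = d' (Suc n) (t x) \<oplus>\<^bsub>Q (Suc n)\<^esub> s (d n x)"] base step by metis
 show ?thesis by (rule that[of s]) (use s in \<open>auto simp: I_def\<close>)
qed

text \<open>The identity is compared with \<open>\<beta> \<alpha>\<close>: their difference lifts
  zero, hence is null-homotopic. Only this composite in positive degrees is recorded, as it serves
  Ext groups of positive index.\<close>

lemma resol_homotopy_equiv:
 assumes M: "rmodule R M" and P: "resol R M P d e" and Q: "resol R M Q d' e'"
 obtains \<alpha> \<beta> s where "!!n. rlin R (P n) (Q n) (\<alpha> n)" "!!n. rlin R (Q n) (P n) (\<beta> n)"
  "!!n. rlin R (P n) (P (Suc n)) (s n)"
  "!!n x. x : $(P (Suc n)) ==> d' n (\<alpha> (Suc n) x) = \<alpha> n (d n x)"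
  "!!n x. x : $(Q (Suc n)) ==> d n (\<beta> (Suc n) x) = \<beta> n (d' n x)"
  "!!n x. x : $(P (Suc n)) ==>
    x \<ominus>\<^bsub>P (Suc n)\<^esub> \<beta> (Suc n) (\<alpha> (Suc n) x) = d (Suc n) (s (Suc n) x) \<oplus>\<^bsub>P (Suc n)\<^esub> s n (d n x)"
proof -
 obtain \<alpha> where \<alpha>: "!!n. rlin R (P n) (Q n) (\<alpha> n)" "!!x. x : $(P 0) ==> e' (\<alpha> 0 x) = e x"
  "!!n x. x : $(P (Suc n)) ==> d' n (\<alpha> (Suc n) x) = \<alpha> n (d n x)" using resol_lift[OF M P Q] by metis
 obtain \<beta> where \<beta>: "!!n. rlin R (Q n) (P n) (\<beta> n)" "!!x. x : $(Q 0) ==> e (\<beta> 0 x) = e' x"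
  "!!n x. x : $(Q (Suc n)) ==> d n (\<beta> (Suc n) x) = \<beta> n (d' n x)" using resol_lift[OF M Q P] by metis
 define \<gamma> where "\<gamma> n x = x \<ominus>\<^bsub>P n\<^esub> \<beta> n (\<alpha> n x)" for n x
 have \<gamma>: "rlin R (P n) (P n) (\<gamma> n)" for n
  unfolding \<gamma>_def by (rule rlin_sub[OF resolD(2)[OF P] rlin_id rlin_comp[OF \<alpha>(1) \<beta>(1)]])
 note dP = rlin_closed[OF resolD(3)[OF P]] and c\<alpha> = rlin_closed[OF \<alpha>(1)] and c\<beta> = rlin_closed[OF \<beta>(1)]
 interpret M: rmodule R M by fact
 have "e (\<gamma> 0 x) = \<zero>\<^sub>M" if "x : $(P 0)" for x
  using rlin_diff[OF resolD(2)[OF P] M resolD(4)[OF P] that c\<beta>[OF c\<alpha>[OF that]]] \<beta>(2)[OF c\<alpha>[OF that]] \<alpha>(2)[OF that]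
   rlin_closed[OF resolD(4)[OF P] that] by (simp add: \<gamma>_def)
 moreover have "d n (\<gamma> (Suc n) x) = \<gamma> n (d n x)" if "x : $(P (Suc n))" for n x
  using rlin_diff[OF resolD(2)[OF P] resolD(2)[OF P] resolD(3)[OF P] that c\<beta>[OF c\<alpha>[OF that]]]
   \<beta>(3)[OF c\<alpha>[OF that]] \<alpha>(3)[OF that] by (simp add: \<gamma>_def)
 ultimately obtain s where "!!n. rlin R (P n) (P (Suc n)) (s n)"
  "!!n x. x : $(P (Suc n)) ==> \<gamma> (Suc n) x = d (Suc n) (s (Suc n) x) \<oplus>\<^bsub>P (Suc n)\<^esub> s n (d n x)"
  using resol_null_homotopic[OF M P P, of \<gamma>] \<gamma> by metis
 then show ?thesis using that[of \<alpha> \<beta> s] \<alpha> \<beta> unfolding \<gamma>_def by blast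
qed

text \<open>Vanishing of the cohomology of \<open>Hom(P, N)\<close> in degree \<open>j + 1\<close>.\<close>

definition ext_van ::
 "('a, 'c) ring_scheme => (nat => ('a, 'u, 'f) module_scheme) => (nat => 'u => 'u)
   => ('a, 'n, 'g) module_scheme => nat => bool" where
 "ext_van R P d N j \<longleftrightarrow> (\<forall>h. rlin R (P (Suc j)) N h \<longrightarrow> (\<forall>x\<in>$(P (Suc (Suc j))). h (d (Suc j) x) = \<zero>\<^sub>N) \<longrightarrow>
   (\<exists>g. rlin R (P j) N g & (\<forall>x\<in>$(P (Suc j)). h x = g (d j x))))"

text \<open>A cocycle \<open>h\<close> on \<open>P\<close> gives the cocycle
  \<open>h \<beta>\<close> on \<open>Q\<close>, which is some \<open>g d'\<close>. As
  \<open>h\<close> kills boundaries, the homotopy formula yields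
  \<open>h = (g \<alpha> + h s) d\<close>.\<close>

lemma ext_van_transfer:
 assumes M: "rmodule R M" and N: "rmodule R N" and P: "resol R M P d e" and Q: "resol R M Q d' e'"
  and van: "ext_van R Q d' N j" shows "ext_van R P d N j" unfolding ext_van_def
proof (intro allI impI)
 fix h assume h: "rlin R (P (Suc j)) N h" and h0: "\<forall>x\<in>$(P (Suc (Suc j))). h (d (Suc j) x) = \<zero>\<^sub>N"
 interpret N: rmodule R N by fact
 obtain \<alpha> \<beta> s where \<alpha>: "!!n. rlin R (P n) (Q n) (\<alpha> n)" and \<beta>: "!!n. rlin R (Q n) (P n) (\<beta> n)"
  and s: "!!n. rlin R (P n) (P (Suc n)) (s n)"
  and \<alpha>': "!!n x. x : $(P (Suc n)) ==> d' n (\<alpha> (Suc n) x) = \<alpha> n (d n x)"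
  and \<beta>': "!!n x. x : $(Q (Suc n)) ==> d n (\<beta> (Suc n) x) = \<beta> n (d' n x)"
  and s': "!!n x. x : $(P (Suc n)) ==>
    x \<ominus>\<^bsub>P (Suc n)\<^esub> \<beta> (Suc n) (\<alpha> (Suc n) x) = d (Suc n) (s (Suc n) x) \<oplus>\<^bsub>P (Suc n)\<^esub> s n (d n x)"
  using resol_homotopy_equiv[OF M P Q] by metis
 note c\<alpha> = rlin_closed[OF \<alpha>] and c\<beta> = rlin_closed[OF \<beta>] and cs = rlin_closed[OF s]
  and dP = rlin_closed[OF resolD(3)[OF P]]
 have "\<forall>x\<in>$(Q (Suc (Suc j))). h (\<beta> (Suc j) (d' (Suc j) x)) = \<zero>\<^sub>N" using \<beta>'[symmetric] h0 c\<beta> by simp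
 then obtain g where g: "rlin R (Q j) N g" "!!x. x : $(Q (Suc j)) ==> h (\<beta> (Suc j) x) = g (d' j x)"
  using van rlin_comp[OF \<beta> h] unfolding ext_van_def by metis
 have "h x = (g (\<alpha> j (d j x)) \<oplus>\<^sub>N h (s j (d j x)))" if x: "x : $(P (Suc j))" for x
 proof -
  interpret Pj: rmodule R "P (Suc j)" by (rule resolD(2)[OF P])
  have c: "\<beta> (Suc j) (\<alpha> (Suc j) x) : $(P (Suc j))" using c\<beta>[OF c\<alpha>[OF x]] .
  have c1: "d (Suc j) (s (Suc j) x) : $(P (Suc j))" "s j (d j x) : $(P (Suc j))" using dP[OF cs[OF x]] cs[OF dP[OF x]] .
  have "h x \<ominus>\<^sub>N h (\<beta> (Suc j) (\<alpha> (Suc j) x)) = h (d (Suc j) (s (Suc j) x) \<oplus>\<^bsub>P (Suc j)\<^esub> s j (d j x))"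
   using rlin_diff[OF resolD(2)[OF P] N h x c] s'[OF x] by simp
  also have "\<dots> = h (s j (d j x))" using rlin_add[OF h c1] h0 cs[OF x] rlin_closed[OF h c1(2)] by simp
  finally show ?thesis using g(2)[OF c\<alpha>[OF x]] \<alpha>'[OF x] N.M.diff_eq_iff rlin_closed[OF h] x c c1
    rlin_closed[OF g(1) c\<alpha>[OF dP[OF x]]] by (simp add: N.M.a_comm)
 qed
 then show "\<exists>g. rlin R (P j) N g & (\<forall>x\<in>$(P (Suc j)). h x = g (d j x))"
  using rlin_sum[OF N rlin_comp[OF \<alpha> g(1)] rlin_comp[OF s h]]
  by (intro exI[of _ "%y. g (\<alpha> j y) \<oplus>\<^sub>N h (s j y)"]) auto
qed

text \<open>Where \<open>P\<close> vanishes the homotopy formula reads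
  \<open>id = d s + s d\<close>; applying \<open>d\<close> gives \<open>d s d = d\<close>, which
  makes the image of \<open>d n\<close> a direct summand of \<open>F n\<close>.\<close>

lemma resol_split:
 assumes M: "rmodule R M" and F: "resol R M F d e" and P: "resol R M P d' e'"
  and z: "$(P (Suc n)) = {\<zero>\<^bsub>P (Suc n)\<^esub>}"
 obtains s where "rlin R (F n) (F (Suc n)) s" "!!x. x : $(F (Suc n)) ==> d n (s (d n x)) = d n x"
proof -
 obtain \<alpha> \<beta> s where \<alpha>: "!!n. rlin R (F n) (P n) (\<alpha> n)" and \<beta>: "!!n. rlin R (P n) (F n) (\<beta> n)"
  and s: "!!n. rlin R (F n) (F (Suc n)) (s n)"
  and s': "!!n x. x : $(F (Suc n)) ==>
    x \<ominus>\<^bsub>F (Suc n)\<^esub> \<beta> (Suc n) (\<alpha> (Suc n) x) = d (Suc n) (s (Suc n) x) \<oplus>\<^bsub>F (Suc n)\<^esub> s n (d n x)"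
  using resol_homotopy_equiv[OF M F P] by metis
 note cs = rlin_closed[OF s] and dF = rlin_closed[OF resolD(3)[OF F]]
 have "d n (s n (d n x)) = d n x" if x: "x : $(F (Suc n))" for x
 proof -
  interpret F1: rmodule R "F (Suc n)" by (rule resolD(2)[OF F])
  interpret Fn: rmodule R "F n" by (rule resolD(2)[OF F])
  have "\<beta> (Suc n) (\<alpha> (Suc n) x) = \<zero>\<^bsub>F (Suc n)\<^esub>"
   using rlin_closed[OF \<alpha> x] z rlin_zero[OF resolD(2)[OF P] resolD(2)[OF F] \<beta>] by auto
  then have "x = d (Suc n) (s (Suc n) x) \<oplus>\<^bsub>F (Suc n)\<^esub> s n (d n x)" using s'[OF x] x by simp
  then have "d n x = d n (d (Suc n) (s (Suc n) x)) \<oplus>\<^bsub>F n\<^esub> d n (s n (d n x))"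
   using rlin_add[OF resolD(3)[OF F] dF[OF cs[OF x]] cs[OF dF[OF x]]] by simp
  then show ?thesis using resol_complex(1)[OF F cs[OF x]] dF[OF cs[OF dF[OF x]]] by simp
 qed
 then show ?thesis using that s by blast
qed

section \<open>Ext groups\<close>

lemma chosen_resolution:
 assumes "\<exists>(P :: nat => ('a, ('a, 'm) resolution_elem) module) d e. projective_resolution R M P d e"
 obtains P d e where "chosen_resolution R (M :: ('a, 'm, 'e) module_scheme) = (P, d, e)" "projective_resolution R M P d e"
proof -
 obtain P d e where c: "chosen_resolution R M = (P, d, e)" by (metis prod_cases3)
 have "case chosen_resolution R M of (P, d, e) => projective_resolution R M P d e"
  unfolding chosen_resolution_def by (rule someI_ex) (use assms in auto)
 then show ?thesis using that c by simp
qed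

lemma hom_group_comm:
 assumes M: "rmodule R M" and N: "rmodule R N" shows "comm_group (hom_group R M N)"
proof (rule comm_groupI)
 interpret N: rmodule R N by fact
 interpret M: rmodule R M by fact
 let ?G = "hom_group R M N"
 have c: "restrict h ($M) : $?G" if "rlin R M N h" for h using restrict_module_hom[OF M that] by (simp add: hom_group_def)
 note l = module_hom_rlin
 have e: "x : $M \<rightarrow>\<^sub>E $N" if "x : $?G" for x using that by (auto simp: hom_group_def module_hom_def)
 show "x \<otimes>\<^sub>?G y : $?G" if "x : $?G" "y : $?G" for x y using c[OF rlin_sum[OF N l l]] that by (simp add: hom_group_def)
 show "\<one>\<^sub>?G : $?G" using c[OF rlin_const_zero[OF N]] by (simp add: hom_group_def)
 show "\<one>\<^sub>?G \<otimes>\<^sub>?G x = x" if "x : $?G" for x using e[OF that] by (auto simp: hom_group_def PiE_def Pi_def extensional_def)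
 show "x \<otimes>\<^sub>?G y \<otimes>\<^sub>?G z = x \<otimes>\<^sub>?G (y \<otimes>\<^sub>?G z)" if "x : $?G" "y : $?G" "z : $?G" for x y z
  using e[OF that(1)] e[OF that(2)] e[OF that(3)] by (auto simp: hom_group_def PiE_def Pi_def N.M.a_assoc intro!: ext)
 show "x \<otimes>\<^sub>?G y = y \<otimes>\<^sub>?G x" if "x : $?G" "y : $?G" for x y using e[OF that(1)] e[OF that(2)]
  by (auto simp: hom_group_def PiE_def Pi_def N.M.a_comm intro!: ext)
 show "\<exists>y\<in>$?G. y \<otimes>\<^sub>?G x = \<one>\<^sub>?G" if "x : $?G" for x
 proof
  show "restrict (%z. \<ominus>\<^sub>N x z) ($M) : $?G" using c[OF rlin_neg[OF N l]] that by (simp add: hom_group_def)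
  show "restrict (%z. \<ominus>\<^sub>N x z) ($M) \<otimes>\<^sub>?G x = \<one>\<^sub>?G"
   using e[OF that] by (auto simp: hom_group_def PiE_def Pi_def N.M.l_neg intro!: ext)
 qed
qed

lemma hom_group_inv:
 assumes M: "rmodule R M" and N: "rmodule R N" and h: "h : module_hom R M N"
 shows "inv\<^bsub>hom_group R M N\<^esub> h = (\<lambda>x\<in>$M. \<ominus>\<^sub>N h x)"
proof -
 interpret N: rmodule R N by fact
 interpret G: comm_group "hom_group R M N" by (rule hom_group_comm[OF M N])
 show ?thesis
 proof (rule G.inv_equality)
  show "(\<lambda>x\<in>$M. \<ominus>\<^sub>N h x) \<otimes>\<^bsub>hom_group R M N\<^esub> h = \<one>\<^bsub>hom_group R M N\<^esub>"
   using h by (auto simp: hom_group_def module_hom_def PiE_def Pi_def N.M.l_neg intro!: ext)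
  show "(\<lambda>x\<in>$M. \<ominus>\<^sub>N h x) : $(hom_group R M N)"
   using restrict_module_hom[OF M rlin_neg[OF N module_hom_rlin[OF h]]] by (simp add: hom_group_def)
 qed (use h in \<open>simp add: hom_group_def\<close>)
qed

lemma trivial_Mod_iff:
 assumes G: "group G" and H: "\<one>\<^sub>G : H" "H \<subseteq> $G" shows "trivial_group (G Mod H) \<longleftrightarrow> H = $G"
proof
 assume "trivial_group (G Mod H)"
 then have t: "$(G Mod H) = {H}" by (simp add: trivial_group_def FactGroup_def)
 show "H = $G"
 proof
  show "$G \<subseteq> H"
  proof
   fix g assume g: "g : $G"
   then have "H #>\<^bsub>G\<^esub> g : $(G Mod H)" by (auto simp: FactGroup_def RCOSETS_def)
   then have "H #>\<^bsub>G\<^esub> g = H" using t by simp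
   moreover have "g : H #>\<^bsub>G\<^esub> g" using g H(1) group.is_monoid[OF G] by (force simp: r_coset_def monoid.l_one)
   ultimately show "g : H" by simp
  qed
 qed (rule H(2))
next
 assume e: "H = $G"
 interpret group G by (rule G)
 interpret normal "$G" G by (rule normalI[OF subgroup_self])
   (metis coset_join2 coset_join3 subgroup_self)
 have "$(G Mod $G) = {$G}" using coset_join2[OF _ subgroup_self] one_closed by (auto simp: FactGroup_def RCOSETS_def)
 then show "trivial_group (G Mod H)" unfolding e trivial_group_def using factorgroup_is_group by (simp add: FactGroup_def)
qed

text \<open>\<open>Ext\<close> uses a chosen resolution of a fixed carrier type. The assumption
  \<open>ex\<close> guarantees that the choice is a resolution, and the comparison of resolutions
  then allows the vanishing to be tested on any \<open>Q\<close>.\<close>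

lemma Ext_trivial_iff:
 assumes M: "rmodule R M" and N: "rmodule R N"
  and ex: "\<exists>(P :: nat => ('a, ('a, 'm) resolution_elem) module) d e. projective_resolution R M P d e"
  and Q: "resol R (M :: ('a, 'm, 'e) module_scheme) Q d' e'" shows "trivial_group (Ext R (Suc j) M N) \<longleftrightarrow> ext_van R Q d' N j"
proof -
 interpret N: rmodule R N by fact
 obtain P :: "nat => ('a, ('a, 'm) resolution_elem) module" and d e
  where c: "chosen_resolution R M = (P, d, e)" and P: "projective_resolution R M P d e" using chosen_resolution[OF ex] by metis
 note P' = projective_resolution_resol[OF P]
 let ?H = "hom_group R (P (Suc j)) N"
 let ?Z = "cocycles R P d N (Suc j)" let ?B = "coboundaries R P d N (Suc j)"
 let ?G = "?H\<lparr>carrier := ?Z\<rparr>"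
 interpret H: comm_group ?H by (rule hom_group_comm[OF resolD(2)[OF P'] N])
 note dP = rlin_closed[OF resolD(3)[OF P']]
 have sub: "subgroup ?Z ?H"
 proof (rule H.subgroupI)
  show "?Z \<subseteq> $?H" by (auto simp: cocycles_def hom_group_def)
  have "(\<lambda>x\<in>$(P (Suc j)). \<zero>\<^sub>N) : ?Z"
   using restrict_module_hom[OF resolD(2)[OF P'] rlin_const_zero[OF N], of "Suc j"] dP by (auto simp: cocycles_def)
  then show "?Z ~= {}" by blast
  show "inv\<^bsub>?H\<^esub> a : ?Z" if "a : ?Z" for a
   using that restrict_module_hom[OF resolD(2)[OF P'] rlin_neg[OF N module_hom_rlin, of a "P (Suc j)"]]
    hom_group_inv[OF resolD(2)[OF P'] N, of a] dP by (auto simp: cocycles_def)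
  show "a \<otimes>\<^sub>?H b : ?Z" if "a : ?Z" "b : ?Z" for a b
   using that restrict_module_hom[OF resolD(2)[OF P'] rlin_sum[OF N module_hom_rlin module_hom_rlin, of a "P (Suc j)" b]]
    dP by (auto simp: cocycles_def hom_group_def)
 qed
 then interpret G: group ?G by (rule H.subgroup_imp_group)
 have B: "?B \<subseteq> ?Z"
 proof
  fix b assume "b : ?B"
  then obtain h where h: "h : module_hom R (P j) N" and b: "b = (\<lambda>x\<in>$(P (Suc j)). h (d j x))" by (auto simp: compose_def)
  have "b : module_hom R (P (Suc j)) N"
   unfolding b by (rule restrict_module_hom[OF resolD(2)[OF P'] rlin_comp[OF resolD(3)[OF P'] module_hom_rlin[OF h]]])
  moreover have "b (d (Suc j) x) = \<zero>\<^sub>N" if "x : $(P (Suc (Suc j)))" for x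
   using dP[OF that] resol_complex(1)[OF P' that] rlin_zero[OF resolD(2)[OF P'] N module_hom_rlin[OF h]] by (simp add: b)
  ultimately show "b : ?Z" by (simp add: cocycles_def)
 qed
 have one: "\<one>\<^sub>?G : ?B"
 proof -
  have "(\<lambda>x\<in>$(P j). \<zero>\<^sub>N) : module_hom R (P j) N" by (rule restrict_module_hom[OF resolD(2)[OF P'] rlin_const_zero[OF N]])
  then have "compose ($(P (Suc j))) (\<lambda>x\<in>$(P j). \<zero>\<^sub>N) (d j) : ?B" by auto
  moreover have "compose ($(P (Suc j))) (\<lambda>x\<in>$(P j). \<zero>\<^sub>N) (d j) = \<one>\<^sub>?G"
   using dP by (auto simp: compose_def hom_group_def intro!: ext)
  ultimately show ?thesis by simp
 qed
 have "?Z \<subseteq> ?B \<longleftrightarrow> ext_van R P d N j"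
 proof
  assume zb: "?Z \<subseteq> ?B"
  show "ext_van R P d N j" unfolding ext_van_def
  proof (intro allI impI)
   fix h assume h: "rlin R (P (Suc j)) N h" "\<forall>x\<in>$(P (Suc (Suc j))). h (d (Suc j) x) = \<zero>\<^sub>N"
   have "restrict h ($(P (Suc j))) : ?Z" using restrict_module_hom[OF resolD(2)[OF P'] h(1)] h(2) dP by (simp add: cocycles_def)
   then obtain g where g: "g : module_hom R (P j) N"
     "restrict h ($(P (Suc j))) = compose ($(P (Suc j))) g (d j)" using zb by (auto simp: image_iff)
   have "h x = g (d j x)" if "x : $(P (Suc j))" for x using fun_cong[OF g(2), of x] that by (simp add: compose_def)
   then show "\<exists>g. rlin R (P j) N g & (\<forall>x\<in>$(P (Suc j)). h x = g (d j x))" using g(1) module_hom_rlin by blast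
  qed
 next
  assume v: "ext_van R P d N j"
  show "?Z \<subseteq> ?B"
  proof
   fix h assume h: "h : ?Z"
   then obtain g where g: "rlin R (P j) N g" "\<forall>x\<in>$(P (Suc j)). h x = g (d j x)"
    using v unfolding ext_van_def cocycles_def by (auto dest: module_hom_rlin)
   have "h = compose ($(P (Suc j))) (restrict g ($(P j))) (d j)"
    using g(2) h dP by (auto simp: compose_def cocycles_def module_hom_iff extensional_def restrict_def intro!: ext)
   then show "h : ?B" using restrict_module_hom[OF resolD(2)[OF P'] g(1)] by auto
  qed
 qed
 moreover have "trivial_group (Ext R (Suc j) M N) \<longleftrightarrow> ?Z \<subseteq> ?B"
  using trivial_Mod_iff[OF G.group_axioms one] B unfolding Ext_def c by auto
 moreover have "ext_van R P d N j \<longleftrightarrow> ext_van R Q d' N j" using ext_van_transfer[OF M N P' Q] ext_van_transfer[OF M N Q P'] by blast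
 ultimately show ?thesis by blast
qed

lemma free_finite: "finite B ==> $(free R B) = B \<rightarrow>\<^sub>E $R" by (auto simp: free_simps)

lemma free_relabel:
 fixes R (structure)
 assumes R: "ring R" and \<iota>: "inj \<iota>"
 obtains s t where "rlin R (free R {..<k}) (free R (\<iota> ` {..<k})) s"
  "rlin R (free R (\<iota> ` {..<k})) (free R {..<k :: nat}) t"
  "!!x. x : $(free R {..<k}) ==> t (s x) = x"
  "!!y. y : $(free R (\<iota> ` {..<k})) ==> s (t y) = y"
proof -
 have [simp]: "inv_into UNIV \<iota> (\<iota> i) = i" for i using \<iota> by simp
 let ?s = "%x. restrict (%j. x (inv_into UNIV \<iota> j)) (\<iota> ` {..<k})" let ?t = "%y. restrict (%i. y (\<iota> i)) {..<k}"
 have cs: "?s x : $(free R (\<iota> ` {..<k}))" if "x : $(free R {..<k})" for x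
  using free_coord[OF that] by (auto simp: free_finite)
 have ct: "?t y : $(free R {..<k})" if "y : $(free R (\<iota> ` {..<k}))" for y
  using free_coord[OF that] by (simp add: free_finite)
 show ?thesis
 proof (rule that[of ?s ?t])
  show "rlin R (free R {..<k}) (free R (\<iota> ` {..<k})) ?s" by (rule rlinI[OF cs]) (auto simp: free_simps(3,4) intro!: restrict_ext)
  show "rlin R (free R (\<iota> ` {..<k})) (free R {..<k}) ?t" by (rule rlinI[OF ct]) (auto simp: free_simps(3,4) intro!: restrict_ext)
  show "?t (?s x) = x" if "x : $(free R {..<k})" for x by (rule free_eqI[OF ct[OF cs[OF that]] that]) auto
  show "?s (?t y) = y" if "y : $(free R (\<iota> ` {..<k}))" for y by (rule free_eqI[OF cs[OF ct[OF that]] that]) auto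
 qed
qed

text \<open>Moves a resolution by finite free modules into the carrier type that
  \<open>projective_dim\<close> and \<open>Ext\<close> prescribe. The second conclusion preserves
  its length.\<close>

lemma finite_free_resolution:
 fixes M :: "('a, 'm, 'e) module_scheme"
 assumes M: "rmodule R M" and F: "resol R M (%n. free R {..<k n :: nat}) d e"
 obtains P :: "nat => ('a, ('a, 'm) resolution_elem) module" and d' e' where
  "projective_resolution R M P d' e'" "!!n. k n = 0 ==> $(P n) = {\<zero>\<^bsub>P n\<^esub>}"
proof -
 interpret M: rmodule R M by fact
 note R = M.R.ring_axioms
 \<comment> \<open>Indices of the prescribed type that are told apart by their length alone.\<close>
 define \<iota> :: "nat => ('a + 'm) list" where "\<iota> n = replicate n (Inl undefined)" for n
 have inj: "inj \<iota>" by (auto simp: inj_def \<iota>_def replicate_eq_replicate)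
 let ?F = "%n. free R {..<k n}"
 define P where "P n = free R (\<iota> ` {..<k n})" for n
 have "\<forall>n. \<exists>s t. rlin R (?F n) (P n) s & rlin R (P n) (?F n) t &
   (\<forall>x\<in>$(?F n). t (s x) = x) & (\<forall>y\<in>$(P n). s (t y) = y)" unfolding P_def using free_relabel[OF R inj] by metis
 then obtain s t where s: "!!n. rlin R (?F n) (P n) (s n)" and t: "!!n. rlin R (P n) (?F n) (t n)"
  and ts: "!!n x. x : $(?F n) ==> t n (s n x) = x" and st: "!!n y. y : $(P n) ==> s n (t n y) = y"
  by metis
 have mP: "rmodule R (P n)" for n unfolding P_def by (rule rmodule_free[OF R])
 define d' where "d' n = restrict (%x. s n (d n (t (Suc n) x))) ($(P (Suc n)))" for n
 define e' where "e' = restrict (%x. e (t 0 x)) ($(P 0))"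
 have im: "d' n ` $(P (Suc n)) = s n ` (d n ` $(?F (Suc n)))" for n
  unfolding d'_def using rlin_closed[OF t] rlin_closed[OF s] ts by (force simp: image_iff)
 have mem: "x : s n ` A \<longleftrightarrow> t n x : A" if "x : $(P n)" "A \<subseteq> $(?F n)" for x n A
  using that ts st by (force simp: image_iff subset_iff)
 have sub: "d n ` $(?F (Suc n)) \<subseteq> $(?F n)" for n using rlin_closed[OF resolD(3)[OF F]] by auto
 have s0: "s n x = \<zero>\<^bsub>P n\<^esub> \<longleftrightarrow> x = \<zero>\<^bsub>?F n\<^esub>" if "x : $(?F n)" for n x
  using rlin_zero[OF rmodule_free[OF R] mP s, of n] rlin_zero[OF mP rmodule_free[OF R] t, of n] ts[OF that] by metis
 have "projective_resolution R M P d' e'" unfolding projective_resolution_def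
 proof (intro conjI allI)
  show "projective_module R (P n)" for n unfolding P_def by (rule projective_free[OF R])
  show "d' n : module_hom R (P (Suc n)) (P n)" for n
   unfolding d'_def by (rule restrict_module_hom[OF mP rlin_comp[OF rlin_comp[OF t resolD(3)[OF F]] s]])
  show "e' : module_hom R (P 0) M" unfolding e'_def by (rule restrict_module_hom[OF mP rlin_comp[OF t resolD(4)[OF F]]])
  have "t 0 ` $(P 0) = $(?F 0)" using rlin_closed[OF t] rlin_closed[OF s] ts by (force simp: image_iff)
  then show "e' ` $(P 0) = $M" unfolding e'_def using resolD(5)[OF F] by (metis image_image image_restrict_eq)
  show "{x : $(P 0). e' x = \<zero>\<^sub>M} = d' 0 ` $(P 1)"
  proof -
   have "x : {x : $(P 0). e' x = \<zero>\<^sub>M} \<longleftrightarrow> x : d' 0 ` $(P 1)" if x: "x : $(P 0)" for x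
    using resolD(6)[OF F rlin_closed[OF t x]] im[of 0] mem[OF x sub] x by (simp add: e'_def)
   moreover have "d' 0 ` $(P 1) \<subseteq> $(P 0)" using im[of 0] sub[of 0] rlin_closed[OF s] by auto
   ultimately show ?thesis by blast
  qed
  show "{x : $(P (Suc n)). d' n x = \<zero>\<^bsub>P n\<^esub>} = d' (Suc n) ` $(P (Suc (Suc n)))" for n
  proof -
   have "x : {x : $(P (Suc n)). d' n x = \<zero>\<^bsub>P n\<^esub>} \<longleftrightarrow> x : d' (Suc n) ` $(P (Suc (Suc n)))"
    if x: "x : $(P (Suc n))" for x using resolD(7)[OF F rlin_closed[OF t x]] im[of "Suc n"] mem[OF x sub]
     s0[OF rlin_closed[OF resolD(3)[OF F] rlin_closed[OF t x]]] x by (simp add: d'_def)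
   moreover have "d' (Suc n) ` $(P (Suc (Suc n))) \<subseteq> $(P (Suc n))" using im[of "Suc n"] sub[of "Suc n"] rlin_closed[OF s] by auto
   ultimately show ?thesis by blast
  qed
 qed
 moreover have "$(P n) = {\<zero>\<^bsub>P n\<^esub>}" if "k n = 0" for n using that by (simp add: P_def free_simps restrict_def)
 ultimately show ?thesis using that by blast
qed

section \<open>Opposite rings and restriction of scalars\<close>

lemma opposite_ring_simps [simp]:
 "$(opp R) = $R" "\<one>\<^bsub>opp R\<^esub> = \<one>\<^sub>R" "\<zero>\<^bsub>opp R\<^esub> = \<zero>\<^sub>R"
 "x \<oplus>\<^bsub>opp R\<^esub> y = x \<oplus>\<^sub>R y" "x \<otimes>\<^bsub>opp R\<^esub> y = y \<otimes>\<^sub>R x"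
 by (simp_all add: opposite_ring_def)

lemma ring_opposite:
 fixes R (structure) assumes "ring R" shows "ring (opp R)"
proof -
 interpret ring R by fact
 show ?thesis
 proof (rule ringI)
  show "abelian_group (opp R)" by (rule abelian_groupI) (auto simp: a_ac intro: l_neg bexI[of _ "\<ominus> _"])
  show "Group.monoid (opp R)" by (rule monoidI) (auto simp: m_assoc)
 qed (auto simp: l_distr r_distr)
qed

lemma finsum_opposite: "finsum (opp R) g B = finsum R g B" by (simp add: finsum_def finprod_def opposite_ring_def)

lemma carrier_free_opposite [simp]:
 "$(free (opp R) B) = $(free R B)" by (simp add: free_simps)

lemma unitv_opposite [simp]: "unitv (opp R) B = unitv R B" by (simp add: unitv_def fun_eq_iff)

lemma restrict_scalars_simps [simp]:
 "$(res p M) = $M" "\<zero>\<^bsub>res p M\<^esub> = \<zero>\<^sub>M"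
 "x \<oplus>\<^bsub>res p M\<^esub> y = x \<oplus>\<^sub>M y" "a \<odot>\<^bsub>res p M\<^esub> x = p a \<odot>\<^sub>M x"
 by (simp_all add: restrict_scalars_def)

lemma rmodule_res_scalars:
 assumes S: "ring S" and p: "p : ring_hom S R" and M: "rmodule R M" shows "rmodule S (res p M)"
proof -
 interpret S: ring S by fact
 interpret M: rmodule R M by fact
 have "abelian_group (res p M)" by (rule abelian_groupI) (auto simp: M.M.a_ac intro: M.M.l_neg bexI[of _ "\<ominus>\<^sub>M _"])
 then interpret abelian_group "res p M" .
 show ?thesis by unfold_locales (auto simp: ring_hom_closed[OF p] ring_hom_add[OF p] ring_hom_mult[OF p] ring_hom_one[OF p]
    M.smult_l_distr M.smult_r_distr M.smult_assoc)
qed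

lemma rlin_res:
 assumes "p : ring_hom S R" "rlin R M N h" shows "rlin S (res p M) (res p N) h" using assms by (auto simp: rlin_def ring_hom_closed)

lemma rlin_res_iff:
 assumes "p : ring_hom S R" "p ` $S = $R" shows "rlin S (res p M) (res p N) h \<longleftrightarrow> rlin R M N h"
 unfolding rlin_def assms(2)[symmetric] by simp

lemma ring_hom_rlin: "p : ring_hom S R ==> rlin S (reg S) (res p (reg R)) p"
 by (rule rlinI) (auto simp: ring_hom_closed ring_hom_add ring_hom_mult)

text \<open>A row \<open>e\<close> times a column \<open>x\<close>: right linear in
  \<open>x\<close>, left linear in \<open>e\<close>. Exchanging the two arguments amounts to passing
  to the opposite ring.\<close>

definition dot :: "('a, 'c) ring_scheme => nat => (nat => 'a) => (nat => 'a) => 'a" where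
 "dot R r e x = finsum R (%i. e i \<otimes>\<^sub>R x i) {..<r}"

lemma dot_lcomb:
 fixes R (structure)
 assumes R: "ring R" and e: "e : $(free R {..<r})" and x: "x : $(free R {..<r})" shows "dot R r e x = lcomb R (reg R) {..<r} e x"
proof -
 interpret M: rmodule R "reg R" by (rule rmodule_regular) fact
 have "e : {..<r} \<rightarrow> $(reg R)" using free_coord[OF e] by simp
 then have "lcomb R (reg R) {..<r} e x = finsum (reg R) (%i. x i \<odot>\<^bsub>reg R\<^esub> e i) {..<r}"
  by (rule M.lcomb_superset[OF x]) auto
 then show ?thesis by (simp add: dot_def regular_finsum)
qed

lemma dot_rlin:
 assumes R: "ring R" and e: "e : $(free R {..<r})" shows "rlin R (free R {..<r}) (reg R) (dot R r e)"
proof -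
 interpret M: rmodule R "reg R" by (rule rmodule_regular) fact
 have "rlin R (free R {..<r}) (reg R) (lcomb R (reg R) {..<r} e)" by (rule M.lcomb_rlin) (simp add: free_coord[OF e])
 then show ?thesis using rlin_cong[OF rmodule_free[OF R], of "{..<r}" "dot R r e"] dot_lcomb[OF R e] by blast
qed

lemma dot_unitv:
 assumes R: "ring R" and e: "e : $(free R {..<r})" and "i < r" shows "dot R r e (unitv R {..<r} i) = e i"
proof -
 interpret M: rmodule R "reg R" by (rule rmodule_regular) fact
 show ?thesis using M.lcomb_unitv[of e "{..<r}" i] dot_lcomb[OF R e unitv_closed[OF R]] free_coord[OF e] assms(3) by (simp add: Pi_def)
qed

lemma dot_opposite: "dot (opp R) r x e = dot R r e x" by (simp add: dot_def finsum_opposite)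

lemma dot_rlin_left:
 assumes R: "ring R" and x: "x : $(free R {..<r})" shows "rlin (opp R) (free (opp R) {..<r}) (reg (opp R)) (%e. dot R r e x)"
proof -
 have "dot (opp R) r x = (%e. dot R r e x)" by (simp add: fun_eq_iff dot_opposite)
 then show ?thesis using dot_rlin[OF ring_opposite[OF R], of x r] x by simp
qed

lemma dot_unitv_left:
 assumes R: "ring R" and x: "x : $(free R {..<r})" and "i < r" shows "dot R r (unitv R {..<r} i) x = x i"
 using dot_unitv[OF ring_opposite[OF R], of x r i] assms(2,3) by (simp add: dot_opposite)

definition row :: "('a, 'c) ring_scheme => nat => ((nat => 'a) => 'a) => nat => 'a" where
 "row R r h = (\<lambda>i\<in>{..<r}. h (unitv R {..<r} i))"

lemma row_closed:
 assumes "ring R" "rlin R (free R {..<r}) (reg R) h" shows "row R r h : $(free R {..<r})"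
 using rlin_closed[OF assms(2) unitv_closed[OF assms(1)]] by (auto simp: row_def free_finite)

lemma dot_row:
 assumes R: "ring R" and h: "rlin R (free R {..<r}) (reg R) h"
  and x: "x : $(free R {..<r})" shows "dot R r (row R r h) x = h x"
 by (rule rlin_free_eqI[OF rmodule_regular[OF R] dot_rlin[OF R row_closed[OF R h]] h _ x])
  (simp add: dot_unitv[OF R row_closed[OF R h]], simp add: row_def)

lemma dot_eqI:
 assumes R: "ring R" and e: "e : $(free R {..<r})" "e' : $(free R {..<r})"
  and "!!x. x : $(free R {..<r}) ==> dot R r e x = dot R r e' x" shows "e = e'"
 by (rule free_eqI[OF e]) (metis assms(4) dot_unitv[OF R] e lessThan_iff unitv_closed[OF R])

section \<open>Quotients by a regular normal element\<close>

text \<open>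
 The quotient \<open>A = S/(f)\<close> enters only through its projection \<open>p\<close>, so that the passage to the
 opposite rings is again an instance.
\<close>

locale normal_quotient = S?: ring S + A: ring A for S (structure) and A :: "('b, 'd) ring_scheme" +
 fixes p :: "'a => 'b" and f :: 'a
 assumes p_hom: "p : ring_hom S A" and p_surj: "p ` $S = $A"
  and p_ker: "a : $S ==> p a = \<zero>\<^sub>A \<longleftrightarrow> a : (%b. f \<otimes> b) ` $S"
  and f_regular: "regular_element S f" and f_normal: "normal_element S f"
begin

lemma f_closed [simp]: "f : $S" using f_regular by (simp add: regular_element_def)

lemma f_left_cancel: "a : $S ==> f \<otimes> a = \<zero> ==> a = \<zero>"
 and f_right_cancel: "a : $S ==> a \<otimes> f = \<zero> ==> a = \<zero>"
 using f_regular unfolding regular_element_def by blast+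

lemma f_image: "(%a. a \<otimes> f) ` $S = (%a. f \<otimes> a) ` $S" using f_normal by (simp add: normal_element_def)

lemma f_commute: "a : $S ==> \<exists>b\<in>$S. a \<otimes> f = f \<otimes> b" using f_image by blast

lemma p_f: "p f = \<zero>\<^sub>A" using p_ker[of f] r_one[of f] by (metis f_closed image_eqI one_closed)

lemma p_zero: "p \<zero> = \<zero>\<^sub>A" by (rule ring_hom_zero[OF p_hom ring_axioms A.ring_axioms])

lemma p_minus: "a : $S ==> b : $S ==> p (a \<ominus> b) = p a \<ominus>\<^sub>A p b"
 using ring_hom_add[OF p_hom, of a "\<ominus> b"] ring_hom_add[OF p_hom, of b "\<ominus> b"] p_zero
  ring_hom_closed[OF p_hom] by (metis A.minus_equality A.a_comm a_inv_closed a_minus_def r_neg)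

text \<open>The conditions on \<open>f\<close> do not distinguish left from right; for the kernel of
  \<open>p\<close> this is \<open>f S = S f\<close>.\<close>

lemma opposite: "normal_quotient (opp S) (opp A) p f"
proof -
 interpret So: ring "opp S" by (rule ring_opposite) (rule ring_axioms)
 interpret Ao: ring "opp A" by (rule ring_opposite) (rule A.ring_axioms)
 show ?thesis
 proof unfold_locales
  show "p : ring_hom (opp S) (opp A)" using p_hom by (auto simp: ring_hom_def)
  show "p ` $(opp S) = $(opp A)" using p_surj by simp
  show "p a = \<zero>\<^bsub>opp A\<^esub> \<longleftrightarrow> a : (%b. f \<otimes>\<^bsub>opp S\<^esub> b) ` $(opp S)"
   if "a : $(opp S)" for a using p_ker[of a] that f_image by simp
  show "regular_element (opp S) f" using f_regular unfolding regular_element_def opposite_ring_simps by blast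
  show "normal_element (opp S) f" using f_image unfolding normal_element_def by simp
 qed
qed

text \<open>
 Modules with a linear map \<open>l\<close> that behaves like left multiplication by \<open>f\<close>: it is injective, and
 so is right multiplication by \<open>f\<close>, with the same image.
\<close>

definition fmod :: "('a, 'n, 'h) module_scheme => ('n => 'n) => bool" where
 "fmod N l \<longleftrightarrow> rmodule S N & rlin S N N l & (\<forall>x\<in>$N. l x = \<zero>\<^sub>N \<longrightarrow> x = \<zero>\<^sub>N) &
   (\<forall>x\<in>$N. f \<odot>\<^sub>N x = \<zero>\<^sub>N \<longrightarrow> x = \<zero>\<^sub>N) & l ` $N = (%x. f \<odot>\<^sub>N x) ` $N"

lemma fmodD:
 assumes "fmod N l" shows "rmodule S N" "rlin S N N l" "l ` $N = (%x. f \<odot>\<^sub>N x) ` $N" using assms by (auto simp: fmod_def)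

lemma fmod_swap:
 assumes "fmod N l" "x : $N"
 obtains y where "y : $N" "f \<odot>\<^sub>N x = l y"
proof -
 have "f \<odot>\<^sub>N x : l ` $N" unfolding fmodD(3)[OF assms(1)] using assms(2) by blast
 then show ?thesis using that by (auto simp: image_iff)
qed

lemma fmod_swap':
 assumes "fmod N l" "x : $N"
 obtains y where "y : $N" "l x = f \<odot>\<^sub>N y"
proof -
 have "l x : (%x. f \<odot>\<^sub>N x) ` $N" unfolding fmodD(3)[OF assms(1), symmetric] using assms(2) by blast
 then show ?thesis using that by (auto simp: image_iff)
qed

lemma fmod_swap_image: "fmod N l ==> x : $N ==> f \<odot>\<^sub>N x : l ` $N" by (simp add: fmodD(3))

lemma fmod_inj:
 assumes "fmod N l" "x : $N" "y : $N"
 shows "l x = l y \<longleftrightarrow> x = y" "f \<odot>\<^sub>N x = f \<odot>\<^sub>N y \<longleftrightarrow> x = y"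
proof -
 interpret N: rmodule S N using assms(1) by (rule fmodD)
 have l: "l (x \<ominus>\<^sub>N y) = l x \<ominus>\<^sub>N l y"
  by (rule rlin_diff[OF N.rmodule_axioms N.rmodule_axioms fmodD(2)[OF assms(1)] assms(2,3)])
 have r: "f \<odot>\<^sub>N (x \<ominus>\<^sub>N y) = f \<odot>\<^sub>N x \<ominus>\<^sub>N f \<odot>\<^sub>N y"
  using assms(2,3) by (simp add: a_minus_def N.smult_r_distr N.smult_r_minus)
 have z: "l (x \<ominus>\<^sub>N y) = \<zero>\<^sub>N \<longrightarrow> x \<ominus>\<^sub>N y = \<zero>\<^sub>N" "f \<odot>\<^sub>N (x \<ominus>\<^sub>N y) = \<zero>\<^sub>N \<longrightarrow> x \<ominus>\<^sub>N y = \<zero>\<^sub>N"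
  using assms by (auto simp: fmod_def)
 have c: "l x : $N" "l y : $N" using rlin_closed[OF fmodD(2)[OF assms(1)]] assms(2,3) by auto
 show "l x = l y \<longleftrightarrow> x = y" "f \<odot>\<^sub>N x = f \<odot>\<^sub>N y \<longleftrightarrow> x = y"
  using z c l r assms(2,3) N.M.minus_zero_iff by (metis N.smult_closed f_closed)+
qed

text \<open>\<open>h\<close> need not commute with \<open>l\<close>, but it commutes with the right
  action of \<open>f\<close>, which has the same image as \<open>l\<close>.\<close>

lemma fmod_image:
 assumes "fmod N l" "rmodule S M" "fmod M k" "rlin S N M h" "x : $N" shows "h (l x) : k ` $M"
proof -
 obtain y where y: "y : $N" "l x = f \<odot>\<^sub>N y" using fmod_swap'[OF assms(1,5)] by metis
 then have "h (l x) = f \<odot>\<^sub>M h y" using rlin_smult[OF assms(4)] by simp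
 then show ?thesis using fmod_swap_image[OF assms(3)] rlin_closed[OF assms(4) y(1)] by simp
qed

text \<open>Quotients by the injective map \<open>l\<close> are unique, hence depend linearly on the
  argument.\<close>

lemma fmod_divide:
 assumes N: "fmod N l" and M: "rmodule S M" and h: "rlin S M N h"
  and im: "!!x. x : $M ==> h x : l ` $N"
 obtains e where "rlin S M N e" "!!x. x : $M ==> h x = l (e x)"
proof -
 interpret N: rmodule S N using N by (rule fmodD)
 interpret M: rmodule S M by fact
 note l = fmodD(2)[OF N]
 have "\<forall>x. \<exists>y. x : $M \<longrightarrow> y : $N & h x = l y" using im by (auto simp: image_iff)
 then obtain e where e: "!!x. x : $M ==> e x : $N" "!!x. x : $M ==> h x = l (e x)" by metis
 have "rlin S M N e"
 proof (rule rlinI[OF e(1)])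
  fix x y assume xy: "x : $M" "y : $M"
  then have "l (e (x \<oplus>\<^sub>M y)) = l (e x \<oplus>\<^sub>N e y)" by (simp add: rlin_add[OF l] rlin_add[OF h] e(1) flip: e(2))
  then show "e (x \<oplus>\<^sub>M y) = e x \<oplus>\<^sub>N e y" using fmod_inj(1)[OF N] xy e(1) by simp
 next
  fix a x assume ax: "a : $S" "x : $M"
  then have "l (e (a \<odot>\<^sub>M x)) = l (a \<odot>\<^sub>N e x)" by (simp add: rlin_smult[OF l] rlin_smult[OF h] e(1) flip: e(2))
  then show "e (a \<odot>\<^sub>M x) = a \<odot>\<^sub>N e x" using fmod_inj(1)[OF N] ax e(1) by simp
 qed
 then show ?thesis using that e(2) by blast
qed

text \<open>For free modules this replaces each matrix entry \<open>a\<close> of \<open>h\<close> by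
  the \<open>b\<close> with \<open>a f = f b\<close>.\<close>

lemma twist:
 assumes "fmod N l" "fmod M k" "rlin S N M h"
 obtains h' where "rlin S N M h'" "!!x. x : $N ==> h (l x) = k (h' x)"
 using fmod_divide[OF assms(2) fmodD(1)[OF assms(1)] rlin_comp[OF fmodD(2)[OF assms(1)] assms(3)]]
  fmod_image[OF assms(1) fmodD(1)[OF assms(2)] assms(2,3)] by metis

text \<open>Maps that agree on \<open>l N\<close> agree on \<open>N f\<close>, which is the same
  set; by linearity \<open>g x\<close> and \<open>h x\<close> then agree after multiplication by
  \<open>f\<close> on the right, and this is injective.\<close>

lemma fmod_right_cancel:
 assumes N: "fmod N l" and M: "fmod M k" and g: "rlin S N M g" and h: "rlin S N M h"
  and e: "!!x. x : $N ==> g (l x) = h (l x)" and x: "x : $N" shows "g x = h x"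
proof -
 obtain y where y: "y : $N" "f \<odot>\<^sub>N x = l y" using fmod_swap[OF N x] by metis
 have "f \<odot>\<^sub>M g x = f \<odot>\<^sub>M h x" using e[OF y(1)] rlin_smult[OF g f_closed x] rlin_smult[OF h f_closed x] y(2) by simp
 then show ?thesis using fmod_inj(2)[OF M rlin_closed[OF g x] rlin_closed[OF h x]] by simp
qed

text \<open>The inverse of the twist. The condition prescribes \<open>h'\<close> only on the image
  of \<open>l\<close>, so a division by \<open>l\<close> does not define it. Instead
  \<open>h' x = z\<close> is determined by \<open>x f = l y\<close> and
  \<open>k (h y) = z f\<close>.\<close>

lemma untwist:
 assumes N: "fmod N l" and M: "fmod M k" and h: "rlin S N M h"
 obtains h' where "rlin S N M h'" "!!x. x : $N ==> h' (l x) = k (h x)"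
proof -
 interpret N: rmodule S N using N by (rule fmodD)
 interpret M: rmodule S M using M by (rule fmodD)
 note l = fmodD(2)[OF N] and k = fmodD(2)[OF M]
 have "\<forall>x\<in>$N. \<exists>zy. fst zy : $M & snd zy : $N &
   f \<odot>\<^sub>N x = l (snd zy) & k (h (snd zy)) = f \<odot>\<^sub>M fst zy"
 proof
  fix x assume x: "x : $N"
  obtain y where y: "y : $N" "f \<odot>\<^sub>N x = l y" using fmod_swap[OF N x] by metis
  obtain z where "z : $M" "k (h y) = f \<odot>\<^sub>M z" using fmod_swap'[OF M rlin_closed[OF h y(1)]] by metis
  then show "\<exists>zy. fst zy : $M & snd zy : $N &
   f \<odot>\<^sub>N x = l (snd zy) & k (h (snd zy)) = f \<odot>\<^sub>M fst zy" using y by (intro exI[of _ "(z, y)"]) simp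
 qed
 from bchoice[OF this] obtain g where g: "\<forall>x\<in>$N. fst (g x) : $M & snd (g x) : $N &
   f \<odot>\<^sub>N x = l (snd (g x)) & k (h (snd (g x))) = f \<odot>\<^sub>M fst (g x)" by blast
 define h' w where "h' x = fst (g x)" and "w x = snd (g x)" for x
 have h': "!!x. x : $N ==> h' x : $M" "!!x. x : $N ==> w x : $N"
  and w: "!!x. x : $N ==> f \<odot>\<^sub>N x = l (w x)" "!!x. x : $N ==> k (h (w x)) = f \<odot>\<^sub>M h' x"
  using g unfolding h'_def w_def by auto
 show ?thesis
 proof (rule that[of h'])
  show "rlin S N M h'"
  proof (rule rlinI[OF h'(1)])
   fix x y assume xy: "x : $N" "y : $N"
   have "l (w (x \<oplus>\<^sub>N y)) = l (w x \<oplus>\<^sub>N w y)"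
    using w(1)[of "x \<oplus>\<^sub>N y"] w(1)[of x] w(1)[of y] xy by (simp add: rlin_add[OF l] h' N.smult_r_distr)
   then have "w (x \<oplus>\<^sub>N y) = w x \<oplus>\<^sub>N w y" using fmod_inj(1)[OF N] xy h' by simp
   then have "f \<odot>\<^sub>M h' (x \<oplus>\<^sub>N y) = k (h (w x \<oplus>\<^sub>N w y))" using w(2)[of "x \<oplus>\<^sub>N y"] xy by simp
   also have "\<dots> = f \<odot>\<^sub>M (h' x \<oplus>\<^sub>M h' y)"
    using xy by (simp add: rlin_add[OF h] rlin_add[OF k] rlin_closed[OF h] h' M.smult_r_distr w(2))
   finally have "f \<odot>\<^sub>M h' (x \<oplus>\<^sub>N y) = f \<odot>\<^sub>M (h' x \<oplus>\<^sub>M h' y)" .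
   then show "h' (x \<oplus>\<^sub>N y) = h' x \<oplus>\<^sub>M h' y" using fmod_inj(2)[OF M] xy h' by simp
  next
   fix a x assume ax: "a : $S" "x : $N"
   \<comment> \<open>The intermediate map is only semilinear, \<open>w (x a) = (w x) b\<close>. The
     second change of sides turns \<open>b\<close> back into \<open>a\<close>.\<close>
   obtain b where b: "b : $S" "a \<otimes> f = f \<otimes> b" using f_commute[OF ax(1)] by blast
   have "l (w (a \<odot>\<^sub>N x)) = (a \<otimes> f) \<odot>\<^sub>N x" using ax w(1)[of "a \<odot>\<^sub>N x"] by (simp add: N.smult_assoc)
   also have "\<dots> = l (b \<odot>\<^sub>N w x)" unfolding b(2) using ax b(1) by (simp add: N.smult_assoc w(1) rlin_smult[OF l] h')
   finally have "w (a \<odot>\<^sub>N x) = b \<odot>\<^sub>N w x" using fmod_inj(1)[OF N] ax b(1) h' by simp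
   then have "f \<odot>\<^sub>M h' (a \<odot>\<^sub>N x) = b \<odot>\<^sub>M (f \<odot>\<^sub>M h' x)"
    using ax b(1) w(2)[of "a \<odot>\<^sub>N x"] w(2)[of x] by (simp add: rlin_smult[OF h] rlin_smult[OF k] rlin_closed[OF h] h')
   also have "\<dots> = f \<odot>\<^sub>M (a \<odot>\<^sub>M h' x)" using ax b h' by (simp flip: M.smult_assoc)
   finally show "h' (a \<odot>\<^sub>N x) = a \<odot>\<^sub>M h' x" using fmod_inj(2)[OF M] ax h' by simp
  qed
  show "h' (l x) = k (h x)" if x: "x : $N" for x
  proof -
   have lx: "l x : $N" by (rule rlin_closed[OF l x])
   have "l (w (l x)) = l (f \<odot>\<^sub>N x)" using w(1)[OF lx] rlin_smult[OF l f_closed x] by simp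
   then have "w (l x) = f \<odot>\<^sub>N x" using fmod_inj(1)[OF N] x lx h' by simp
   then have "f \<odot>\<^sub>M h' (l x) = f \<odot>\<^sub>M k (h x)"
    using w(2)[OF lx] x rlin_smult[OF h f_closed x] rlin_smult[OF k f_closed rlin_closed[OF h x]] by simp
   then show ?thesis using fmod_inj(2)[OF M h'(1)[OF lx] rlin_closed[OF k rlin_closed[OF h x]]] by simp
  qed
 qed
qed

lemma fmod_regular: "fmod (reg S) (%x. f \<otimes> x)"
proof -
 have "rlin S (reg S) (reg S) (%x. f \<otimes> x)" by (rule rlinI) (simp_all add: r_distr m_assoc)
 then show ?thesis unfolding fmod_def regular_module_simps
  using f_left_cancel f_right_cancel f_image[symmetric] rmodule_regular[OF ring_axioms] by blast
qed

section \<open>Left multiplication by \<open>f\<close> on free modules of finite rank\<close>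

definition lmul :: "nat => (nat => 'a) => nat => 'a" where
 "lmul r x = (\<lambda>i\<in>{..<r}. f \<otimes> x i)"

abbreviation Fr :: "nat => ('a, nat => 'a) module" where
 "Fr r \<equiv> free S {..<r}"

abbreviation Fl :: "int list => ('a, nat => 'a) module" where "Fl m \<equiv> Fr (length m)"
abbreviation lml :: "int list => (nat => 'a) => nat => 'a" where "lml m \<equiv> lmul (length m)"

lemma rmodule_Fr: "rmodule S (Fr r)" by (rule rmodule_free) (rule ring_axioms)

lemma lmul_image_iff:
 assumes y: "y : $(Fr r)" shows "y : lmul r ` $(Fr r) \<longleftrightarrow> (\<forall>i<r. p (y i) = \<zero>\<^sub>A)"
proof
 assume "y : lmul r ` $(Fr r)"
 then obtain x where x: "x : $(Fr r)" "y = lmul r x" by blast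
 show "\<forall>i<r. p (y i) = \<zero>\<^sub>A"
 proof (intro allI impI)
  fix i assume "i < r"
  then have "x i : $S" "y i = f \<otimes> x i" using x by (auto simp: free_coord lmul_def)
  then show "p (y i) = \<zero>\<^sub>A" using p_ker[of "y i"] by simp
 qed
next
 assume a: "\<forall>i<r. p (y i) = \<zero>\<^sub>A"
 have "\<exists>b. b : $S & y i = f \<otimes> b" if "i < r" for i using a that p_ker[of "y i"] free_coord[OF y, of i] by auto
 then obtain x where x: "!!i. i < r ==> x i : $S & y i = f \<otimes> x i" by metis
 have "restrict x {..<r} : $(Fr r)" using x by (auto simp: free_finite)
 moreover have "y = lmul r (restrict x {..<r})" by (rule free_eqI[OF y]) (use x in \<open>auto simp: lmul_def free_finite\<close>)
 ultimately show "y : lmul r ` $(Fr r)" by blast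
qed

lemma fmod_Fr: "fmod (Fr r) (lmul r)" unfolding fmod_def
proof (intro conjI ballI impI)
 interpret F: rmodule S "Fr r" by (rule rmodule_Fr)
 have c: "lmul r x : $(Fr r)" if "x : $(Fr r)" for x using free_coord[OF that] by (auto simp: lmul_def free_finite)
 show "rmodule S (Fr r)" by (rule rmodule_Fr)
 show "rlin S (Fr r) (Fr r) (lmul r)"
  by (rule rlinI[OF c]) (auto simp: lmul_def free_simps(3,4) r_distr m_assoc free_coord intro!: restrict_ext)
 show "x = \<zero>\<^bsub>Fr r\<^esub>" if "x : $(Fr r)" "lmul r x = \<zero>\<^bsub>Fr r\<^esub>" for x
 proof (rule free_eqI[OF that(1) F.M.zero_closed])
  show "x i = \<zero>\<^bsub>Fr r\<^esub> i" if i: "i : {..<r}" for i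
   using fun_cong[OF \<open>lmul r x = \<zero>\<^bsub>Fr r\<^esub>\<close>, of i] f_left_cancel[OF free_coord[OF \<open>x : $(Fr r)\<close> i]] i
   by (simp add: lmul_def free_simps(2))
 qed
 show "x = \<zero>\<^bsub>Fr r\<^esub>" if "x : $(Fr r)" "f \<odot>\<^bsub>Fr r\<^esub> x = \<zero>\<^bsub>Fr r\<^esub>" for x
 proof (rule free_eqI[OF that(1) F.M.zero_closed])
  show "x i = \<zero>\<^bsub>Fr r\<^esub> i" if i: "i : {..<r}" for i
   using fun_cong[OF \<open>f \<odot>\<^bsub>Fr r\<^esub> x = \<zero>\<^bsub>Fr r\<^esub>\<close>, of i] f_right_cancel[OF free_coord[OF \<open>x : $(Fr r)\<close> i]] i
   by (simp add: free_simps(2,4))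
 qed
 show "lmul r ` $(Fr r) = (%x. f \<odot>\<^bsub>Fr r\<^esub> x) ` $(Fr r)"
 proof
  show "(%x. f \<odot>\<^bsub>Fr r\<^esub> x) ` $(Fr r) \<subseteq> lmul r ` $(Fr r)"
  proof clarify
   fix x assume x: "x : $(Fr r)"
   show "f \<odot>\<^bsub>Fr r\<^esub> x : lmul r ` $(Fr r)"
   proof (subst lmul_image_iff)
    interpret F: rmodule S "Fr r" by (rule rmodule_Fr)
    show "f \<odot>\<^bsub>Fr r\<^esub> x : $(Fr r)" using x by simp
    show "\<forall>i<r. p ((f \<odot>\<^bsub>Fr r\<^esub> x) i) = \<zero>\<^sub>A"
     using free_coord[OF x] ring_hom_mult[OF p_hom _ f_closed] ring_hom_closed[OF p_hom] by (simp add: free_simps(4) p_f)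
   qed
  qed
  show "lmul r ` $(Fr r) \<subseteq> (%x. f \<odot>\<^bsub>Fr r\<^esub> x) ` $(Fr r)"
  proof clarify
   fix x assume x: "x : $(Fr r)"
   have "\<exists>b. b : $S & f \<otimes> x i = b \<otimes> f" if "i < r" for i using f_image free_coord[OF x, of i] that by blast
   then obtain y where y: "!!i. i < r ==> y i : $S & f \<otimes> x i = y i \<otimes> f" by metis
   have "restrict y {..<r} : $(Fr r)" using y by (auto simp: free_finite)
   moreover have "lmul r x = f \<odot>\<^bsub>Fr r\<^esub> restrict y {..<r}"
    using y by (auto simp: lmul_def free_simps(4) intro!: restrict_ext)
   ultimately show "lmul r x : (%x. f \<odot>\<^bsub>Fr r\<^esub> x) ` $(Fr r)" by blast
  qed
 qed
qed

lemma lmul_rlin: "rlin S (Fr r) (Fr r) (lmul r)" by (rule fmodD(2)[OF fmod_Fr])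

section \<open>Reduction of free modules and their maps modulo \<open>f\<close>\<close>

definition proj :: "nat => (nat => 'a) => nat => 'b" where
 "proj r x = (\<lambda>i\<in>{..<r}. p (x i))"

abbreviation FA :: "nat => ('b, nat => 'b) module" where
 "FA r \<equiv> free A {..<r}"

lemma rmodule_FA: "rmodule A (FA r)" by (rule rmodule_free) (rule A.ring_axioms)

lemma rmodule_res: "rmodule A M ==> rmodule S (res p M)" by (rule rmodule_res_scalars[OF ring_axioms p_hom])

lemma proj_closed: "x : $(Fr r) ==> proj r x : $(FA r)" using free_coord[of x S "{..<r}"] ring_hom_closed[OF p_hom]
 by (auto simp: proj_def free_finite)

lemma proj_rlin: "rlin S (Fr r) (res p (FA r)) (proj r)"
 by (rule rlinI) (auto simp: proj_closed, auto simp: proj_def free_simps(3,4) free_coord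
   ring_hom_add[OF p_hom] ring_hom_mult[OF p_hom] intro!: restrict_ext)

lemma proj_surj: "proj r ` $(Fr r) = $(FA r)"
proof
 show "$(FA r) \<subseteq> proj r ` $(Fr r)"
 proof
  fix y assume y: "y : $(FA r)"
  have "\<exists>a. a : $S & p a = y i" if "i < r" for i using p_surj free_coord[OF y, of i] that by (metis imageE lessThan_iff)
  then obtain x where x: "!!i. i < r ==> x i : $S & p (x i) = y i" by metis
  have "restrict x {..<r} : $(Fr r)" using x by (auto simp: free_finite)
  moreover from this have "y = proj r (restrict x {..<r})" by (intro free_eqI[OF y proj_closed]) (use x in \<open>auto simp: proj_def\<close>)
  ultimately show "y : proj r ` $(Fr r)" by blast
 qed
qed (use proj_closed in auto)

lemma proj_zero_iff: "x : $(Fr r) ==> proj r x = \<zero>\<^bsub>FA r\<^esub> \<longleftrightarrow> x : lmul r ` $(Fr r)"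
 by (auto simp: lmul_image_iff proj_def free_simps(2) fun_eq_iff)

text \<open>An element of \<open>f F = F f\<close> is some \<open>y f\<close>, and \<open>f\<close>
  acts on an \<open>A\<close>-module as \<open>p f = 0\<close>.\<close>

lemma rlin_res_lmul:
 assumes "rmodule A M" "rlin S (Fr r) (res p M) h" "x : lmul r ` $(Fr r)" shows "h x = \<zero>\<^sub>M"
proof -
 interpret M: rmodule A M by fact
 obtain z where z: "z : $(Fr r)" "x = lmul r z" using assms(3) by blast
 obtain y where "y : $(Fr r)" "x = f \<odot>\<^bsub>Fr r\<^esub> y" using fmod_swap'[OF fmod_Fr z(1)] z(2) by metis
 then show ?thesis using rlin_smult[OF assms(2) f_closed] rlin_closed[OF assms(2)] by (simp add: p_f)
qed

lemma proj_descend: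
 assumes M: "rmodule A M" and h: "rlin S (Fr r) (res p M) h"
 obtains g where "rlin A (FA r) M g" "!!x. x : $(Fr r) ==> g (proj r x) = h x"
proof -
 have 1: "rlin S (res p (FA r)) (res p M) (descend ($(Fr r)) (proj r) h)"
  "!!x. x : $(Fr r) ==> descend ($(Fr r)) (proj r) h (proj r x) = h x"
  by (rule descend_rlin[OF rmodule_Fr rmodule_res[OF rmodule_FA] rmodule_res[OF M] proj_rlin _ h];
    simp add: proj_surj proj_zero_iff rlin_res_lmul[OF M h])+
 then show ?thesis using that rlin_res_iff[OF p_hom p_surj] by metis
qed

lemma functional_lift:
 assumes "rlin S (Fr r) (res p (reg A)) h"
 obtains c where "rlin S (Fr r) (reg S) c" "!!x. x : $(Fr r) ==> p (c x) = h x"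
proof -
 have "h (unitv S {..<r} b) : p ` $(reg S)" for b using rlin_closed[OF assms unitv_closed[OF ring_axioms]] p_surj by simp
 then show ?thesis using free_lift[OF rmodule_regular[OF ring_axioms] rmodule_res[OF rmodule_regular[OF A.ring_axioms]]
    ring_hom_rlin[OF p_hom] assms] that by metis
qed

text \<open>A resolution of the \<open>A\<close>-module \<open>M\<close> by free modules, described by lifts of its maps to \<open>S\<close>.\<close>

definition sresol :: "('b, 'm, 'e) module_scheme => (nat => nat) => (nat => (nat => 'a) => nat => 'a)
  => ((nat => 'a) => 'm) => bool" where
 "sresol M k E q \<longleftrightarrow> (\<forall>n. rlin S (Fr (k (Suc n))) (Fr (k n)) (E n)) &
   rlin S (Fr (k 0)) (res p M) q & q ` $(Fr (k 0)) = $M &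
   (\<forall>x\<in>$(Fr (k 0)). q x = \<zero>\<^sub>M \<longleftrightarrow> x : E 0 ` $(Fr (k 1))) &
   (\<forall>n. \<forall>x\<in>$(Fr (k (Suc n))).
    E n x : lmul (k n) ` $(Fr (k n)) \<longleftrightarrow> x : E (Suc n) ` $(Fr (k (Suc (Suc n)))))"

text \<open>In \<open>sresol\<close> the kernel of the reduction of \<open>E n\<close> appears as
  the set of elements that \<open>E n\<close> maps into \<open>f F\<close>; reducing everything
  modulo \<open>f\<close> turns this into ordinary exactness.\<close>

lemma sresol_resol:
 assumes M: "rmodule A M" and s: "sresol M k E q"
 obtains E' q' where "resol A M (%n. FA (k n)) E' q'"
  "!!n x. x : $(Fr (k (Suc n))) ==> E' n (proj (k (Suc n)) x) = proj (k n) (E n x)"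
  "!!x. x : $(Fr (k 0)) ==> q' (proj (k 0) x) = q x"
proof -
 have E: "rlin S (Fr (k (Suc n))) (Fr (k n)) (E n)" for n using s by (simp add: sresol_def)
 have q: "rlin S (Fr (k 0)) (res p M) q" using s by (simp add: sresol_def)
 obtain q' where q': "rlin A (FA (k 0)) M q'" "!!x. x : $(Fr (k 0)) ==> q' (proj (k 0) x) = q x"
  using proj_descend[OF M q] by metis
 have "\<forall>n. \<exists>g. rlin A (FA (k (Suc n))) (FA (k n)) g &
   (\<forall>x\<in>$(Fr (k (Suc n))). g (proj (k (Suc n)) x) = proj (k n) (E n x))"
  using proj_descend[OF rmodule_FA rlin_comp[OF E proj_rlin]] by metis
 then obtain E' where E': "!!n. rlin A (FA (k (Suc n))) (FA (k n)) (E' n)"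
  "!!n x. x : $(Fr (k (Suc n))) ==> E' n (proj (k (Suc n)) x) = proj (k n) (E n x)" by metis
 have cE: "E n x : $(Fr (k n))" if "x : $(Fr (k (Suc n)))" for n x by (rule rlin_closed[OF E that])
 \<comment> \<open>Passing from classes to representatives costs an element of \<open>f F\<close>,
   which has to lie in the image of \<open>E n\<close>. It does so because \<open>q\<close> kills
   \<open>f F\<close> and each \<open>E n\<close> maps \<open>f F\<close> into
   \<open>f F\<close>.\<close>
 have im: "proj (k n) x : E' n ` $(FA (k (Suc n))) \<longleftrightarrow> x : E n ` $(Fr (k (Suc n)))"
  if x: "x : $(Fr (k n))" and l: "lmul (k n) ` $(Fr (k n)) \<subseteq> E n ` $(Fr (k (Suc n)))" for n x
 proof
  assume "x : E n ` $(Fr (k (Suc n)))"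
  then obtain y where y: "y : $(Fr (k (Suc n)))" "x = E n y" by blast
  show "proj (k n) x : E' n ` $(FA (k (Suc n)))" unfolding y(2) E'(2)[OF y(1), symmetric] by (rule imageI[OF proj_closed[OF y(1)]])
 next
  assume "proj (k n) x : E' n ` $(FA (k (Suc n)))"
  then obtain y where y: "y : $(Fr (k (Suc n)))" "proj (k n) x = proj (k n) (E n y)"
   unfolding proj_surj[of "k (Suc n)", symmetric] image_image by (auto simp: E'(2))
  interpret F: rmodule S "Fr (k n)" by (rule rmodule_Fr)
  interpret G: rmodule S "Fr (k (Suc n))" by (rule rmodule_Fr)
  interpret B: rmodule S "res p (FA (k n))" by (rule rmodule_res[OF rmodule_FA])
  have "proj (k n) (x \<ominus>\<^bsub>Fr (k n)\<^esub> E n y) = \<zero>\<^bsub>FA (k n)\<^esub>"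
   using rlin_diff[OF rmodule_Fr B.rmodule_axioms proj_rlin x cE[OF y(1)]] y(2) proj_closed[OF cE[OF y(1)]] by simp
  then have "x \<ominus>\<^bsub>Fr (k n)\<^esub> E n y : lmul (k n) ` $(Fr (k n))" using proj_zero_iff x cE[OF y(1)] by simp
  then obtain z where z: "z : $(Fr (k (Suc n)))" "x \<ominus>\<^bsub>Fr (k n)\<^esub> E n y = E n z" using l by blast
  then have "x = E n (z \<oplus>\<^bsub>Fr (k (Suc n))\<^esub> y)" using rlin_add[OF E z(1) y(1)] x cE[OF y(1)] by (simp flip: z(2))
  then show "x : E n ` $(Fr (k (Suc n)))" using z(1) y(1) by blast
 qed
 have l: "lmul (k n) ` $(Fr (k n)) \<subseteq> E n ` $(Fr (k (Suc n)))" for n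
 proof (cases n)
  case 0
  then show ?thesis using rlin_res_lmul[OF M q] s rlin_closed[OF lmul_rlin] by (auto simp: sresol_def)
 next
  case (Suc m)
  then show ?thesis using fmod_image[OF fmod_Fr rmodule_Fr fmod_Fr E] s rlin_closed[OF lmul_rlin] by (auto simp: sresol_def)
 qed
 have "resol A M (%n. FA (k n)) E' q'" unfolding resol_def
 proof (intro conjI allI ballI)
  show "projective_module A (FA (k n))" for n by (rule projective_free[OF A.ring_axioms])
  show "rlin A (FA (k (Suc n))) (FA (k n)) (E' n)" "rlin A (FA (k 0)) M q'" for n by fact+
  show "q' ` $(FA (k 0)) = $M" using q'(2) s unfolding proj_surj[symmetric] image_image by (simp add: sresol_def)
 next
  fix x assume "x : $(FA (k 0))"
  then obtain y where "y : $(Fr (k 0))" "x = proj (k 0) y" using proj_surj by blast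
  then show "q' x = \<zero>\<^sub>M \<longleftrightarrow> x : E' 0 ` $(FA (k 1))" using im[of y 0] l[of 0] q'(2) s by (simp add: sresol_def)
 next
  fix n x assume "x : $(FA (k (Suc n)))"
  then obtain y where "y : $(Fr (k (Suc n)))" "x = proj (k (Suc n)) y" using proj_surj by blast
  then show "E' n x = \<zero>\<^bsub>FA (k n)\<^esub> \<longleftrightarrow> x : E' (Suc n) ` $(FA (k (Suc (Suc n))))"
   using im[of y "Suc n"] l[of "Suc n"] E'(2) s proj_zero_iff[OF cE] by (simp add: sresol_def)
 qed
 then show ?thesis using that E'(2) q'(2) by blast
qed

text \<open>\<open>ext_van\<close> of the reduced resolution with coefficients \<open>A\<close>,
  where functionals are lifted to \<open>S\<close> and compared after \<open>p\<close>.\<close>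

definition svan :: "(nat => nat) => (nat => (nat => 'a) => nat => 'a) => nat => bool" where
 "svan k E j \<longleftrightarrow> (\<forall>c. rlin S (Fr (k (Suc j))) (reg S) c \<longrightarrow>
   (\<forall>x\<in>$(Fr (k (Suc (Suc j)))). p (c (E (Suc j) x)) = \<zero>\<^sub>A) \<longrightarrow>
   (\<exists>g. rlin S (Fr (k j)) (reg S) g & (\<forall>x\<in>$(Fr (k (Suc j))). p (c x) = p (g (E j x)))))"

lemma svan_iff:
 assumes M: "rmodule A M" and s: "sresol M k E q"
  and E': "!!n. rlin A (FA (k (Suc n))) (FA (k n)) (E' n)"
  "!!n x. x : $(Fr (k (Suc n))) ==> E' n (proj (k (Suc n)) x) = proj (k n) (E n x)"
 shows "svan k E j \<longleftrightarrow> ext_van A (%n. FA (k n)) E' (reg A) j"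
proof -
 have E: "rlin S (Fr (k (Suc n))) (Fr (k n)) (E n)" for n using s by (simp add: sresol_def)
 note cE = rlin_closed[OF E] and RA = rmodule_regular[OF A.ring_axioms]
 have down: "\<exists>h. rlin A (FA r) (reg A) h & (\<forall>x\<in>$(Fr r). h (proj r x) = p (c x))"
  if "rlin S (Fr r) (reg S) c" for r c using proj_descend[OF RA rlin_comp[OF that ring_hom_rlin[OF p_hom]]] by metis
 have up: "\<exists>c. rlin S (Fr r) (reg S) c & (\<forall>x\<in>$(Fr r). p (c x) = h (proj r x))"
  if "rlin A (FA r) (reg A) h" for r h using functional_lift[OF rlin_comp[OF proj_rlin rlin_res[OF p_hom that]]] by metis
 have surj: "(\<forall>x\<in>$(FA r). P x) \<longleftrightarrow> (\<forall>x\<in>$(Fr r). P (proj r x))" for r P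
  unfolding proj_surj[symmetric] by blast
 show ?thesis
 proof
  assume v: "svan k E j"
  show "ext_van A (%n. FA (k n)) E' (reg A) j" unfolding ext_van_def
  proof (intro allI impI)
   fix h assume h: "rlin A (FA (k (Suc j))) (reg A) h"
    and 0: "\<forall>x\<in>$(FA (k (Suc (Suc j)))). h (E' (Suc j) x) = \<zero>\<^bsub>reg A\<^esub>"
   obtain c where c: "rlin S (Fr (k (Suc j))) (reg S) c" "\<forall>x\<in>$(Fr (k (Suc j))). p (c x) = h (proj (k (Suc j)) x)" using up[OF h] by blast
   have "\<forall>x\<in>$(Fr (k (Suc (Suc j)))). p (c (E (Suc j) x)) = \<zero>\<^sub>A" using 0 c(2) E'(2) cE unfolding surj by simp
   then obtain g where g: "rlin S (Fr (k j)) (reg S) g" "\<forall>x\<in>$(Fr (k (Suc j))). p (c x) = p (g (E j x))"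
    using v c(1) unfolding svan_def by blast
   obtain g' where g': "rlin A (FA (k j)) (reg A) g'" "\<forall>x\<in>$(Fr (k j)). g' (proj (k j) x) = p (g x)" using down[OF g(1)] by blast
   have "\<forall>x\<in>$(FA (k (Suc j))). h x = g' (E' j x)" unfolding surj using g(2) c(2) g'(2) E'(2) cE by simp
   then show "\<exists>g. rlin A (FA (k j)) (reg A) g & (\<forall>x\<in>$(FA (k (Suc j))). h x = g (E' j x))" using g'(1) by blast
  qed
 next
  assume v: "ext_van A (%n. FA (k n)) E' (reg A) j"
  show "svan k E j" unfolding svan_def
  proof (intro allI impI)
   fix c assume c: "rlin S (Fr (k (Suc j))) (reg S) c"
    and 0: "\<forall>x\<in>$(Fr (k (Suc (Suc j)))). p (c (E (Suc j) x)) = \<zero>\<^sub>A"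
   obtain h where h: "rlin A (FA (k (Suc j))) (reg A) h" "\<forall>x\<in>$(Fr (k (Suc j))). h (proj (k (Suc j)) x) = p (c x)"
    using down[OF c] by blast
   have "\<forall>x\<in>$(FA (k (Suc (Suc j)))). h (E' (Suc j) x) = \<zero>\<^bsub>reg A\<^esub>" unfolding surj using 0 h(2) E'(2) cE by simp
   then obtain g where g: "rlin A (FA (k j)) (reg A) g" "\<forall>x\<in>$(FA (k (Suc j))). h x = g (E' j x)"
    using v h(1) unfolding ext_van_def by blast
   obtain g' where g': "rlin S (Fr (k j)) (reg S) g'" "\<forall>x\<in>$(Fr (k j)). p (g' x) = g (proj (k j) x)" using up[OF g(1)] by blast
   have "\<forall>x\<in>$(Fr (k (Suc j))). p (c x) = p (g' (E j x))" using g(2) h(2) g'(2) E'(2) cE unfolding surj by simp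
   then show "\<exists>g. rlin S (Fr (k j)) (reg S) g & (\<forall>x\<in>$(Fr (k (Suc j))). p (c x) = p (g (E j x)))" using g'(1) by blast
  qed
 qed
qed

text \<open>The bridge between Ext groups over \<open>A\<close> and computations with matrices over
  \<open>S\<close>.\<close>

lemma Ext_trivial_iff_svan:
 fixes M :: "('b, 'm, 'e) module_scheme"
 assumes M: "rmodule A M" and s: "sresol M k E q" shows "trivial_group (Ext A (Suc j) M (reg A)) \<longleftrightarrow> svan k E j"
proof -
 obtain E' q' where 1: "resol A M (%n. FA (k n)) E' q'"
  and 2: "!!n x. x : $(Fr (k (Suc n))) ==> E' n (proj (k (Suc n)) x) = proj (k n) (E n x)" using sresol_resol[OF M s] by metis
 have "\<exists>(P :: nat => ('b, ('b, 'm) resolution_elem) module) d e. projective_resolution A M P d e"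
  using finite_free_resolution[OF M 1] by metis
 then show ?thesis using Ext_trivial_iff[OF M rmodule_regular[OF A.ring_axioms] _ 1] svan_iff[OF M s resolD(3)[OF 1] 2] by blast
qed

end

section \<open>Cokernels of matrix factorizations are totally reflexive\<close>

text \<open>The grading is forgotten here, since total reflexivity refers to ungraded homomorphisms
  and Ext groups.\<close>

locale matrix_factorization = normal_quotient S A p f
 for S :: "('a, 'c) ring_scheme" (structure) and A :: "('b, 'd) ring_scheme" and p f +
 fixes r :: nat and \<phi> :: "int => (nat => 'a) => nat => 'a"
 assumes \<phi>_rlin: "rlin S (Fr r) (Fr r) (\<phi> i)"
  and \<phi>_\<phi>: "x : $(Fr r) ==> \<phi> i (\<phi> (i + 1) x) = lmul r x"
begin

lemma \<phi>_closed: "x : $(Fr r) ==> \<phi> i x : $(Fr r)" by (rule rlin_closed[OF \<phi>_rlin])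

lemma lmul_inj: "x : $(Fr r) ==> y : $(Fr r) ==> lmul r x = lmul r y \<longleftrightarrow> x = y"
 by (rule fmod_inj(1)[OF fmod_Fr])

lemma \<phi>_inj: "x : $(Fr r) ==> y : $(Fr r) ==> \<phi> i x = \<phi> i y \<longleftrightarrow> x = y"
 using \<phi>_\<phi>[of x "i - 1"] \<phi>_\<phi>[of y "i - 1"] lmul_inj[of x y] by auto

text \<open>Both sides are \<open>\<phi> i \<phi> (i + 1) \<phi> (i + 2)\<close>. Thus
  \<open>\<phi> (i + 2)\<close> is the twist of \<open>\<phi> i\<close>, and the sequence need not
  be periodic.\<close>

lemma \<phi>_lmul: "x : $(Fr r) ==> \<phi> i (lmul r x) = lmul r (\<phi> (i + 2) x)"
 using \<phi>_\<phi>[of x "i + 1"] \<phi>_\<phi>[OF \<phi>_closed, of x i "i + 2"] by (simp add: add.assoc)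

text \<open>Exactness of the sequence modulo \<open>f\<close>: if
  \<open>\<phi> i x = f y = \<phi> i (\<phi> (i + 1) y)\<close>, injectivity of
  \<open>\<phi> i\<close> gives \<open>x\<close>.\<close>

lemma \<phi>_image_iff:
 assumes "x : $(Fr r)" shows "\<phi> i x : lmul r ` $(Fr r) \<longleftrightarrow> x : \<phi> (i + 1) ` $(Fr r)"
proof
 assume "\<phi> i x : lmul r ` $(Fr r)"
 then obtain y where y: "y : $(Fr r)" "\<phi> i x = \<phi> i (\<phi> (i + 1) y)" using \<phi>_\<phi> by auto
 then have "x = \<phi> (i + 1) y" using \<phi>_inj[OF assms \<phi>_closed] by blast
 then show "x : \<phi> (i + 1) ` $(Fr r)" using y(1) by blast
qed (use \<phi>_\<phi> in auto)

text \<open>Exactness of the dual sequence modulo \<open>f\<close>. Write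
  \<open>a \<phi> (i + 1) = f e\<close> and untwist \<open>e\<close> to \<open>e' f = f e\<close>.
  Then \<open>e' \<phi> i f = e' f \<phi> (i + 2) = f e \<phi> (i + 2) = a \<phi> (i + 1) \<phi> (i
  + 2) = a f\<close>, and \<open>f\<close> is cancelled on the right. The resulting equation holds
  in \<open>S\<close>, not only modulo \<open>f\<close>.\<close>

lemma row_exact:
 assumes a: "rlin S (Fr r) (reg S) a" and 0: "!!x. x : $(Fr r) ==> p (a (\<phi> (i + 1) x)) = \<zero>\<^sub>A"
 obtains e where "rlin S (Fr r) (reg S) e" "!!x. x : $(Fr r) ==> a x = e (\<phi> i x)"
proof -
 have "a (\<phi> (i + 1) x) : (%b. f \<otimes> b) ` $(reg S)" if "x : $(Fr r)" for x
  using 0[OF that] p_ker rlin_closed[OF a \<phi>_closed[OF that]] by simp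
 then obtain e where e: "rlin S (Fr r) (reg S) e"
   "!!x. x : $(Fr r) ==> a (\<phi> (i + 1) x) = f \<otimes> e x"
  using fmod_divide[OF fmod_regular rmodule_Fr rlin_comp[OF \<phi>_rlin a]] by metis
 obtain e' where e': "rlin S (Fr r) (reg S) e'" "!!x. x : $(Fr r) ==> e' (lmul r x) = f \<otimes> e x"
  using untwist[OF fmod_Fr fmod_regular e(1)] by metis
 have "e' (\<phi> i (lmul r x)) = a (lmul r x)" if x: "x : $(Fr r)" for x
  using e'(2)[OF \<phi>_closed[OF x], of "i + 2"] e(2)[OF \<phi>_closed[OF x], of "i + 2"] \<phi>_lmul[OF x, of i]
   \<phi>_\<phi>[OF x, of "i + 1"] by (simp add: add.assoc)
 then have "a x = e' (\<phi> i x)" if "x : $(Fr r)" for x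
  using fmod_right_cancel[OF fmod_Fr fmod_regular a rlin_comp[OF \<phi>_rlin e'(1)] _ that] by simp
 then show ?thesis using that e'(1) by blast
qed

definition coker_map :: "('b, 'm, 'e) module_scheme => ((nat => 'a) => 'm) => bool" where
 "coker_map M q \<longleftrightarrow> rlin S (Fr r) (res p M) q & q ` $(Fr r) = $M &
   (\<forall>x\<in>$(Fr r). q x = \<zero>\<^sub>M \<longleftrightarrow> x : \<phi> 0 ` $(Fr r))"

text \<open>The factorization itself, read in nonnegative degrees, is a lifted free resolution of
  its cokernel.\<close>

lemma coker_sresol:
 assumes "coker_map M q" shows "sresol M (%_. r) (%n. \<phi> (int n)) q"
 using assms \<phi>_rlin \<phi>_image_iff unfolding sresol_def coker_map_def by (auto simp: add.commute)

lemma svan_\<phi>: "svan (%_. r) (%n. \<phi> (int n)) j" unfolding svan_def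
proof (intro allI impI)
 fix c assume c: "rlin S (Fr r) (reg S) c" and 0: "\<forall>x\<in>$(Fr r). p (c (\<phi> (int (Suc j)) x)) = \<zero>\<^sub>A"
 obtain e where "rlin S (Fr r) (reg S) e" "!!x. x : $(Fr r) ==> c x = e (\<phi> (int j) x)"
  using row_exact[OF c, of "int j"] 0 by (metis of_nat_Suc add.commute)
 then show "\<exists>g. rlin S (Fr r) (reg S) g & (\<forall>x\<in>$(Fr r). p (c x) = p (g (\<phi> (int j) x)))" by (intro exI[of _ e]) simp
qed

lemma coker_Ext_trivial:
 assumes "rmodule A M" "coker_map M q" "i \<ge> 1" shows "trivial_group (Ext A i M (reg A))"
proof -
 obtain j where "i = Suc j" using assms(3) by (cases i) auto
 then show ?thesis using Ext_trivial_iff_svan[OF assms(1) coker_sresol[OF assms(2)], of j] svan_\<phi> by simp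
qed

section \<open>Transposition of factorizations and duality\<close>

definition transposed :: "((nat => 'a) => nat => 'a) => (nat => 'a) => nat => 'a" where
 "transposed \<psi> e = row S r (%x. dot S r e (\<psi> x))"

lemma
 assumes \<psi>: "rlin S (Fr r) (Fr r) \<psi>" and e: "e : $(Fr r)" shows transposed_closed: "transposed \<psi> e : $(Fr r)"
  and dot_transposed: "x : $(Fr r) ==> dot S r (transposed \<psi> e) x = dot S r e (\<psi> x)" unfolding transposed_def
 using row_closed[OF ring_axioms rlin_comp[OF \<psi> dot_rlin[OF ring_axioms e]]]
  dot_row[OF ring_axioms rlin_comp[OF \<psi> dot_rlin[OF ring_axioms e]]] by blast+

lemma dot_add_left:
 assumes "e : $(Fr r)" "e' : $(Fr r)" "x : $(Fr r)"
 shows "dot S r (e \<oplus>\<^bsub>Fr r\<^esub> e') x = dot S r e x \<oplus> dot S r e' x"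
 using rlin_add[OF dot_rlin_left[OF ring_axioms assms(3)], of e e'] assms(1,2) by (simp add: free_simps(3))

lemma dot_smult_left:
 assumes "a : $S" "e : $(Fr r)" "x : $(Fr r)" shows "dot S r (a \<odot>\<^bsub>free (opp S) {..<r}\<^esub> e) x = a \<otimes> dot S r e x"
 using rlin_smult[OF dot_rlin_left[OF ring_axioms assms(3)], of a e] assms(1,2) by simp

lemma free_opposite_add [simp]: "x \<oplus>\<^bsub>free (opp S) B\<^esub> y = x \<oplus>\<^bsub>free S B\<^esub> y"
 by (simp add: free_simps(3))

lemma transposed_rlin:
 assumes \<psi>: "rlin S (Fr r) (Fr r) \<psi>" shows "rlin (opp S) (free (opp S) {..<r}) (free (opp S) {..<r}) (transposed \<psi>)"
proof (rule rlinI)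
 interpret F: rmodule S "Fr r" by (rule rmodule_Fr)
 interpret Fo: rmodule "opp S" "free (opp S) {..<r}" by (rule rmodule_free[OF ring_opposite[OF ring_axioms]])
 fix e assume "e : $(free (opp S) {..<r})"
 then have e: "e : $(Fr r)" by simp
 show "transposed \<psi> e : $(free (opp S) {..<r})" using transposed_closed[OF \<psi> e] by simp
 show "transposed \<psi> (e \<oplus>\<^bsub>free (opp S) {..<r}\<^esub> e') =
   transposed \<psi> e \<oplus>\<^bsub>free (opp S) {..<r}\<^esub> transposed \<psi> e'"
  if "e' : $(free (opp S) {..<r})" for e' using that e by (intro dot_eqI[where r = r, OF ring_axioms])
   (simp_all add: transposed_closed[OF \<psi>] dot_transposed[OF \<psi>] dot_add_left rlin_closed[OF \<psi>])
 show "transposed \<psi> (a \<odot>\<^bsub>free (opp S) {..<r}\<^esub> e) =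
   a \<odot>\<^bsub>free (opp S) {..<r}\<^esub> transposed \<psi> e"
  if a: "a : $(opp S)" for a
 proof (rule dot_eqI[where r = r, OF ring_axioms])
  have c: "a \<odot>\<^bsub>free (opp S) {..<r}\<^esub> e' : $(Fr r)" if "e' : $(Fr r)" for e' using Fo.smult_closed[of a e'] a that by simp
  show "transposed \<psi> (a \<odot>\<^bsub>free (opp S) {..<r}\<^esub> e) : $(Fr r)"
   "a \<odot>\<^bsub>free (opp S) {..<r}\<^esub> transposed \<psi> e : $(Fr r)" using c e transposed_closed[OF \<psi>] by auto
  fix x assume x: "x : $(Fr r)"
  show "dot S r (transposed \<psi> (a \<odot>\<^bsub>free (opp S) {..<r}\<^esub> e)) x =
    dot S r (a \<odot>\<^bsub>free (opp S) {..<r}\<^esub> transposed \<psi> e) x"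
   using x e a by (simp add: dot_transposed[OF \<psi>] dot_smult_left transposed_closed[OF \<psi>] c rlin_closed[OF \<psi>])
 qed
qed

text \<open>Transposition reverses composition, hence the order of the indices. The offset is chosen
  so that the new map at index 0 is the transpose of \<open>\<phi> (-2)\<close>, whose cokernel
  turns out to be the dual of the cokernel of \<open>\<phi> 0\<close>.\<close>

lemma transpose: "matrix_factorization (opp S) (opp A) p f r (%i. transposed (\<phi> (- 2 - i)))"
proof -
 interpret o: normal_quotient "opp S" "opp A" p f by (rule opposite)
 show ?thesis
 proof unfold_locales
  show "rlin (opp S) (o.Fr r) (o.Fr r) (transposed (\<phi> (- 2 - i)))" for i by (rule transposed_rlin[OF \<phi>_rlin])
  show "transposed (\<phi> (- 2 - i)) (transposed (\<phi> (- 2 - (i + 1))) e) = o.lmul r e"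
   if "e : $(o.Fr r)" for i e
  proof (rule free_eqI)
   have e: "e : $(Fr r)" using that by simp
   have c: "transposed (\<phi> (- 2 - (i + 1))) e : $(Fr r)" by (rule transposed_closed[OF \<phi>_rlin e])
   show "transposed (\<phi> (- 2 - i)) (transposed (\<phi> (- 2 - (i + 1))) e) : $(Fr r)" by (rule transposed_closed[OF \<phi>_rlin c])
   show "o.lmul r e : $(Fr r)" using rlin_closed[OF o.lmul_rlin that] by simp
   fix j assume j: "j : {..<r}"
   let ?u = "unitv S {..<r} j"
   have u: "?u : $(Fr r)" by (rule unitv_closed[OF ring_axioms])
   have "transposed (\<phi> (- 2 - i)) (transposed (\<phi> (- 2 - (i + 1))) e) j
     = dot S r (transposed (\<phi> (- 2 - i)) (transposed (\<phi> (- 2 - (i + 1))) e)) ?u"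
    using dot_unitv[OF ring_axioms transposed_closed[OF \<phi>_rlin c]] j by simp
   also have "\<dots> = dot S r (transposed (\<phi> (- 2 - (i + 1))) e) (\<phi> (- 2 - i) ?u)" by (rule dot_transposed[OF \<phi>_rlin c u])
   also have "\<dots> = dot S r e (\<phi> (- 2 - (i + 1)) (\<phi> (- 2 - i) ?u))" by (rule dot_transposed[OF \<phi>_rlin e \<phi>_closed[OF u]])
   also have "\<phi> (- 2 - (i + 1)) (\<phi> (- 2 - i) ?u) = lmul r ?u" using \<phi>_\<phi>[OF u, of "- 2 - (i + 1)"] by simp
   \<comment> \<open>Left and right multiplication by \<open>f\<close> agree on unit vectors. The
     right one is the one that can be moved through the linear map \<open>dot S r e\<close>.\<close>
   also have "lmul r ?u = f \<odot>\<^bsub>Fr r\<^esub> ?u" by (auto simp: lmul_def free_simps(4) unitv_def)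
   also have "dot S r e (f \<odot>\<^bsub>Fr r\<^esub> ?u) = o.lmul r e j"
    using rlin_smult[OF dot_rlin[OF ring_axioms e] f_closed u] dot_unitv[OF ring_axioms e] j by (simp add: o.lmul_def)
   finally show "transposed (\<phi> (- 2 - i)) (transposed (\<phi> (- 2 - (i + 1))) e) j = o.lmul r e j" .
  qed
 qed
qed

lemma coker_totally_reflexive:
 fixes M :: "('b, 'm, 'e) module_scheme"
 assumes M: "rmodule A M" and q: "coker_map M q" shows "totally_reflexive A M"
proof -
 interpret M: rmodule A M by fact
 interpret o: matrix_factorization "opp S" "opp A" p f r "%i. transposed (\<phi> (- 2 - i))" by (rule transpose)
 let ?D = "dual_module A M"
 note RA = rmodule_regular[OF A.ring_axioms]
 have q1: "rlin S (Fr r) (res p M) q" and q2: "q ` $(Fr r) = $M"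
  and q3: "!!x. x : $(Fr r) ==> q x = \<zero>\<^sub>M \<longleftrightarrow> x : \<phi> 0 ` $(Fr r)"
  using q by (auto simp: coker_map_def)
 have D: "rmodule (opp A) ?D"
 proof -
  interpret G: comm_group "hom_group A M (reg A)" by (rule hom_group_comm[OF M RA])
  have eq: "$?D = $(hom_group A M (reg A))" "\<zero>\<^sub>?D = \<one>\<^bsub>hom_group A M (reg A)\<^esub>"
   "x \<oplus>\<^sub>?D y = x \<otimes>\<^bsub>hom_group A M (reg A)\<^esub> y" for x y by (simp_all add: dual_module_def hom_group_def)
  have "abelian_group ?D"
   by (rule abelian_groupI) (auto simp: eq G.m_ac intro: G.l_inv G.inv_closed bexI[of _ "inv\<^bsub>hom_group A M (reg A)\<^esub> _"])
  then interpret abelian_group ?D .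
  have l: "rlin A M (reg A) (%x. a \<otimes>\<^sub>A h x)" if "a : $A" "rlin A M (reg A) h" for a h
   by (rule rlinI) (use that rlin_closed[OF that(2)] in \<open>simp_all add: rlin_add[OF that(2)] rlin_smult[OF that(2)] A.r_distr A.m_assoc\<close>)
  show ?thesis
  proof unfold_locales
   show "a \<odot>\<^sub>?D h : $?D" if "a : $(opp A)" "h : $?D" for a h
    using restrict_module_hom[OF M l[OF _ module_hom_rlin]] that by (simp add: dual_module_def)
   have hc: "!!x. x : $M ==> h x : $A" if "h : $?D" for h
    using that rlin_closed[OF module_hom_rlin] by (fastforce simp: dual_module_def)
   show "(a \<oplus>\<^bsub>opp A\<^esub> b) \<odot>\<^sub>?D h = a \<odot>\<^sub>?D h \<oplus>\<^sub>?D b \<odot>\<^sub>?D h"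
    if "a : $(opp A)" "b : $(opp A)" "h : $?D" for a b h
    using that hc[OF that(3)] by (auto simp: dual_module_def A.l_distr intro!: restrict_ext)
   show "a \<odot>\<^sub>?D (h \<oplus>\<^sub>?D g) = a \<odot>\<^sub>?D h \<oplus>\<^sub>?D a \<odot>\<^sub>?D g"
    if "a : $(opp A)" "h : $?D" "g : $?D" for a h g
    using that hc[OF that(2)] hc[OF that(3)] by (auto simp: dual_module_def A.r_distr intro!: restrict_ext)
   show "(a \<otimes>\<^bsub>opp A\<^esub> b) \<odot>\<^sub>?D h = b \<odot>\<^sub>?D (a \<odot>\<^sub>?D h)"
    if "a : $(opp A)" "b : $(opp A)" "h : $?D" for a b h
    using that hc[OF that(3)] by (auto simp: dual_module_def A.m_assoc intro!: restrict_ext)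
   show "\<one>\<^bsub>opp A\<^esub> \<odot>\<^sub>?D h = h" if "h : $?D" for h
    using that hc[OF that] by (auto simp: dual_module_def module_hom_iff extensional_def restrict_def intro!: ext)
  qed
 qed
 text \<open>The functional attached to the row \<open>e\<close> sends the class of \<open>x\<close> to the class of \<open>e (\<phi> (-1) x)\<close>.\<close>
 have "\<exists>h. rlin A M (reg A) h & (\<forall>x\<in>$(Fr r). h (q x) = p (dot S r e (\<phi> (-1) x)))"
  if e: "e : $(Fr r)" for e
 proof -
  let ?g = "%x. p (dot S r e (\<phi> (-1) x))"
  have g: "rlin S (Fr r) (res p (reg A)) ?g" by (rule rlin_comp[OF \<phi>_rlin rlin_comp[OF dot_rlin[OF ring_axioms e] ring_hom_rlin[OF p_hom]]])
  have k: "?g x = \<zero>\<^bsub>reg A\<^esub>" if x: "x : $(Fr r)" "q x = \<zero>\<^sub>M" for x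
  proof -
   obtain y where y: "y : $(Fr r)" "x = \<phi> 0 y" using q3[OF x(1)] x(2) by blast
   then have "\<phi> (-1) x = lmul r y" using \<phi>_\<phi>[OF y(1), of "-1"] by simp
   then show ?thesis using rlin_res_lmul[OF RA rlin_comp[OF dot_rlin[OF ring_axioms e] ring_hom_rlin[OF p_hom]]] y(1) by simp
  qed
  have "rlin S (res p M) (res p (reg A)) (descend ($(Fr r)) q ?g)"
   "!!x. x : $(Fr r) ==> descend ($(Fr r)) q ?g (q x) = ?g x"
   by (rule descend_rlin[OF rmodule_Fr rmodule_res[OF M] rmodule_res[OF RA] q1 _ g]; simp add: q2 k[simplified])+
  then show ?thesis using rlin_res_iff[OF p_hom p_surj] by blast
 qed
 then have "\<forall>e. \<exists>h. e : $(Fr r) \<longrightarrow> rlin A M (reg A) h &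
   (\<forall>x\<in>$(Fr r). h (q x) = p (dot S r e (\<phi> (-1) x)))" by blast
 then obtain H where H: "!!e. e : $(Fr r) ==> rlin A M (reg A) (H e)"
  "!!e x. e : $(Fr r) ==> x : $(Fr r) ==> H e (q x) = p (dot S r e (\<phi> (-1) x))" by metis
 define Q where "Q e = restrict (H e) ($M)" for e
 have Q: "Q e : $?D" if "e : $(Fr r)" for e unfolding Q_def using restrict_module_hom[OF M H(1)[OF that]] by (simp add: dual_module_def)
 have qc: "q x : $M" if "x : $(Fr r)" for x using q2 that by blast
 have Qq: "Q e (q x) = p (dot S r e (\<phi> (-1) x))" if "e : $(Fr r)" "x : $(Fr r)" for e x
  using H(2)[OF that] qc[OF that(2)] by (simp add: Q_def)
 have ext: "g = h" if "g : $?D" "h : $?D" "!!x. x : $(Fr r) ==> g (q x) = h (q x)" for g h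
 proof (rule extensionalityI[of _ "$M"])
  show "g : extensional ($M)" "h : extensional ($M)" using that(1,2) by (auto simp: dual_module_def module_hom_iff)
  show "g x = h x" if "x : $M" for x
  proof -
   obtain y where "y : $(Fr r)" "x = q y" using \<open>x : $M\<close> q2 by auto
   then show ?thesis using \<open>!!x. x : $(Fr r) ==> g (q x) = h (q x)\<close> by blast
  qed
 qed
 interpret D: rmodule "opp A" ?D by (rule D)
 interpret Fo: rmodule "opp S" "o.Fr r" by (rule o.rmodule_Fr)
 have Dadd: "(g \<oplus>\<^sub>?D h) (q x) = g (q x) \<oplus>\<^sub>A h (q x)" "(a \<odot>\<^sub>?D h) (q x) = a \<otimes>\<^sub>A h (q x)" "\<zero>\<^sub>?D (q x) = \<zero>\<^sub>A"
  if "x : $(Fr r)" for g h x a using qc[OF that] by (simp_all add: dual_module_def)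
 have dc: "dot S r e x : $S" if "e : $(Fr r)" "x : $(Fr r)" for e x using rlin_closed[OF dot_rlin[OF ring_axioms that(1)] that(2)] by simp
 have Qlin: "rlin (opp S) (o.Fr r) (res p ?D) Q"
 proof (rule rlinI)
  show "Q e : $(res p ?D)" if "e : $(o.Fr r)" for e using that Q by simp
  show "Q (e \<oplus>\<^bsub>o.Fr r\<^esub> e') = Q e \<oplus>\<^bsub>res p ?D\<^esub> Q e'"
   if "e : $(o.Fr r)" "e' : $(o.Fr r)" for e e'
  proof -
   have c: "e : $(Fr r)" "e' : $(Fr r)" "e \<oplus>\<^bsub>Fr r\<^esub> e' : $(Fr r)" using that Fo.M.a_closed[OF that] by simp_all
   have "Q (e \<oplus>\<^bsub>Fr r\<^esub> e') = Q e \<oplus>\<^sub>?D Q e'" by (rule ext)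
     (simp_all add: Q c D.M.a_closed Qq Dadd dot_add_left dc \<phi>_closed ring_hom_add[OF p_hom])
   then show ?thesis by simp
  qed
  show "Q (a \<odot>\<^bsub>o.Fr r\<^esub> e) = a \<odot>\<^bsub>res p ?D\<^esub> Q e"
   if "a : $(opp S)" "e : $(o.Fr r)" for a e
  proof -
   have c: "e : $(Fr r)" "a : $S" "a \<odot>\<^bsub>o.Fr r\<^esub> e : $(Fr r)" using that Fo.smult_closed[OF that] by simp_all
   have "p a \<odot>\<^sub>?D Q e : $?D" using D.smult_closed[of "p a" "Q e"] Q c ring_hom_closed[OF p_hom] by simp
   then have "Q (a \<odot>\<^bsub>o.Fr r\<^esub> e) = p a \<odot>\<^sub>?D Q e"
    by (intro ext) (simp_all add: Q c Qq Dadd dot_smult_left dc \<phi>_closed ring_hom_mult[OF p_hom])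
   then show ?thesis by simp
  qed
 qed
 \<comment> \<open>If \<open>e \<phi> (-1)\<close> vanishes modulo \<open>f\<close>,
   \<open>row_exact\<close> at index -2 gives \<open>e = g \<phi> (-2)\<close>. Conversely
   \<open>g \<phi> (-2) \<phi> (-1) = g f\<close> has values in the kernel of
   \<open>p\<close>.\<close>
 have Qker: "Q e = \<zero>\<^sub>?D \<longleftrightarrow> e : transposed (\<phi> (- 2 - 0)) ` $(o.Fr r)" if "e : $(o.Fr r)" for e
 proof
  have e: "e : $(Fr r)" using that by simp
  assume "Q e = \<zero>\<^sub>?D"
  then have "p (dot S r e (\<phi> (-2 + 1) x)) = \<zero>\<^sub>A" if "x : $(Fr r)" for x using Qq[OF e that] Dadd(3)[OF that] by simp
  then obtain g where g: "rlin S (Fr r) (reg S) g"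
    "!!x. x : $(Fr r) ==> dot S r e x = g (\<phi> (-2) x)" using row_exact[OF dot_rlin[OF ring_axioms e]] by metis
  note rc = row_closed[OF ring_axioms g(1)]
  have "e = transposed (\<phi> (-2)) (row S r g)" by (rule dot_eqI[OF ring_axioms e transposed_closed[OF \<phi>_rlin rc]])
    (simp add: dot_transposed[OF \<phi>_rlin rc] g(2) dot_row[OF ring_axioms g(1)] \<phi>_closed)
  then show "e : transposed (\<phi> (- 2 - 0)) ` $(o.Fr r)" using rc by auto
 next
  have e: "e : $(Fr r)" using that by simp
  assume "e : transposed (\<phi> (- 2 - 0)) ` $(o.Fr r)"
  then obtain e' where e': "e' : $(Fr r)" "e = transposed (\<phi> (-2)) e'" by auto
  show "Q e = \<zero>\<^sub>?D"
  proof (rule ext[OF Q[OF e] D.M.zero_closed])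
   fix x assume x: "x : $(Fr r)"
   have "dot S r e (\<phi> (-1) x) = dot S r e' (lmul r x)"
    using \<phi>_\<phi>[OF x, of "-2"] x by (simp add: e'(2) dot_transposed[OF \<phi>_rlin e'(1)] \<phi>_closed)
   then show "Q e (q x) = \<zero>\<^sub>?D (q x)" using rlin_res_lmul[OF RA rlin_comp[OF dot_rlin[OF ring_axioms e'(1)] ring_hom_rlin[OF p_hom]]] x
    by (simp add: Qq[OF e x] Dadd(3)[OF x])
  qed
 qed
 \<comment> \<open>A functional on \<open>M\<close> lifts to a row \<open>c\<close> over
   \<open>S\<close> that vanishes on the image of \<open>\<phi> 0\<close> modulo \<open>f\<close>;
   \<open>row_exact\<close> at index -1 factors it through \<open>\<phi> (-1)\<close>.\<close>
 have Qsurj: "Q ` $(o.Fr r) = $?D"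
 proof
  show "Q ` $(o.Fr r) \<subseteq> $?D" using Q by auto
  show "$?D \<subseteq> Q ` $(o.Fr r)"
  proof
   fix h assume h: "h : $?D"
   then have hl: "rlin A M (reg A) h" by (simp add: dual_module_def module_hom_rlin)
   obtain c where c: "rlin S (Fr r) (reg S) c" "!!x. x : $(Fr r) ==> p (c x) = h (q x)"
    using functional_lift[OF rlin_comp[OF q1 rlin_res[OF p_hom hl]]] by metis
   have "p (c (\<phi> (-1 + 1) x)) = \<zero>\<^sub>A" if "x : $(Fr r)" for x
    using c(2)[OF \<phi>_closed[OF that, of 0]] q3[OF \<phi>_closed[OF that, of 0]] that rlin_zero[OF M RA hl] by simp
   then obtain g where g: "rlin S (Fr r) (reg S) g"
     "!!x. x : $(Fr r) ==> c x = g (\<phi> (-1) x)" using row_exact[OF c(1)] by metis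
   note rc = row_closed[OF ring_axioms g(1)]
   have "h = Q (row S r g)" by (rule ext[OF h Q[OF rc]]) (simp add: Qq[OF rc] dot_row[OF ring_axioms g(1)] \<phi>_closed flip: g(2) c(2))
   then show "h : Q ` $(o.Fr r)" using rc by auto
  qed
 qed
 \<comment> \<open>So the dual is itself the cokernel of a factorization, and the vanishing of its
   Ext groups is the lemma already proved, over the opposite rings.\<close>
 have oq: "o.coker_map ?D Q" unfolding o.coker_map_def using Qlin Qsurj Qker by simp
 let ?DD = "dual_module (opp A) ?D"
 have ev: "evaluation_map A M x = (\<lambda>h\<in>$?D. h x)" if "x : $M" for x using that by (simp add: evaluation_map_def)
 have hl: "rlin A M (reg A) h" if "h : $?D" for h using that by (simp add: dual_module_def module_hom_rlin)
 have hc: "h x : $A" if "h : $?D" "x : $M" for h x using rlin_closed[OF hl[OF that(1)] that(2)] by simp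
 have evD: "(\<lambda>h\<in>$?D. h x) : $?DD" if x: "x : $M" for x
 proof -
  have "rlin (opp A) ?D (reg (opp A)) (%h. h x)" by (rule rlinI) (use x hc in \<open>auto simp: dual_module_def\<close>)
  then show ?thesis using restrict_module_hom[OF D] by (simp add: dual_module_def[of "opp A"])
 qed
 have "evaluation_map A M : module_hom A M ?DD"
 proof (subst module_hom_iff, intro conjI rlinI)
  show "evaluation_map A M : extensional ($M)" by (simp add: evaluation_map_def)
  show "evaluation_map A M x : $?DD" if "x : $M" for x using ev evD that by simp
  show "evaluation_map A M (x \<oplus>\<^sub>M y) = evaluation_map A M x \<oplus>\<^sub>?DD evaluation_map A M y"
   if "x : $M" "y : $M" for x y using that by (auto simp: ev dual_module_def[of "opp A"] rlin_add[OF hl] intro!: restrict_ext)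
  show "evaluation_map A M (a \<odot>\<^sub>M x) = a \<odot>\<^sub>?DD evaluation_map A M x"
   if "a : $A" "x : $M" for a x using that by (auto simp: ev dual_module_def[of "opp A"] rlin_smult[OF hl] intro!: restrict_ext)
 qed
 moreover have "bij_betw (evaluation_map A M) ($M) ($?DD)" unfolding bij_betw_def
 proof
  show "inj_on (evaluation_map A M) ($M)"
  proof (rule inj_onI)
   fix y y' assume y: "y : $M" "y' : $M" and e: "evaluation_map A M y = evaluation_map A M y'"
   have "y : q ` $(Fr r)" "y' : q ` $(Fr r)" unfolding q2 by fact+
   then obtain x x' where x: "x : $(Fr r)" "y = q x" "x' : $(Fr r)" "y' = q x'" by blast
   interpret F: rmodule S "Fr r" by (rule rmodule_Fr)
   interpret R: rmodule S "res p M" by (rule rmodule_res[OF M])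
   have d: "x \<ominus>\<^bsub>Fr r\<^esub> x' : $(Fr r)" using x by simp
   \<comment> \<open>The functionals of the unit rows see all coordinates of
     \<open>\<phi> (-1) x\<close> modulo \<open>f\<close>. Equality of these puts
     \<open>\<phi> (-1) (x - x')\<close> into \<open>f F\<close>, so \<open>x - x'\<close> comes
     from \<open>\<phi> 0\<close> and dies in \<open>M\<close>.\<close>
   have pe: "p (\<phi> (-1) x i) = p (\<phi> (-1) x' i)" if "i < r" for i
   proof -
    let ?u = "unitv S {..<r} i"
    have u: "?u : $(Fr r)" by (rule unitv_closed[OF ring_axioms])
    have "Q ?u y = Q ?u y'" using fun_cong[OF e, of "Q ?u"] Q[OF u] y by (simp add: ev)
    then show ?thesis using x Qq[OF u] dot_unitv_left[OF ring_axioms \<phi>_closed that] by simp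
   qed
   have "\<phi> (-1) (x \<ominus>\<^bsub>Fr r\<^esub> x') : lmul r ` $(Fr r)"
   proof (subst lmul_image_iff[OF \<phi>_closed[OF d]], intro allI impI)
    fix i assume i: "i < r"
    have c: "\<phi> (-1) x i : $S" "\<phi> (-1) x' i : $S" using free_coord[OF \<phi>_closed] x i by auto
    have "\<phi> (-1) (x \<ominus>\<^bsub>Fr r\<^esub> x') i = \<phi> (-1) x i \<ominus> \<phi> (-1) x' i"
     using rlin_diff[OF rmodule_Fr rmodule_Fr \<phi>_rlin x(1,3)] free_module_diff[OF ring_axioms \<phi>_closed[OF x(1)] \<phi>_closed[OF x(3)]] i by simp
    then show "p (\<phi> (-1) (x \<ominus>\<^bsub>Fr r\<^esub> x') i) = \<zero>\<^sub>A"
     using p_minus[OF c] pe[OF i] ring_hom_closed[OF p_hom c(2)] by simp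
   qed
   then have "q (x \<ominus>\<^bsub>Fr r\<^esub> x') = \<zero>\<^sub>M" using \<phi>_image_iff[OF d, of "-1"] q3[OF d] by simp
   then show "y = y'" using rlin_diff[OF rmodule_Fr R.rmodule_axioms q1 x(1,3)] R.M.minus_zero_iff x y by simp
  qed
  show "evaluation_map A M ` $M = $?DD"
  proof
   show "evaluation_map A M ` $M \<subseteq> $?DD" using ev evD by auto
   show "$?DD \<subseteq> evaluation_map A M ` $M"
   proof
    fix \<theta> assume \<theta>: "\<theta> : $?DD"
    then have \<theta>l: "rlin (opp A) ?D (reg (opp A)) \<theta>" and \<theta>e: "\<theta> : extensional ($?D)"
     by (simp_all add: dual_module_def[of "opp A"] module_hom_iff)
    have "\<exists>s. s : $S & p s = \<theta> (Q (unitv S {..<r} i))" for i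
    proof -
     have "\<theta> (Q (unitv S {..<r} i)) : p ` $S" using rlin_closed[OF \<theta>l Q[OF unitv_closed[OF ring_axioms]]] p_surj by simp
     then show ?thesis by (auto simp: image_iff)
    qed
    then obtain t where t: "!!i. t i : $S" "!!i. p (t i) = \<theta> (Q (unitv S {..<r} i))" by metis
    \<comment> \<open>The values of \<open>\<theta>\<close> on the functionals of the unit rows,
      lifted to a column over \<open>S\<close>, so that \<open>\<theta> (Q e)\<close> is the class
      of \<open>e T\<close>. The relations \<open>Q (e \<phi> (-2)) = 0\<close> put
      \<open>\<phi> (-2) T\<close> into \<open>f F\<close>; hence \<open>T = \<phi> (-1) x\<close>,
      and \<open>\<theta>\<close> is evaluation at \<open>q x\<close>.\<close>
    define T where "T = restrict t {..<r}"
    have T: "T : $(Fr r)" using t by (auto simp: T_def free_finite)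
    have l1: "rlin (opp S) (o.Fr r) (res p (reg (opp A))) (%e. \<theta> (Q e))"
     by (rule rlin_comp[OF Qlin rlin_res[OF o.p_hom \<theta>l]])
    have l2: "rlin (opp S) (o.Fr r) (res p (reg (opp A))) (%e. p (dot S r e T))"
     by (rule rlin_comp[OF dot_rlin_left[OF ring_axioms T] ring_hom_rlin[OF o.p_hom]])
    have \<theta>Q: "\<theta> (Q e) = p (dot S r e T)" if "e : $(Fr r)" for e
     by (rule rlin_free_eqI[OF o.rmodule_res[OF rmodule_regular[OF o.A.ring_axioms]] l1 l2])
      (use that in \<open>auto simp: dot_unitv_left[OF ring_axioms T] t(2), simp add: T_def t(2)\<close>)
    have "p (\<phi> (-2) T i) = \<zero>\<^sub>A" if i: "i < r" for i
    proof -
     let ?u = "unitv S {..<r} i"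
     have u: "?u : $(Fr r)" by (rule unitv_closed[OF ring_axioms])
     have c: "transposed (\<phi> (-2)) ?u : $(Fr r)" by (rule transposed_closed[OF \<phi>_rlin u])
     have "Q (transposed (\<phi> (-2)) ?u) = \<zero>\<^sub>?D" using Qker[of "transposed (\<phi> (-2)) ?u"] c u by simp
     then have "p (dot S r (transposed (\<phi> (-2)) ?u) T) = \<zero>\<^sub>A"
      using \<theta>Q[OF c] rlin_zero[OF D rmodule_regular[OF o.A.ring_axioms] \<theta>l] by simp
     then show ?thesis using dot_transposed[OF \<phi>_rlin u T] dot_unitv_left[OF ring_axioms \<phi>_closed[OF T] i] by simp
    qed
    then have "\<phi> (-2) T : lmul r ` $(Fr r)" using lmul_image_iff[OF \<phi>_closed[OF T]] by simp
    then have "T : \<phi> (-1) ` $(Fr r)" using \<phi>_image_iff[OF T, of "-2"] by simp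
    then obtain x where x: "x : $(Fr r)" "T = \<phi> (-1) x" by blast
    have "\<theta> = evaluation_map A M (q x)"
    proof (rule extensionalityI[OF \<theta>e])
     show "evaluation_map A M (q x) : extensional ($?D)" using ev[OF qc[OF x(1)]] by simp
     fix h assume h: "h : $?D"
     then obtain e where e: "e : $(Fr r)" "h = Q e" using Qsurj by auto
     show "\<theta> h = evaluation_map A M (q x) h" using h Qq[OF e(1) x(1)] \<theta>Q[OF e(1)] by (simp add: ev[OF qc[OF x(1)]] x(2) e(2))
    qed
    then show "\<theta> : evaluation_map A M ` $M" using qc[OF x(1)] by blast
   qed
  qed
 qed
 ultimately show ?thesis unfolding totally_reflexive_def using coker_Ext_trivial[OF M q] o.coker_Ext_trivial[OF D oq] by simp
qed

end

section \<open>Noetherian rings\<close>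

lemma (in rmodule) submoduleI:
 assumes "N \<subseteq> $M" "\<zero>\<^sub>M : N" "!!x y. x : N ==> y : N ==> x \<oplus>\<^sub>M y : N"
  "!!a x. a : $R ==> x : N ==> a \<odot>\<^sub>M x : N" shows "submodule N R M"
proof (intro submodule.intro M.add.subgroupI)
 show "\<ominus>\<^sub>M x : N" if "x : N" for x
 proof -
  have x: "x : $M" using assms(1) that by blast
  have "\<ominus>\<^sub>M x = (\<ominus> \<one>) \<odot>\<^sub>M x" using smult_l_minus[of \<one> x] x by simp
  then show ?thesis using assms(4)[OF _ that, of "\<ominus> \<one>"] by simp
 qed
qed (use assms in \<open>auto simp: submodule_axioms_def\<close>)

lemma submoduleD:
 assumes "submodule N R M"
 shows "N \<subseteq> $M" "\<zero>\<^sub>M : N" "!!x y. x : N ==> y : N ==> x \<oplus>\<^sub>M y : N"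
  "!!a x. a : $R ==> x : N ==> a \<odot>\<^sub>M x : N"
proof -
 interpret submodule N R M by fact
 show "N \<subseteq> $M" "\<zero>\<^sub>M : N" "!!x y. x : N ==> y : N ==> x \<oplus>\<^sub>M y : N"
  "!!a x. a : $R ==> x : N ==> a \<odot>\<^sub>M x : N"
  using subset one_closed m_closed smult_closed by auto
qed

lemma (in rmodule) submodule_diff:
 assumes "submodule N R M" "x : N" "y : N" shows "x \<ominus>\<^sub>M y : N"
proof -
 have y: "y : $M" using submoduleD(1)[OF assms(1)] assms(3) by blast
 have "\<ominus>\<^sub>M y = (\<ominus> \<one>) \<odot>\<^sub>M y" using smult_l_minus[of \<one> y] y by simp
 then show ?thesis using submoduleD[OF assms(1)] assms(2,3) by (simp add: a_minus_def)
qed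

lemma (in rmodule) submodule_finsum:
 assumes N: "submodule N R M" and "g : B \<rightarrow> N" shows "finsum M g B : N" using assms(2)
proof (induction B rule: infinite_finite_induct)
 case (insert x B)
 then show ?case using submoduleD[OF N] by (subst M.finsum_insert) (auto simp: Pi_def subset_iff)
qed (use submoduleD(2)[OF N] in \<open>auto simp: M.finsum_infinite\<close>)

lemma (in rmodule) lcomb_mem:
 assumes N: "submodule N R M" and "v : B \<rightarrow> N" "x : $(free R B)" shows "lcomb R M B v x : N" unfolding lcomb_def
 by (rule submodule_finsum[OF N]) (use assms(2) submoduleD(4)[OF N] free_coord[OF assms(3)] in \<open>auto simp: Pi_def\<close>)

lemma submodule_kernel:
 assumes "rmodule R M" "rmodule R N" "rlin R M N h" shows "submodule {x : $M. h x = \<zero>\<^sub>N} R M"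
proof -
 interpret M: rmodule R M by fact
 interpret N: rmodule R N by fact
 show ?thesis by (rule M.submoduleI) (auto simp: rlin_zero[OF assms] rlin_add[OF assms(3)] rlin_smult[OF assms(3)])
qed

lemma submodule_image:
 assumes "rmodule R M" "rmodule R N" "rlin R M N h" shows "submodule (h ` $M) R N"
proof -
 interpret M: rmodule R M by fact
 interpret N: rmodule R N by fact
 show ?thesis
 proof (rule N.submoduleI)
  show "\<zero>\<^sub>N : h ` $M" using rlin_zero[OF assms, symmetric] by blast
  show "x \<oplus>\<^sub>N y : h ` $M" if "x : h ` $M" "y : h ` $M" for x y
  proof -
   obtain x' y' where "x' : $M" "x = h x'" "y' : $M" "y = h y'" using \<open>x : h ` $M\<close> \<open>y : h ` $M\<close> by blast
   then have "x \<oplus>\<^sub>N y = h (x' \<oplus>\<^sub>M y')" "x' \<oplus>\<^sub>M y' : $M" by (simp_all add: rlin_add[OF assms(3)])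
   then show ?thesis by blast
  qed
  show "a \<odot>\<^sub>N x : h ` $M" if "a : $R" "x : h ` $M" for a x
  proof -
   obtain x' where "x' : $M" "x = h x'" using \<open>x : h ` $M\<close> by blast
   then have "a \<odot>\<^sub>N x = h (a \<odot>\<^sub>M x')" "a \<odot>\<^sub>M x' : $M" using that(1) by (simp_all add: rlin_smult[OF assms(3)])
   then show ?thesis by blast
  qed
 qed (use rlin_closed[OF assms(3)] in auto)
qed

lemma span_lcomb:
 assumes M: "rmodule R M" and v: "v : B \<rightarrow> $M" shows "submodule_span R M (v ` B) \<subseteq> lcomb R M B v ` $(free R B)"
proof -
 interpret M: rmodule R M by fact
 have "submodule (lcomb R M B v ` $(free R B)) R M" by (rule submodule_image[OF rmodule_free[OF M.R.ring_axioms] M M.lcomb_rlin[OF v]])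
 moreover have "v b : lcomb R M B v ` $(free R B)" if "b : B" for b
  using M.lcomb_unitv[OF v that] unitv_closed[OF M.R.ring_axioms] by (metis image_eqI)
 ultimately show ?thesis unfolding submodule_span_def by blast
qed

lemma span_least: "submodule N R M ==> X \<subseteq> N ==> submodule_span R M X \<subseteq> N"
 by (auto simp: submodule_span_def)

lemma span_superset: "X \<subseteq> submodule_span R M X" by (auto simp: submodule_span_def)

lemma finite_enumerate:
 assumes "finite X" obtains v and l :: nat where "v ` {..<l} = X"
 using assms ex_bij_betw_nat_finite[OF assms] unfolding bij_betw_def by (metis atLeast0LessThan)

text \<open>Finite generation of the submodules of finite free modules, expressed by maps because
  the syzygies of a resolution are built from it.\<close>

definition noeth :: "('a, 'c) ring_scheme => bool" where
 "noeth R \<longleftrightarrow> (\<forall>(k::nat) N. submodule N R (free R {..<k}) \<longrightarrow>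
   (\<exists>(l::nat) h. rlin R (free R {..<l}) (free R {..<k}) h & h ` $(free R {..<l}) = N))"

lemma noethD:
 assumes "noeth R" "submodule N R (free R {..<k :: nat})"
 obtains l :: nat and h where "rlin R (free R {..<l}) (free R {..<k}) h"
  "h ` $(free R {..<l}) = N" using assms(1)[unfolded noeth_def, rule_format, OF assms(2)] by blast

lemma free_concat:
 fixes R (structure)
 assumes R: "ring R" and F: "rmodule R F" and g: "rlin R (free R {..<l :: nat}) F g" and h: "rlin R (free R {..<m :: nat}) F h"
 obtains k where "rlin R (free R {..<l + m}) F k"
  "k ` $(free R {..<l + m}) =
   {g x \<oplus>\<^sub>F h y | x y. x : $(free R {..<l}) & y : $(free R {..<m})}"
proof -
 let ?a = "%z. restrict z {..<l}" and ?b = "%z. (\<lambda>i\<in>{..<m}. z (l + i))"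
 have a: "rlin R (free R {..<l + m}) (free R {..<l}) ?a"
 proof (rule rlinI)
  show "?a x : $(free R {..<l})" if "x : $(free R {..<l + m})" for x using free_coord[OF that] by (auto simp: free_finite)
 qed (auto simp: free_simps(3,4) intro!: restrict_ext)
 have b: "rlin R (free R {..<l + m}) (free R {..<m}) ?b"
 proof (rule rlinI)
  show "?b x : $(free R {..<m})" if "x : $(free R {..<l + m})" for x using free_coord[OF that] by (auto simp: free_finite)
 qed (auto simp: free_simps(3,4) intro!: restrict_ext)
 have "\<exists>z\<in>$(free R {..<l + m}). ?a z = x & ?b z = y"
  if x: "x : $(free R {..<l})" and y: "y : $(free R {..<m})" for x y
 proof (intro bexI conjI)
  let ?z = "\<lambda>i\<in>{..<l + m}. if i < l then x i else y (i - l)"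
  show z: "?z : $(free R {..<l + m})" using free_coord[OF x] free_coord[OF y] by (auto simp: free_finite)
  show "?a ?z = x" by (rule free_eqI[OF rlin_closed[OF a z] x]) auto
  show "?b ?z = y" by (rule free_eqI[OF rlin_closed[OF b z] y]) auto
 qed
 then have "(%z. g (?a z) \<oplus>\<^sub>F h (?b z)) ` $(free R {..<l + m}) =
   {g x \<oplus>\<^sub>F h y | x y. x : $(free R {..<l}) & y : $(free R {..<m})}"
  using rlin_closed[OF a] rlin_closed[OF b] by (fastforce simp: image_iff)
 then show ?thesis using that[OF rlin_sum[OF F rlin_comp[OF a g] rlin_comp[OF b h]]] by blast
qed

text \<open>Induction on the rank. The last coordinates of elements of \<open>N\<close> form a right
  ideal, whose finitely many generators are lifted to \<open>N\<close>. Subtracting a combination of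
  the lifts makes the last coordinate zero, and the induction hypothesis applies to the remaining
  coordinates.\<close>

lemma right_noetherian_noeth:
 fixes R (structure)
 assumes n: "right_noetherian R" shows "noeth R"
proof -
 interpret ring R using n by (simp add: right_noetherian_def)
 note R = ring_axioms
 have "\<exists>(l::nat) h. rlin R (free R {..<l}) (free R {..<k}) h & h ` $(free R {..<l}) = N"
  if "submodule N R (free R {..<k})" for k :: nat and N using that
 proof (induction k arbitrary: N)
  case 0
  have "$(free R {..<0 :: nat}) = {\<zero>\<^bsub>free R {..<0 :: nat}\<^esub>}" by (simp add: free_simps restrict_def)
  then have "N = $(free R {..<0 :: nat})" using submoduleD(1,2)[OF 0] by auto
  then show ?case using rlin_id by (intro exI[of _ 0] exI[of _ "%x. x"]) auto
 next
  case (Suc k)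
  let ?F = "free R {..<Suc k}" and ?G = "free R {..<k}"
  note N = submoduleD[OF Suc.prems]
  interpret F: rmodule R ?F by (rule rmodule_free[OF R])
  interpret Q: rmodule R "reg R" by (rule rmodule_regular[OF R])
  have c: "rlin R ?F (reg R) (%x. x k)" by (rule free_coord_rlin[OF R]) simp
  have "submodule ((%x. x k) ` N) R (reg R)"
  proof (rule Q.submoduleI)
   show "(%x. x k) ` N \<subseteq> $(reg R)" using N(1) rlin_closed[OF c] by auto
   show "\<zero>\<^bsub>reg R\<^esub> : (%x. x k) ` N"  by (rule image_eqI[OF _ N(2)]) (simp add: free_simps(2))
   show "x \<oplus>\<^bsub>reg R\<^esub> y : (%x. x k) ` N" if xy: "x : (%x. x k) ` N" "y : (%x. x k) ` N" for x y
   proof -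
    obtain x' y' where "x' : N" "x = x' k" "y' : N" "y = y' k" using xy by blast
    then have "x \<oplus>\<^bsub>reg R\<^esub> y = (x' \<oplus>\<^sub>?F y') k" "x' \<oplus>\<^sub>?F y' : N" using N(3) by (auto simp: free_simps(3))
    then show ?thesis by blast
   qed
   show "a \<odot>\<^bsub>reg R\<^esub> x : (%x. x k) ` N" if ax: "a : $R" "x : (%x. x k) ` N" for a x
   proof -
    obtain x' where "x' : N" "x = x' k" using ax(2) by blast
    then have "a \<odot>\<^bsub>reg R\<^esub> x = (a \<odot>\<^sub>?F x') k" "a \<odot>\<^sub>?F x' : N"
     using N(4) ax(1) by (auto simp: free_simps(4))
    then show ?thesis by blast
   qed
  qed
  then obtain X where X: "finite X" "X \<subseteq> (%x. x k) ` N" "submodule_span R (reg R) X = (%x. x k) ` N"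
   using n unfolding right_noetherian_def by blast
  obtain Y where Y: "finite Y" "Y \<subseteq> N" "X = (%x. x k) ` Y" using X(1,2) by (meson finite_subset_image)
  obtain v and l :: nat where v: "v ` {..<l} = Y" using finite_enumerate[OF Y(1)] by blast
  have vN: "v i : N" if "i < l" for i using v Y(2) that by blast
  have vF: "v : {..<l} \<rightarrow> $?F" using vN N(1) by auto
  let ?g = "lcomb R ?F {..<l} v"
  have g: "rlin R (free R {..<l}) ?F ?g" by (rule F.lcomb_rlin[OF vF])
  have vQ: "(%i. v i k) : {..<l} \<rightarrow> $(reg R)" using vF rlin_closed[OF c] by (auto simp: Pi_def)
  have gk: "?g x k = lcomb R (reg R) {..<l} (%i. v i k) x" if "x : $(free R {..<l})" for x
   by (rule rlin_free_eqI[OF Q.rmodule_axioms rlin_comp[OF g c] Q.lcomb_rlin[OF vQ] _ that])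
    (simp add: F.lcomb_unitv[OF vF] Q.lcomb_unitv[OF vQ])
  have gN: "?g x : N" if "x : $(free R {..<l})" for x by (rule F.lcomb_mem[OF Suc.prems _ that]) (use vN in auto)
  define z where "z y = (\<lambda>i\<in>{..<Suc k}. if i < k then y i else \<zero>)" for y
  have z: "rlin R ?G ?F z"
  proof (rule rlinI)
   show "z x : $?F" if "x : $?G" for x using free_coord[OF that] by (auto simp: z_def free_finite)
  qed (auto simp: z_def free_simps(3,4) intro!: restrict_ext)
  have "submodule {y : $?G. z y : N} R ?G"
  proof -
   interpret G: rmodule R ?G by (rule rmodule_free[OF R])
   show ?thesis by (rule G.submoduleI)
     (use N rlin_zero[OF G.rmodule_axioms F.rmodule_axioms z] in \<open>auto simp: rlin_add[OF z] rlin_smult[OF z]\<close>)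
  qed
  from Suc.IH[OF this] obtain m :: nat and h where h: "rlin R (free R {..<m}) ?G h"
   "h ` $(free R {..<m}) = {y : $?G. z y : N}" by blast
  obtain K where K: "rlin R (free R {..<l + m}) ?F K" "K ` $(free R {..<l + m}) =
   {?g x \<oplus>\<^sub>?F z (h y) | x y. x : $(free R {..<l}) & y : $(free R {..<m})}"
   by (rule free_concat[OF R F.rmodule_axioms g rlin_comp[OF h(1) z]])
  have "K ` $(free R {..<l + m}) = N"
  proof
   show "K ` $(free R {..<l + m}) \<subseteq> N" unfolding K(2) using gN h(2) N(3) by blast
   show "N \<subseteq> K ` $(free R {..<l + m})"
   proof
    fix x assume x: "x : N"
    have vX: "(%i. v i k) ` {..<l} = X" unfolding Y(3) v[symmetric] image_image by simp
    have "x k : submodule_span R (reg R) ((%i. v i k) ` {..<l})" unfolding vX X(3) using x by blast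
    then have "x k : lcomb R (reg R) {..<l} (%i. v i k) ` $(free R {..<l})" using subsetD[OF span_lcomb[OF Q.rmodule_axioms vQ]] by blast
    then obtain c where c': "c : $(free R {..<l})" "x k = ?g c k" by (auto simp: gk)
    define w where "w = x \<ominus>\<^sub>?F ?g c"
    have xF: "x : $?F" "?g c : $?F" using x N(1) gN[OF c'(1)] by auto
    have w: "w : N" unfolding w_def by (rule F.submodule_diff[OF Suc.prems x gN[OF c'(1)]])
    have wF: "w : $?F" using w N(1) by blast
    have wk: "w k = \<zero>" using free_module_diff[OF R xF, of k] c'(2) free_coord[OF xF(2), of k] by (simp add: w_def)
    have rG: "restrict w {..<k} : $?G" using free_coord[OF wF] by (auto simp: free_finite)
    have "z (restrict w {..<k}) = w" by (rule free_eqI[OF rlin_closed[OF z rG] wF]) (use wk in \<open>auto simp: z_def less_Suc_eq\<close>)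
    then have "restrict w {..<k} : h ` $(free R {..<m})" using w rG h(2) by simp
    then obtain y where "y : $(free R {..<m})" "z (h y) = w" using \<open>z (restrict w {..<k}) = w\<close> by auto
    moreover have "x = ?g c \<oplus>\<^sub>?F w" unfolding w_def using xF by simp
    ultimately show "x : K ` $(free R {..<l + m})" unfolding K(2) using c'(1) by blast
   qed
  qed
  then show ?case using K(1) by blast
 qed
 then show ?thesis unfolding noeth_def by blast
qed

text \<open>Generators of the preimage of a right ideal are mapped to generators of the
  ideal.\<close>

lemma right_noetherian_image:
 assumes n: "right_noetherian T" and S: "ring S" and h: "h : ring_hom T S" "h ` $T = $S" shows "right_noetherian S" unfolding right_noetherian_def
proof (intro conjI allI impI)
 show "ring S" by fact
 have T: "ring T" using n by (simp add: right_noetherian_def)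
 interpret S: ring S by fact
 interpret MT: rmodule T "reg T" by (rule rmodule_regular[OF T])
 fix I assume I: "submodule I S (reg S)"
 note I' = submoduleD[OF I, simplified]
 have "submodule {x : $T. h x : I} T (reg T)" by (rule MT.submoduleI)
   (use I' ring_hom_zero[OF h(1) T S] in \<open>auto simp: ring_hom_add[OF h(1)] ring_hom_mult[OF h(1)] ring_hom_closed[OF h(1)]\<close>)
 then obtain X where X: "finite X" "X \<subseteq> {x : $T. h x : I}"
   "submodule_span T (reg T) X = {x : $T. h x : I}" using n unfolding right_noetherian_def by blast
 have "submodule_span S (reg S) (h ` X) = I"
 proof
  show "submodule_span S (reg S) (h ` X) \<subseteq> I" by (rule span_least[OF I]) (use X(2) in auto)
  show "I \<subseteq> submodule_span S (reg S) (h ` X)"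
  proof (unfold submodule_span_def, clarify)
   fix y J assume y: "y : I" and J: "submodule J S (reg S)" and XJ: "h ` X \<subseteq> J"
   note J' = submoduleD[OF J, simplified]
   have "submodule {x : $T. h x : J} T (reg T)" by (rule MT.submoduleI)
     (use J' ring_hom_zero[OF h(1) T S] in \<open>auto simp: ring_hom_add[OF h(1)] ring_hom_mult[OF h(1)] ring_hom_closed[OF h(1)]\<close>)
   then have "{x : $T. h x : I} \<subseteq> {x : $T. h x : J}" unfolding X(3)[symmetric] by (rule span_least) (use X(2) XJ in auto)
   moreover obtain x where "x : $T" "y = h x" using y I'(1) h(2) by blast
   ultimately show "y : J" using y by blast
  qed
 qed
 then show "\<exists>X. finite X & X \<subseteq> I & submodule_span S (reg S) X = I" using X(1,2) by (intro exI[of _ "h ` X"]) auto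
qed

text \<open>
 The strong rank condition: an injection \<open>R\<^sup>a \<rightarrow> R\<^sup>b\<close> with \<open>a > b\<close> would produce the infinite
 direct sum of the submodules \<open>\<psi>\<^sup>n L\<close> inside a noetherian module.
\<close>

lemma noeth_rank:
 fixes R (structure)
 assumes R: "ring R" and nz: "\<one> ~= \<zero>" and n: "noeth R"
  and h: "rlin R (free R {..<a :: nat}) (free R {..<b :: nat}) h"
  and inj: "!!x. x : $(free R {..<a}) ==> h x = \<zero>\<^bsub>free R {..<b}\<^esub> ==> x = \<zero>\<^bsub>free R {..<a}\<^esub>"
 shows "a \<le> b"
proof (rule ccontr)
 interpret ring R by fact
 assume "\<not> a \<le> b"
 then have ba: "b < a" by simp
 let ?F = "free R {..<a}" and ?G = "free R {..<b}"
 interpret F: rmodule R ?F by (rule rmodule_free[OF R])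
 interpret G: rmodule R ?G by (rule rmodule_free[OF R])
 \<comment> \<open>Padding by zeros, which needs \<open>b < a\<close>. Every value of the injective
   endomorphism \<open>\<psi> = z h\<close> thus has coordinate \<open>b\<close> equal to zero,
   unlike the unit vector \<open>?u\<close>.\<close>
 define z where "z y = (\<lambda>i\<in>{..<a}. if i < b then y i else \<zero>)" for y
 have z: "rlin R ?G ?F z"
 proof (rule rlinI)
  show "z x : $?F" if "x : $?G" for x using free_coord[OF that] by (auto simp: z_def free_finite)
 qed (use ba in \<open>auto simp: z_def free_simps(3,4) intro!: restrict_ext\<close>)
 define \<psi> where "\<psi> x = z (h x)" for x
 have \<psi>: "rlin R ?F ?F \<psi>" unfolding \<psi>_def by (rule rlin_comp[OF h z])
 have \<psi>b: "\<psi> x b = \<zero>" for x using ba by (simp add: \<psi>_def z_def)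
 have \<psi>0: "x = \<zero>\<^sub>?F" if x: "x : $?F" "\<psi> x = \<zero>\<^sub>?F" for x
 proof (rule inj[OF x(1)])
  show "h x = \<zero>\<^sub>?G"
  proof (rule free_eqI[OF rlin_closed[OF h x(1)] G.M.zero_closed])
   show "h x i = \<zero>\<^sub>?G i" if "i : {..<b}" for i
    using fun_cong[OF x(2), of i] ba that by (simp add: \<psi>_def z_def free_simps(2))
  qed
 qed
 let ?u = "unitv R {..<a} b"
 have u: "?u : $?F" by (rule unitv_closed[OF R])
 \<comment> \<open>\<open>W n\<close> is generated by the elements \<open>\<psi>^i u\<close> with
   \<open>i < n\<close>.\<close>
 define W where "W n = rec_nat {\<zero>\<^sub>?F} (%_ X. {\<alpha> \<odot>\<^sub>?F ?u \<oplus>\<^sub>?F \<psi> w | \<alpha> w. \<alpha> : $R & w : X}) n" for n :: nat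
 have W0: "W 0 = {\<zero>\<^sub>?F}" and WS: "W (Suc n) = {\<alpha> \<odot>\<^sub>?F ?u \<oplus>\<^sub>?F \<psi> w | \<alpha> w. \<alpha> : $R & w : W n}" for n
  by (simp_all add: W_def)
 note \<psi>c = rlin_closed[OF \<psi>] and \<psi>z = rlin_zero[OF F.rmodule_axioms F.rmodule_axioms \<psi>]
 have sub: "submodule (W n) R ?F" for n
 proof (induction n)
  case 0 then show ?case unfolding W0 by (intro F.submoduleI) auto
 next
  case (Suc n)
  note N = submoduleD[OF Suc]
  have c: "w : $?F" if "w : W n" for w using N(1) that by blast
  show ?case
  proof (rule F.submoduleI)
   show "W (Suc n) \<subseteq> $?F" unfolding WS using u c \<psi>c by auto
   have "\<zero>\<^sub>?F = \<zero> \<odot>\<^sub>?F ?u \<oplus>\<^sub>?F \<psi> \<zero>\<^sub>?F" using u by (simp add: \<psi>z)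
   then show "\<zero>\<^sub>?F : W (Suc n)" unfolding WS using N(2) by blast
   show "x \<oplus>\<^sub>?F y : W (Suc n)" if xy: "x : W (Suc n)" "y : W (Suc n)" for x y
   proof -
    obtain \<alpha> v \<beta> w where vw: "\<alpha> : $R" "v : W n" "x = \<alpha> \<odot>\<^sub>?F ?u \<oplus>\<^sub>?F \<psi> v"
     "\<beta> : $R" "w : W n" "y = \<beta> \<odot>\<^sub>?F ?u \<oplus>\<^sub>?F \<psi> w" using xy unfolding WS by blast
    have "x \<oplus>\<^sub>?F y = (\<alpha> \<oplus> \<beta>) \<odot>\<^sub>?F ?u \<oplus>\<^sub>?F \<psi> (v \<oplus>\<^sub>?F w)"
     using vw u c \<psi>c by (simp add: rlin_add[OF \<psi>] F.smult_l_distr F.M.a_ac)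
    then show ?thesis unfolding WS using vw N(3) by blast
   qed
   show "\<beta> \<odot>\<^sub>?F x : W (Suc n)" if "\<beta> : $R" "x : W (Suc n)" for \<beta> x
   proof -
    obtain \<alpha> v where v: "\<alpha> : $R" "v : W n" "x = \<alpha> \<odot>\<^sub>?F ?u \<oplus>\<^sub>?F \<psi> v"
     using \<open>x : W (Suc n)\<close> unfolding WS by blast
    have "\<beta> \<odot>\<^sub>?F x = (\<alpha> \<otimes> \<beta>) \<odot>\<^sub>?F ?u \<oplus>\<^sub>?F \<psi> (\<beta> \<odot>\<^sub>?F v)"
     using v u c \<psi>c that(1) by (simp add: rlin_smult[OF \<psi>] F.smult_r_distr F.smult_assoc)
    then show ?thesis unfolding WS using v N(4) that(1) by blast
   qed
  qed
 qed
 have "W n \<subseteq> W (Suc n)" for n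
 proof (induction n)
  case 0 then show ?case using submoduleD(2)[OF sub, of "Suc 0"] unfolding W0 by blast
 next
  case (Suc n) then show ?case unfolding WS[of n] WS[of "Suc n"] by blast
 qed
 then have mono: "W m \<subseteq> W n" if "m \<le> n" for m n using lift_Suc_mono_le[of W] that by blast
 have "submodule (\<Union>n. W n) R ?F"
 proof (rule F.submoduleI)
  show "(\<Union>n. W n) \<subseteq> $?F" using submoduleD(1)[OF sub] by blast
  show "\<zero>\<^sub>?F : (\<Union>n. W n)" using submoduleD(2)[OF sub] by blast
  show "x \<oplus>\<^sub>?F y : (\<Union>n. W n)" if xy: "x : (\<Union>n. W n)" "y : (\<Union>n. W n)" for x y
  proof -
   obtain m n where mn: "x : W m" "y : W n" using xy by blast
   then have "x : W (max m n)" "y : W (max m n)" using mono[of m "max m n"] mono[of n "max m n"] by auto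
   then show ?thesis using submoduleD(3)[OF sub] by blast
  qed
  show "\<alpha> \<odot>\<^sub>?F x : (\<Union>n. W n)" if "\<alpha> : $R" "x : (\<Union>n. W n)" for \<alpha> x
   using that submoduleD(4)[OF sub] by blast
 qed
 then obtain l :: nat and g where g: "rlin R (free R {..<l}) ?F g" "g ` $(free R {..<l}) = (\<Union>n. W n)" by (rule noethD[OF n])
 \<comment> \<open>The finitely many generators of the union already lie in one member of the chain;
   \<open>sum \<nu> {..<l}\<close> bounds all the indices involved.\<close>
 have "\<exists>n. g (unitv R {..<l} i) : W n" for i
 proof -
  have "g (unitv R {..<l} i) : (\<Union>n. W n)" unfolding g(2)[symmetric] by (rule imageI[OF unitv_closed[OF R]])
  then show ?thesis by blast
 qed
 then obtain \<nu> where \<nu>: "!!i. g (unitv R {..<l} i) : W (\<nu> i)" by metis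
 have "g (unitv R {..<l} i) : W (sum \<nu> {..<l})" if i: "i < l" for i
  using \<nu>[of i] mono[of "\<nu> i" "sum \<nu> {..<l}"] member_le_sum[of i "{..<l}" \<nu>] i by auto
 then have "g x : W (sum \<nu> {..<l})" if "x : $(free R {..<l})" for x
  using F.lcomb_mem[OF sub _ that, of "%i. g (unitv R {..<l} i)"] rlin_free_eq_lcomb[OF F.rmodule_axioms g(1) that] by (simp add: Pi_def)
 then have all: "(\<Union>n. W n) \<subseteq> W (sum \<nu> {..<l})" unfolding g(2)[symmetric] by blast
 have "(\<psi> ^^ n) ?u : W (Suc n)" for n
 proof (induction n)
  case 0
  have "?u = \<one> \<odot>\<^sub>?F ?u \<oplus>\<^sub>?F \<psi> \<zero>\<^sub>?F" using u by (simp add: \<psi>z)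
  then show ?case unfolding WS W0 by auto
 next
  case (Suc n)
  then have "(\<psi> ^^ n) ?u : $?F" using submoduleD(1)[OF sub] by blast
  then have "(\<psi> ^^ Suc n) ?u = \<zero> \<odot>\<^sub>?F ?u \<oplus>\<^sub>?F \<psi> ((\<psi> ^^ n) ?u)" using u \<psi>c by simp
  then show ?case unfolding WS[of "Suc n"] using Suc by blast
 qed
 then have "(\<psi> ^^ sum \<nu> {..<l}) ?u : W (sum \<nu> {..<l})" using all by blast
 \<comment> \<open>Coordinate \<open>b\<close> forces the coefficient of \<open>?u\<close> to be
   zero, and injectivity of \<open>\<psi>\<close> then lowers the exponent by one.\<close>
 moreover have "(\<psi> ^^ n) ?u : $?F & (\<psi> ^^ n) ?u \<notin> W n" for n
 proof (induction n)
  case 0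
  have "?u b ~= \<zero>\<^sub>?F b" using ba nz by (simp add: unitv_def free_simps(2))
  then show ?case using u unfolding W0 by auto
 next
  case (Suc n)
  have False if asm: "(\<psi> ^^ Suc n) ?u : W (Suc n)"
  proof -
   obtain \<alpha> w where w: "\<alpha> : $R" "w : W n" "\<psi> ((\<psi> ^^ n) ?u) = \<alpha> \<odot>\<^sub>?F ?u \<oplus>\<^sub>?F \<psi> w"
    using asm unfolding WS by auto
   have wc: "w : $?F" using w(2) submoduleD(1)[OF sub] by blast
   have "\<alpha> = \<zero>" using fun_cong[OF w(3), of b] \<psi>b w(1) ba by (simp add: free_simps(3,4) unitv_def)
   then have "\<psi> ((\<psi> ^^ n) ?u \<ominus>\<^sub>?F w) = \<zero>\<^sub>?F"
    using w(3) u \<psi>c[OF wc] rlin_diff[OF F.rmodule_axioms F.rmodule_axioms \<psi> _ wc] Suc by simp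
   then have "(\<psi> ^^ n) ?u = w" using \<psi>0[of "(\<psi> ^^ n) ?u \<ominus>\<^sub>?F w"] F.M.minus_zero_iff Suc wc by simp
   then show False using Suc w(2) by simp
  qed
  then show ?case using Suc \<psi>c by auto
 qed
 ultimately show False by blast
qed

section \<open>Modules of finite projective dimension over the ambient ring\<close>

lemma rlin_pair:
 "rlin R M N g ==> rlin R M N' h ==> rlin R M (prod_module N N') (%x. (g x, h x))"
 by (rule rlinI) (simp_all add: rlin_closed rlin_add rlin_smult)

lemma rlin_fst: "rlin R (prod_module N N') N fst" and rlin_snd: "rlin R (prod_module N N') N' snd" by (rule rlinI; auto)+

lemma rlin_inl:
 assumes "rmodule R N'" shows "rlin R N (prod_module N N') (%x. (x, \<zero>\<^bsub>N'\<^esub>))"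
 by (rule rlin_pair[OF rlin_id rlin_const_zero[OF assms]])

lemma rlin_inr:
 assumes "rmodule R N" shows "rlin R N' (prod_module N N') (%x. (\<zero>\<^sub>N, x))"
 by (rule rlin_pair[OF rlin_const_zero[OF assms] rlin_id])

lemma ext_van_free:
 assumes R: "ring R" and v: "ext_van R F d (reg R) j" shows "ext_van R F d (free R {..<r :: nat}) j" unfolding ext_van_def
proof (intro allI impI)
 fix h assume h: "rlin R (F (Suc j)) (free R {..<r}) h"
  and 0: "\<forall>x\<in>$(F (Suc (Suc j))). h (d (Suc j) x) = \<zero>\<^bsub>free R {..<r}\<^esub>"
 have "\<exists>g. rlin R (F j) (reg R) g & (\<forall>x\<in>$(F (Suc j)). h x i = g (d j x))" if i: "i < r" for i
  using v[unfolded ext_van_def, rule_format, OF rlin_comp[OF h free_coord_rlin[OF R, of i]]] 0 i by (simp add: free_simps(2))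
 then obtain g where g: "!!i. i < r ==> rlin R (F j) (reg R) (g i)"
  "!!i x. i < r ==> x : $(F (Suc j)) ==> h x i = g i (d j x)" by metis
 have gl: "rlin R (F j) (free R {..<r}) (%x. \<lambda>i\<in>{..<r}. g i x)"
 proof (rule rlinI)
  show "(\<lambda>i\<in>{..<r}. g i x) : $(free R {..<r})" if "x : $(F j)" for x
   using rlin_closed[OF g(1) that] by (auto simp: free_finite)
 qed (auto simp: free_simps(3,4) rlin_add[OF g(1)] rlin_smult[OF g(1)] intro!: restrict_ext)
 have "h x = (\<lambda>i\<in>{..<r}. g i (d j x))" if x: "x : $(F (Suc j))" for x
 proof -
  have c: "h x : $(free R {..<r})" by (rule rlin_closed[OF h x])
  have "(\<lambda>i\<in>{..<r}. h x i) = h x" using c by (simp add: free_finite PiE_restrict)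
  moreover have "(\<lambda>i\<in>{..<r}. h x i) = (\<lambda>i\<in>{..<r}. g i (d j x))" using g(2) x by (auto intro!: restrict_ext)
  ultimately show ?thesis by simp
 qed
 then show "\<exists>g. rlin R (F j) (free R {..<r}) g & (\<forall>x\<in>$(F (Suc j)). h x = g (d j x))" using gl by blast
qed

lemma ext_van_prod:
 assumes 1: "ext_van R F d N j" and 2: "ext_van R F d N' j" shows "ext_van R F d (prod_module N N') j" unfolding ext_van_def
proof (intro allI impI)
 fix h assume h: "rlin R (F (Suc j)) (prod_module N N') h"
  and 0: "\<forall>x\<in>$(F (Suc (Suc j))). h (d (Suc j) x) = \<zero>\<^bsub>prod_module N N'\<^esub>"
 obtain g where g: "rlin R (F j) N g" "\<forall>x\<in>$(F (Suc j)). fst (h x) = g (d j x)"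
  using 1[unfolded ext_van_def, rule_format, OF rlin_comp[OF h rlin_fst]] 0 by auto
 obtain g' where g': "rlin R (F j) N' g'" "\<forall>x\<in>$(F (Suc j)). snd (h x) = g' (d j x)"
  using 2[unfolded ext_van_def, rule_format, OF rlin_comp[OF h rlin_snd]] 0 by auto
 show "\<exists>g. rlin R (F j) (prod_module N N') g & (\<forall>x\<in>$(F (Suc j)). h x = g (d j x))"
  using rlin_pair[OF g(1) g'(1)] g(2) g'(2) by (intro exI[of _ "%x. (g x, g' x)"]) (simp add: prod_eq_iff)
qed

text \<open>
 A free resolution of \<open>M\<close> over \<open>A\<close> lifts to maps \<open>D\<close> over \<open>S\<close> with \<open>D D = f H\<close>.  They are
 assembled to a free resolution over \<open>S\<close>: the mapping cone of the multiplication by \<open>f\<close>.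
 The index is shifted so that \<open>D 0\<close> is a map to zero.
\<close>

locale cone = normal_quotient S A p f
 for S :: "('a, 'c) ring_scheme" (structure) and A :: "('b, 'd) ring_scheme" and p f +
 fixes M :: "('b, 'm, 'e) module_scheme" and k :: "nat => nat"
  and E :: "nat => (nat => 'a) => nat => 'a" and q :: "(nat => 'a) => 'm"
 assumes M: "rmodule A M" and sres: "sresol M k E q"
begin

interpretation Fr: rmodule S "Fr r" for r by (rule rmodule_Fr)

definition \<rho> :: "nat => nat" where "\<rho> n = (case n of 0 => 0 | Suc m => k m)"

definition D :: "nat => (nat => 'a) => nat => 'a" where
 "D n = (case n of 0 => (%_. \<zero>\<^bsub>Fr 0\<^esub>) | Suc m => E m)"

abbreviation G where "G n \<equiv> Fr (\<rho> n)"
abbreviation l where "l n \<equiv> lmul (\<rho> n)"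

lemma \<rho>_simps [simp]: "\<rho> 0 = 0" "\<rho> (Suc n) = k n" by (simp_all add: \<rho>_def)
lemma D_Suc [simp]: "D (Suc n) = E n" by (simp add: D_def)

lemma E_rlin: "rlin S (Fr (k (Suc n))) (Fr (k n)) (E n)" and q_rlin: "rlin S (Fr (k 0)) (res p M) q"
 and q_surj: "q ` $(Fr (k 0)) = $M"
 and q_ker: "x : $(Fr (k 0)) ==> q x = \<zero>\<^sub>M \<longleftrightarrow> x : E 0 ` $(Fr (k (Suc 0)))"
 and E_ker: "y : $(Fr (k (Suc n))) ==>
  E n y : lmul (k n) ` $(Fr (k n)) \<longleftrightarrow> y : E (Suc n) ` $(Fr (k (Suc (Suc n))))" using sres by (auto simp: sresol_def)

lemma D_rlin: "rlin S (G (Suc n)) (G n) (D n)"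
proof (cases n)
 case 0
 then show ?thesis using rlin_const_zero[OF rmodule_Fr, of "Fr (k 0)" 0] by (simp add: D_def)
qed (use E_rlin in simp)

lemma carrier_Fr0: "$(Fr 0) = {\<zero>\<^bsub>Fr 0\<^esub>}" by (simp add: free_simps restrict_def)

lemma l_rlin: "rlin S (G n) (G n) (l n)" by (rule lmul_rlin)

lemma D_D: "x : $(G (Suc (Suc n))) ==> D n (D (Suc n) x) : l n ` $(G n)"
proof (cases n)
 case 0
 have "l 0 \<zero>\<^bsub>Fr 0\<^esub> = \<zero>\<^bsub>Fr 0\<^esub>" using rlin_zero[OF rmodule_Fr rmodule_Fr l_rlin, of 0] by simp
 then show ?thesis using 0 carrier_Fr0 by (simp add: D_def)
next
 case (Suc m)
 assume "x : $(G (Suc (Suc n)))"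
 then show ?thesis using Suc E_ker[of "E (Suc m) x" m] rlin_closed[OF E_rlin, of x "Suc m"] by simp
qed

text \<open>\<open>D'\<close> is the twist, \<open>D f = f D'\<close>, and \<open>H\<close> is the
  quotient in \<open>D D = f H\<close>. Both are unique, but their existence is stated without a
  formula, whence the choice.\<close>

definition D' where "D' n = (SOME h. rlin S (G (Suc n)) (G n) h & (\<forall>x\<in>$(G (Suc n)). D n (l (Suc n) x) = l n (h x)))"
definition H where "H n = (SOME h. rlin S (G (Suc (Suc n))) (G n) h & (\<forall>x\<in>$(G (Suc (Suc n))). D n (D (Suc n) x) = l n (h x)))"

lemma D': "rlin S (G (Suc n)) (G n) (D' n)" "x : $(G (Suc n)) ==> D n (l (Suc n) x) = l n (D' n x)"
proof -
 have "\<exists>h. rlin S (G (Suc n)) (G n) h & (\<forall>x\<in>$(G (Suc n)). D n (l (Suc n) x) = l n (h x))"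
  using twist[OF fmod_Fr fmod_Fr D_rlin] by metis
 from someI_ex[OF this] show "rlin S (G (Suc n)) (G n) (D' n)" "x : $(G (Suc n)) ==> D n (l (Suc n) x) = l n (D' n x)"
  unfolding D'_def by auto
qed

lemma H: "rlin S (G (Suc (Suc n))) (G n) (H n)" "x : $(G (Suc (Suc n))) ==> D n (D (Suc n) x) = l n (H n x)"
proof -
 have "\<exists>h. rlin S (G (Suc (Suc n))) (G n) h & (\<forall>x\<in>$(G (Suc (Suc n))). D n (D (Suc n) x) = l n (h x))"
  using fmod_divide[OF fmod_Fr rmodule_Fr rlin_comp[OF D_rlin D_rlin] D_D] by metis
 from someI_ex[OF this] show "rlin S (G (Suc (Suc n))) (G n) (H n)" "x : $(G (Suc (Suc n))) ==> D n (D (Suc n) x) = l n (H n x)"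
  unfolding H_def by auto
qed

lemmas cD = rlin_closed[OF D_rlin] and cD' = rlin_closed[OF D'(1)] and cH = rlin_closed[OF H(1)]
 and cl = rlin_closed[OF l_rlin]

lemma l_inj: "x : $(G n) ==> y : $(G n) ==> l n x = l n y ==> x = y"
 using fmod_inj(1)[OF fmod_Fr] by blast

text \<open>Cancel \<open>f\<close> in \<open>f D' H = D f H = D D D = f H D\<close>.\<close>

lemma D'_H: "x : $(G (Suc (Suc (Suc n)))) ==> D' n (H (Suc n) x) = H n (D (Suc (Suc n)) x)"
 by (rule l_inj[where n = n]) (use D'(2)[of "H (Suc n) x" n] H(2)[of x "Suc n"] H(2)[of "D (Suc (Suc n)) x" n] cH[of x "Suc n"]
   cD[of x "Suc (Suc n)"] in \<open>simp_all add: cD' cH del: \<rho>_simps D_Suc\<close>)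

text \<open>Cancel \<open>f\<close> in \<open>f H f = D D f = D f D' = f D' D'\<close>.\<close>

lemma H_l: "x : $(G (Suc (Suc n))) ==> H n (l (Suc (Suc n)) x) = D' n (D' (Suc n) x)"
 by (rule l_inj[where n = n]) (use H(2)[of "l (Suc (Suc n)) x" n] D'(2)[of x "Suc n"] D'(2)[of "D' (Suc n) x" n] cD'[of x "Suc n"]
   cl[of x "Suc (Suc n)"] in \<open>simp_all add: cD' cH del: \<rho>_simps D_Suc\<close>)

definition F where "F n = prod_module (G (Suc n)) (G n)"

text \<open>The block matrix with rows \<open>(D, - f)\<close> and \<open>(H, - D')\<close>. The
  four entries of its square vanish by \<open>D D = f H\<close>, \<open>D f = f D'\<close>,
  \<open>H D = D' H\<close> and \<open>H f = D' D'\<close>.\<close>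

definition dif where
 "dif n z = (D (Suc n) (fst z) \<ominus>\<^bsub>G (Suc n)\<^esub> l (Suc n) (snd z), H n (fst z) \<ominus>\<^bsub>G n\<^esub> D' n (snd z))"

lemma carrier_F [simp]: "$(F n) = $(G (Suc n)) \<times> $(G n)"
 and zero_F: "\<zero>\<^bsub>F n\<^esub> = (\<zero>\<^bsub>G (Suc n)\<^esub>, \<zero>\<^bsub>G n\<^esub>)" by (simp_all add: F_def)

lemma rmodule_F: "rmodule S (F n)" unfolding F_def by (rule rmodule_prod[OF rmodule_Fr rmodule_Fr])

lemma dif_rlin: "rlin S (F (Suc n)) (F n) (dif n)" unfolding F_def dif_def
 by (intro rlin_pair rlin_sub rmodule_Fr rlin_comp[OF rlin_fst] rlin_comp[OF rlin_snd] D_rlin l_rlin H D')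

text \<open>If \<open>(x, y)\<close> is a cycle, then \<open>D x = f y\<close>, and exactness modulo
  \<open>f\<close> gives \<open>x = D w\<close>. Now \<open>f y = D D w = f H w\<close> implies
  \<open>y = H w\<close>, so \<open>(x, y)\<close> is the boundary of \<open>(w, 0)\<close>.\<close>

lemma F_resol: "resol S (res p M) F dif (%z. q (fst z))" unfolding resol_def
proof (intro conjI allI ballI)
 show "projective_module S (F n)" for n unfolding F_def by (rule projective_prod) (rule ring_axioms)
 show "rlin S (F (Suc n)) (F n) (dif n)" for n by (rule dif_rlin)
 show "rlin S (F 0) (res p M) (%z. q (fst z))" unfolding F_def using rlin_comp[OF rlin_fst q_rlin] by simp
 have "$(Fr 0) ~= {}" using Fr.M.zero_closed by blast
 then have "fst ` $(F 0) = $(Fr (k 0))" by (simp add: fst_image_times del: lessThan_0)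
 then show "(%z. q (fst z)) ` $(F 0) = $(res p M)" using q_surj by (simp add: image_image[symmetric, of q fst])
next
 fix z assume z: "z : $(F 0)"
 show "q (fst z) = \<zero>\<^bsub>res p M\<^esub> \<longleftrightarrow> z : dif 0 ` $(F 1)"
 proof
  assume "q (fst z) = \<zero>\<^bsub>res p M\<^esub>"
  then have "fst z : E 0 ` $(Fr (k (Suc 0)))" using q_ker[of "fst z"] z by auto
  then obtain x where x: "x : $(Fr (k (Suc 0)))" "fst z = E 0 x" by blast
  have zl: "l (Suc 0) \<zero>\<^bsub>G (Suc 0)\<^esub> = \<zero>\<^bsub>G (Suc 0)\<^esub>" by (rule rlin_zero[OF rmodule_Fr rmodule_Fr l_rlin])
  have "snd (dif 0 (x, \<zero>\<^bsub>G (Suc 0)\<^esub>)) : $(G 0)" "snd z : $(G 0)"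
   using rlin_closed[OF dif_rlin, of "(x, \<zero>\<^bsub>G (Suc 0)\<^esub>)" 0] x z by auto
  then have "snd (dif 0 (x, \<zero>\<^bsub>G (Suc 0)\<^esub>)) = snd z" using carrier_Fr0 by auto
  moreover have "fst (dif 0 (x, \<zero>\<^bsub>G (Suc 0)\<^esub>)) = fst z" using x zl rlin_closed[OF E_rlin x(1)] by (simp add: dif_def)
  ultimately have "z = dif 0 (x, \<zero>\<^bsub>G (Suc 0)\<^esub>)" by (simp add: prod_eq_iff)
  then show "z : dif 0 ` $(F 1)" using x(1) by auto
 next
  assume "z : dif 0 ` $(F 1)"
  then obtain x y where xy: "x : $(Fr (k (Suc 0)))" "y : $(Fr (k 0))" "fst z = E 0 x \<ominus>\<^bsub>Fr (k 0)\<^esub> lmul (k 0) y"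
   by (auto simp: dif_def)
  interpret R: rmodule S "res p M" by (rule rmodule_res[OF M])
  have c: "E 0 x : $(Fr (k 0))" "lmul (k 0) y : $(Fr (k 0))" using rlin_closed[OF E_rlin xy(1)] rlin_closed[OF lmul_rlin xy(2)] by auto
  have "q (E 0 x) = \<zero>\<^sub>M" using q_ker[OF c(1)] xy(1) by blast
  moreover have "q (lmul (k 0) y) = \<zero>\<^sub>M" by (rule rlin_res_lmul[OF M q_rlin]) (use xy(2) in blast)
  ultimately show "q (fst z) = \<zero>\<^bsub>res p M\<^esub>"
   unfolding xy(3) using rlin_diff[OF rmodule_Fr R.rmodule_axioms q_rlin c] R.M.diff_self[OF R.M.zero_closed] by simp
 qed
next
 fix n z assume z: "z : $(F (Suc n))"
 have c: "fst z : $(G (Suc (Suc n)))" "snd z : $(G (Suc n))" using z by auto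
 show "dif n z = \<zero>\<^bsub>F n\<^esub> \<longleftrightarrow> z : dif (Suc n) ` $(F (Suc (Suc n)))"
 proof
  assume 0: "dif n z = \<zero>\<^bsub>F n\<^esub>"
  have e: "D (Suc n) (fst z) = l (Suc n) (snd z)" using 0 Fr.M.minus_zero_iff[OF cD[OF c(1)] cl[OF c(2)]] by (simp add: dif_def zero_F)
  have "E n (fst z) : lmul (k n) ` $(Fr (k n))" using e c(2) by simp
  then have "fst z : E (Suc n) ` $(Fr (k (Suc (Suc n))))" using E_ker[of "fst z" n] c(1) by simp
  then obtain w where w: "w : $(G (Suc (Suc (Suc n))))" "fst z = D (Suc (Suc n)) w" by auto
  have "l (Suc n) (snd z) = l (Suc n) (H (Suc n) w)" using e H(2)[OF w(1)] w(2) by simp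
  then have s: "snd z = H (Suc n) w" by (rule l_inj[OF c(2) cH[OF w(1)]])
  have "dif (Suc n) (w, \<zero>\<^bsub>G (Suc (Suc n))\<^esub>) = z"
   unfolding dif_def fst_conv snd_conv rlin_zero[OF rmodule_Fr rmodule_Fr l_rlin] rlin_zero[OF rmodule_Fr rmodule_Fr D'(1)]
    Fr.M.diff_zero[OF cD[OF w(1)]] Fr.M.diff_zero[OF cH[OF w(1)]] using w(2) s by (simp add: prod_eq_iff)
  moreover have "(w, \<zero>\<^bsub>G (Suc (Suc n))\<^esub>) : $(F (Suc (Suc n)))" using w(1) Fr.M.zero_closed by (simp del: \<rho>_simps)
  ultimately show "z : dif (Suc n) ` $(F (Suc (Suc n)))" by (metis image_eqI)
 next
  assume "z : dif (Suc n) ` $(F (Suc (Suc n)))"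
  then obtain x y where x: "x : $(G (Suc (Suc (Suc n))))" and y: "y : $(G (Suc (Suc n)))"
   and zz: "z = dif (Suc n) (x, y)" by (auto simp del: \<rho>_simps)
  note cc = cD[OF x] cl[OF y] cH[OF x] cD'[OF y]
  have 1: "D (Suc n) (fst z) = l (Suc n) (H (Suc n) x) \<ominus>\<^bsub>G (Suc n)\<^esub> l (Suc n) (D' (Suc n) y)"
   unfolding zz dif_def fst_conv snd_conv rlin_diff[OF rmodule_Fr rmodule_Fr D_rlin cc(1,2)]
   using H(2)[OF x] D'(2)[OF y] by (simp del: \<rho>_simps D_Suc)
  have 2: "l (Suc n) (snd z) = l (Suc n) (H (Suc n) x) \<ominus>\<^bsub>G (Suc n)\<^esub> l (Suc n) (D' (Suc n) y)"
   unfolding zz dif_def fst_conv snd_conv by (rule rlin_diff[OF rmodule_Fr rmodule_Fr l_rlin cc(3,4)])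
  have 3: "H n (fst z) = H n (D (Suc (Suc n)) x) \<ominus>\<^bsub>G n\<^esub> D' n (D' (Suc n) y)"
   unfolding zz dif_def fst_conv snd_conv rlin_diff[OF rmodule_Fr rmodule_Fr H(1) cc(1,2)] H_l[OF y] by simp
  have 4: "D' n (snd z) = H n (D (Suc (Suc n)) x) \<ominus>\<^bsub>G n\<^esub> D' n (D' (Suc n) y)"
   unfolding zz dif_def fst_conv snd_conv rlin_diff[OF rmodule_Fr rmodule_Fr D'(1) cc(3,4)] D'_H[OF x] by simp
  have "D (Suc n) (fst z) = l (Suc n) (snd z)" "H n (fst z) = D' n (snd z)" using 1 2 3 4 by simp_all
  then show "dif n z = \<zero>\<^bsub>F n\<^esub>"
   unfolding dif_def zero_F using Fr.M.diff_self[OF cl[OF c(2)]] Fr.M.diff_self[OF cD'[OF c(2)]] by simp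
 qed
qed

text \<open>
 A cocycle on the cone restricts on the second summand to a map \<open>b\<close> that, after the twist \<open>\<beta>\<close> by
 \<open>f\<close>, is a cocycle modulo \<open>f\<close>.  Hence it is modulo \<open>f\<close> a coboundary by assumption.
\<close>

lemma cone_ext_van:
 assumes van: "svan k E i" shows "ext_van S F dif (reg S) (Suc i)" unfolding ext_van_def
proof (intro allI impI)
 let ?S = "reg S"
 interpret Q: rmodule S ?S by (rule rmodule_regular) (rule ring_axioms)
 fix h assume h: "rlin S (F (Suc (Suc i))) ?S h" and h0: "\<forall>z\<in>$(F (Suc (Suc (Suc i)))). h (dif (Suc (Suc i)) z) = \<zero>\<^sub>?S"
 let ?z1 = "\<zero>\<^bsub>G (Suc (Suc (Suc i)))\<^esub>" and ?z2 = "\<zero>\<^bsub>G (Suc (Suc i))\<^esub>"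
 define a where "a x = h (x, ?z2)" for x
 define b where "b y = h (?z1, y)" for y
 have a: "rlin S (G (Suc (Suc (Suc i)))) ?S a" unfolding a_def using rlin_comp[OF rlin_inl[OF rmodule_Fr] h[unfolded F_def]] by simp
 have b: "rlin S (G (Suc (Suc i))) ?S b" unfolding b_def using rlin_comp[OF rlin_inr[OF rmodule_Fr] h[unfolded F_def]] by simp
 have hab: "h (x, y) = a x \<oplus> b y" if "x : $(G (Suc (Suc (Suc i))))" "y : $(G (Suc (Suc i)))" for x y
 proof -
  have "h ((x, ?z2) \<oplus>\<^bsub>F (Suc (Suc i))\<^esub> (?z1, y)) = a x \<oplus> b y" unfolding a_def b_def
   by (subst rlin_add[OF h]) (use that Fr.M.zero_closed in \<open>simp_all del: \<rho>_simps\<close>)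
  then show ?thesis unfolding F_def prod_module_simps fst_conv snd_conv Fr.M.r_zero[OF that(1)] Fr.M.l_zero[OF that(2)] .
 qed
 \<comment> \<open>The cocycle condition at \<open>(0, y)\<close>, whose boundary is
   \<open>(- f y, - D' y)\<close>.\<close>
 have bD': "b (D' (Suc (Suc i)) y) = \<ominus> a (l (Suc (Suc (Suc i))) y)" if y: "y : $(G (Suc (Suc (Suc i))))" for y
 proof -
  let ?z = "\<zero>\<^bsub>G (Suc (Suc (Suc (Suc i))))\<^esub>"
  have zz: "dif (Suc (Suc i)) (?z, y) = (\<ominus>\<^bsub>G (Suc (Suc (Suc i)))\<^esub> l (Suc (Suc (Suc i))) y, \<ominus>\<^bsub>G (Suc (Suc i))\<^esub> D' (Suc (Suc i)) y)"
   unfolding dif_def fst_conv snd_conv rlin_zero[OF rmodule_Fr rmodule_Fr D_rlin] rlin_zero[OF rmodule_Fr rmodule_Fr H(1)] a_minus_def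
   using Fr.M.l_zero[OF Fr.M.a_inv_closed[OF cl[OF y]]] Fr.M.l_zero[OF Fr.M.a_inv_closed[OF cD'[OF y]]] by simp
  have "h (dif (Suc (Suc i)) (?z, y)) = \<zero>" using h0 y Fr.M.zero_closed by (simp del: \<rho>_simps)
  then have "a (\<ominus>\<^bsub>G (Suc (Suc (Suc i)))\<^esub> l (Suc (Suc (Suc i))) y) \<oplus> b (\<ominus>\<^bsub>G (Suc (Suc i))\<^esub> D' (Suc (Suc i)) y) = \<zero>"
   unfolding zz using hab[OF Fr.M.a_inv_closed[OF cl[OF y]] Fr.M.a_inv_closed[OF cD'[OF y]]] by simp
  then have "(\<ominus> a (l (Suc (Suc (Suc i))) y)) \<oplus> (\<ominus> b (D' (Suc (Suc i)) y)) = \<zero>"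
   unfolding rlin_minus[OF rmodule_Fr Q.rmodule_axioms a cl[OF y]] rlin_minus[OF rmodule_Fr Q.rmodule_axioms b cD'[OF y]]
   using regular_minus[OF ring_axioms] rlin_closed[OF a cl[OF y]] rlin_closed[OF b cD'[OF y]] by (simp del: \<rho>_simps)
  then show ?thesis
   using rlin_closed[OF a cl[OF y]] rlin_closed[OF b cD'[OF y]] minus_equality[of "\<ominus> a (l (Suc (Suc (Suc i))) y)" "\<ominus> b (D' (Suc (Suc i)) y)"]
   by (simp del: \<rho>_simps)
 qed
 obtain \<beta> where \<beta>: "rlin S (G (Suc (Suc i))) ?S \<beta>" "!!y. y : $(G (Suc (Suc i))) ==> \<beta> (l (Suc (Suc i)) y) = f \<otimes> b y"
  by (rule untwist[OF fmod_Fr fmod_regular b]) blast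
 have fa: "rlin S (G (Suc (Suc (Suc i)))) ?S (%y. f \<otimes> (\<ominus> a y))" by (rule rlin_comp[OF _ fmodD(2)[OF fmod_regular]])
   (use rlin_neg[OF Q.rmodule_axioms a] rlin_closed[OF a] in
    \<open>simp add: rlin_cong[OF rmodule_Fr, of _ "%y. \<ominus> a y" "%x. \<ominus>\<^sub>?S a x"] regular_minus[OF ring_axioms] del: \<rho>_simps\<close>)
 \<comment> \<open>Composed with \<open>f\<close> on the right, this reads
   \<open>\<beta> D f = \<beta> f D' = f b D' = - f a f\<close>; then \<open>f\<close> is
   cancelled.\<close>
 have \<beta>D: "\<beta> (D (Suc (Suc i)) y) = f \<otimes> (\<ominus> a y)" if y: "y : $(G (Suc (Suc (Suc i))))" for y
 proof (rule fmod_right_cancel[OF fmod_Fr fmod_regular rlin_comp[OF D_rlin \<beta>(1)] fa _ y])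
  fix w assume w: "w : $(G (Suc (Suc (Suc i))))"
  show "\<beta> (D (Suc (Suc i)) (l (Suc (Suc (Suc i))) w)) = f \<otimes> (\<ominus> a (l (Suc (Suc (Suc i))) w))"
   unfolding D'(2)[OF w] \<beta>(2)[OF cD'[OF w]] bD'[OF w] ..
 qed
 have "p (\<beta> (E (Suc i) y)) = \<zero>\<^sub>A" if y: "y : $(Fr (k (Suc (Suc i))))" for y
 proof -
  have c: "a y : $S" using rlin_closed[OF a, of y] y by simp
  show ?thesis using \<beta>D[of y] y p_ker[of "f \<otimes> (\<ominus> a y)"] c by simp
 qed
 then obtain g where g: "rlin S (Fr (k i)) ?S g" "\<forall>x\<in>$(Fr (k (Suc i))). p (\<beta> x) = p (g (E i x))"
  using van[unfolded svan_def, rule_format, of \<beta>] \<beta>(1) by auto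
 have gE: "rlin S (Fr (k (Suc i))) ?S (%x. g (E i x))" by (rule rlin_comp[OF E_rlin g(1)])
 have \<beta>1: "rlin S (Fr (k (Suc i))) ?S \<beta>" using \<beta>(1) by simp
 have im: "\<beta> x \<ominus>\<^sub>?S g (E i x) : (%x. f \<otimes> x) ` $?S" if x: "x : $(Fr (k (Suc i)))" for x
 proof -
  have c: "\<beta> x : $S" "g (E i x) : $S" using rlin_closed[OF \<beta>1 x] rlin_closed[OF gE x] by auto
  have "p (\<beta> x \<ominus> g (E i x)) = \<zero>\<^sub>A" using p_minus[OF c] g(2) x ring_hom_closed[OF p_hom c(2)] by simp
  then show ?thesis using p_ker[of "\<beta> x \<ominus> g (E i x)"] c by (simp add: regular_diff[OF ring_axioms])
 qed
 obtain e where e: "rlin S (Fr (k (Suc i))) ?S e"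
   "!!x. x : $(Fr (k (Suc i))) ==> \<beta> x \<ominus>\<^sub>?S g (E i x) = f \<otimes> e x"
  by (rule fmod_divide[OF fmod_regular rmodule_Fr rlin_sub[OF Q.rmodule_axioms \<beta>1 gE] im]) (assumption | (rule that; assumption))+
 obtain g' where g': "rlin S (Fr (k i)) ?S g'" "!!x. x : $(Fr (k i)) ==> g (lmul (k i) x) = f \<otimes> g' x"
  by (rule twist[OF fmod_Fr fmod_regular g(1)]) blast
 \<comment> \<open>With \<open>\<beta> - g E = f e\<close> and \<open>g f = f g'\<close> one gets
   \<open>f b = \<beta> f = g E f + f e f = f (g' D' + e f)\<close>.\<close>
 have bb: "b y = g' (D' (Suc i) y) \<oplus> e (l (Suc (Suc i)) y)" if y: "y : $(G (Suc (Suc i)))" for y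
 proof -
  have y': "y : $(Fr (k (Suc i)))" using y by simp
  have ly: "lmul (k (Suc i)) y : $(Fr (k (Suc i)))" by (rule rlin_closed[OF lmul_rlin y'])
  have Dy: "D' (Suc i) y : $(Fr (k i))" using cD'[OF y] by simp
  have c: "g' (D' (Suc i) y) : $S" "e (lmul (k (Suc i)) y) : $S" "b y : $S" "\<beta> (lmul (k (Suc i)) y) : $S"
   using rlin_closed[OF g'(1) Dy] rlin_closed[OF e(1) ly] rlin_closed[OF b y] rlin_closed[OF \<beta>1 ly] by auto
  have "g (E i (lmul (k (Suc i)) y)) = f \<otimes> g' (D' (Suc i) y)" using D'(2)[OF y] g'(2)[OF Dy] by simp
  then have "\<beta> (lmul (k (Suc i)) y) \<ominus> f \<otimes> g' (D' (Suc i) y) = f \<otimes> e (lmul (k (Suc i)) y)"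
   using e(2)[OF ly] regular_diff[OF ring_axioms c(4)] c(1) by simp
  then have "\<beta> (lmul (k (Suc i)) y) = f \<otimes> e (lmul (k (Suc i)) y) \<oplus> f \<otimes> g' (D' (Suc i) y)" using diff_eq_iff c by simp
  then have "f \<otimes> b y = f \<otimes> (g' (D' (Suc i) y) \<oplus> e (lmul (k (Suc i)) y))" using \<beta>(2)[OF y] c by (simp add: r_distr a_comm)
  then show ?thesis using fmod_inj(1)[OF fmod_regular, of "b y" "g' (D' (Suc i) y) \<oplus> e (lmul (k (Suc i)) y)"] c by simp
 qed
 \<comment> \<open>The sign is that of the second column \<open>(- f, - D')\<close> of the
   differential: by \<open>bb\<close> the composite of \<open>\<Gamma>\<close> with it is
   \<open>b\<close>.\<close>
 define \<Gamma> where "\<Gamma> z = \<ominus>\<^sub>?S (e (fst z) \<oplus>\<^sub>?S g' (snd z))" for z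
 have \<Gamma>: "rlin S (F (Suc i)) ?S \<Gamma>" unfolding \<Gamma>_def F_def
  by (rule rlin_neg[OF Q.rmodule_axioms rlin_sum[OF Q.rmodule_axioms rlin_comp[OF rlin_fst] rlin_comp[OF rlin_snd]]])
   (use e(1) g'(1) in simp_all)
 \<comment> \<open>A cocycle that vanishes on the second summand. The cocycle condition at
   \<open>(0, y)\<close> then says \<open>w (f y, 0) = 0\<close>, and cancelling \<open>f\<close>
   shows that \<open>w\<close> is zero.\<close>
 define w where "w z = h z \<ominus>\<^sub>?S \<Gamma> (dif (Suc i) z)" for z
 have w: "rlin S (F (Suc (Suc i))) ?S w" unfolding w_def by (rule rlin_sub[OF Q.rmodule_axioms h rlin_comp[OF dif_rlin \<Gamma>]])
 have w2: "w (?z1, y) = \<zero>" if y: "y : $(G (Suc (Suc i)))" for y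
 proof -
  have ly: "l (Suc (Suc i)) y : $(Fr (k (Suc i)))" using cl[OF y] by simp
  have Dy: "D' (Suc i) y : $(Fr (k i))" using cD'[OF y] by simp
  have c: "g' (D' (Suc i) y) : $S" "e (l (Suc (Suc i)) y) : $S" using rlin_closed[OF g'(1) Dy] rlin_closed[OF e(1) ly] by auto
  have zz: "dif (Suc i) (?z1, y) = (\<ominus>\<^bsub>G (Suc (Suc i))\<^esub> l (Suc (Suc i)) y, \<ominus>\<^bsub>G (Suc i)\<^esub> D' (Suc i) y)"
   unfolding dif_def fst_conv snd_conv rlin_zero[OF rmodule_Fr rmodule_Fr D_rlin] rlin_zero[OF rmodule_Fr rmodule_Fr H(1)] a_minus_def
   using Fr.M.l_zero[OF Fr.M.a_inv_closed[OF cl[OF y]]] Fr.M.l_zero[OF Fr.M.a_inv_closed[OF cD'[OF y]]] by simp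
  have n1: "e (\<ominus>\<^bsub>G (Suc (Suc i))\<^esub> l (Suc (Suc i)) y) = \<ominus> e (l (Suc (Suc i)) y)"
   using rlin_minus[OF rmodule_Fr Q.rmodule_axioms e(1) ly] regular_minus[OF ring_axioms c(2)] by simp
  have n2: "g' (\<ominus>\<^bsub>G (Suc i)\<^esub> D' (Suc i) y) = \<ominus> g' (D' (Suc i) y)"
   using rlin_minus[OF rmodule_Fr Q.rmodule_axioms g'(1) Dy] regular_minus[OF ring_axioms c(1)] by simp
  have "\<Gamma> (dif (Suc i) (?z1, y)) = b y" unfolding zz \<Gamma>_def fst_conv snd_conv n1 n2 bb[OF y] using c
   by (simp add: regular_minus[OF ring_axioms] minus_add a_comm)
  moreover have "h (?z1, y) = b y" by (simp add: b_def)
  ultimately show ?thesis using rlin_closed[OF b y] by (simp add: w_def)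
 qed
 have w0: "w (dif (Suc (Suc i)) z) = \<zero>" if z: "z : $(F (Suc (Suc (Suc i))))" for z
  unfolding w_def h0[rule_format, OF z] resol_complex(1)[OF F_resol z] rlin_zero[OF rmodule_F Q.rmodule_axioms \<Gamma>]
  using Q.M.diff_self[OF Q.M.zero_closed] by simp
 have w1: "rlin S (G (Suc (Suc (Suc i)))) ?S (%x. w (x, ?z2))" using rlin_comp[OF rlin_inl[OF rmodule_Fr] w[unfolded F_def]] by simp
 have w12: "w (x, y) = w (x, ?z2)" if x: "x : $(G (Suc (Suc (Suc i))))" and y: "y : $(G (Suc (Suc i)))" for x y
 proof -
  have "w ((x, ?z2) \<oplus>\<^bsub>F (Suc (Suc i))\<^esub> (?z1, y)) = w (x, ?z2) \<oplus> w (?z1, y)"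
   by (subst rlin_add[OF w]) (use x y Fr.M.zero_closed in \<open>simp_all del: \<rho>_simps\<close>)
  then show ?thesis unfolding F_def prod_module_simps fst_conv snd_conv Fr.M.r_zero[OF x] Fr.M.l_zero[OF y] w2[OF y]
   using rlin_closed[OF w1 x] by simp
 qed
 have "w (x, ?z2) = \<zero>\<^sub>?S" if x: "x : $(G (Suc (Suc (Suc i))))" for x
 proof (rule fmod_right_cancel[OF fmod_Fr fmod_regular w1 rlin_const_zero[OF Q.rmodule_axioms] _ x])
  fix y assume y: "y : $(G (Suc (Suc (Suc i))))"
  let ?z = "\<zero>\<^bsub>G (Suc (Suc (Suc (Suc i))))\<^esub>"
  have "dif (Suc (Suc i)) (?z, y) = (\<ominus>\<^bsub>G (Suc (Suc (Suc i)))\<^esub> l (Suc (Suc (Suc i))) y, \<ominus>\<^bsub>G (Suc (Suc i))\<^esub> D' (Suc (Suc i)) y)"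
   unfolding dif_def fst_conv snd_conv rlin_zero[OF rmodule_Fr rmodule_Fr D_rlin] rlin_zero[OF rmodule_Fr rmodule_Fr H(1)] a_minus_def
   using Fr.M.l_zero[OF Fr.M.a_inv_closed[OF cl[OF y]]] Fr.M.l_zero[OF Fr.M.a_inv_closed[OF cD'[OF y]]] by simp
  then have "w (\<ominus>\<^bsub>G (Suc (Suc (Suc i)))\<^esub> l (Suc (Suc (Suc i))) y, ?z2) = \<zero>"
   using w0[of "(?z, y)"] w12[OF Fr.M.a_inv_closed[OF cl[OF y]] Fr.M.a_inv_closed[OF cD'[OF y]]] y Fr.M.zero_closed by (simp del: \<rho>_simps)
  then have "\<ominus>\<^sub>?S w (l (Suc (Suc (Suc i))) y, ?z2) = \<zero>\<^sub>?S"
   using rlin_minus[OF rmodule_Fr Q.rmodule_axioms w1 cl[OF y]] by simp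
  then show "w (l (Suc (Suc (Suc i))) y, ?z2) = \<zero>\<^sub>?S" using rlin_closed[OF w1 cl[OF y]] by (metis Q.M.a_inv_zero Q.M.minus_minus)
 qed
 then have "w z = \<zero>\<^sub>?S" if "z : $(F (Suc (Suc i)))" for z using w12[of "fst z" "snd z"] that by (cases z) simp
 then have "h z = \<Gamma> (dif (Suc i) z)" if "z : $(F (Suc (Suc i)))" for z
  using that rlin_closed[OF h that] rlin_closed[OF rlin_comp[OF dif_rlin \<Gamma>] that]
   Q.M.minus_zero_iff[of "h z" "\<Gamma> (dif (Suc i) z)"] by (simp add: w_def)
 then show "\<exists>g. rlin S (F (Suc i)) ?S g & (\<forall>z\<in>$(F (Suc (Suc i))). h z = g (dif (Suc i) z))" using \<Gamma> by blast
qed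

text \<open>The terms of the cone are products of finite free modules, so the vanishing for
  coefficients \<open>S\<close> passes to them; their own identity maps become available as
  coefficients.\<close>

lemma cone_ext_van_F:
 assumes "svan k E i" shows "ext_van S F dif (F n) (Suc i)" unfolding F_def[of n] by (intro ext_van_prod ext_van_free ring_axioms cone_ext_van assms)

text \<open>Moves a splitting one degree down. The map \<open>id - d s\<close> kills boundaries, so
  it is a cocycle with values in the cone and hence of the form \<open>t d\<close>. Applying
  \<open>d\<close> gives \<open>d t d = d\<close>.\<close>

lemma dif_split_descend:
 assumes van: "svan k E i"
  and s: "rlin S (F (Suc (Suc i))) (F (Suc (Suc (Suc i)))) s"
  "!!x. x : $(F (Suc (Suc (Suc i)))) ==> dif (Suc (Suc i)) (s (dif (Suc (Suc i)) x)) = dif (Suc (Suc i)) x"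
 obtains t where "rlin S (F (Suc i)) (F (Suc (Suc i))) t"
  "!!x. x : $(F (Suc (Suc i))) ==> dif (Suc i) (t (dif (Suc i) x)) = dif (Suc i) x"
proof -
 interpret F: rmodule S "F n" for n by (rule rmodule_F)
 let ?n = "Suc (Suc i)"
 define e where "e x = x \<ominus>\<^bsub>F ?n\<^esub> dif ?n (s x)" for x
 have e: "rlin S (F ?n) (F ?n) e" unfolding e_def by (rule rlin_sub[OF rmodule_F rlin_id rlin_comp[OF s(1) dif_rlin]])
 note cd = rlin_closed[OF dif_rlin]
 have "\<forall>x\<in>$(F (Suc ?n)). e (dif ?n x) = \<zero>\<^bsub>F ?n\<^esub>" using s(2) F.M.diff_self[OF cd] by (simp add: e_def del: carrier_F)
 then obtain t where t: "rlin S (F (Suc i)) (F ?n) t" "\<forall>x\<in>$(F ?n). e x = t (dif (Suc i) x)"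
  using cone_ext_van_F[OF van, of ?n, unfolded ext_van_def, rule_format, OF e] by blast
 have "dif (Suc i) (t (dif (Suc i) x)) = dif (Suc i) x" if x: "x : $(F ?n)" for x
 proof -
  have c: "dif ?n (s x) : $(F ?n)" by (rule cd[OF rlin_closed[OF s(1) x]])
  have "dif (Suc i) (t (dif (Suc i) x)) = dif (Suc i) (x \<ominus>\<^bsub>F ?n\<^esub> dif ?n (s x))" using t(2) x by (simp add: e_def del: carrier_F)
  also have "\<dots> = dif (Suc i) x" unfolding rlin_diff[OF rmodule_F rmodule_F dif_rlin x c] resol_complex(1)[OF F_resol rlin_closed[OF s(1) x]]
   by (rule F.M.diff_zero[OF cd[OF x]])
  finally show ?thesis .
 qed
 then show ?thesis using that t(1) by blast
qed

text \<open>The map \<open>e\<close> witnesses projectivity of the first syzygy, the image of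
  \<open>E 0\<close>: it kills the kernel of \<open>E 0\<close>, so it factors through this image,
  and there it is a section of \<open>E 0\<close>.\<close>

lemma first_syzygy_projective:
 assumes van: "!!i. svan k E i" and pd: "projective_dim S (res p M) < \<infinity>"
 obtains e where "rlin S (Fr (k 1)) (Fr (k 1)) e" "!!x. x : $(Fr (k 1)) ==> E 0 (e x) = E 0 x"
  "!!x. x : $(Fr (k 1)) ==> E 0 x = \<zero>\<^bsub>Fr (k 0)\<^esub> ==> e x = \<zero>\<^bsub>Fr (k 1)\<^esub>"
proof -
 interpret F: rmodule S "F n" for n by (rule rmodule_F)
 obtain n and P :: "nat => ('a, ('a, 'm) resolution_elem) module" and \<delta> \<epsilon>
  where P: "projective_resolution S (res p M) P \<delta> \<epsilon>" "\<forall>i>n. $(P i) = {\<zero>\<^bsub>P i\<^esub>}"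
  using pd unfolding projective_dim_def Inf_less_iff by auto
 have base: "\<exists>s. rlin S (F (Suc n)) (F (Suc (Suc n))) s & (\<forall>x\<in>$(F (Suc (Suc n))). dif (Suc n) (s (dif (Suc n) x)) = dif (Suc n) x)"
 proof -
  have "$(P (Suc (Suc n))) = {\<zero>\<^bsub>P (Suc (Suc n))\<^esub>}" using P(2) by simp
  from resol_split[OF rmodule_res[OF M] F_resol projective_resolution_resol[OF P(1)] this] show ?thesis by metis
 qed
 \<comment> \<open>A resolution of length \<open>n\<close> splits the cone at index
   \<open>Suc n\<close>. The induction carries the splitting down to index 1, the last one reached
   by the vanishing of Ext.\<close>
 have "\<exists>s. rlin S (F (Suc 0)) (F (Suc (Suc 0))) s & (\<forall>x\<in>$(F (Suc (Suc 0))). dif (Suc 0) (s (dif (Suc 0) x)) = dif (Suc 0) x)"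
  using base
 proof (induction n)
  case (Suc n)
  then obtain s where s: "rlin S (F (Suc (Suc n))) (F (Suc (Suc (Suc n)))) s"
   "!!x. x : $(F (Suc (Suc (Suc n)))) ==> dif (Suc (Suc n)) (s (dif (Suc (Suc n)) x)) = dif (Suc (Suc n)) x" by blast
  obtain t where "rlin S (F (Suc n)) (F (Suc (Suc n))) t"
   "!!x. x : $(F (Suc (Suc n))) ==> dif (Suc n) (t (dif (Suc n) x)) = dif (Suc n) x"
   by (rule dif_split_descend[OF van s]) (assumption | (rule that; assumption))+
  then show ?case using Suc.IH by blast
 qed
 then obtain s where s: "rlin S (F (Suc 0)) (F (Suc (Suc 0))) s"
  "!!x. x : $(F (Suc (Suc 0))) ==> dif (Suc 0) (s (dif (Suc 0) x)) = dif (Suc 0) x" by blast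
 let ?F = "F (Suc 0)"
 note cd = rlin_closed[OF dif_rlin]
 \<comment> \<open>\<open>\<epsilon>\<close> kills the image of \<open>dif 1\<close>, which is the
   kernel of \<open>dif 0\<close>, and does not change \<open>dif 0\<close>.\<close>
 define \<epsilon> where "\<epsilon> x = x \<ominus>\<^sub>?F dif (Suc 0) (s x)" for x
 have \<epsilon>: "rlin S ?F ?F \<epsilon>" unfolding \<epsilon>_def by (rule rlin_sub[OF rmodule_F rlin_id rlin_comp[OF s(1) dif_rlin]])
 have \<epsilon>0: "\<epsilon> (dif (Suc 0) x) = \<zero>\<^sub>?F" if "x : $(F (Suc (Suc 0)))" for x
  using s(2)[OF that] F.M.diff_self[OF cd[OF that]] by (simp add: \<epsilon>_def)
 have d\<epsilon>: "dif 0 (\<epsilon> x) = dif 0 x" if x: "x : $?F" for x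
  unfolding \<epsilon>_def rlin_diff[OF rmodule_F rmodule_F dif_rlin x cd[OF rlin_closed[OF s(1) x]]]
   resol_complex(1)[OF F_resol rlin_closed[OF s(1) x]] by (rule F.M.diff_zero[OF cd[OF x]])
 have d0: "rlin S ?F (Fr (k 0)) (%z. fst (dif 0 z))" using rlin_comp[OF dif_rlin[of 0, unfolded F_def[of 0]] rlin_fst] by simp
 have im: "fst (dif 0 z) : E 0 ` $(Fr (k (Suc 0)))" if "z : $?F" for z
  using resol_complex(2)[OF F_resol that] q_ker[OF rlin_closed[OF d0 that]] by simp
 \<comment> \<open>\<open>dif 0\<close> also involves \<open>- f\<close> on the second summand. Its
   values are killed by \<open>q\<close>, so they lie in the image of \<open>E 0\<close>, and
   projectivity of \<open>F 1\<close> rewrites it as \<open>E 0 j\<close>.\<close>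
 obtain j where j: "rlin S ?F (Fr (k (Suc 0))) j" "!!z. z : $?F ==> E 0 (j z) = fst (dif 0 z)"
  by (rule projective_lift[OF resolD(1)[OF F_resol] rmodule_Fr rmodule_Fr E_rlin d0 im]) (assumption | (rule that; assumption))+
 have inl: "rlin S (Fr (k (Suc 0))) ?F (%x. (x, \<zero>\<^bsub>Fr (k 0)\<^esub>))" unfolding F_def using rlin_inl[OF rmodule_Fr] by simp
 have d1: "fst (dif 0 (x, \<zero>\<^bsub>Fr (k 0)\<^esub>)) = E 0 x" if "x : $(Fr (k (Suc 0)))" for x
  using rlin_zero[OF rmodule_Fr rmodule_Fr lmul_rlin] Fr.M.diff_zero[OF rlin_closed[OF E_rlin that]] by (simp add: dif_def)
 show ?thesis
 proof (rule that)
  show "rlin S (Fr (k 1)) (Fr (k 1)) (%x. j (\<epsilon> (x, \<zero>\<^bsub>Fr (k 0)\<^esub>)))"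
   using rlin_comp[OF inl rlin_comp[OF \<epsilon> j(1)]] by simp
  fix x assume "x : $(Fr (k 1))"
  then have x: "x : $(Fr (k (Suc 0)))" "(x, \<zero>\<^bsub>Fr (k 0)\<^esub>) : $?F" using rlin_closed[OF inl, of x] by auto
  show "E 0 (j (\<epsilon> (x, \<zero>\<^bsub>Fr (k 0)\<^esub>))) = E 0 x"
   unfolding j(2)[OF rlin_closed[OF \<epsilon> x(2)]] d\<epsilon>[OF x(2)] by (rule d1[OF x(1)])
  assume E0: "E 0 x = \<zero>\<^bsub>Fr (k 0)\<^esub>"
  have "snd (dif 0 (x, \<zero>\<^bsub>Fr (k 0)\<^esub>)) : $(Fr 0)" using cd[OF x(2)] unfolding carrier_F mem_Times_iff by simp
  then have "dif 0 (x, \<zero>\<^bsub>Fr (k 0)\<^esub>) = \<zero>\<^bsub>F 0\<^esub>"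
   using d1[OF x(1)] E0 carrier_Fr0 by (simp add: zero_F prod_eq_iff)
  then obtain z where "z : $(F (Suc (Suc 0)))" "(x, \<zero>\<^bsub>Fr (k 0)\<^esub>) = dif (Suc 0) z" using resolD(7)[OF F_resol x(2)] by auto
  then have "\<epsilon> (x, \<zero>\<^bsub>Fr (k 0)\<^esub>) = \<zero>\<^sub>?F" using \<epsilon>0 by simp
  then show "j (\<epsilon> (x, \<zero>\<^bsub>Fr (k 0)\<^esub>)) = \<zero>\<^bsub>Fr (k 1)\<^esub>"
   using rlin_zero[OF rmodule_F rmodule_Fr j(1)] by simp
 qed
qed

end

section \<open>Syzygies of modules over the quotient\<close>

context normal_quotient
begin

text \<open>The presentation \<open>g\<close> is prescribed, because it will be given by minimal
  homogeneous generators; only the later maps are chosen, without regard to the grading.\<close>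

lemma sresol_exists:
 assumes n: "noeth S" and M: "rmodule A M" and q: "rlin S (Fr m) (res p M) q" "q ` $(Fr m) = $M"
  and g: "rlin S (Fr n) (Fr m) g" "!!x. x : $(Fr m) ==> q x = \<zero>\<^sub>M \<longleftrightarrow> x : g ` $(Fr n)"
 obtains k E where "sresol M k E q" "k 0 = m" "k 1 = n" "E 0 = g"
proof -
 \<comment> \<open>A triple \<open>(a, b, h)\<close> codes a map \<open>h\<close> from rank
   \<open>b\<close> to rank \<open>a\<close>. The relation \<open>C\<close> says that the image of
   the next map is the kernel of the present one modulo \<open>f\<close>.\<close>
 define Q where "Q i t \<longleftrightarrow> (case t of (a, b, h) => rlin S (Fr b) (Fr a) h) & (i = 0 \<longrightarrow> t = (m, n, g))" for i :: nat and t
 define C where "C t t' \<longleftrightarrow> (case t of (a, b, h) => case t' of (a', b', h') =>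
  a' = b & (\<forall>x\<in>$(Fr b). h x : lmul a ` $(Fr a) \<longleftrightarrow> x : h' ` $(Fr b')))" for t t'
 have step: "\<exists>t'. Q (Suc i) t' & C t t'" if "Q i t" for i t
 proof -
  obtain a b h where t: "t = (a, b, h)" by (metis prod_cases3)
  have h: "rlin S (Fr b) (Fr a) h" using that by (simp add: Q_def t)
  have "submodule {x : $(Fr b). proj a (h x) = \<zero>\<^bsub>res p (FA a)\<^esub>} S (Fr b)"
   by (rule submodule_kernel[OF rmodule_Fr rmodule_res[OF rmodule_FA] rlin_comp[OF h proj_rlin]])
  then obtain b' :: nat and h' where h': "rlin S (Fr b') (Fr b) h'"
   "h' ` $(Fr b') = {x : $(Fr b). proj a (h x) = \<zero>\<^bsub>res p (FA a)\<^esub>}" by (rule noethD[OF n])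
  have "h x : lmul a ` $(Fr a) \<longleftrightarrow> x : h' ` $(Fr b')" if "x : $(Fr b)" for x
   unfolding h'(2) using proj_zero_iff[OF rlin_closed[OF h that]] that by simp
  then show ?thesis using h'(1) by (intro exI[of _ "(b, b', h')"]) (simp add: Q_def C_def t)
 qed
 have "\<exists>t. Q 0 t" using g(1) by (auto simp: Q_def)
 then obtain t where t: "!!i. Q i (t i)" "!!i. C (t i) (t (Suc i))" using dependent_nat_choice[of Q "%i. C"] step by metis
 define k where "k i = fst (t i)" for i
 define E where "E i = snd (snd (t i))" for i
 have b: "fst (snd (t i)) = k (Suc i)" for i using t(2)[of i] unfolding C_def k_def by (auto split: prod.splits)
 have t0: "t 0 = (m, n, g)" using t(1)[of 0] by (simp add: Q_def)
 have E: "rlin S (Fr (k (Suc i))) (Fr (k i)) (E i)" for i using t(1)[of i] b[of i] by (simp add: Q_def E_def k_def case_prod_beta)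
 have Ek: "E i x : lmul (k i) ` $(Fr (k i)) \<longleftrightarrow> x : E (Suc i) ` $(Fr (k (Suc (Suc i))))"
  if "x : $(Fr (k (Suc i)))" for i x using t(2)[of i] b[of i] b[of "Suc i"] that by (simp add: C_def E_def k_def case_prod_beta)
 have k0: "k 0 = m" "k 1 = n" "E 0 = g" using t0 b[of 0] by (simp_all add: k_def E_def)
 have "sresol M k E q" unfolding sresol_def using E Ek q g(2) k0 by simp
 then show ?thesis using that k0 by blast
qed

text \<open>The outcome of the cone argument for a presentation \<open>g\<close> of
  \<open>M\<close>, with the resolution and the cone no longer visible.\<close>

lemma syzygy_projective:
 fixes M :: "('b, 'm, 'e) module_scheme"
 assumes n: "noeth S" and M: "rmodule A M" and q: "rlin S (Fr m) (res p M) q" "q ` $(Fr m) = $M"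
  and g: "rlin S (Fr n) (Fr m) g" "!!x. x : $(Fr m) ==> q x = \<zero>\<^sub>M \<longleftrightarrow> x : g ` $(Fr n)"
  and ext: "!!i. i \<ge> 1 ==> trivial_group (Ext A i M (reg A))"
  and pd: "projective_dim S (res p M) < \<infinity>"
 obtains e where "rlin S (Fr n) (Fr n) e" "!!x. x : $(Fr n) ==> g (e x) = g x"
  "!!x. x : $(Fr n) ==> g x = \<zero>\<^bsub>Fr m\<^esub> ==> e x = \<zero>\<^bsub>Fr n\<^esub>"
proof -
 obtain k E where s: "sresol M k E q" and k: "k 0 = m" "k 1 = n" "E 0 = g" by (rule sresol_exists[OF n M q g])
 interpret cone S A p f M k E q by (rule cone.intro[OF normal_quotient_axioms cone_axioms.intro[OF M s]])
 have van: "svan k E i" for i using Ext_trivial_iff_svan[OF M s, of i] ext by simp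
 obtain e where e: "rlin S (Fr (k 1)) (Fr (k 1)) e" "!!x. x : $(Fr (k 1)) ==> E 0 (e x) = E 0 x"
  "!!x. x : $(Fr (k 1)) ==> E 0 x = \<zero>\<^bsub>Fr (k 0)\<^esub> ==> e x = \<zero>\<^bsub>Fr (k 1)\<^esub>"
  by (rule first_syzygy_projective[OF van pd]) (rule that; assumption)
 show ?thesis by (rule that[OF e[unfolded k]])
qed

end

section \<open>Graded groups and modules\<close>

text \<open>The homogeneous component of \<open>x\<close> in a given degree.\<close>

definition hc :: "('a, 'm, 'i) graded_module => 'm => 'i => 'm" where
 "hc M x = (THE c. (\<forall>i. c i : part M i) & finite {i. c i ~= \<zero>\<^sub>M} & x = finsum M c {i. c i ~= \<zero>\<^sub>M})"

locale graded_group = abelian_group M for M :: "('a, 'm, 'i) graded_module" (structure) +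
 assumes graded: "internally_graded M"
begin

lemma part_subgroup: "subgroup (part M i) (add_monoid M)" using graded by (simp add: internally_graded_def)

lemma part_closed: "x : part M i ==> x : $M"
 and part_zero [simp]: "\<zero> : part M i"
 and part_add: "x : part M i ==> y : part M i ==> x \<oplus> y : part M i"
 and part_neg: "x : part M i ==> \<ominus> x : part M i"
 using subgroup.subset[OF part_subgroup[of i]] subgroup.one_closed[OF part_subgroup[of i]]
  subgroup.m_closed[OF part_subgroup[of i]] subgroup.m_inv_closed[OF part_subgroup[of i]] by (auto simp: a_inv_def)

lemma hc_decomp:
 assumes "x : $M"
 shows "(\<forall>i. hc M x i : part M i) & finite {i. hc M x i ~= \<zero>} & x = finsum M (hc M x) {i. hc M x i ~= \<zero>}"
proof -
 have "\<exists>!c. (\<forall>i. c i : part M i) & finite {i. c i ~= \<zero>} & x = finsum M c {i. c i ~= \<zero>}"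
  using graded assms by (simp add: internally_graded_def)
 from theI'[OF this] show ?thesis unfolding hc_def .
qed

lemma hc_part: "x : $M ==> hc M x i : part M i"
 and hc_finite: "x : $M ==> finite {i. hc M x i ~= \<zero>}"
 and hc_sum: "x : $M ==> finsum M (hc M x) {i. hc M x i ~= \<zero>} = x" using hc_decomp by simp_all

lemma hc_closed: "x : $M ==> hc M x i : $M" by (rule part_closed[OF hc_part])

lemma hc_unique:
 assumes "!!i. c i : part M i" "finite I" "!!i. i \<notin> I ==> c i = \<zero>" "x = finsum M c I" shows "hc M x = c"
proof -
 have cc: "c i : $M" for i by (rule part_closed[OF assms(1)])
 then have x: "x : $M" unfolding assms(4) by auto
 have fin: "finite {i. c i ~= \<zero>}" by (rule finite_subset[OF _ assms(2)]) (use assms(3) in blast)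
 have "finsum M c {i. c i ~= \<zero>} = finsum M c I" by (rule add.finprod_mono_neutral_cong_left) (use assms cc in auto)
 then have "(\<forall>i. c i : part M i) & finite {i. c i ~= \<zero>} & x = finsum M c {i. c i ~= \<zero>}"
  using assms(1,4) fin by simp
 moreover have "\<exists>!c. (\<forall>i. c i : part M i) & finite {i. c i ~= \<zero>} & x = finsum M c {i. c i ~= \<zero>}"
  using graded x by (simp add: internally_graded_def)
 ultimately show ?thesis using hc_decomp[OF x] by blast
qed

lemma hc_sum_superset:
 assumes "x : $M" "finite I" "{i. hc M x i ~= \<zero>} \<subseteq> I" shows "finsum M (hc M x) I = x"
proof -
 have "finsum M (hc M x) {i. hc M x i ~= \<zero>} = finsum M (hc M x) I"
  by (rule add.finprod_mono_neutral_cong_left) (use assms hc_closed in auto)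
 then show ?thesis using hc_sum[OF assms(1)] by simp
qed

lemma hc_add:
 assumes x: "x : $M" and y: "y : $M" shows "hc M (x \<oplus> y) i = hc M x i \<oplus> hc M y i"
proof -
 let ?I = "{i. hc M x i ~= \<zero>} \<union> {i. hc M y i ~= \<zero>}"
 have fin: "finite ?I" using hc_finite x y by simp
 have "x \<oplus> y = finsum M (hc M x) ?I \<oplus> finsum M (hc M y) ?I" using hc_sum_superset[OF x fin] hc_sum_superset[OF y fin] by simp
 also have "\<dots> = finsum M (%i. hc M x i \<oplus> hc M y i) ?I" by (rule finsum_addf[symmetric]) (use hc_closed x y in auto)
 finally have "hc M (x \<oplus> y) = (%i. hc M x i \<oplus> hc M y i)" by (intro hc_unique[OF _ fin]) (use part_add hc_part x y in auto)
 then show ?thesis by simp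
qed

lemma hc_homogeneous:
 assumes "x : part M i" shows "hc M x j = (if j = i then x else \<zero>)"
proof -
 have "finsum M (%j. if j = i then x else \<zero>) {i} = x" using part_closed[OF assms] by (subst finsum_insert) auto
 then have "hc M x = (%j. if j = i then x else \<zero>)" by (intro hc_unique[of _ "{i}"]) (use assms in auto)
 then show ?thesis by simp
qed

lemma hc_zero [simp]: "hc M \<zero> i = \<zero>" using hc_homogeneous[of \<zero> i i] by simp

lemma hc_finsum:
 assumes "g : B \<rightarrow> $M" shows "hc M (finsum M g B) i = finsum M (%b. hc M (g b) i) B"
 by (rule additive_finsum[of M M "%x. hc M x i"])
  (use assms hc_add hc_closed abelian_group_axioms in auto)

lemma part_iff: "x : part M i \<longleftrightarrow> x : $M & (\<forall>j. j ~= i \<longrightarrow> hc M x j = \<zero>)"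
proof
 assume a: "x : $M & (\<forall>j. j ~= i \<longrightarrow> hc M x j = \<zero>)"
 then have "finsum M (hc M x) {i} = x" by (intro hc_sum_superset) auto
 then have "x = hc M x i" using a hc_closed[of x i] by (subst (asm) finsum_insert) auto
 then show "x : part M i" using a hc_part by metis
qed (use part_closed hc_homogeneous in auto)

lemma hc_eq_zero: "x : $M ==> (!!i. hc M x i = \<zero>) ==> x = \<zero>" using hc_sum[of x] by simp

lemma part_finsum: "(!!b. b : B ==> g b : part M i) ==> finsum M g B : part M i"
proof (induction B rule: infinite_finite_induct)
 case (insert x F)
 then show ?case by (subst finsum_insert) (auto intro: part_add part_closed)
qed (auto simp: finsum_infinite)

end

text \<open>Components move along an additive map that changes degrees by an injection
  \<open>\<sigma>\<close>. The identity serves graded maps, translations serve multiplication by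
  homogeneous elements.\<close>

lemma hc_shift:
 assumes M: "graded_group M" and N: "graded_group N" and h: "h : $M \<rightarrow> $N"
  and add: "!!x y. x : $M ==> y : $M ==> h (x \<oplus>\<^sub>M y) = h x \<oplus>\<^sub>N h y"
  and part: "!!i x. x : part M i ==> h x : part N (\<sigma> i)" and \<sigma>: "inj \<sigma>" and x: "x : $M"
 shows "hc N (h x) (\<sigma> i) = h (hc M x i)" and "j \<notin> range \<sigma> ==> hc N (h x) j = \<zero>\<^sub>N"
proof -
 interpret M: graded_group M by fact
 interpret N: graded_group N by fact
 define c where "c j = (if j : range \<sigma> then h (hc M x (inv_into UNIV \<sigma> j)) else \<zero>\<^sub>N)" for j
 have c\<sigma>: "c (\<sigma> i) = h (hc M x i)" for i using \<sigma> by (simp add: c_def)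
 have h0: "h \<zero>\<^sub>M = \<zero>\<^sub>N" by (rule additive_zero[OF M.abelian_group_axioms N.abelian_group_axioms h add])
 let ?I = "{i. hc M x i ~= \<zero>\<^sub>M}"
 have "h x = h (finsum M (hc M x) ?I)" using M.hc_sum[OF x] by simp
 also have "\<dots> = finsum N (%i. h (hc M x i)) ?I"
  by (rule additive_finsum[OF M.abelian_group_axioms N.abelian_group_axioms h add]) (use M.hc_closed[OF x] in auto)
 also have "\<dots> = finsum N (%i. c (\<sigma> i)) ?I" by (simp add: c\<sigma>)
 also have "\<dots> = finsum N c (\<sigma> ` ?I)"
  by (rule N.finsum_reindex[symmetric]) (use h M.hc_closed[OF x] \<sigma> in \<open>auto simp: c\<sigma> inj_on_def Pi_def\<close>)
 finally have e: "h x = finsum N c (\<sigma> ` ?I)" .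
 have "hc N (h x) = c"
 proof (rule N.hc_unique[OF _ _ _ e])
  show "finite (\<sigma> ` ?I)" using M.hc_finite[OF x] by simp
  show "c j : part N j" for j
  proof (cases "j : range \<sigma>")
   case True
   then obtain i where "j = \<sigma> i" by blast
   then show ?thesis using part[OF M.hc_part[OF x]] c\<sigma> by simp
  qed (simp add: c_def)
  show "c j = \<zero>\<^sub>N" if "j \<notin> \<sigma> ` ?I" for j
  proof (cases "j : range \<sigma>")
   case True
   then obtain i where "j = \<sigma> i" by blast
   then show ?thesis using that h0 c\<sigma> by auto
  qed (simp add: c_def)
 qed
 then show "hc N (h x) (\<sigma> i) = h (hc M x i)" "j \<notin> range \<sigma> ==> hc N (h x) j = \<zero>\<^sub>N"
  using c\<sigma> by (simp_all add: c_def)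
qed

lemma hc_hom:
 assumes "graded_group M" "graded_group N" "h : $M \<rightarrow> $N"
  "!!x y. x : $M ==> y : $M ==> h (x \<oplus>\<^sub>M y) = h x \<oplus>\<^sub>N h y"
  "!!i x. x : part M i ==> h x : part N i" "x : $M" shows "hc N (h x) i = h (hc M x i)"
 by (rule hc_shift(1)[of M N h "%i. i"]) (use assms in auto)

text \<open>A family of projections determines the grading: applied to any decomposition,
  \<open>\<pi> i\<close> returns its term of degree \<open>i\<close>, which gives
  uniqueness.\<close>

lemma internally_gradedI:
 assumes M: "abelian_group M" and sub: "!!i. subgroup (part M i) (add_monoid M)"
  and \<pi>: "!!i x. x : $M ==> \<pi> i x : part M i"
  and sum: "!!x. x : $M ==> \<exists>I. finite I & (\<forall>i. i \<notin> I \<longrightarrow> \<pi> i x = \<zero>\<^sub>M) & x = finsum M (%i. \<pi> i x) I"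
  and add: "!!i x y. x : $M ==> y : $M ==> \<pi> i (x \<oplus>\<^sub>M y) = \<pi> i x \<oplus>\<^sub>M \<pi> i y"
  and hom: "!!i j x. x : part M i ==> \<pi> j x = (if j = i then x else \<zero>\<^sub>M)"
 shows "internally_graded M" and "!!i x. x : $M ==> hc M x i = \<pi> i x"
proof -
 interpret M: abelian_group M by fact
 have pc: "x : $M" if "x : part M i" for x i using subgroup.subset[OF sub] that by auto
 have ex1: "\<exists>!c. (\<forall>i. c i : part M i) & finite {i. c i ~= \<zero>\<^sub>M} & x = finsum M c {i. c i ~= \<zero>\<^sub>M}"
  if x: "x : $M" for x
 proof (rule ex1I[of _ "%i. \<pi> i x"])
  obtain I where I: "finite I" "\<forall>i. i \<notin> I \<longrightarrow> \<pi> i x = \<zero>\<^sub>M" "x = finsum M (%i. \<pi> i x) I" using sum[OF x] by blast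
  have "finite {i. \<pi> i x ~= \<zero>\<^sub>M}" by (rule finite_subset[OF _ I(1)]) (use I(2) in blast)
  moreover have "finsum M (%i. \<pi> i x) {i. \<pi> i x ~= \<zero>\<^sub>M} = finsum M (%i. \<pi> i x) I"
   by (rule M.add.finprod_mono_neutral_cong_left) (use I pc[OF \<pi>[OF x]] in auto)
  ultimately show "(\<forall>i. \<pi> i x : part M i) & finite {i. \<pi> i x ~= \<zero>\<^sub>M} & x = finsum M (%i. \<pi> i x) {i. \<pi> i x ~= \<zero>\<^sub>M}"
   using \<pi>[OF x] I(3) by simp
 next
  fix c assume c: "(\<forall>i. c i : part M i) & finite {i. c i ~= \<zero>\<^sub>M} & x = finsum M c {i. c i ~= \<zero>\<^sub>M}"
  have cc: "c i : $M" for i using c pc by blast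
  show "c = (%i. \<pi> i x)"
  proof
   fix i
   have "\<pi> i x = finsum M (%j. \<pi> i (c j)) {j. c j ~= \<zero>\<^sub>M}"
   proof -
    have "\<pi> i : $M \<rightarrow> $M" using \<pi> pc by blast
    from additive_finsum[OF M M this add, of c "{j. c j ~= \<zero>\<^sub>M}"] show ?thesis using cc c by auto
   qed
   also have "\<dots> = finsum M (%j. if i = j then c j else \<zero>\<^sub>M) {j. c j ~= \<zero>\<^sub>M}"
    by (rule M.finsum_cong') (use hom c cc in auto)
   also have "\<dots> = c i"
   proof (cases "c i = \<zero>\<^sub>M")
    case True
    then have "finsum M (%j. if i = j then c j else \<zero>\<^sub>M) {j. c j ~= \<zero>\<^sub>M} = finsum M (%j. \<zero>\<^sub>M) {j. c j ~= \<zero>\<^sub>M}"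
     by (intro M.finsum_cong') auto
    then show ?thesis using True by simp
   next
    case False
    then show ?thesis using M.add.finprod_singleton[of i "{j. c j ~= \<zero>\<^sub>M}" c] c cc by auto
   qed
   finally show "c i = \<pi> i x" by simp
  qed
 qed
 then show g: "internally_graded M" unfolding internally_graded_def using sub by blast
 interpret G: graded_group M by unfold_locales (rule g)
 show "hc M x i = \<pi> i x" if x: "x : $M" for i x
 proof -
  obtain I where I: "finite I" "\<forall>i. i \<notin> I \<longrightarrow> \<pi> i x = \<zero>\<^sub>M" "x = finsum M (%i. \<pi> i x) I" using sum[OF x] by blast
  have "hc M x = (%i. \<pi> i x)" by (rule G.hc_unique[OF \<pi>[OF x] I(1) _ I(3)]) (use I(2) in blast)
  then show ?thesis by simp
 qed
qed

section \<open>Graded free modules\<close>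

locale graded_ring = S?: ring S for S :: "('k, 'a, nat) graded_module" (structure) +
 assumes S_graded: "internally_graded S" and one_part: "\<one> : part S 0"
  and mult_part: "x : part S i ==> y : part S j ==> x \<otimes> y : part S (i + j)"

sublocale graded_ring \<subseteq> Sg: graded_group S by unfold_locales (rule S_graded)

lemma graded_algebra_ring: "graded_algebra K S ==> graded_ring S"
 unfolding graded_algebra_def graded_ring_def graded_ring_axioms_def by simp

text \<open>The grading extended by zero to negative degrees, as needed for the coordinates of
  shifted free modules.\<close>

definition zpart :: "('k, 'a, nat) graded_module => int => 'a set" where
 "zpart S j = (if 0 \<le> j then part S (nat j) else {\<zero>\<^sub>S})"

lemma graded_free_simps [simp]:
 "$(graded_free S m) = $(free S {..<length m})"
 "\<zero>\<^bsub>graded_free S m\<^esub> = \<zero>\<^bsub>free S {..<length m}\<^esub>"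
 "x \<oplus>\<^bsub>graded_free S m\<^esub> y = x \<oplus>\<^bsub>free S {..<length m}\<^esub> y"
 "a \<odot>\<^bsub>graded_free S m\<^esub> x = a \<odot>\<^bsub>free S {..<length m}\<^esub> x"
 by (simp_all add: graded_free_def graded_direct_sum_def free_module_def direct_sum_def shift_def
   graded_regular_module_def regular_module_def module.defs)

lemma part_graded_free:
 "part (graded_free S m) n = {x : $(free S {..<length m}). \<forall>i<length m. x i : zpart S (n - m ! i)}"
 by (auto simp add: graded_free_def graded_direct_sum_def free_module_def direct_sum_def shift_def
   graded_regular_module_def regular_module_def module.defs zpart_def)

lemma rlin_graded_free [simp]:
 "rlin R (graded_free S m) N h \<longleftrightarrow> rlin R (free S {..<length m}) N h"
 "rlin R M (graded_free S m) g \<longleftrightarrow> rlin R M (free S {..<length m}) g" by (simp_all add: rlin_def)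

lemma rmodule_graded_free: "ring S ==> rmodule S (graded_free S m)"
proof -
 assume "ring S"
 then interpret F: rmodule S "free S {..<length m}" by (rule rmodule_free)
 have "abelian_group (graded_free S m)"
  by (rule abelian_groupI) (auto simp: F.M.a_ac intro: F.M.l_neg bexI[of _ "\<ominus>\<^bsub>free S {..<length m}\<^esub> _"])
 then interpret abelian_group "graded_free S m" .
 show ?thesis by unfold_locales (auto simp: F.smult_l_distr F.smult_r_distr F.smult_assoc)
qed

locale gmodule = rmodule R M for R :: "('k, 'a, nat) graded_module" (structure) and M :: "('a, 'm, int) graded_module" (structure) +
 assumes M_graded: "internally_graded M"
  and smult_part: "x : part M i ==> a : part R j ==> a \<odot>\<^sub>M x : part M (i + int j)"

sublocale gmodule \<subseteq> Mg: graded_group M by unfold_locales (rule M_graded)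

lemma gmodule_iff: "graded_right_module R M \<longleftrightarrow> gmodule R M"
 unfolding graded_right_module_def gmodule_def gmodule_axioms_def right_module_iff by blast

context graded_ring
begin

definition zhc :: "'a => int => 'a" where "zhc x j = (if 0 \<le> j then hc S x (nat j) else \<zero>)"

lemma zhc_zpart: "x : $S ==> zhc x j : zpart S j" by (simp add: zhc_def zpart_def Sg.hc_part)

lemma zpart_closed: "x : zpart S j ==> x : $S" by (auto simp: zpart_def Sg.part_closed split: if_splits)

lemma zpart_ops:
 "\<zero> : zpart S j" "x : zpart S j ==> y : zpart S j ==> x \<oplus> y : zpart S j" "x : zpart S j ==> \<ominus> x : zpart S j"
 by (auto simp: zpart_def Sg.part_add Sg.part_neg split: if_splits)

lemma zhc_add: "x : $S ==> y : $S ==> zhc (x \<oplus> y) j = zhc x j \<oplus> zhc y j"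
 by (simp add: zhc_def Sg.hc_add)

lemma zhc_homogeneous: "x : zpart S i ==> zhc x j = (if j = i then x else \<zero>)"
 by (auto simp: zhc_def zpart_def Sg.hc_homogeneous split: if_splits)

lemma zhc_finite: "x : $S ==> finite {j. zhc x j ~= \<zero>}"
proof -
 assume x: "x : $S"
 have "{j. zhc x j ~= \<zero>} \<subseteq> int ` {i. hc S x i ~= \<zero>}"
 proof
  fix j assume "j : {j. zhc x j ~= \<zero>}"
  then have "0 \<le> j" "hc S x (nat j) ~= \<zero>" by (auto simp: zhc_def split: if_splits)
  then show "j : int ` {i. hc S x i ~= \<zero>}" by (intro image_eqI[of _ _ "nat j"]) auto
 qed
 then show ?thesis using Sg.hc_finite[OF x] finite_surj by blast
qed

lemma zhc_sum:
 assumes x: "x : $S" and I: "finite I" "!!j. j \<notin> I ==> zhc x j = \<zero>" shows "finsum S (zhc x) I = x"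
proof -
 have cl: "zhc x j : $S" for j by (rule zpart_closed[OF zhc_zpart[OF x]])
 have "finsum S (zhc x) (int ` {i. hc S x i ~= \<zero>}) = finsum S (%i. zhc x (int i)) {i. hc S x i ~= \<zero>}"
  by (rule finsum_reindex) (use cl in auto)
 also have "\<dots> = x" using Sg.hc_sum[OF x] by (simp add: zhc_def)
 finally have e: "finsum S (zhc x) (int ` {i. hc S x i ~= \<zero>}) = x" .
 have sub: "int ` {i. hc S x i ~= \<zero>} \<subseteq> I"
 proof clarify
  fix i assume "hc S x i ~= \<zero>"
  then have "zhc x (int i) ~= \<zero>" by (simp add: zhc_def)
  then show "int i : I" using I(2) by blast
 qed
 have "finsum S (zhc x) (int ` {i. hc S x i ~= \<zero>}) = finsum S (zhc x) I"
 proof (rule add.finprod_mono_neutral_cong_left[OF I(1) sub])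
  fix j assume j: "j : I - int ` {i. hc S x i ~= \<zero>}"
  show "zhc x j = \<zero>"
  proof (rule ccontr)
   assume "zhc x j ~= \<zero>"
   then have "0 \<le> j" "hc S x (nat j) ~= \<zero>" by (auto simp: zhc_def split: if_splits)
   then have "j : int ` {i. hc S x i ~= \<zero>}" by (intro image_eqI[of _ _ "nat j"]) auto
   then show False using j by blast
  qed
 qed (use cl in auto)
 then show ?thesis using e by simp
qed

lemma zpart_mult: "x : zpart S i ==> a : part S j ==> x \<otimes> a : zpart S (i + int j)"
proof (cases "0 \<le> i")
 case True
 assume "x : zpart S i" "a : part S j"
 then show ?thesis using True mult_part[of x "nat i" a j] by (simp add: zpart_def nat_add_distrib)
next
 case False
 assume "x : zpart S i" "a : part S j"
 then show ?thesis using False zpart_ops(1) Sg.part_closed[of a j] by (auto simp: zpart_def)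
qed

lemma zpart_mult_left: "x : zpart S i ==> a : part S j ==> a \<otimes> x : zpart S (i + int j)"
proof (cases "0 \<le> i")
 case True
 assume "x : zpart S i" "a : part S j"
 then show ?thesis using True mult_part[of a j x "nat i"] by (simp add: zpart_def nat_add_distrib add.commute)
next
 case False
 assume "x : zpart S i" "a : part S j"
 then show ?thesis using False zpart_ops(1) Sg.part_closed[of a j] by (auto simp: zpart_def)
qed

lemma part_graded_free_closed: "x : part (graded_free S m) n ==> x : $(free S {..<length m})" by (simp add: part_graded_free)

lemma graded_free_internally:
 shows "internally_graded (graded_free S m)"
  and "!!x n. x : $(free S {..<length m}) ==>
   hc (graded_free S m) x n = (\<lambda>i\<in>{..<length m}. zhc (x i) (n - m ! i))"
proof -
 let ?F = "graded_free S m" and ?G = "free S {..<length m}"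
 interpret F: rmodule S ?F by (rule rmodule_graded_free[OF ring_axioms])
 interpret G: rmodule S ?G by (rule rmodule_free[OF ring_axioms])
 let ?\<pi> = "%n x. \<lambda>i\<in>{..<length m}. zhc (x i) (n - m ! i)"
 have co: "x i : $S" if "x : $?G" "i < length m" for x i using free_coord[OF that(1)] that(2) by simp
 have zc: "zhc (x i) j : $S" if "x : $?G" "i < length m" for x i j by (rule zpart_closed[OF zhc_zpart[OF co[OF that]]])
 have 1: "subgroup (part ?F i) (add_monoid ?F)" for i
 proof (rule F.M.add.subgroupI)
  show "part ?F i \<subseteq> $?F" using part_graded_free_closed by auto
  have "\<zero>\<^sub>?F : part ?F i" using zpart_ops(1) G.M.zero_closed by (simp add: part_graded_free free_simps(2))
  then show "part ?F i ~= {}" by blast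
  show "\<ominus>\<^sub>?F x : part ?F i" if "x : part ?F i" for x
  proof -
   have x: "x : $?G" by (rule part_graded_free_closed[OF that])
   have "\<ominus>\<^sub>?F x = (\<ominus> \<one>) \<odot>\<^sub>?F x" using F.smult_l_minus[of \<one> x] x by simp
   moreover have "((\<ominus> \<one>) \<odot>\<^sub>?F x) i = \<ominus> x i" if "i < length m" for i
    using co[OF x that] that by (simp add: free_simps(4) r_minus)
   moreover have "(\<ominus> \<one>) \<odot>\<^sub>?F x : $?G" using G.smult_closed[of "\<ominus> \<one>" x] x by simp
   ultimately show ?thesis using that zpart_ops(3) by (simp add: part_graded_free)
  qed
  show "x \<oplus>\<^sub>?F y : part ?F i" if "x : part ?F i" "y : part ?F i" for x y
   using that zpart_ops(2) G.M.a_closed[of x y] by (simp add: part_graded_free free_simps(3))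
 qed
 have \<pi>c: "?\<pi> n x : $?G" if "x : $?G" for x n using zc[OF that] by (auto simp: free_finite)
 have 2: "?\<pi> n x : part ?F n" if "x : $?F" for x n using that \<pi>c[of x n] zhc_zpart[OF co] by (simp add: part_graded_free)
 have 3: "\<exists>I. finite I & (\<forall>n. n \<notin> I \<longrightarrow> ?\<pi> n x = \<zero>\<^sub>?F) & x = finsum ?F (%n. ?\<pi> n x) I" if "x : $?F" for x
 proof -
  have x: "x : $?G" using that by simp
  let ?I = "\<Union>i\<in>{..<length m}. (%j. j + m ! i) ` {j. zhc (x i) j ~= \<zero>}"
  have fin: "finite ?I" using zhc_finite[OF co[OF x]] by simp
  have out: "zhc (x i) (n - m ! i) = \<zero>" if "n \<notin> ?I" "i < length m" for n i
  proof (rule ccontr)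
   assume "zhc (x i) (n - m ! i) ~= \<zero>"
   then have "n : (%j. j + m ! i) ` {j. zhc (x i) j ~= \<zero>}" by (intro image_eqI[of _ _ "n - m ! i"]) auto
   then show False using that by blast
  qed
  have "x = finsum ?F (%n. ?\<pi> n x) ?I"
  proof (rule free_eqI[OF x])
   show "finsum ?F (%n. ?\<pi> n x) ?I : $?G" using F.M.finsum_closed[of "%n. ?\<pi> n x" ?I] \<pi>c[OF x] by (simp add: Pi_def)
   fix i assume "i : {..<length m}"
   then have i: "i < length m" by simp
   have cl: "rlin S ?F (reg S) (%x. x i)" using free_coord_rlin[OF ring_axioms, of i "{..<length m}"] i by simp
   have "finsum ?F (%n. ?\<pi> n x) ?I i = finsum S (%n. ?\<pi> n x i) ?I"
    using rlin_finsum[OF F.rmodule_axioms rmodule_regular[OF ring_axioms] cl, of "%n. ?\<pi> n x" ?I] \<pi>c[OF x]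
    by (simp add: regular_finsum Pi_def)
   also have "\<dots> = finsum S (%n. zhc (x i) (n - m ! i)) ?I" using i by simp
   also have "\<dots> = finsum S (zhc (x i)) ((%n. n - m ! i) ` ?I)"
    by (rule finsum_reindex[symmetric]) (use zc[OF x i] in \<open>auto simp: inj_on_def\<close>)
   also have "\<dots> = x i"
   proof (rule zhc_sum[OF co[OF x i]])
    show "finite ((%n. n - m ! i) ` ?I)" using fin by simp
    fix j assume j: "j \<notin> (%n. n - m ! i) ` ?I"
    have "j + m ! i \<notin> ?I" using j by (metis (no_types, lifting) add_diff_cancel_right' image_eqI)
    then show "zhc (x i) j = \<zero>" using out[OF _ i, of "j + m ! i"] by simp
   qed
   finally show "x i = finsum ?F (%n. ?\<pi> n x) ?I i" by simp
  qed
  moreover have "?\<pi> n x = \<zero>\<^sub>?F" if "n \<notin> ?I" for n using out[OF that] by (auto simp: free_simps(2) intro!: restrict_ext)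
  ultimately show ?thesis using fin by blast
 qed
 have 4: "?\<pi> i (x \<oplus>\<^sub>?F y) = ?\<pi> i x \<oplus>\<^sub>?F ?\<pi> i y" if "x : $?F" "y : $?F" for i x y
  using that co by (auto simp: free_simps(3) zhc_add intro!: restrict_ext)
 have 5: "?\<pi> j x = (if j = i then x else \<zero>\<^sub>?F)" if "x : part ?F i" for i j x
 proof (rule free_eqI)
  have x: "x : $?G" by (rule part_graded_free_closed[OF that])
  show "?\<pi> j x : $?G" by (rule \<pi>c[OF x])
  show "(if j = i then x else \<zero>\<^sub>?F) : $?G" using x by simp
  fix k assume k: "k : {..<length m}"
  then have "x k : zpart S (i - m ! k)" using that by (simp add: part_graded_free)
  from zhc_homogeneous[OF this, of "j - m ! k"] show "?\<pi> j x k = (if j = i then x else \<zero>\<^sub>?F) k"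
   using k by (simp add: free_simps(2))
 qed
 show "internally_graded ?F" by (rule internally_gradedI(1)[OF F.M.abelian_group_axioms 1 2 3 4 5]; assumption)
 show "hc ?F x n = ?\<pi> n x" if "x : $?G" for x n using that by (intro internally_gradedI(2)[OF F.M.abelian_group_axioms 1 2 3 4 5]; simp)
qed

lemma gmodule_free: "gmodule S (graded_free S m)"
proof -
 interpret F: rmodule S "graded_free S m" by (rule rmodule_graded_free[OF ring_axioms])
 show ?thesis
 proof unfold_locales
  show "internally_graded (graded_free S m)" by (rule graded_free_internally(1))
  show "a \<odot>\<^bsub>graded_free S m\<^esub> x : part (graded_free S m) (i + int j)"
   if x: "x : part (graded_free S m) i" and a: "a : part S j" for x i a j
  proof -
   have "a \<odot>\<^bsub>graded_free S m\<^esub> x : $(graded_free S m)"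
    using F.smult_closed[of a x] x Sg.part_closed[OF a] by (simp add: part_graded_free)
   moreover have "x k \<otimes> a : zpart S (i + int j - m ! k)" if "k < length m" for k
    using zpart_mult[of "x k" "i - m ! k" a j] x a that by (simp add: part_graded_free algebra_simps)
   ultimately show ?thesis by (simp add: part_graded_free free_simps(4))
  qed
 qed
qed

end

lemma (in gmodule) lcomb_graded:
 assumes v: "!!i. i < length m ==> v i : part M (m ! i)" and x: "x : part (graded_free R m) n"
 shows "lcomb R M {..<length m} v x : part M n"
proof -
 have xc: "x : $(free R {..<length m})" using x by (simp add: part_graded_free)
 have xi: "x i : zpart R (n - m ! i)" if "i < length m" for i using x that by (simp add: part_graded_free)
 have "x i \<odot>\<^sub>M v i : part M n" if i: "i < length m" for i
 proof (cases "0 \<le> n - m ! i")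
  case True
  then have "x i : part R (nat (n - m ! i))" using xi[OF i] by (simp add: zpart_def)
  then have "x i \<odot>\<^sub>M v i : part M (m ! i + int (nat (n - m ! i)))" by (rule smult_part[OF v[OF i]])
  then show ?thesis using True by simp
 next
  case False
  then show ?thesis using xi[OF i] Mg.part_closed[OF v[OF i]] by (simp add: zpart_def)
 qed
 then show ?thesis unfolding lcomb_def by (intro Mg.part_finsum) auto
qed

section \<open>Minimal homogeneous generators\<close>

lemma (in rmodule) span_submodule:
 assumes "X \<subseteq> $M" shows "submodule (submodule_span R M X) R M"
proof (rule submoduleI)
 have "submodule ($M) R M" by (rule submoduleI) auto
 then show "submodule_span R M X \<subseteq> $M" using span_least[of "$M" R M X] assms by blast
 show "\<zero>\<^sub>M : submodule_span R M X" unfolding submodule_span_def by (auto intro: submoduleD(2))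
 show "x \<oplus>\<^sub>M y : submodule_span R M X" if "x : submodule_span R M X" "y : submodule_span R M X" for x y
  using that unfolding submodule_span_def by (auto intro: submoduleD(3))
 show "a \<odot>\<^sub>M x : submodule_span R M X" if "a : $R" "x : submodule_span R M X" for a x
  using that unfolding submodule_span_def by (auto intro: submoduleD(4))
qed

lemma (in rmodule) span_eq_lcomb:
 assumes "v : B \<rightarrow> $M" shows "submodule_span R M (v ` B) = lcomb R M B v ` $(free R B)"
proof
 show "submodule_span R M (v ` B) \<subseteq> lcomb R M B v ` $(free R B)" by (rule span_lcomb[OF rmodule_axioms assms])
 have s: "submodule (submodule_span R M (v ` B)) R M" by (rule span_submodule) (use assms in auto)
 have "v : B \<rightarrow> submodule_span R M (v ` B)" using subsetD[OF span_superset[of "v ` B" R M]] by (intro funcsetI) simp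
 then show "lcomb R M B v ` $(free R B) \<subseteq> submodule_span R M (v ` B)" using lcomb_mem[OF s] by (intro image_subsetI) simp
qed

text \<open>Each generator is replaced by its finitely many homogeneous components, which stay in
  the graded submodule.\<close>

lemma (in gmodule) homogeneous_generators:
 assumes N: "submodule N R M" and gr: "!!x i. x : N ==> hc M x i : N"
  and X: "finite X" "submodule_span R M X = N"
 obtains Y where "finite Y" "!!y. y : Y ==> \<exists>i. y : part M i" "submodule_span R M Y = N"
proof -
 have XN: "X \<subseteq> N" unfolding X(2)[symmetric] by (rule span_superset)
 have NM: "N \<subseteq> $M" by (rule submoduleD(1)[OF N])
 define Y where "Y = (\<Union>x\<in>X. hc M x ` {i. hc M x i ~= \<zero>\<^sub>M})"
 have Yf: "finite Y" unfolding Y_def using X(1) Mg.hc_finite XN NM by auto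
 have YN: "Y \<subseteq> N" unfolding Y_def using gr XN by auto
 have s: "submodule (submodule_span R M Y) R M" by (rule span_submodule) (use YN NM in blast)
 have "submodule_span R M Y = N"
 proof
  show "submodule_span R M Y \<subseteq> N" by (rule span_least[OF N YN])
  have "x : submodule_span R M Y" if x: "x : X" for x
  proof -
   have xM: "x : $M" using x XN NM by blast
   have "hc M x i : submodule_span R M Y" if "hc M x i ~= \<zero>\<^sub>M" for i
    using x that span_superset[of Y R M] unfolding Y_def by blast
   then have "finsum M (hc M x) {i. hc M x i ~= \<zero>\<^sub>M} : submodule_span R M Y" by (intro submodule_finsum[OF s]) auto
   then show ?thesis using Mg.hc_sum[OF xM] by simp
  qed
  then show "N \<subseteq> submodule_span R M Y" unfolding X(2)[symmetric] by (intro span_least[OF s]) blast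
 qed
 moreover have "\<exists>i. y : part M i" if "y : Y" for y using that Mg.hc_part XN NM unfolding Y_def by blast
 ultimately show ?thesis using that Yf by blast
qed

text \<open>Among all finite homogeneous generating sets one of least cardinality is taken; a
  redundant member could be dropped.\<close>

lemma (in gmodule) minimal_generators:
 assumes N: "submodule N R M" and gr: "!!x i. x : N ==> hc M x i : N"
  and X: "finite X" "submodule_span R M X = N"
 obtains m v where "!!i. i < length m ==> v i : part M (m ! i)"
  "lcomb R M {..<length m} v ` $(free R {..<length m}) = N"
  "!!i. i < length m ==> v i \<notin> submodule_span R M (v ` ({..<length m} - {i}))"
proof -
 define P where "P Y \<longleftrightarrow> finite Y & (\<forall>y\<in>Y. \<exists>i. y : part M i) & submodule_span R M Y = N" for Y
 have "\<exists>Y. P Y" using homogeneous_generators[OF N gr X] unfolding P_def by metis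
 then obtain Y where Y: "P Y" "!!Z. P Z ==> card Y \<le> card Z" using ex_has_least_nat[of P _ card] by metis
 have fY: "finite Y" and hY: "!!y. y : Y ==> \<exists>i. y : part M i" and sY: "submodule_span R M Y = N"
  using Y(1) by (auto simp: P_def)
 obtain v where v: "bij_betw v {..<card Y} Y" using ex_bij_betw_nat_finite[OF fY] by (metis atLeast0LessThan)
 have vY: "v i : Y" if "i < card Y" for i using v that by (auto simp: bij_betw_def)
 have "\<exists>n. v i : part M n" if "i < card Y" for i using hY[OF vY[OF that]] .
 then obtain \<mu> where \<mu>: "!!i. i < card Y ==> v i : part M (\<mu> i)" by metis
 have vM: "v : {..<card Y} \<rightarrow> $M" using \<mu> Mg.part_closed by auto
 have im: "v ` {..<card Y} = Y" using v by (simp add: bij_betw_def)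
 have "v i \<notin> submodule_span R M (v ` ({..<card Y} - {i}))" if i: "i < card Y" for i
 proof
  assume a: "v i : submodule_span R M (v ` ({..<card Y} - {i}))"
  let ?Z = "v ` ({..<card Y} - {i})"
  have ZY: "?Z \<subseteq> Y" using vY by auto
  have "submodule (submodule_span R M ?Z) R M" by (rule span_submodule) (use vM in auto)
  moreover have "Y \<subseteq> submodule_span R M ?Z"
  proof
   fix y assume "y : Y"
   then have "y : v ` {..<card Y}" using im by simp
   then obtain j where j: "j < card Y" "y = v j" by auto
   show "y : submodule_span R M ?Z"
   proof (cases "j = i")
    case False
    then have "y : ?Z" using j by blast
    then show ?thesis by (rule subsetD[OF span_superset])
   qed (use a j in simp)
  qed
  ultimately have 1: "submodule_span R M Y \<subseteq> submodule_span R M ?Z" by (rule span_least)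
  have "Y \<subseteq> N" unfolding sY[symmetric] by (rule span_superset)
  then have "?Z \<subseteq> N" using ZY by (rule subset_trans[rotated])
  then have 2: "submodule_span R M ?Z \<subseteq> N" by (rule span_least[OF N])
  have "P ?Z" unfolding P_def
  proof (intro conjI ballI)
   show "finite ?Z" by simp
   show "\<exists>n. y : part M n" if "y : ?Z" for y using hY subsetD[OF ZY that] by blast
   show "submodule_span R M ?Z = N" by (rule equalityI[OF 2]) (use 1 sY in simp)
  qed
  moreover have "card ?Z < card Y" using i card_image_le[of "{..<card Y} - {i}" v] by simp
  ultimately show False using Y(2)[of ?Z] by simp
 qed
 moreover have "lcomb R M {..<card Y} v ` $(free R {..<card Y}) = N" using span_eq_lcomb[OF vM] im sY by simp
 ultimately show ?thesis using that[of "map \<mu> [0..<card Y]" v] \<mu> by simp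
qed

lemma free_image_span:
 assumes F: "rmodule R M" and h: "rlin R (free R {..<l :: nat}) M h"
 shows "submodule_span R M ((%i. h (unitv R {..<l} i)) ` {..<l}) = h ` $(free R {..<l})"
proof -
 interpret rmodule R M by fact
 have "(%i. h (unitv R {..<l} i)) : {..<l} \<rightarrow> $M" using rlin_closed[OF h unitv_closed[OF R.ring_axioms]] by simp
 from span_eq_lcomb[OF this] show ?thesis using rlin_free_eq_lcomb[OF F h] by (simp cong: image_cong_simp)
qed

section \<open>Orders of elements and the graded Nakayama lemma\<close>

context graded_ring
begin

text \<open>The elements of order at least \<open>n\<close>. Orders, unlike degrees, can be followed
  under maps that do not respect the grading.\<close>

definition ord_ge :: "nat => 'a set" where
 "ord_ge n = {a : $S. \<forall>k<n. hc S a k = \<zero>}"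

lemma part_mult_hc:
 assumes a: "a : part S i" and b: "b : $S"
 shows "hc S (a \<otimes> b) (i + j) = a \<otimes> hc S b j" and "k < i ==> hc S (a \<otimes> b) k = \<zero>"
proof -
 have "inj (%j. i + j)" by (simp add: inj_def)
 note s = hc_shift[OF Sg.graded_group_axioms Sg.graded_group_axioms _ _ _ this b, of "%x. a \<otimes> x"]
 note ac = Sg.part_closed[OF a]
 show "hc S (a \<otimes> b) (i + j) = a \<otimes> hc S b j" by (rule s(1)) (simp_all add: ac r_distr mult_part[OF a])
 show "hc S (a \<otimes> b) k = \<zero>" if "k < i" by (rule s(2)) (use that in \<open>simp_all add: ac r_distr mult_part[OF a], auto\<close>)
qed

lemma part_mult_hc':
 assumes a: "a : part S i" and b: "b : $S"
 shows "hc S (b \<otimes> a) (i + j) = hc S b j \<otimes> a" and "k < i ==> hc S (b \<otimes> a) k = \<zero>"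
proof -
 have "inj (%j. i + j)" by (simp add: inj_def)
 note s = hc_shift[OF Sg.graded_group_axioms Sg.graded_group_axioms _ _ _ this b, of "%x. x \<otimes> a"]
 note ac = Sg.part_closed[OF a]
 have p: "x \<otimes> a : part S (i + l)" if "x : part S l" for x l using mult_part[OF that a] by (simp add: add.commute)
 show "hc S (b \<otimes> a) (i + j) = hc S b j \<otimes> a" by (rule s(1)) (simp_all add: ac l_distr p)
 show "hc S (b \<otimes> a) k = \<zero>" if "k < i" by (rule s(2)) (use that in \<open>simp_all add: ac l_distr p, auto\<close>)
qed

lemma ord_ge_mult:
 assumes a: "a : ord_ge m" and b: "b : ord_ge n" shows "a \<otimes> b : ord_ge (m + n)"
proof -
 have c: "a : $S" "b : $S" using a b by (auto simp: ord_ge_def)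
 let ?I = "{i. hc S a i ~= \<zero>}"
 have "a \<otimes> b = finsum S (hc S a) ?I \<otimes> b" using Sg.hc_sum[OF c(1)] by simp
 also have "\<dots> = finsum S (%i. hc S a i \<otimes> b) ?I" by (rule additive_finsum[OF abelian_group_axioms abelian_group_axioms])
   (use c Sg.hc_closed in \<open>auto simp: l_distr\<close>)
 finally have e: "a \<otimes> b = finsum S (%i. hc S a i \<otimes> b) ?I" .
 have "hc S (a \<otimes> b) k = \<zero>" if k: "k < m + n" for k
 proof -
  have "hc S (hc S a i \<otimes> b) k = \<zero>" if i: "i : ?I" for i
  proof (cases "k < i")
   case True
   then show ?thesis using part_mult_hc(2)[OF Sg.hc_part[OF c(1)] c(2)] by simp
  next
   case False
   have "m \<le> i" using i a by (auto simp: ord_ge_def not_less[symmetric])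
   then have "hc S b (k - i) = \<zero>" using b k False by (auto simp: ord_ge_def)
   then show ?thesis using part_mult_hc(1)[OF Sg.hc_part[OF c(1)] c(2), of i "k - i"] False Sg.hc_closed[OF c(1)] by simp
  qed
  then have "finsum S (%i. hc S (hc S a i \<otimes> b) k) ?I = finsum S (%i. \<zero>) ?I" by (intro finsum_cong') auto
  then show ?thesis unfolding e using Sg.hc_finsum[of "%i. hc S a i \<otimes> b" ?I k] c Sg.hc_closed by simp
 qed
 then show ?thesis using c by (simp add: ord_ge_def)
qed

lemma ord_ge_finsum: "(!!i. i : B ==> g i : ord_ge n) ==> finsum S g B : ord_ge n"
proof -
 assume g: "!!i. i : B ==> g i : ord_ge n"
 then have gc: "g : B \<rightarrow> $S" by (auto simp: ord_ge_def)
 have "hc S (finsum S g B) k = \<zero>" if "k < n" for k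
  unfolding Sg.hc_finsum[OF gc] using g that by (intro add.finprod_one_eqI) (auto simp: ord_ge_def)
 then show ?thesis using finsum_closed[OF gc] by (simp add: ord_ge_def)
qed

text \<open>If the coefficient of \<open>v i\<close> in a relation had a nonzero component of degree
  zero, the component of the whole relation in degree \<open>m ! i\<close> would have a unit as
  coefficient of \<open>v i\<close>, and \<open>v i\<close> would be a combination of the other
  generators.\<close>

lemma minimal_kernel_ord:
 assumes F: "gmodule S F" and v: "!!i. i < length m ==> v i : part F (m ! i)"
  and min: "!!i. i < length m ==> v i \<notin> submodule_span S F (v ` ({..<length m} - {i}))"
  and units: "!!c. c : part S 0 ==> c ~= \<zero> ==> \<exists>b\<in>$S. c \<otimes> b = \<one>"
  and y: "y : $(free S {..<length m})" "lcomb S F {..<length m} v y = \<zero>\<^sub>F" and i: "i < length m" shows "y i : ord_ge 1"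
proof (rule ccontr)
 interpret F: gmodule S F by fact
 interpret Fm: gmodule S "graded_free S m" by (rule gmodule_free)
 let ?l = "length m" and ?g = "lcomb S F {..<length m} v"
 have vF: "v : {..<?l} \<rightarrow> $F" using v F.Mg.part_closed by auto
 have g: "rlin S (free S {..<?l}) F ?g" by (rule F.lcomb_rlin[OF vF])
 have yi: "y i : $S" using free_coord[OF y(1)] i by simp
 define c where "c = hc S (y i) 0"
 assume "y i \<notin> ord_ge 1"
 then have c0: "c ~= \<zero>" using yi by (simp add: ord_ge_def c_def)
 have c: "c : part S 0" unfolding c_def by (rule Sg.hc_part[OF yi])
 obtain b where b: "b : $S" "c \<otimes> b = \<one>" using units[OF c c0] by blast
 define z where "z = hc (graded_free S m) y (m ! i)"
 have z: "z : $(free S {..<?l})" using Fm.Mg.hc_closed[of y "m ! i"] y(1) by (simp add: z_def)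
 have zi: "z i = c" using graded_free_internally(2)[OF y(1)] i by (simp add: z_def c_def zhc_def)
 have "?g z = hc F (?g y) (m ! i)" unfolding z_def by (rule hc_hom[of "graded_free S m" F ?g, symmetric])
   (use y(1) Fm.Mg.graded_group_axioms F.Mg.graded_group_axioms F.lcomb_graded[OF v] rlin_closed[OF g] rlin_add[OF g] in auto)
 then have gz: "?g z = \<zero>\<^sub>F" using y(2) by simp
 have zc: "z j : $S" if "j < ?l" for j using free_coord[OF z] that by simp
 let ?r = "finsum F (%j. z j \<odot>\<^sub>F v j) ({..<?l} - {i})"
 have "?g z = finsum F (%j. z j \<odot>\<^sub>F v j) {..<?l}" by (rule F.lcomb_superset[OF z vF]) auto
 also have "\<dots> = c \<odot>\<^sub>F v i \<oplus>\<^sub>F ?r"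
 proof -
  have "finsum F (%j. z j \<odot>\<^sub>F v j) (insert i ({..<?l} - {i})) = c \<odot>\<^sub>F v i \<oplus>\<^sub>F ?r"
   using vF i zc Sg.part_closed[OF c] by (subst F.M.finsum_insert) (auto simp: zi Pi_def)
  moreover have "insert i ({..<?l} - {i}) = {..<?l}" using i by auto
  ultimately show ?thesis by simp
 qed
 finally have e: "c \<odot>\<^sub>F v i \<oplus>\<^sub>F ?r = \<zero>\<^sub>F" using gz by simp
 let ?W = "submodule_span S F (v ` ({..<?l} - {i}))"
 have W: "submodule ?W S F" by (rule F.span_submodule) (use vF in auto)
 have "z j \<odot>\<^sub>F v j : ?W" if "j : {..<?l} - {i}" for j
  using submoduleD(4)[OF W] zc that span_superset[of "v ` ({..<?l} - {i})" S F] by blast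
 then have r: "?r : ?W" by (intro F.submodule_finsum[OF W]) auto
 have rF: "?r : $F" using r submoduleD(1)[OF W] by blast
 have viF: "v i : $F" using vF i by auto
 have cS: "c : $S" by (rule Sg.part_closed[OF c])
 have "c \<odot>\<^sub>F v i = \<zero>\<^sub>F \<ominus>\<^sub>F ?r"
  using F.M.diff_eq_iff[of "\<zero>\<^sub>F" ?r "c \<odot>\<^sub>F v i"] e viF cS rF by simp
 then have "c \<odot>\<^sub>F v i : ?W" using F.submodule_diff[OF W submoduleD(2)[OF W] r] by simp
 then have "b \<odot>\<^sub>F (c \<odot>\<^sub>F v i) : ?W" by (rule submoduleD(4)[OF W b(1)])
 then have "v i : ?W" using b cS viF by (simp flip: F.smult_assoc)
 then show False using min[OF i] by simp
qed

text \<open>Graded Nakayama: \<open>x = x - e x\<close> raises the order of every element of the kernel.\<close>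

lemma minimal_projective_injective:
 assumes F: "gmodule S F" and v: "!!i. i < length m ==> v i : part F (m ! i)"
  and min: "!!i. i < length m ==> v i \<notin> submodule_span S F (v ` ({..<length m} - {i}))"
  and units: "!!c. c : part S 0 ==> c ~= \<zero> ==> \<exists>b\<in>$S. c \<otimes> b = \<one>"
  and e: "rlin S (free S {..<length m}) (free S {..<length m}) e"
  and ge: "!!x. x : $(free S {..<length m}) ==> lcomb S F {..<length m} v (e x) = lcomb S F {..<length m} v x"
  and eker: "!!x. x : $(free S {..<length m}) ==> lcomb S F {..<length m} v x = \<zero>\<^sub>F ==>
   e x = \<zero>\<^bsub>free S {..<length m}\<^esub>"
  and x: "x : $(free S {..<length m})" "lcomb S F {..<length m} v x = \<zero>\<^sub>F" shows "x = \<zero>\<^bsub>free S {..<length m}\<^esub>"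
proof -
 interpret F: gmodule S F by fact
 let ?l = "length m" and ?g = "lcomb S F {..<length m} v" and ?G = "free S {..<length m}"
 interpret G: rmodule S ?G by (rule rmodule_free[OF ring_axioms])
 interpret Q: rmodule S "reg S" by (rule rmodule_regular[OF ring_axioms])
 have vF: "v : {..<?l} \<rightarrow> $F" using v F.Mg.part_closed by auto
 have g: "rlin S ?G F ?g" by (rule F.lcomb_rlin[OF vF])
 define d where "d y = y \<ominus>\<^sub>?G e y" for y
 have d: "rlin S ?G ?G d" unfolding d_def by (rule rlin_sub[OF G.rmodule_axioms rlin_id e])
 have dx: "d x = x" using eker[OF x] x(1) by (simp add: d_def)
 have u: "unitv S {..<?l} j : $?G" for j by (rule unitv_closed[OF ring_axioms])
 \<comment> \<open>The columns of \<open>d = id - e\<close> are relations between the generators, so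
   all its matrix entries have positive order. Since \<open>d x = x\<close>, the order of
   \<open>x\<close> exceeds every bound.\<close>
 have w: "d (unitv S {..<?l} j) i : ord_ge 1" if i: "i < ?l" for i j
 proof (rule minimal_kernel_ord[OF F v min units _ _ i])
  show "d (unitv S {..<?l} j) : $?G" by (rule rlin_closed[OF d u])
  show "?g (d (unitv S {..<?l} j)) = \<zero>\<^sub>F" unfolding d_def rlin_diff[OF G.rmodule_axioms F.rmodule_axioms g u rlin_closed[OF e u]] ge[OF u]
   by (rule F.M.diff_self[OF rlin_closed[OF g u]])
 qed
 have "\<forall>i<?l. x i : ord_ge n" for n
 proof (induction n)
  case 0 then show ?case using free_coord[OF x(1)] by (simp add: ord_ge_def)
 next
  case (Suc n)
  show ?case
  proof (intro allI impI)
   fix i assume i: "i < ?l"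
   have l: "rlin S ?G (reg S) (%x. d x i)" using rlin_comp[OF d free_coord_rlin[OF ring_axioms, of i]] i by simp
   have "x i = d x i" by (simp add: dx)
   also have "\<dots> = finsum S (%j. d (unitv S {..<?l} j) i \<otimes> x j) {j : {..<?l}. x j ~= \<zero>}"
    using rlin_free_eq_lcomb[OF Q.rmodule_axioms l x(1)] by (simp add: lcomb_def regular_finsum)
   also have "\<dots> : ord_ge (Suc n)" using ord_ge_mult[OF w[OF i]] Suc by (intro ord_ge_finsum) fastforce
   finally show "x i : ord_ge (Suc n)" .
  qed
 qed
 then have "x i : ord_ge (Suc k)" if "i < ?l" for i k using that by blast
 then have "hc S (x i) k = \<zero>" if "i < ?l" for i k using that unfolding ord_ge_def by blast
 then have "x i = \<zero>" if "i < ?l" for i using Sg.hc_eq_zero free_coord[OF x(1)] that by simp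
 then show ?thesis by (intro free_eqI[OF x(1) G.M.zero_closed]) (simp add: free_simps(2))
qed

lemma unitv_part: "i < length m ==> unitv S {..<length m} i : part (graded_free S m) (m ! i)"
 using one_part unitv_closed[OF ring_axioms] by (auto simp: part_graded_free unitv_def zpart_def)

text \<open>A preimage of a homogeneous element can be taken homogeneous, by passing to the
  component of the right degree.\<close>

lemma graded_free_lift:
 assumes X: "gmodule S X" and Y: "gmodule S Y"
  and g: "rlin S X Y g" "!!i x. x : part X i ==> g x : part Y i"
  and h: "rlin S (free S {..<length m}) Y h" "!!i x. x : part (graded_free S m) i ==> h x : part Y i"
  and im: "!!x. x : $(free S {..<length m}) ==> h x : g ` $X"
 obtains k where "rlin S (free S {..<length m}) X k" "!!i x. x : part (graded_free S m) i ==> k x : part X i"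
  "!!x. x : $(free S {..<length m}) ==> g (k x) = h x"
proof -
 interpret X: gmodule S X by fact
 interpret Y: gmodule S Y by fact
 let ?l = "length m"
 have u: "unitv S {..<?l} i : $(free S {..<?l})" for i by (rule unitv_closed[OF ring_axioms])
 have "\<exists>x. x : part X (m ! i) & g x = h (unitv S {..<?l} i)" if i: "i < ?l" for i
 proof -
  obtain x where x: "x : $X" "h (unitv S {..<?l} i) = g x" using im[OF u] by blast
  have p: "h (unitv S {..<?l} i) : part Y (m ! i)" by (rule h(2)[OF unitv_part[OF i]])
  have "g (hc X x (m ! i)) = hc Y (g x) (m ! i)" by (rule hc_hom[of X Y g, symmetric])
    (use X.Mg.graded_group_axioms Y.Mg.graded_group_axioms g(2) rlin_closed[OF g(1)] rlin_add[OF g(1)] x(1) in auto)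
  then have "g (hc X x (m ! i)) = h (unitv S {..<?l} i)" using Y.Mg.hc_homogeneous[OF p, of "m ! i"] x(2) by simp
  then show ?thesis using X.Mg.hc_part[OF x(1)] by blast
 qed
 then obtain v where v: "!!i. i < ?l ==> v i : part X (m ! i)" "!!i. i < ?l ==> g (v i) = h (unitv S {..<?l} i)"
  by metis
 have vX: "v : {..<?l} \<rightarrow> $X" using v(1) X.Mg.part_closed by auto
 have k: "rlin S (free S {..<?l}) X (lcomb S X {..<?l} v)" by (rule X.lcomb_rlin[OF vX])
 show ?thesis
 proof (rule that[OF k X.lcomb_graded[OF v(1)]])
  show "g (lcomb S X {..<?l} v x) = h x" if "x : $(free S {..<?l})" for x
   by (rule rlin_free_eqI[OF Y.rmodule_axioms rlin_comp[OF k g(1)] h(1) _ that])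
    (simp add: X.lcomb_unitv[OF vX] v(2))
 qed
qed

end

text \<open>Dependent choice along the integers in both directions, starting from a value at 0. It
  continues morphisms and factorizations to all indices.\<close>

lemma int_chain:
 fixes P :: "int => 'x => bool"
 assumes a: "P 0 a" and up: "!!i x. P i x ==> \<exists>y. P (i + 1) y & C i x y"
  and down: "!!i y. P (i + 1) y ==> \<exists>x. P i x & C i x y"
 obtains h where "h 0 = a" "!!i. P i (h i)" "!!i. C i (h i) (h (i + 1))"
proof -
 have "\<exists>u. \<forall>n. (P (int n) (u n) & (n = 0 \<longrightarrow> u n = a)) & C (int n) (u n) (u (Suc n))"
 proof (rule dependent_nat_choice)
  show "\<exists>x. P (int 0) x & (0 = 0 \<longrightarrow> x = a)" using a by auto
  show "\<exists>y. (P (int (Suc n)) y & (Suc n = 0 \<longrightarrow> y = a)) & C (int n) x y" if "P (int n) x & (n = 0 \<longrightarrow> x = a)" for x n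
   using up[of "int n" x] that by (auto simp: add.commute)
 qed
 then obtain u where u: "!!n. P (int n) (u n)" "u 0 = a" "!!n. C (int n) (u n) (u (Suc n))" by metis
 have "\<exists>w. \<forall>n. (P (- int n) (w n) & (n = 0 \<longrightarrow> w n = a)) & C (- int (Suc n)) (w (Suc n)) (w n)"
 proof (rule dependent_nat_choice)
  show "\<exists>x. P (- int 0) x & (0 = 0 \<longrightarrow> x = a)" using a by auto
  show "\<exists>y. (P (- int (Suc n)) y & (Suc n = 0 \<longrightarrow> y = a)) & C (- int (Suc n)) y x" if "P (- int n) x & (n = 0 \<longrightarrow> x = a)" for x n
   using down[of "- int (Suc n)" x] that by auto
 qed
 then obtain w where w: "!!n. P (- int n) (w n)" "w 0 = a" "!!n. C (- int (Suc n)) (w (Suc n)) (w n)" by metis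
 define h where "h i = (if 0 \<le> i then u (nat i) else w (nat (- i)))" for i
 show ?thesis
 proof (rule that[of h])
  show "h 0 = a" by (simp add: h_def u)
  show "P i (h i)" for i using u(1)[of "nat i"] w(1)[of "nat (- i)"] by (auto simp: h_def)
  show "C i (h i) (h (i + 1))" for i
  proof (cases "0 \<le> i")
   case True
   then show ?thesis using u(3)[of "nat i"] by (simp add: h_def nat_add_distrib)
  next
   case False
   then have e: "nat (- i) = Suc (nat (- (i + 1)))" by linarith
   have "h (i + 1) = w (nat (- (i + 1)))" using False u(2) w(2) by (cases "i = -1") (auto simp: h_def)
   moreover have "h i = w (Suc (nat (- (i + 1))))" using False arg_cong[OF e, of w] by (simp add: h_def)
   moreover have "- int (Suc (nat (- (i + 1)))) = i" using False by simp
   ultimately show ?thesis using w(3)[of "nat (- (i + 1))"] by simp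
  qed
 qed
qed

section \<open>Equivalences of factor categories\<close>

locale precat =
 fixes C :: "('o, 'h) precategory"
 assumes pre: "preadditive_category C"
begin

lemma hom_group: "X : Obj C ==> Y : Obj C ==> comm_group (Hom C X Y)"
 and id_closed: "X : Obj C ==> Ident C X : $(Hom C X X)"
 and comp_closed: "X : Obj C ==> Y : Obj C ==> Z : Obj C ==> g : $(Hom C Y Z) ==> h : $(Hom C X Y) ==>
  Comp C X Y Z g h : $(Hom C X Z)"
 and id_right: "X : Obj C ==> Y : Obj C ==> h : $(Hom C X Y) ==> Comp C X X Y h (Ident C X) = h"
 and id_left: "X : Obj C ==> Y : Obj C ==> h : $(Hom C X Y) ==> Comp C X Y Y (Ident C Y) h = h"
 and assoc: "W : Obj C ==> X : Obj C ==> Y : Obj C ==> Z : Obj C ==> k : $(Hom C Y Z) ==>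
  g : $(Hom C X Y) ==> h : $(Hom C W X) ==>
  Comp C W Y Z k (Comp C W X Y g h) = Comp C W X Z (Comp C X Y Z k g) h"
 and comp_mult_left: "X : Obj C ==> Y : Obj C ==> Z : Obj C ==> g : $(Hom C Y Z) ==> g' : $(Hom C Y Z) ==>
  h : $(Hom C X Y) ==> Comp C X Y Z (g \<otimes>\<^bsub>Hom C Y Z\<^esub> g') h = Comp C X Y Z g h \<otimes>\<^bsub>Hom C X Z\<^esub> Comp C X Y Z g' h"
 and comp_mult_right: "X : Obj C ==> Y : Obj C ==> Z : Obj C ==> g : $(Hom C Y Z) ==> h : $(Hom C X Y) ==>
  h' : $(Hom C X Y) ==> Comp C X Y Z g (h \<otimes>\<^bsub>Hom C X Y\<^esub> h') = Comp C X Y Z g h \<otimes>\<^bsub>Hom C X Z\<^esub> Comp C X Y Z g h'"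
 using pre unfolding preadditive_category_def by simp_all

lemma hom_is_group: "X : Obj C ==> Y : Obj C ==> group (Hom C X Y)" using hom_group by (auto simp: comm_group_def)

lemma comp_one_left:
 assumes "X : Obj C" "Y : Obj C" "Z : Obj C" "h : $(Hom C X Y)"
 shows "Comp C X Y Z \<one>\<^bsub>Hom C Y Z\<^esub> h = \<one>\<^bsub>Hom C X Z\<^esub>"
proof -
 interpret YZ: comm_group "Hom C Y Z" by (rule hom_group) fact+
 interpret XZ: comm_group "Hom C X Z" by (rule hom_group) fact+
 have c: "Comp C X Y Z \<one>\<^bsub>Hom C Y Z\<^esub> h : $(Hom C X Z)" using assms by (intro comp_closed) auto
 have "Comp C X Y Z \<one>\<^bsub>Hom C Y Z\<^esub> h \<otimes>\<^bsub>Hom C X Z\<^esub> Comp C X Y Z \<one>\<^bsub>Hom C Y Z\<^esub> h = Comp C X Y Z \<one>\<^bsub>Hom C Y Z\<^esub> h"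
  using comp_mult_left[OF assms(1-3) YZ.one_closed YZ.one_closed assms(4)] by simp
 then show ?thesis using c XZ.r_cancel_one by blast
qed

lemma comp_one_right:
 assumes "X : Obj C" "Y : Obj C" "Z : Obj C" "g : $(Hom C Y Z)"
 shows "Comp C X Y Z g \<one>\<^bsub>Hom C X Y\<^esub> = \<one>\<^bsub>Hom C X Z\<^esub>"
proof -
 interpret XY: comm_group "Hom C X Y" by (rule hom_group) fact+
 interpret XZ: comm_group "Hom C X Z" by (rule hom_group) fact+
 have c: "Comp C X Y Z g \<one>\<^bsub>Hom C X Y\<^esub> : $(Hom C X Z)" using assms by (intro comp_closed) auto
 have "Comp C X Y Z g \<one>\<^bsub>Hom C X Y\<^esub> \<otimes>\<^bsub>Hom C X Z\<^esub> Comp C X Y Z g \<one>\<^bsub>Hom C X Y\<^esub> = Comp C X Y Z g \<one>\<^bsub>Hom C X Y\<^esub>"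
  using comp_mult_right[OF assms(1-4) XY.one_closed XY.one_closed] by simp
 then show ?thesis using c XZ.r_cancel_one by blast
qed

end

text \<open>The inverse on objects chooses \<open>G Z\<close> with mutually inverse
  \<open>\<eta> Z\<close> and \<open>\<zeta> Z\<close>. A morphism is conjugated by these to
  \<open>K\<close> and pulled back along the bijection of hom-sets. Equations in \<open>C\<close>
  are checked after applying \<open>F'\<close>.\<close>

lemma fully_faithful_equivalence:
 assumes C: "preadditive_category C" and D: "preadditive_category D" and F: "is_functor C D F F'"
  and inj: "!!X Y. X : Obj C ==> Y : Obj C ==> inj_on (F' X Y) ($(Hom C X Y))"
  and full: "!!X Y k. X : Obj C ==> Y : Obj C ==> k : $(Hom D (F X) (F Y)) ==>
   \<exists>h\<in>$(Hom C X Y). F' X Y h = k"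
  and ess: "!!Z. Z : Obj D ==> \<exists>X\<in>Obj C. isomorphisms D (F X) Z ~= {}" shows "equivalent_categories C D"
proof -
 interpret C: precat C by unfold_locales fact
 interpret D: precat D by unfold_locales fact
 have FO: "F X : Obj D" if "X : Obj C" for X using F that by (simp add: is_functor_def)
 have FH: "F' X Y h : $(Hom D (F X) (F Y))" if "X : Obj C" "Y : Obj C" "h : $(Hom C X Y)" for X Y h
  using F that by (simp add: is_functor_def)
 have FI: "F' X X (Ident C X) = Ident D (F X)" if "X : Obj C" for X using F that by (simp add: is_functor_def)
 have FC: "F' X Z (Comp C X Y Z g h) = Comp D (F X) (F Y) (F Z) (F' Y Z g) (F' X Y h)"
  if "X : Obj C" "Y : Obj C" "Z : Obj C" "g : $(Hom C Y Z)" "h : $(Hom C X Y)" for X Y Z g h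
  using F that by (simp add: is_functor_def)
 have "\<forall>Z. \<exists>X. \<exists>e. \<exists>z. Z : Obj D \<longrightarrow> X : Obj C & e : $(Hom D (F X) Z) & z : $(Hom D Z (F X)) &
   Comp D (F X) Z (F X) z e = Ident D (F X) & Comp D Z (F X) Z e z = Ident D Z"
 proof
  fix Z
  show "\<exists>X. \<exists>e. \<exists>z. Z : Obj D \<longrightarrow> X : Obj C & e : $(Hom D (F X) Z) & z : $(Hom D Z (F X)) &
   Comp D (F X) Z (F X) z e = Ident D (F X) & Comp D Z (F X) Z e z = Ident D Z" using ess[of Z] unfolding isomorphisms_def by blast
 qed
 from choice[OF this] obtain G where "\<forall>Z. \<exists>e. \<exists>z. Z : Obj D \<longrightarrow> G Z : Obj C & e : $(Hom D (F (G Z)) Z) &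
   z : $(Hom D Z (F (G Z))) &
   Comp D (F (G Z)) Z (F (G Z)) z e = Ident D (F (G Z)) & Comp D Z (F (G Z)) Z e z = Ident D Z" ..
 from choice[OF this] obtain \<eta> where "\<forall>Z. \<exists>z. Z : Obj D \<longrightarrow> G Z : Obj C & \<eta> Z : $(Hom D (F (G Z)) Z) &
   z : $(Hom D Z (F (G Z))) &
   Comp D (F (G Z)) Z (F (G Z)) z (\<eta> Z) = Ident D (F (G Z)) & Comp D Z (F (G Z)) Z (\<eta> Z) z = Ident D Z" ..
 from choice[OF this] obtain \<zeta> where "\<forall>Z. Z : Obj D \<longrightarrow> G Z : Obj C & \<eta> Z : $(Hom D (F (G Z)) Z) &
   \<zeta> Z : $(Hom D Z (F (G Z))) &
   Comp D (F (G Z)) Z (F (G Z)) (\<zeta> Z) (\<eta> Z) = Ident D (F (G Z)) & Comp D Z (F (G Z)) Z (\<eta> Z) (\<zeta> Z) = Ident D Z" ..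
 then have GO: "G Z : Obj C" and \<eta>: "\<eta> Z : $(Hom D (F (G Z)) Z)" and \<zeta>: "\<zeta> Z : $(Hom D Z (F (G Z)))"
  and \<zeta>\<eta>: "Comp D (F (G Z)) Z (F (G Z)) (\<zeta> Z) (\<eta> Z) = Ident D (F (G Z))"
  and \<eta>\<zeta>: "Comp D Z (F (G Z)) Z (\<eta> Z) (\<zeta> Z) = Ident D Z" if "Z : Obj D" for Z using that by blast+
 define I where "I X Y k = inv_into ($(Hom C X Y)) (F' X Y) k" for X Y k
 have I: "I X Y k : $(Hom C X Y)" "F' X Y (I X Y k) = k"
  if "X : Obj C" "Y : Obj C" "k : $(Hom D (F X) (F Y))" for X Y k
 proof -
  have "k : F' X Y ` $(Hom C X Y)" using full[OF that] by blast
  then show "I X Y k : $(Hom C X Y)" "F' X Y (I X Y k) = k" unfolding I_def by (rule inv_into_into, rule f_inv_into_f)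
 qed
 have eqI: "g = h" if "X : Obj C" "Y : Obj C" "g : $(Hom C X Y)" "h : $(Hom C X Y)" "F' X Y g = F' X Y h" for X Y g h
  using inj_onD[OF inj[OF that(1,2)] that(5,3,4)] .
 define K where "K Z W k = Comp D (F (G Z)) Z (F (G W)) (Comp D Z W (F (G W)) (\<zeta> W) k) (\<eta> Z)" for Z W k
 have K: "K Z W k : $(Hom D (F (G Z)) (F (G W)))" if "Z : Obj D" "W : Obj D" "k : $(Hom D Z W)" for Z W k
  unfolding K_def using that by (intro D.comp_closed FO GO \<eta> \<zeta>)
 have \<eta>K: "Comp D (F (G Z)) (F (G W)) W (\<eta> W) (K Z W k) = Comp D (F (G Z)) Z W k (\<eta> Z)"
  if Z: "Z : Obj D" and W: "W : Obj D" and k: "k : $(Hom D Z W)" for Z W k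
 proof -
  note o = FO[OF GO[OF Z]] FO[OF GO[OF W]] Z W
  have "Comp D (F (G Z)) (F (G W)) W (\<eta> W) (K Z W k) =
    Comp D (F (G Z)) Z W (Comp D Z (F (G W)) W (\<eta> W) (Comp D Z W (F (G W)) (\<zeta> W) k)) (\<eta> Z)"
   unfolding K_def by (rule D.assoc[OF o(1,3,2,4) \<eta>[OF W] D.comp_closed[OF Z W o(2) \<zeta>[OF W] k] \<eta>[OF Z]])
  also have "Comp D Z (F (G W)) W (\<eta> W) (Comp D Z W (F (G W)) (\<zeta> W) k) = Comp D Z W W (Comp D W (F (G W)) W (\<eta> W) (\<zeta> W)) k"
   by (rule D.assoc[OF Z W o(2) W \<eta>[OF W] \<zeta>[OF W] k])
  also have "\<dots> = k" unfolding \<eta>\<zeta>[OF W] by (rule D.id_left[OF Z W k])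
  finally show ?thesis .
 qed
 have \<zeta>l: "h = Comp D X W (F (G W)) (\<zeta> W) (Comp D X (F (G W)) W (\<eta> W) h)"
  if X: "X : Obj D" and W: "W : Obj D" and h: "h : $(Hom D X (F (G W)))" for X W h
  using D.assoc[OF X FO[OF GO[OF W]] W FO[OF GO[OF W]] \<zeta>[OF W] \<eta>[OF W] h] D.id_left[OF X FO[OF GO[OF W]] h] \<zeta>\<eta>[OF W] by simp
 define G' where "G' Z W k = I (G Z) (G W) (K Z W k)" for Z W k
 have G': "G' Z W k : $(Hom C (G Z) (G W))" "F' (G Z) (G W) (G' Z W k) = K Z W k"
  if "Z : Obj D" "W : Obj D" "k : $(Hom D Z W)" for Z W k unfolding G'_def using I[OF GO GO K] that by auto
 have Gfun: "is_functor D C G G'" unfolding is_functor_def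
 proof (intro conjI ballI)
  show "G Z : Obj C" if "Z : Obj D" for Z by (rule GO[OF that])
  show "G' Z W k : $(Hom C (G Z) (G W))" if "Z : Obj D" "W : Obj D" "k : $(Hom D Z W)" for Z W k by (rule G'(1)[OF that])
  show "G' Z Z (Ident D Z) = Ident C (G Z)" if Z: "Z : Obj D" for Z
  proof (rule eqI[OF GO[OF Z] GO[OF Z] G'(1)[OF Z Z D.id_closed[OF Z]] C.id_closed[OF GO[OF Z]]])
   show "F' (G Z) (G Z) (G' Z Z (Ident D Z)) = F' (G Z) (G Z) (Ident C (G Z))" unfolding G'(2)[OF Z Z D.id_closed[OF Z]] FI[OF GO[OF Z]] K_def
     D.id_right[OF Z FO[OF GO[OF Z]] \<zeta>[OF Z]] by (rule \<zeta>\<eta>[OF Z])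
  qed
  show "G' X Z (Comp D X Y Z g h) = Comp C (G X) (G Y) (G Z) (G' Y Z g) (G' X Y h)"
   if X: "X : Obj D" and Y: "Y : Obj D" and Z: "Z : Obj D" and g: "g : $(Hom D Y Z)" and h: "h : $(Hom D X Y)" for X Y Z g h
  proof (rule eqI[OF GO[OF X] GO[OF Z] G'(1)[OF X Z D.comp_closed[OF X Y Z g h]]
     C.comp_closed[OF GO[OF X] GO[OF Y] GO[OF Z] G'(1)[OF Y Z g] G'(1)[OF X Y h]]])
   note o = FO[OF GO[OF X]] FO[OF GO[OF Y]] FO[OF GO[OF Z]]
   let ?L = "K X Z (Comp D X Y Z g h)"
   let ?R = "Comp D (F (G X)) (F (G Y)) (F (G Z)) (K Y Z g) (K X Y h)"
   have L: "?L : $(Hom D (F (G X)) (F (G Z)))" by (rule K[OF X Z D.comp_closed[OF X Y Z g h]])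
   have R: "?R : $(Hom D (F (G X)) (F (G Z)))" by (rule D.comp_closed[OF o K[OF Y Z g] K[OF X Y h]])
   have "Comp D (F (G X)) (F (G Z)) Z (\<eta> Z) ?R
     = Comp D (F (G X)) (F (G Y)) Z (Comp D (F (G Y)) (F (G Z)) Z (\<eta> Z) (K Y Z g)) (K X Y h)"
    by (rule D.assoc[OF o Z \<eta>[OF Z] K[OF Y Z g] K[OF X Y h]])
   also have "\<dots> = Comp D (F (G X)) Y Z g (Comp D (F (G X)) (F (G Y)) Y (\<eta> Y) (K X Y h))"
    unfolding \<eta>K[OF Y Z g] by (rule D.assoc[OF o(1,2) Y Z g \<eta>[OF Y] K[OF X Y h], symmetric])
   also have "\<dots> = Comp D (F (G X)) X Z (Comp D X Y Z g h) (\<eta> X)"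
    unfolding \<eta>K[OF X Y h] by (rule D.assoc[OF o(1) X Y Z g h \<eta>[OF X]])
   also have "\<dots> = Comp D (F (G X)) (F (G Z)) Z (\<eta> Z) ?L" by (rule \<eta>K[OF X Z D.comp_closed[OF X Y Z g h], symmetric])
   finally have "?R = ?L" using \<zeta>l[OF o(1) Z R] \<zeta>l[OF o(1) Z L] by simp
   then show "F' (G X) (G Z) (G' X Z (Comp D X Y Z g h)) = F' (G X) (G Z) (Comp C (G X) (G Y) (G Z) (G' Y Z g) (G' X Y h))"
    unfolding G'(2)[OF X Z D.comp_closed[OF X Y Z g h]]
     FC[OF GO[OF X] GO[OF Y] GO[OF Z] G'(1)[OF Y Z g] G'(1)[OF X Y h]] G'(2)[OF Y Z g] G'(2)[OF X Y h] by simp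
  qed
 qed
 have natD: "naturally_isomorphic D D (%X. F (G X)) (%X Y h. F' (G X) (G Y) (G' X Y h)) (%X. X) (%X Y h. h)"
  unfolding naturally_isomorphic_def
 proof (intro exI[of _ \<eta>] conjI ballI)
  show "\<eta> Z : isomorphisms D (F (G Z)) Z" if "Z : Obj D" for Z
   unfolding isomorphisms_def using \<eta>[OF that] \<zeta>[OF that] \<zeta>\<eta>[OF that] \<eta>\<zeta>[OF that] by blast
  show "Comp D (F (G X)) (F (G Y)) Y (\<eta> Y) (F' (G X) (G Y) (G' X Y h)) = Comp D (F (G X)) X Y h (\<eta> X)"
   if "X : Obj D" "Y : Obj D" "h : $(Hom D X Y)" for X Y h unfolding G'(2)[OF that] by (rule \<eta>K[OF that])
 qed
 define \<theta> where "\<theta> X = I (G (F X)) X (\<eta> (F X))" for X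
 have \<theta>: "\<theta> X : $(Hom C (G (F X)) X)" "F' (G (F X)) X (\<theta> X) = \<eta> (F X)" if "X : Obj C" for X
  unfolding \<theta>_def using I[OF GO[OF FO[OF that]] that \<eta>[OF FO[OF that]]] by auto
 have natC: "naturally_isomorphic C C (%X. G (F X)) (%X Y h. G' (F X) (F Y) (F' X Y h)) (%X. X) (%X Y h. h)"
  unfolding naturally_isomorphic_def
 proof (intro exI[of _ \<theta>] conjI ballI)
  show "\<theta> X : isomorphisms C (G (F X)) X" if X: "X : Obj C" for X
  proof -
   note GF = GO[OF FO[OF X]]
   let ?j = "I X (G (F X)) (\<zeta> (F X))"
   note j = I[OF X GF \<zeta>[OF FO[OF X]]]
   have 1: "Comp C (G (F X)) X (G (F X)) ?j (\<theta> X) = Ident C (G (F X))"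
    by (rule eqI[OF GF GF C.comp_closed[OF GF X GF j(1) \<theta>(1)[OF X]] C.id_closed[OF GF]])
     (simp add: FC[OF GF X GF j(1) \<theta>(1)[OF X]] j(2) \<theta>(2)[OF X] FI[OF GF] \<zeta>\<eta>[OF FO[OF X]])
   have 2: "Comp C X (G (F X)) X (\<theta> X) ?j = Ident C X" by (rule eqI[OF X X C.comp_closed[OF X GF X \<theta>(1)[OF X] j(1)] C.id_closed[OF X]])
     (simp add: FC[OF X GF X \<theta>(1)[OF X] j(1)] j(2) \<theta>(2)[OF X] FI[OF X] \<eta>\<zeta>[OF FO[OF X]])
   show ?thesis unfolding isomorphisms_def using \<theta>(1)[OF X] j(1) 1 2 by blast
  qed
  show "Comp C (G (F X)) (G (F Y)) Y (\<theta> Y) (G' (F X) (F Y) (F' X Y h)) = Comp C (G (F X)) X Y h (\<theta> X)"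
   if X: "X : Obj C" and Y: "Y : Obj C" and h: "h : $(Hom C X Y)" for X Y h
  proof -
   note GX = GO[OF FO[OF X]] and GY = GO[OF FO[OF Y]]
   note g = G'[OF FO[OF X] FO[OF Y] FH[OF X Y h]]
   show ?thesis by (rule eqI[OF GX Y C.comp_closed[OF GX GY Y \<theta>(1)[OF Y] g(1)] C.comp_closed[OF GX X Y h \<theta>(1)[OF X]]])
     (simp add: FC[OF GX GY Y \<theta>(1)[OF Y] g(1)] FC[OF GX X Y h \<theta>(1)[OF X]] \<theta>(2)[OF X] \<theta>(2)[OF Y] g(2)
      \<eta>K[OF FO[OF X] FO[OF Y] FH[OF X Y h]])
  qed
 qed
 show ?thesis unfolding equivalent_categories_def using C D F Gfun natC natD by blast
qed

text \<open>For an arbitrary set of objects the factoring morphisms need not be closed under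
  addition. That they form a two-sided ideal is assumed here and derived either from a description
  as a kernel or from \<open>factor_dataI\<close>.\<close>

locale factor_data = precat C for C :: "('o, 'h) precategory" +
 fixes \<X> :: "'o set"
 assumes fm_subgroup: "X : Obj C ==> Y : Obj C ==> subgroup (factoring_morphisms C \<X> X Y) (Hom C X Y)"
  and fm_left: "X : Obj C ==> Y : Obj C ==> Z : Obj C ==> g : factoring_morphisms C \<X> Y Z ==>
   h : $(Hom C X Y) ==> Comp C X Y Z g h : factoring_morphisms C \<X> X Z"
  and fm_right: "X : Obj C ==> Y : Obj C ==> Z : Obj C ==> g : $(Hom C Y Z) ==>
   h : factoring_morphisms C \<X> X Y ==> Comp C X Y Z g h : factoring_morphisms C \<X> X Z"
begin

abbreviation fm where "fm X Y \<equiv> factoring_morphisms C \<X> X Y"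
abbreviation cl where "cl X Y h \<equiv> fm X Y #>\<^bsub>Hom C X Y\<^esub> h"
abbreviation Q where "Q \<equiv> factor_category C \<X>"

lemma fm_normal: "X : Obj C ==> Y : Obj C ==> fm X Y \<lhd> Hom C X Y"
 using comm_group.subgroup_imp_normal[OF hom_group fm_subgroup] by blast

lemma Q_simps [simp]:
 "Obj Q = Obj C" "Hom Q X Y = Hom C X Y Mod fm X Y" "Ident Q X = cl X X (Ident C X)" by (simp_all add: factor_category_def)

lemma carrier_Q: "$(Hom Q X Y) = cl X Y ` $(Hom C X Y)" by (auto simp: FactGroup_def RCOSETS_def)

lemma cl_eq_iff:
 assumes "X : Obj C" "Y : Obj C" "g : $(Hom C X Y)" "h : $(Hom C X Y)"
 shows "cl X Y g = cl X Y h \<longleftrightarrow> g : cl X Y h"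
proof -
 interpret group "Hom C X Y" by (rule hom_is_group) fact+
 show ?thesis using repr_independence[OF _ assms(4) fm_subgroup[OF assms(1,2)], of g] rcos_self[OF assms(3) fm_subgroup[OF assms(1,2)]] by metis
qed

lemma mem_cl: "g : cl X Y h \<longleftrightarrow> (\<exists>n\<in>fm X Y. g = n \<otimes>\<^bsub>Hom C X Y\<^esub> h)" by (auto simp: r_coset_def)

lemma cl_mult:
 assumes "X : Obj C" "Y : Obj C" "g : $(Hom C X Y)" "h : $(Hom C X Y)"
 shows "cl X Y g \<otimes>\<^bsub>Hom Q X Y\<^esub> cl X Y h = cl X Y (g \<otimes>\<^bsub>Hom C X Y\<^esub> h)"
 using normal.rcos_sum[OF fm_normal[OF assms(1,2)] assms(3,4)] by (simp add: FactGroup_def)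

lemma cl_one_iff:
 assumes "X : Obj C" "Y : Obj C" "h : $(Hom C X Y)"
 shows "cl X Y h = \<one>\<^bsub>Hom Q X Y\<^esub> \<longleftrightarrow> h : fm X Y"
proof -
 interpret group "Hom C X Y" by (rule hom_is_group) fact+
 show ?thesis using coset_join1[OF _ assms(3) fm_subgroup[OF assms(1,2)]] coset_join2[OF assms(3) fm_subgroup[OF assms(1,2)]]
   subgroup.subset[OF fm_subgroup[OF assms(1,2)]] by (auto simp: FactGroup_def)
qed

text \<open>Composition of classes is a union over all representatives; the ideal property makes
  each pair contribute the same coset.\<close>

lemma cl_comp:
 assumes X: "X : Obj C" and Y: "Y : Obj C" and Z: "Z : Obj C"
  and g: "g : $(Hom C Y Z)" and h: "h : $(Hom C X Y)" shows "Comp Q X Y Z (cl Y Z g) (cl X Y h) = cl X Z (Comp C X Y Z g h)"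
proof -
 interpret XY: comm_group "Hom C X Y" by (rule hom_group) fact+
 interpret YZ: comm_group "Hom C Y Z" by (rule hom_group) fact+
 interpret XZ: comm_group "Hom C X Z" by (rule hom_group) fact+
 have gh: "Comp C X Y Z g h : $(Hom C X Z)" by (rule comp_closed[OF X Y Z g h])
 have "cl X Z (Comp C X Y Z g' h') = cl X Z (Comp C X Y Z g h)" if g': "g' : cl Y Z g" and h': "h' : cl X Y h" for g' h'
 proof -
  obtain n m where n: "n : fm Y Z" "g' = n \<otimes>\<^bsub>Hom C Y Z\<^esub> g" and m: "m : fm X Y" "h' = m \<otimes>\<^bsub>Hom C X Y\<^esub> h"
   using g' h' unfolding mem_cl by blast
  have nc: "n : $(Hom C Y Z)" and mc: "m : $(Hom C X Y)" using n(1) m(1) subgroup.subset[OF fm_subgroup] X Y Z by blast+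
  have h'c: "h' : $(Hom C X Y)" unfolding m(2) by (rule XY.m_closed[OF mc h])
  have g'c: "g' : $(Hom C Y Z)" unfolding n(2) by (rule YZ.m_closed[OF nc g])
  have 1: "Comp C X Y Z n h' : fm X Z" by (rule fm_left[OF X Y Z n(1) h'c])
  have 2: "Comp C X Y Z g m : fm X Z" by (rule fm_right[OF X Y Z g m(1)])
  have c12: "Comp C X Y Z n h' : $(Hom C X Z)" "Comp C X Y Z g m : $(Hom C X Z)"
   using comp_closed[OF X Y Z nc h'c] comp_closed[OF X Y Z g mc] .
  have "Comp C X Y Z g' h' = Comp C X Y Z n h' \<otimes>\<^bsub>Hom C X Z\<^esub> Comp C X Y Z g h'"
   unfolding n(2) by (rule comp_mult_left[OF X Y Z nc g h'c])
  also have "Comp C X Y Z g h' = Comp C X Y Z g m \<otimes>\<^bsub>Hom C X Z\<^esub> Comp C X Y Z g h"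
   unfolding m(2) by (rule comp_mult_right[OF X Y Z g mc h])
  finally have "Comp C X Y Z g' h' = (Comp C X Y Z n h' \<otimes>\<^bsub>Hom C X Z\<^esub> Comp C X Y Z g m) \<otimes>\<^bsub>Hom C X Z\<^esub> Comp C X Y Z g h"
   using c12 gh by (simp add: XZ.m_assoc)
  then have "Comp C X Y Z g' h' : cl X Z (Comp C X Y Z g h)" unfolding mem_cl using subgroup.m_closed[OF fm_subgroup[OF X Z] 1 2] by blast
  then show ?thesis using cl_eq_iff[OF X Z comp_closed[OF X Y Z g'c h'c] gh] by blast
 qed
 moreover have "g : cl Y Z g" "h : cl X Y h" using YZ.rcos_self[OF g fm_subgroup[OF Y Z]] XY.rcos_self[OF h fm_subgroup[OF X Y]] .
 ultimately show ?thesis unfolding factor_category_def precategory.simps by blast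
qed

lemma Q_hom_group:
 assumes "X : Obj C" "Y : Obj C" shows "comm_group (Hom Q X Y)"
proof -
 interpret comm_group "Hom C X Y" by (rule hom_group) fact+
 show ?thesis using abelian_FactGroup[OF fm_subgroup[OF assms]] by simp
qed

lemma factor_preadditive: "preadditive_category Q" unfolding preadditive_category_def
proof (intro conjI ballI)
 fix X Y assume "X : Obj Q" "Y : Obj Q"
 then show "comm_group (Hom Q X Y)" by (intro Q_hom_group) simp_all
next
 fix X assume "X : Obj Q"
 then show "Ident Q X : $(Hom Q X X)" unfolding carrier_Q using id_closed by simp
next
 fix X Y Z G H assume o: "X : Obj Q" "Y : Obj Q" "Z : Obj Q" and G: "G : $(Hom Q Y Z)" and H: "H : $(Hom Q X Y)"
 obtain g h where "g : $(Hom C Y Z)" "G = cl Y Z g" "h : $(Hom C X Y)" "H = cl X Y h" using G H unfolding carrier_Q by blast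
 then show "Comp Q X Y Z G H : $(Hom Q X Z)" unfolding carrier_Q using cl_comp comp_closed o by simp
next
 fix X Y H assume o: "X : Obj Q" "Y : Obj Q" and H: "H : $(Hom Q X Y)"
 obtain h where h: "h : $(Hom C X Y)" "H = cl X Y h" using H unfolding carrier_Q by blast
 show "Comp Q X X Y H (Ident Q X) = H" "Comp Q X Y Y (Ident Q Y) H = H" using h o by (simp_all add: cl_comp id_closed id_left id_right)
next
 fix W X Y Z K G H assume o: "W : Obj Q" "X : Obj Q" "Y : Obj Q" "Z : Obj Q" and K: "K : $(Hom Q Y Z)"
  and G: "G : $(Hom Q X Y)" and H: "H : $(Hom Q W X)"
 obtain k where "k : $(Hom C Y Z)" "K = cl Y Z k" using K unfolding carrier_Q by blast
 moreover obtain g where "g : $(Hom C X Y)" "G = cl X Y g" using G unfolding carrier_Q by blast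
 moreover obtain h where "h : $(Hom C W X)" "H = cl W X h" using H unfolding carrier_Q by blast
 ultimately show "Comp Q W Y Z K (Comp Q W X Y G H) = Comp Q W X Z (Comp Q X Y Z K G) H" using o by (simp add: cl_comp comp_closed assoc)
next
 fix X Y Z G G' H H' assume o: "X : Obj Q" "Y : Obj Q" "Z : Obj Q" and G: "G : $(Hom Q Y Z)" "G' : $(Hom Q Y Z)"
  and H: "H : $(Hom Q X Y)" "H' : $(Hom Q X Y)"
 have o': "X : Obj C" "Y : Obj C" "Z : Obj C" using o by simp_all
 interpret XY: comm_group "Hom C X Y" by (rule hom_group) fact+
 interpret YZ: comm_group "Hom C Y Z" by (rule hom_group) fact+
 obtain g g' where g: "g : $(Hom C Y Z)" "G = cl Y Z g" "g' : $(Hom C Y Z)" "G' = cl Y Z g'" using G unfolding carrier_Q by blast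
 obtain h h' where h: "h : $(Hom C X Y)" "H = cl X Y h" "h' : $(Hom C X Y)" "H' = cl X Y h'" using H unfolding carrier_Q by blast
 show "Comp Q X Y Z (G \<otimes>\<^bsub>Hom Q Y Z\<^esub> G') H = Comp Q X Y Z G H \<otimes>\<^bsub>Hom Q X Z\<^esub> Comp Q X Y Z G' H"
  unfolding g(2,4) h(2) cl_mult[OF o'(2,3) g(1,3)] cl_comp[OF o' g(1) h(1)] cl_comp[OF o' g(3) h(1)]
   cl_mult[OF o'(1,3) comp_closed[OF o' g(1) h(1)] comp_closed[OF o' g(3) h(1)]]
   cl_comp[OF o' YZ.m_closed[OF g(1,3)] h(1)] comp_mult_left[OF o' g(1,3) h(1)] ..
 show "Comp Q X Y Z G (H \<otimes>\<^bsub>Hom Q X Y\<^esub> H') = Comp Q X Y Z G H \<otimes>\<^bsub>Hom Q X Z\<^esub> Comp Q X Y Z G H'"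
  unfolding g(2) h(2,4) cl_mult[OF o'(1,2) h(1,3)] cl_comp[OF o' g(1) h(1)] cl_comp[OF o' g(1) h(3)]
   cl_mult[OF o'(1,3) comp_closed[OF o' g(1) h(1)] comp_closed[OF o' g(1) h(3)]]
   cl_comp[OF o' g(1) XY.m_closed[OF h(1,3)]] comp_mult_right[OF o' g(1) h(1,3)] ..
qed

end

section \<open>Equivalences induced by full and dense additive functors\<close>

definition additive_functor where
 "additive_functor C D F F' \<longleftrightarrow> is_functor C D F F' & (\<forall>X\<in>Obj C. \<forall>Y\<in>Obj C. \<forall>g\<in>$(Hom C X Y). \<forall>h\<in>$(Hom C X Y).
   F' X Y (g \<otimes>\<^bsub>Hom C X Y\<^esub> h) = F' X Y g \<otimes>\<^bsub>Hom D (F X) (F Y)\<^esub> F' X Y h)"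

text \<open>The kernel of an additive functor is an ideal, so \<open>ker\<close> supplies the
  structure of the factor category and also the faithfulness of the induced functor.\<close>

lemma factor_category_equivalence:
 assumes C: "preadditive_category C" and D: "preadditive_category D" and F: "additive_functor C D F F'"
  and full: "!!X Y k. X : Obj C ==> Y : Obj C ==> k : $(Hom D (F X) (F Y)) ==>
   \<exists>h\<in>$(Hom C X Y). F' X Y h = k"
  and ess: "!!Z. Z : Obj D ==> \<exists>X\<in>Obj C. isomorphisms D (F X) Z ~= {}"
  and ker: "!!X Y. X : Obj C ==> Y : Obj C ==>
   factoring_morphisms C \<X> X Y = {h : $(Hom C X Y). F' X Y h = \<one>\<^bsub>Hom D (F X) (F Y)\<^esub>}"
 shows "equivalent_categories (factor_category C \<X>) D"
proof -
 interpret C: precat C by unfold_locales fact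
 interpret D: precat D by unfold_locales fact
 have FO: "F X : Obj D" if "X : Obj C" for X using F that by (simp add: additive_functor_def is_functor_def)
 have FH: "F' X Y h : $(Hom D (F X) (F Y))" if "X : Obj C" "Y : Obj C" "h : $(Hom C X Y)" for X Y h
  using F that by (simp add: additive_functor_def is_functor_def)
 have FI: "F' X X (Ident C X) = Ident D (F X)" if "X : Obj C" for X using F that by (simp add: additive_functor_def is_functor_def)
 have FC: "F' X Z (Comp C X Y Z g h) = Comp D (F X) (F Y) (F Z) (F' Y Z g) (F' X Y h)"
  if "X : Obj C" "Y : Obj C" "Z : Obj C" "g : $(Hom C Y Z)" "h : $(Hom C X Y)" for X Y Z g h
  using F that by (simp add: additive_functor_def is_functor_def)
 have Fadd: "F' X Y (g \<otimes>\<^bsub>Hom C X Y\<^esub> h) = F' X Y g \<otimes>\<^bsub>Hom D (F X) (F Y)\<^esub> F' X Y h"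
  if "X : Obj C" "Y : Obj C" "g : $(Hom C X Y)" "h : $(Hom C X Y)" for X Y g h using F that by (simp add: additive_functor_def)
 have hom: "group_hom (Hom C X Y) (Hom D (F X) (F Y)) (F' X Y)" if "X : Obj C" "Y : Obj C" for X Y
  using C.hom_is_group[OF that] D.hom_is_group[OF FO[OF that(1)] FO[OF that(2)]] FH[OF that] Fadd[OF that]
  by (auto simp: group_hom_def group_hom_axioms_def hom_def)
 have kereq: "factoring_morphisms C \<X> X Y = kernel (Hom C X Y) (Hom D (F X) (F Y)) (F' X Y)" if "X : Obj C" "Y : Obj C" for X Y
  using ker[OF that] by (simp add: kernel_def)
 have 1: "subgroup (factoring_morphisms C \<X> X Y) (Hom C X Y)" if "X : Obj C" "Y : Obj C" for X Y
  unfolding kereq[OF that] by (rule group_hom.subgroup_kernel[OF hom[OF that]])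
 have 2: "Comp C X Y Z g h : factoring_morphisms C \<X> X Z"
  if o: "X : Obj C" "Y : Obj C" "Z : Obj C" and g: "g : factoring_morphisms C \<X> Y Z" and h: "h : $(Hom C X Y)" for X Y Z g h
  using g C.comp_closed[OF o _ h] FC[OF o _ h] D.comp_one_left[OF FO[OF o(1)] FO[OF o(2)] FO[OF o(3)] FH[OF o(1,2) h]]
  unfolding ker[OF o(2,3)] ker[OF o(1,3)] by simp
 have 3: "Comp C X Y Z g h : factoring_morphisms C \<X> X Z"
  if o: "X : Obj C" "Y : Obj C" "Z : Obj C" and g: "g : $(Hom C Y Z)" and h: "h : factoring_morphisms C \<X> X Y" for X Y Z g h
  using h C.comp_closed[OF o g] FC[OF o g] D.comp_one_right[OF FO[OF o(1)] FO[OF o(2)] FO[OF o(3)] FH[OF o(2,3) g]]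
  unfolding ker[OF o(1,2)] ker[OF o(1,3)] by simp
 interpret factor_data C \<X> by (rule factor_data.intro[OF C.precat_axioms factor_data_axioms.intro[OF 1 2 3]]; assumption)
 define F'' where "F'' X Y H = F' X Y (SOME h. h : $(Hom C X Y) & H = cl X Y h)" for X Y H
 have feq: "F' X Y g = F' X Y h" if o: "X : Obj C" "Y : Obj C" and g: "g : $(Hom C X Y)" and h: "h : $(Hom C X Y)"
  and e: "cl X Y g = cl X Y h" for X Y g h
 proof -
  interpret XY: comm_group "Hom D (F X) (F Y)" by (rule D.hom_group[OF FO FO, OF o])
  obtain n where n: "n : fm X Y" "g = n \<otimes>\<^bsub>Hom C X Y\<^esub> h" using e cl_eq_iff[OF o g h] mem_cl[of g X Y h] by blast
  have "n : $(Hom C X Y)" "F' X Y n = \<one>\<^bsub>Hom D (F X) (F Y)\<^esub>" using n(1) ker[OF o] by simp_all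
  then show ?thesis using Fadd[OF o _ h, of n] n(2) FH[OF o h] by simp
 qed
 have F'': "F'' X Y (cl X Y h) = F' X Y h" if o: "X : Obj C" "Y : Obj C" and h: "h : $(Hom C X Y)" for X Y h
 proof -
  let ?g = "SOME g. g : $(Hom C X Y) & cl X Y h = cl X Y g"
  have "\<exists>g. g : $(Hom C X Y) & cl X Y h = cl X Y g" using h by blast
  from someI_ex[OF this] have g: "?g : $(Hom C X Y)" "cl X Y h = cl X Y ?g" by blast+
  show ?thesis unfolding F''_def by (rule feq[OF o g(1) h g(2)[symmetric]])
 qed
 show ?thesis
 proof (rule fully_faithful_equivalence[OF factor_preadditive D])
  show "is_functor Q D F F''" unfolding is_functor_def
  proof (intro conjI ballI)
   show "F X : Obj D" if "X : Obj Q" for X using FO that by simp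
   show "F'' X Y H : $(Hom D (F X) (F Y))" if o: "X : Obj Q" "Y : Obj Q" and H: "H : $(Hom Q X Y)" for X Y H
   proof -
    obtain h where "h : $(Hom C X Y)" "H = cl X Y h" using H unfolding carrier_Q by blast
    then show ?thesis using F'' FH o by simp
   qed
   show "F'' X X (Ident Q X) = Ident D (F X)" if "X : Obj Q" for X using that F'' C.id_closed FI by simp
   show "F'' X Z (Comp Q X Y Z G H) = Comp D (F X) (F Y) (F Z) (F'' Y Z G) (F'' X Y H)"
    if o: "X : Obj Q" "Y : Obj Q" "Z : Obj Q" and G: "G : $(Hom Q Y Z)" and H: "H : $(Hom Q X Y)" for X Y Z G H
   proof -
    obtain g where "g : $(Hom C Y Z)" "G = cl Y Z g" using G unfolding carrier_Q by blast
    moreover obtain h where "h : $(Hom C X Y)" "H = cl X Y h" using H unfolding carrier_Q by blast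
    ultimately show ?thesis using o by (simp add: cl_comp F'' C.comp_closed FC)
   qed
  qed
  show "inj_on (F'' X Y) ($(Hom Q X Y))" if "X : Obj Q" "Y : Obj Q" for X Y
  proof (rule inj_onI)
   have o: "X : Obj C" "Y : Obj C" using \<open>X : Obj Q\<close> \<open>Y : Obj Q\<close> by simp_all
   interpret CG: comm_group "Hom C X Y" by (rule C.hom_group[OF o])
   interpret DG: comm_group "Hom D (F X) (F Y)" by (rule D.hom_group[OF FO FO, OF o])
   interpret h: group_hom "Hom C X Y" "Hom D (F X) (F Y)" "F' X Y" by (rule hom[OF o])
   fix G H assume G: "G : $(Hom Q X Y)" and H: "H : $(Hom Q X Y)" and e: "F'' X Y G = F'' X Y H"
   obtain g where g: "g : $(Hom C X Y)" "G = cl X Y g" using G unfolding carrier_Q by blast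
   obtain h where h: "h : $(Hom C X Y)" "H = cl X Y h" using H unfolding carrier_Q by blast
   have fe: "F' X Y g = F' X Y h" using e g h F''[OF o] by simp
   let ?n = "g \<otimes>\<^bsub>Hom C X Y\<^esub> inv\<^bsub>Hom C X Y\<^esub> h"
   have "F' X Y ?n = \<one>\<^bsub>Hom D (F X) (F Y)\<^esub>" using g(1) h(1) fe FH[OF o h(1)] by simp
   then have "?n : fm X Y" unfolding ker[OF o] using g(1) h(1) by simp
   moreover have "g = ?n \<otimes>\<^bsub>Hom C X Y\<^esub> h" using g(1) h(1) by (simp add: CG.m_assoc)
   ultimately have "g : cl X Y h" unfolding mem_cl by blast
   then show "G = H" unfolding g(2) h(2) using cl_eq_iff[OF o g(1) h(1)] by blast
  qed
  show "\<exists>H\<in>$(Hom Q X Y). F'' X Y H = k" if XY: "X : Obj Q" "Y : Obj Q" and k: "k : $(Hom D (F X) (F Y))" for X Y k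
  proof -
   have o: "X : Obj C" "Y : Obj C" using XY by simp_all
   obtain h where "h : $(Hom C X Y)" "F' X Y h = k" using full[OF o k] by blast
   then show ?thesis unfolding carrier_Q using F''[OF o] by auto
  qed
  show "\<exists>X\<in>Obj Q. isomorphisms D (F X) Z ~= {}" if "Z : Obj D" for Z using ess[OF that] by simp
 qed
qed

text \<open>The previous lemma applied to \<open>F\<close> followed by the projection onto the
  factor category of \<open>D\<close>, whose zero morphisms are the factoring ones.\<close>

lemma factor_category_equivalence':
 assumes C: "preadditive_category C" and D: "factor_data D \<Y>" and F: "additive_functor C D F F'"
  and full: "!!X Y k. X : Obj C ==> Y : Obj C ==> k : $(Hom D (F X) (F Y)) ==>
   \<exists>h\<in>$(Hom C X Y). F' X Y h = k"
  and ess: "!!Z. Z : Obj D ==> \<exists>X\<in>Obj C. isomorphisms D (F X) Z ~= {}"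
  and ker: "!!X Y. X : Obj C ==> Y : Obj C ==>
   factoring_morphisms C \<X> X Y = {h : $(Hom C X Y). F' X Y h : factoring_morphisms D \<Y> (F X) (F Y)}"
 shows "equivalent_categories (factor_category C \<X>) (factor_category D \<Y>)"
proof -
 interpret C: precat C by unfold_locales fact
 interpret D: factor_data D \<Y> by fact
 have FO: "F X : Obj D" if "X : Obj C" for X using F that by (simp add: additive_functor_def is_functor_def)
 have FH: "F' X Y h : $(Hom D (F X) (F Y))" if "X : Obj C" "Y : Obj C" "h : $(Hom C X Y)" for X Y h
  using F that by (simp add: additive_functor_def is_functor_def)
 have FI: "F' X X (Ident C X) = Ident D (F X)" if "X : Obj C" for X using F that by (simp add: additive_functor_def is_functor_def)
 have FC: "F' X Z (Comp C X Y Z g h) = Comp D (F X) (F Y) (F Z) (F' Y Z g) (F' X Y h)"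
  if "X : Obj C" "Y : Obj C" "Z : Obj C" "g : $(Hom C Y Z)" "h : $(Hom C X Y)" for X Y Z g h
  using F that by (simp add: additive_functor_def is_functor_def)
 have Fadd: "F' X Y (g \<otimes>\<^bsub>Hom C X Y\<^esub> h) = F' X Y g \<otimes>\<^bsub>Hom D (F X) (F Y)\<^esub> F' X Y h"
  if "X : Obj C" "Y : Obj C" "g : $(Hom C X Y)" "h : $(Hom C X Y)" for X Y g h using F that by (simp add: additive_functor_def)
 define F'' where "F'' X Y h = D.cl (F X) (F Y) (F' X Y h)" for X Y h
 show ?thesis
 proof (rule factor_category_equivalence[OF C D.factor_preadditive, of F F''])
  show "additive_functor C D.Q F F''" unfolding additive_functor_def is_functor_def
  proof (intro conjI ballI)
   show "F X : Obj D.Q" if "X : Obj C" for X using FO[OF that] by simp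
   show "F'' X Y h : $(Hom D.Q (F X) (F Y))" if "X : Obj C" "Y : Obj C" "h : $(Hom C X Y)" for X Y h
    unfolding D.carrier_Q F''_def using FH[OF that] by blast
   show "F'' X X (Ident C X) = Ident D.Q (F X)" if "X : Obj C" for X by (simp add: F''_def FI[OF that])
   show "F'' X Z (Comp C X Y Z g h) = Comp D.Q (F X) (F Y) (F Z) (F'' Y Z g) (F'' X Y h)"
    if o: "X : Obj C" "Y : Obj C" "Z : Obj C" and g: "g : $(Hom C Y Z)" and h: "h : $(Hom C X Y)" for X Y Z g h
    unfolding F''_def FC[OF o g h] D.cl_comp[OF FO[OF o(1)] FO[OF o(2)] FO[OF o(3)] FH[OF o(2,3) g] FH[OF o(1,2) h]] ..
   show "F'' X Y (g \<otimes>\<^bsub>Hom C X Y\<^esub> h) = F'' X Y g \<otimes>\<^bsub>Hom D.Q (F X) (F Y)\<^esub> F'' X Y h"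
    if o: "X : Obj C" "Y : Obj C" and g: "g : $(Hom C X Y)" and h: "h : $(Hom C X Y)" for X Y g h
    unfolding F''_def Fadd[OF o g h] D.cl_mult[OF FO[OF o(1)] FO[OF o(2)] FH[OF o g] FH[OF o h]] ..
  qed
  show "\<exists>h\<in>$(Hom C X Y). F'' X Y h = k" if o: "X : Obj C" "Y : Obj C" and k: "k : $(Hom D.Q (F X) (F Y))" for X Y k
  proof -
   obtain k' where "k' : $(Hom D (F X) (F Y))" "k = D.cl (F X) (F Y) k'" using k unfolding D.carrier_Q by blast
   then show ?thesis unfolding F''_def using full[OF o] by blast
  qed
  show "\<exists>X\<in>Obj C. isomorphisms D.Q (F X) Z ~= {}" if "Z : Obj D.Q" for Z
  proof -
   have Z: "Z : Obj D" using that by simp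
   obtain X h g where X: "X : Obj C" and h: "h : $(Hom D (F X) Z)" and g: "g : $(Hom D Z (F X))"
    and gh: "Comp D (F X) Z (F X) g h = Ident D (F X)" "Comp D Z (F X) Z h g = Ident D Z" using ess[OF Z] unfolding isomorphisms_def by blast
   have "D.cl (F X) Z h : isomorphisms D.Q (F X) Z" unfolding isomorphisms_def D.carrier_Q
    using h g gh D.cl_comp[OF FO[OF X] Z FO[OF X] g h] D.cl_comp[OF Z FO[OF X] Z h g] by auto
   then show ?thesis using X by blast
  qed
  show "factoring_morphisms C \<X> X Y = {h : $(Hom C X Y). F'' X Y h = \<one>\<^bsub>Hom D.Q (F X) (F Y)\<^esub>}"
   if o: "X : Obj C" "Y : Obj C" for X Y unfolding ker[OF o] F''_def using D.cl_one_iff[OF FO[OF o(1)] FO[OF o(2)] FH[OF o]] by blast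
 qed
qed

section \<open>Graded hypersurfaces\<close>

text \<open>\<open>S0_units\<close> is what a quotient inherits from connectedness of the algebra
  above it; the zero ring is still included.\<close>

locale graded_hypersurface = graded_ring S for S :: "('k, 's, nat) graded_module" (structure) +
 fixes f :: 's and d :: nat
 assumes d_pos: "1 \<le> d" and f_part: "f : part S d"
  and f_reg: "regular_element S f" and f_norm: "normal_element S f"
  and noetherian: "noeth S"
  and S0_units: "c : part S 0 ==> c ~= \<zero> ==> \<exists>b\<in>$S. c \<otimes> b = \<one>"
begin

abbreviation A :: "('k, 's set, nat) graded_module" where "A \<equiv> hypersurface S f"
abbreviation p :: "'s => 's set" where "p \<equiv> %x. Idl\<^bsub>S\<^esub> {f} +>\<^bsub>S\<^esub> x"

text \<open>Normality makes the right ideal \<open>f S\<close> two-sided.\<close>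

lemma ideal_f: "Idl\<^bsub>S\<^esub> {f} = (%b. f \<otimes> b) ` $S"
proof
 note f = Sg.part_closed[OF f_part]
 let ?J = "(%b. f \<otimes> b) ` $S"
 have "ideal ?J S"
 proof (rule idealI[OF ring_axioms])
  have "submodule ?J S (reg S)"
   using submodule_image[OF rmodule_regular[OF ring_axioms] rmodule_regular[OF ring_axioms], of "%b. f \<otimes> b"] f
   by (simp add: rlin_def r_distr m_assoc)
  then show "subgroup ?J (add_monoid S)" unfolding submodule_def subgroup_def by (simp add: a_inv_def regular_module_def m_inv_def)
  show "x \<otimes> a : ?J" if "a : ?J" "x : $S" for a x
  proof -
   obtain b where b: "b : $S" "a = f \<otimes> b" using \<open>a : ?J\<close> by blast
   have "x \<otimes> f : ?J" using f_norm that(2) unfolding normal_element_def by blast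
   then obtain c where c: "c : $S" "x \<otimes> f = f \<otimes> c" by blast
   have "x \<otimes> a = f \<otimes> (c \<otimes> b)" using b c that f by (metis m_assoc)
   then show ?thesis using b c by blast
  qed
  show "a \<otimes> x : ?J" if "a : ?J" "x : $S" for a x
  proof -
   obtain b where b: "b : $S" "a = f \<otimes> b" using \<open>a : ?J\<close> by blast
   have "a \<otimes> x = f \<otimes> (b \<otimes> x)" using b that f by (simp add: m_assoc)
   then show ?thesis using b that by blast
  qed
 qed
 moreover have "f : ?J" using f by (intro image_eqI[of _ _ \<one>]) auto
 ultimately show "Idl\<^bsub>S\<^esub> {f} \<subseteq> ?J" by (intro genideal_minimal) auto
 interpret I: ideal "Idl\<^bsub>S\<^esub> {f}" S by (rule genideal_ideal) (use f in auto)
 show "?J \<subseteq> Idl\<^bsub>S\<^esub> {f}" using I.I_r_closed genideal_self'[OF f] by auto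
qed

lemma A_simps: "$A = $(S Quot Idl\<^bsub>S\<^esub> {f})" "x \<otimes>\<^sub>A y = x \<otimes>\<^bsub>S Quot Idl\<^bsub>S\<^esub> {f}\<^esub> y"
 "x \<oplus>\<^sub>A y = x \<oplus>\<^bsub>S Quot Idl\<^bsub>S\<^esub> {f}\<^esub> y" "\<one>\<^sub>A = \<one>\<^bsub>S Quot Idl\<^bsub>S\<^esub> {f}\<^esub>" "\<zero>\<^sub>A = \<zero>\<^bsub>S Quot Idl\<^bsub>S\<^esub> {f}\<^esub>"
 "part A n = p ` part S n" by (simp_all add: hypersurface_def quotient_algebra_def ring.defs)

lemma quotient: "normal_quotient S A p f"
proof -
 note f = Sg.part_closed[OF f_part]
 interpret I: ideal "Idl\<^bsub>S\<^esub> {f}" S by (rule genideal_ideal) (use f in auto)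
 interpret Q: ring "S Quot Idl\<^bsub>S\<^esub> {f}" by (rule I.quotient_is_ring)
 have "abelian_group A" by (rule abelian_groupI; unfold A_simps)
   (rule Q.a_closed Q.zero_closed Q.l_zero, assumption+, rule Q.zero_closed, (rule Q.a_assoc Q.a_comm Q.l_zero; assumption)+,
    use Q.l_neg Q.a_inv_closed in blast)
 moreover have "monoid A" by (rule monoidI) (auto simp: A_simps Q.m_assoc)
 ultimately interpret A: ring A by (intro ringI) (auto simp: A_simps Q.l_distr Q.r_distr)
 show ?thesis
 proof
  show "p : ring_hom S A" using I.rcos_ring_hom by (simp add: ring_hom_def A_simps)
  show "p ` $S = $A" by (auto simp: A_simps FactRing_def A_RCOSETS_def')
  show "p a = \<zero>\<^sub>A \<longleftrightarrow> a : (%b. f \<otimes> b) ` $S" if "a : $S" for a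
  proof -
   have "p a = Idl\<^bsub>S\<^esub> {f} \<longleftrightarrow> a : Idl\<^bsub>S\<^esub> {f}" using I.a_rcos_self[OF that] I.a_rcos_const[of a] by auto
   then show ?thesis by (simp add: ideal_f[symmetric] A_simps FactRing_def)
  qed
 qed (rule f_reg f_norm)+
qed

end

sublocale graded_hypersurface \<subseteq> normal_quotient S A p f by (rule quotient)

section \<open>Degrees under multiplication by \<open>f\<close>\<close>

context graded_hypersurface
begin

text \<open>The components of a product with the homogeneous element \<open>f\<close> are the
  products of the components with \<open>f\<close>, and none of them is lost because
  \<open>f\<close> is regular. Hence degrees can also be read backwards, which makes twists and
  untwists graded.\<close>

lemma f_degree:
 assumes x: "x : $S"
 shows "f \<otimes> x : zpart S (j + int d) \<longleftrightarrow> x : zpart S j" and "x \<otimes> f : zpart S (j + int d) \<longleftrightarrow> x : zpart S j"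
proof -
 have *: "g x : zpart S (j + int d) \<longleftrightarrow> x : zpart S j"
  if g: "!!y. y : $S ==> g y : $S" "!!y. y : $S ==> g y = \<zero> ==> y = \<zero>"
   and h: "!!i. hc S (g x) (d + i) = g (hc S x i)" "!!i. i < d ==> hc S (g x) i = \<zero>"
   and deg: "!!j. x : zpart S j ==> g x : zpart S (j + int d)" for g
 proof (intro iffI deg)
  assume a: "g x : zpart S (j + int d)"
  have z: "hc S x i = \<zero>" if "int i ~= j" for i
  proof -
   have "hc S (g x) (d + i) = \<zero>" using a that by (auto simp: zpart_def Sg.hc_homogeneous split: if_splits)
   then show ?thesis using g(2)[OF Sg.hc_closed[OF x]] h(1) by simp
  qed
  show "x : zpart S j"
  proof (cases "0 \<le> j")
   case True
   then show ?thesis using x z by (auto simp: zpart_def Sg.part_iff)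
  next
   case False
   then have "x = \<zero>" by (intro Sg.hc_eq_zero[OF x] z) auto
   then show ?thesis by (simp add: zpart_ops)
  qed
 qed
 show "f \<otimes> x : zpart S (j + int d) \<longleftrightarrow> x : zpart S j"
  by (rule *) (auto simp: part_mult_hc[OF f_part x] f_left_cancel zpart_mult_left[OF _ f_part])
 show "x \<otimes> f : zpart S (j + int d) \<longleftrightarrow> x : zpart S j"
  by (rule *) (auto simp: part_mult_hc'[OF f_part x] f_right_cancel zpart_mult[OF _ f_part])
qed

text \<open>The generator degrees of \<open>F(-d)\<close>.\<close>

abbreviation up :: "int list => int list" where "up m \<equiv> map (%j. j + int d) m"

lemma lmul_part:
 assumes "x : $(Fl m)" shows "lml m x : part (graded_free S m) i \<longleftrightarrow> x : part (graded_free S (up m)) i"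
proof -
 have "f \<otimes> x s : zpart S (i - m ! s) \<longleftrightarrow> x s : zpart S (i - up m ! s)" if "s < length m" for s
  using f_degree(1)[of "x s" "i - m ! s - int d"] free_coord[OF assms, of s] that by (simp add: diff_diff_eq)
 then show ?thesis using assms rlin_closed[OF lmul_rlin assms] by (simp add: part_graded_free) (simp add: lmul_def)
qed

lemma smult_f_part:
 assumes "x : $(Fl m)"
 shows "f \<odot>\<^bsub>Fl m\<^esub> x : part (graded_free S m) (i + int d) \<longleftrightarrow> x : part (graded_free S m) i"
proof -
 interpret F: rmodule S "Fr r" for r by (rule rmodule_Fr)
 have "x s \<otimes> f : zpart S (i + int d - m ! s) \<longleftrightarrow> x s : zpart S (i - m ! s)" if "s < length m" for s
  using f_degree(2)[of "x s" "i - m ! s"] free_coord[OF assms, of s] that by (simp add: algebra_simps)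
 then show ?thesis using assms F.smult_closed[OF f_closed assms] by (simp add: part_graded_free) (simp add: free_simps(4))
qed

end

section \<open>Degree-preserving linear maps without extensionality\<close>

definition ghom :: "('k, 'a, nat) graded_module => ('a, 'm, int) graded_module => ('a, 'n, int) graded_module => ('m => 'n) => bool" where
 "ghom R M N h \<longleftrightarrow> rlin R M N h & (\<forall>i. \<forall>x\<in>part M i. h x : part N i)"

lemma ghomD: "ghom R M N h ==> rlin R M N h" "ghom R M N h ==> x : part M i ==> h x : part N i"
 by (auto simp: ghom_def)

lemma ghom_comp: "ghom R L M g ==> ghom R M N h ==> ghom R L N (%x. h (g x))"
 by (simp add: ghom_def rlin_comp[of R L M g N h])

lemma ghom_id: "ghom R M M (%x. x)" by (simp add: ghom_def rlin_id)

lemma graded_hom_iff: "h : graded_hom R M N \<longleftrightarrow> ghom R M N h & h : extensional ($M)"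
 unfolding graded_hom_def ghom_def module_hom_iff by blast

lemma ghom_cong:
 assumes "gmodule R M" "!!x. x : $M ==> h x = g x" shows "ghom R M N h \<longleftrightarrow> ghom R M N g"
proof -
 interpret gmodule R M by fact
 have "rlin R M N h \<longleftrightarrow> rlin R M N g" by (rule rlin_cong[OF rmodule_axioms assms(2)])
 moreover have "h x = g x" if "x : part M i" for x i using assms(2) Mg.part_closed[OF that] .
 ultimately show ?thesis by (simp add: ghom_def)
qed

lemma restrict_graded_hom:
 assumes "gmodule R M" "ghom R M N h" shows "restrict h ($M) : graded_hom R M N"
 using assms(2) ghom_cong[OF assms(1), of "restrict h ($M)" h N] by (simp add: graded_hom_iff)

context graded_ring
begin

lemma ghom_lift:
 assumes "gmodule S X" "gmodule S Y" "ghom S X Y g" "ghom S (graded_free S m) Y h"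
  and "!!x. x : $(graded_free S m) ==> h x : g ` $X"
 obtains k where "ghom S (graded_free S m) X k" "!!x. x : $(graded_free S m) ==> g (k x) = h x"
proof -
 have "rlin S (free S {..<length m}) Y h" "!!i x. x : part (graded_free S m) i ==> h x : part Y i"
  "!!x. x : $(free S {..<length m}) ==> h x : g ` $X" using assms(4,5) by (simp_all add: ghom_def)
 from graded_free_lift[OF assms(1,2) ghomD(1)[OF assms(3)] ghomD(2)[OF assms(3)] this]
 obtain k where "rlin S (free S {..<length m}) X k" "!!i x. x : part (graded_free S m) i ==> k x : part X i"
  "!!x. x : $(free S {..<length m}) ==> g (k x) = h x" by blast
 then show thesis by (intro that[of k]) (auto simp: ghom_def)
qed

end

definition gres :: "('s => 'a) => ('a, 'm, int) graded_module => ('s, 'm, int) graded_module" where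
 "gres p M = module.extend (res p M) \<lparr>part = part M\<rparr>"

lemma gres_simps [simp]:
 "$(gres p M) = $M" "\<zero>\<^bsub>gres p M\<^esub> = \<zero>\<^sub>M" "x \<oplus>\<^bsub>gres p M\<^esub> y = x \<oplus>\<^sub>M y"
 "a \<odot>\<^bsub>gres p M\<^esub> x = p a \<odot>\<^sub>M x" "part (gres p M) i = part M i"
 "add (gres p M) = add M" by (simp_all add: gres_def module.defs restrict_scalars_def)

lemma rlin_gres [simp]: "rlin S F (gres p M) h \<longleftrightarrow> rlin S F (res p M) h" by (simp add: rlin_def)

section \<open>Graded modules over a hypersurface and their free covers\<close>

context graded_hypersurface
begin

lemma gmodule_gres:
 assumes "gmodule A M" shows "gmodule S (gres p M)"
proof -
 interpret M: gmodule A M by fact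
 interpret R: rmodule S "res p M" by (rule rmodule_res[OF M.rmodule_axioms])
 have "abelian_group (gres p M)" by (rule abelian_groupI) (auto simp: M.M.a_ac intro: M.M.l_neg bexI[of _ "\<ominus>\<^sub>M _"])
 then interpret G: abelian_group "gres p M" .
 note id = M.M.abelian_group_axioms G.abelian_group_axioms
 have neg: "\<ominus>\<^bsub>gres p M\<^esub> x = \<ominus>\<^sub>M x" if "x : $M" for x
  by (rule additive_minus[OF id, of "%x. x", symmetric]) (use that in auto)
 have fs: "finsum (gres p M) c I = finsum M c I" if "c : I \<rightarrow> $M" for c and I :: "int set"
  by (rule additive_finsum[OF id, of "%x. x", symmetric]) (use that in auto)
 show ?thesis
 proof
  show "internally_graded (gres p M)"
  proof (rule internally_gradedI(1)[of _ "%i x. hc M x i"])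
   show "subgroup (part (gres p M) i) (add_monoid (gres p M))" for i by (rule G.add.subgroupI)
     (auto simp: M.Mg.part_add M.Mg.part_closed neg M.Mg.part_neg simp flip: a_inv_def dest: equals0D[of _ "\<zero>\<^sub>M"])
   show "\<exists>I. finite I & (\<forall>i. i \<notin> I \<longrightarrow> hc M x i = \<zero>\<^bsub>gres p M\<^esub>) & x = finsum (gres p M) (hc M x) I"
    if "x : $(gres p M)" for x using that M.Mg.hc_finite[of x] M.Mg.hc_sum[of x] fs[of "hc M x"] M.Mg.hc_closed[of x]
    by (intro exI[of _ "{i. hc M x i ~= \<zero>\<^sub>M}"]) auto
  qed (auto simp: G.abelian_group_axioms M.Mg.hc_part M.Mg.hc_add M.Mg.hc_homogeneous)
  show "a \<odot>\<^bsub>gres p M\<^esub> x : part (gres p M) (i + int j)" if "x : part (gres p M) i" "a : part S j" for x i a j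
   using M.smult_part[of x i "p a" j] that by (simp add: A_simps)
 qed (use R.smult_l_distr R.smult_r_distr R.smult_assoc R.smult_one R.smult_closed in auto)
qed

text \<open>Covers of \<open>A\<close>-modules are taken by free \<open>S\<close>-modules, so that
  their kernels contain \<open>f F\<close> and maps between them are matrices over
  \<open>S\<close>.\<close>

definition cover :: "int list => ('s set, 'm, int) graded_module => ((nat => 's) => 'm) => bool" where
 "cover m M q \<longleftrightarrow> ghom S (graded_free S m) (gres p M) q & q ` $(Fl m) = $M"

lemma cover_rlin: "cover m M q ==> rlin S (Fl m) (res p M) q" by (simp add: cover_def ghom_def)

lemma cover_surj: "cover m M q ==> q ` $(Fl m) = $M" by (simp add: cover_def)

lemma cover_part:
 assumes M: "gmodule A M" and c: "cover m M q" and y: "y : part M i"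
 obtains x where "x : part (graded_free S m) i" "q x = y"
proof -
 interpret M: gmodule A M by fact
 interpret G: gmodule S "gres p M" by (rule gmodule_gres[OF M])
 interpret F: gmodule S "graded_free S m" by (rule gmodule_free)
 have "y : q ` $(Fl m)" using M.Mg.part_closed[OF y] cover_surj[OF c] by simp
 then obtain z where z: "z : $(graded_free S m)" "y = q z" by auto
 have q: "ghom S (graded_free S m) (gres p M) q" using c by (simp add: cover_def)
 have "hc (gres p M) (q z) i = q (hc (graded_free S m) z i)"
  by (rule hc_hom[OF F.Mg.graded_group_axioms G.Mg.graded_group_axioms _ rlin_add[OF ghomD(1)[OF q]] ghomD(2)[OF q] z(1)])
   (use rlin_closed[OF ghomD(1)[OF q]] in auto)
 moreover have "hc (gres p M) y i = y" using G.Mg.hc_homogeneous[of y i i] y by simp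
 ultimately show thesis using that[OF F.Mg.hc_part[OF z(1)]] z(2) by simp
qed

lemma cover_lift:
 assumes N: "gmodule A N" and m: "cover m M q" and n: "cover n N r" and k: "ghom A M N k"
 obtains \<tau> where "ghom S (graded_free S m) (graded_free S n) \<tau>" "!!x. x : $(Fl m) ==> r (\<tau> x) = k (q x)"
proof -
 have "ghom S (gres p M) (gres p N) k" using k ring_hom_closed[OF p_hom] unfolding ghom_def rlin_def by simp
 then have 1: "ghom S (graded_free S m) (gres p N) (%x. k (q x))" using ghom_comp m unfolding cover_def by blast
 have 2: "ghom S (graded_free S n) (gres p N) r" using n by (simp add: cover_def)
 show thesis by (rule ghom_lift[OF gmodule_free gmodule_gres[OF N] 2 1])
   (use rlin_closed[OF ghomD(1)[OF 1]] cover_surj[OF n] in simp, use that in simp)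
qed

lemma cover_descend:
 assumes M: "gmodule A M" and N: "gmodule A N" and c: "cover m M q" and h: "ghom S (graded_free S m) (gres p N) h"
  and ker: "!!x. x : $(Fl m) ==> q x = \<zero>\<^sub>M ==> h x = \<zero>\<^sub>N"
 obtains k where "k : graded_hom A M N" "!!x. x : $(Fl m) ==> k (q x) = h x"
proof -
 interpret M: gmodule A M by fact
 interpret N: gmodule A N by fact
 have h': "rlin S (Fl m) (res p N) h" using h by (simp add: ghom_def)
 let ?k = "descend ($(Fl m)) q h"
 have "rlin S (res p M) (res p N) ?k"
  and e: "!!x. x : $(Fl m) ==> ?k (q x) = h x"
  by (rule descend_rlin[OF rmodule_Fr rmodule_res[OF M.rmodule_axioms] rmodule_res[OF N.rmodule_axioms] cover_rlin[OF c] _ h'];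
    use cover_surj[OF c] ker in simp)+
 then have l: "rlin A M N ?k" using rlin_res_iff[OF p_hom p_surj, of M N] by simp
 have "?k y : part N i" if y: "y : part M i" for y i
 proof -
  obtain x where x: "x : part (graded_free S m) i" "q x = y" by (rule cover_part[OF M c y])
  then show ?thesis using e[OF part_graded_free_closed[OF x(1)]] ghomD(2)[OF h x(1)] by simp
 qed
 with l have g: "ghom A M N ?k" by (simp add: ghom_def)
 show thesis
 proof (rule that[OF restrict_graded_hom[OF M g]])
  fix x assume x: "x : $(Fl m)"
  then show "restrict ?k ($M) (q x) = h x" using e[OF x] rlin_closed[OF cover_rlin[OF c] x] by simp
 qed
qed

lemma cover_eqI:
 assumes "cover m M q" "k : extensional ($M)" "k' : extensional ($M)"
  and "!!x. x : $(Fl m) ==> k (q x) = k' (q x)" shows "k = k'"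
proof (rule extensionalityI[OF assms(2,3)])
 fix y assume "y : $M"
 then have "y : q ` $(Fl m)" using cover_surj[OF assms(1)] by simp
 then show "k y = k' y" using assms(4) by auto
qed

lemma cover_iso:
 assumes M: "gmodule A M" and N: "gmodule A N" and q: "cover m M q" and r: "cover m N r"
  and e: "!!x. x : $(Fl m) ==> q x = \<zero>\<^sub>M \<longleftrightarrow> r x = \<zero>\<^sub>N"
 obtains k k' where "k : graded_hom A M N" "k' : graded_hom A N M"
  "!!x. x : $(Fl m) ==> k (q x) = r x" "!!x. x : $(Fl m) ==> k' (r x) = q x"
  "!!y. y : $M ==> k' (k y) = y" "!!y. y : $N ==> k (k' y) = y"
proof -
 obtain k where k: "k : graded_hom A M N" "!!x. x : $(Fl m) ==> k (q x) = r x"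
  by (rule cover_descend[OF M N q, of r]) (use e r in \<open>auto simp: cover_def\<close>)
 obtain k' where k': "k' : graded_hom A N M" "!!x. x : $(Fl m) ==> k' (r x) = q x"
  by (rule cover_descend[OF N M r, of q]) (use e q in \<open>auto simp: cover_def\<close>)
 have "k' (k y) = y" if "y : $M" for y using that k(2) k'(2) unfolding cover_surj[OF q, symmetric] by auto
 moreover have "k (k' y) = y" if "y : $N" for y using that k(2) k'(2) unfolding cover_surj[OF r, symmetric] by auto
 ultimately show thesis using that k k' by blast
qed

lemma proj_part: "y : part (graded_free A n) i \<longleftrightarrow> y : proj (length n) ` part (graded_free S n) i"
proof
 assume y: "y : part (graded_free A n) i"
 have z: "zpart A j = p ` zpart S j" for j using p_zero by (simp add: zpart_def A_simps(6))
 then have "\<forall>s. \<exists>a. s < length n \<longrightarrow> a : zpart S (i - n ! s) & y s = p a"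
  using y by (auto simp: part_graded_free)
 from choice[OF this] obtain x where x: "!!s. s < length n ==> x s : zpart S (i - n ! s) & y s = p (x s)" by blast
 have "restrict x {..<length n} : part (graded_free S n) i" using x zpart_closed by (auto simp: part_graded_free free_finite)
 moreover have "y = proj (length n) (restrict x {..<length n})"
 proof -
  have "y : {..<length n} \<rightarrow>\<^sub>E $A" using y by (simp add: part_graded_free free_finite)
  then show ?thesis using x by (intro extensionalityI[of _ "{..<length n}"]) (auto simp: proj_def PiE_iff)
 qed
 ultimately show "y : proj (length n) ` part (graded_free S n) i" by blast
next
 assume "y : proj (length n) ` part (graded_free S n) i"
 then obtain x where x: "x : part (graded_free S n) i" "y = proj (length n) x" by blast
 have "p (x s) : zpart A (i - n ! s)" if "s < length n" for s
  using x(1) that p_zero by (auto simp: part_graded_free zpart_def A_simps(6) split: if_splits)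
 then show "y : part (graded_free A n) i"
  using x(2) proj_closed[OF part_graded_free_closed[OF x(1)]] by (simp add: part_graded_free) (simp add: proj_def)
qed

lemma cover_exists:
 fixes M :: "('s set, 'm, int) graded_module"
 assumes M: "gmodule A M" and fg: "finitely_generated A M"
 obtains m q where "cover m M q"
proof -
 interpret M: gmodule A M by fact
 obtain X where X: "finite X" "X \<subseteq> $M" "submodule_span A M X = $M" using fg unfolding finitely_generated_def by blast
 have "submodule ($M) A M" by (rule M.submoduleI) auto
 then obtain m v where v: "!!i. i < length m ==> v i : part M (m ! i)"
  and im: "lcomb A M {..<length m} v ` $(free A {..<length m}) = $M" using M.minimal_generators[of "$M" X] X M.Mg.hc_closed by metis
 let ?l = "lcomb A M {..<length m} v"
 let ?q = "%x. ?l (proj (length m) x)"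
 have vc: "v : {..<length m} \<rightarrow> $M" using v M.Mg.part_closed by blast
 have l: "rlin A (FA (length m)) M ?l" by (rule M.lcomb_rlin[OF vc])
 have "rlin S (Fl m) (res p M) ?q" by (rule rlin_comp[OF proj_rlin rlin_res[OF p_hom l]])
 moreover have "?q x : part M i" if "x : part (graded_free S m) i" for x i using M.lcomb_graded[of m v] v proj_part that by blast
 moreover have "?q ` $(Fl m) = $M" unfolding im[symmetric] proj_surj[symmetric] by (simp add: image_image)
 ultimately have "cover m M ?q" by (simp add: cover_def ghom_def)
 then show thesis by (rule that)
qed

lemma cover_fg:
 assumes M: "gmodule A M" and c: "cover m M q" shows "finitely_generated A M"
proof -
 interpret M: gmodule A M by fact
 obtain g where g: "rlin A (FA (length m)) M g" "!!x. x : $(Fl m) ==> g (proj (length m) x) = q x"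
  by (rule proj_descend[OF M.rmodule_axioms cover_rlin[OF c]]) (assumption | (rule that; assumption))+
 have "g ` $(FA (length m)) = $M" unfolding proj_surj[symmetric] cover_surj[OF c, symmetric] image_image using g(2) by (intro image_cong) auto
 moreover have "(%i. g (unitv A {..<length m} i)) ` {..<length m} \<subseteq> $M"
  using rlin_closed[OF g(1) unitv_closed[OF A.ring_axioms]] by (simp add: image_subset_iff)
 ultimately show ?thesis using free_image_span[OF M.rmodule_axioms g(1)] unfolding finitely_generated_def
  by (intro exI[of _ "(%i. g (unitv A {..<length m} i)) ` {..<length m}"]) simp
qed

end

text \<open>
 The elements of the given type serve as names for the cosets of a graded submodule of a free
 module: a coset is named after the coordinate list of a chosen representative.
\<close>

lemma (in rmodule) coset_names:
 assumes N: "submodule N R M" and \<iota>: "inj_on \<iota> ($M)"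
 obtains q where "!!x y. x : $M ==> y : $M ==> q x = q y \<longleftrightarrow> x \<ominus>\<^sub>M y : N" "range q \<subseteq> range \<iota>"
proof -
 define K where "K x = {y : $M. x \<ominus>\<^sub>M y : N}" for x
 define rep where "rep x = (SOME y. y : K x)" for x
 have rep: "rep x : $M" "x \<ominus>\<^sub>M rep x : N" if "x : $M" for x
 proof -
  have "x : K x" using that submoduleD(2)[OF N] by (simp add: K_def)
  then have "rep x : K x" unfolding rep_def by (rule someI)
  then show "rep x : $M" "x \<ominus>\<^sub>M rep x : N" by (auto simp: K_def)
 qed
 have sym: "y \<ominus>\<^sub>M x : N" if "x : $M" "y : $M" "x \<ominus>\<^sub>M y : N" for x y
  using submodule_diff[OF N submoduleD(2)[OF N] that(3)] that M.diff_diff_swap[of x y] by (simp add: M.minus_eq)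
 have tr: "x \<ominus>\<^sub>M z : N" if "x : $M" "y : $M" "z : $M" "x \<ominus>\<^sub>M y : N" "y \<ominus>\<^sub>M z : N" for x y z
  using submoduleD(3)[OF N that(4,5)] M.diff_trans[OF that(1-3)] by simp
 show thesis
 proof (rule that[of "%x. \<iota> (rep x)"])
  show "\<iota> (rep x) = \<iota> (rep y) \<longleftrightarrow> x \<ominus>\<^sub>M y : N" if x: "x : $M" and y: "y : $M" for x y
  proof
   assume "\<iota> (rep x) = \<iota> (rep y)"
   then have "rep x = rep y" using \<iota> rep(1) x y by (simp add: inj_on_eq_iff)
   then show "x \<ominus>\<^sub>M y : N" using tr[OF x rep(1)[OF x] y rep(2)[OF x]] sym[OF y rep(1)[OF y] rep(2)[OF y]] by simp
  next
   assume xy: "x \<ominus>\<^sub>M y : N"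
   have "K x = K y" using tr[OF x y _ xy] tr[OF y x _ sym[OF x y xy]] by (auto simp: K_def)
   then show "\<iota> (rep x) = \<iota> (rep y)" by (simp add: rep_def)
  qed
 qed auto
qed

context graded_hypersurface
begin

text \<open>The quotient of the free module by \<open>N\<close>, realized on names of cosets so that
  its elements have the prescribed type. The operations go through representatives \<open>i\<close>
  and \<open>j\<close> of module elements and scalars; that \<open>N\<close> contains
  \<open>f F\<close> makes it a module over \<open>A\<close>.\<close>

lemma realize:
 fixes u :: "'s list => 'm"
 assumes u: "inj u" and N: "submodule N S (graded_free S m)"
  and gr: "!!x i. x : N ==> hc (graded_free S m) x i : N"
  and lm: "!!x. x : $(Fl m) ==> lml m x : N"
 obtains M :: "('s set, 'm, int) graded_module" and q where "gmodule A M" "cover m M q"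
  "!!x. x : $(Fl m) ==> q x = \<zero>\<^sub>M \<longleftrightarrow> x : N"
proof -
 let ?F = "graded_free S m"
 interpret F: gmodule S ?F by (rule gmodule_free)
 have "inj_on (%x. u (map x [0..<length m])) ($?F)"
 proof (rule inj_onI)
  fix x y assume xy: "x : $?F" "y : $?F" "u (map x [0..<length m]) = u (map y [0..<length m])"
  then have "map x [0..<length m] = map y [0..<length m]" using u by (simp add: inj_eq)
  then show "x = y" using xy by (intro free_eqI[of x S "{..<length m}" y]) auto
 qed
 then obtain q :: "(nat => 's) => 'm" where
  q: "!!x y. x : $?F ==> y : $?F ==> q x = q y \<longleftrightarrow> x \<ominus>\<^sub>?F y : N"
  using F.coset_names[OF N] by metis
 define i where "i = inv_into ($?F) q"
 define j where "j = inv_into ($S) p"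
 define M :: "('s set, 'm, int) graded_module" where "M =
  \<lparr>carrier = q ` $?F, mult = undefined, one = undefined, zero = q \<zero>\<^sub>?F,
   add = %a b. q (i a \<oplus>\<^sub>?F i b), smult = \<lambda>\<alpha> a. q (j \<alpha> \<odot>\<^sub>?F i a), part = %n. q ` part ?F n\<rparr>"
 have M: "$M = q ` $?F" "\<zero>\<^sub>M = q \<zero>\<^sub>?F" "part M n = q ` part ?F n"
  "x \<oplus>\<^sub>M y = q (i x \<oplus>\<^sub>?F i y)" "\<alpha> \<odot>\<^sub>M x = q (j \<alpha> \<odot>\<^sub>?F i x)" for n x y \<alpha>
  by (simp_all add: M_def)
 have i: "i (q x) : $?F" "q (i (q x)) = q x" if "x : $?F" for x
  unfolding i_def using inv_into_into[of "q x" q "$?F"] f_inv_into_f[of "q x" q "$?F"] that by simp_all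
 have iN: "i (q x) \<ominus>\<^sub>?F x : N" if "x : $?F" for x using q[OF i(1)[OF that] that] i(2)[OF that] by simp
 have Nc: "x : $?F" if "x : N" for x using submoduleD(1)[OF N] that by blast
 have add: "q x \<oplus>\<^sub>M q y = q (x \<oplus>\<^sub>?F y)" if x: "x : $?F" and y: "y : $?F" for x y
 proof -
  have "(i (q x) \<oplus>\<^sub>?F i (q y)) \<ominus>\<^sub>?F (x \<oplus>\<^sub>?F y) : N"
   unfolding F.M.diff_add_swap[OF i(1)[OF x] i(1)[OF y] x y] by (rule submoduleD(3)[OF N iN[OF x] iN[OF y]])
  then show ?thesis unfolding M(4) q[OF F.M.a_closed[OF i(1)[OF x] i(1)[OF y]] F.M.a_closed[OF x y]] .
 qed
 have smult: "p s \<odot>\<^sub>M q x = q (s \<odot>\<^sub>?F x)" if s: "s : $S" and x: "x : $?F" for s x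
 proof -
  have jp: "j (p s) : $S" "p (j (p s)) = p s" unfolding j_def using inv_into_into[of "p s" p "$S"] f_inv_into_f[of "p s" p "$S"] s by simp_all
  then have "p (j (p s) \<ominus> s) = \<zero>\<^sub>A" using s p_minus ring_hom_closed[OF p_hom s] by simp
  \<comment> \<open>Two lifts of a scalar differ by some \<open>f b\<close>. Acting by it gives
    \<open>(x f) b\<close>, and \<open>x f\<close> lies in \<open>F f = f F\<close>, which is
    contained in \<open>N\<close>.\<close>
  then obtain b where b: "b : $S" "j (p s) \<ominus> s = f \<otimes> b" using p_ker[of "j (p s) \<ominus> s"] jp s by auto
  let ?x = "i (q x)"
  note x' = i(1)[OF x]
  have "f \<odot>\<^sub>?F ?x : N"
  proof -
   obtain z where "z : $(Fl m)" "f \<odot>\<^bsub>Fl m\<^esub> ?x = lml m z" by (rule fmod_swap[OF fmod_Fr]) (use x' in auto)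
   then show ?thesis using lm by simp
  qed
  then have 1: "b \<odot>\<^sub>?F (f \<odot>\<^sub>?F ?x) : N" using submoduleD(4)[OF N b(1)] by blast
  have "b \<odot>\<^sub>?F (f \<odot>\<^sub>?F ?x) = (j (p s) \<ominus> s) \<odot>\<^sub>?F ?x"
   unfolding b(2) by (rule F.smult_assoc[OF f_closed b(1) x', symmetric])
  also have "\<dots> = j (p s) \<odot>\<^sub>?F ?x \<ominus>\<^sub>?F s \<odot>\<^sub>?F ?x"
   unfolding minus_eq F.M.minus_eq using F.smult_l_distr[OF jp(1) a_inv_closed[OF s] x'] F.smult_l_minus[OF s x'] by (simp only:)
  finally have 2: "j (p s) \<odot>\<^sub>?F ?x \<ominus>\<^sub>?F s \<odot>\<^sub>?F ?x : N" using 1 by (simp only:)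
  have "s \<odot>\<^sub>?F (?x \<ominus>\<^sub>?F x) = s \<odot>\<^sub>?F ?x \<ominus>\<^sub>?F s \<odot>\<^sub>?F x"
   unfolding F.M.minus_eq using F.smult_r_distr[OF s x' F.M.a_inv_closed[OF x]] F.smult_r_minus[OF s x] by (simp only:)
  then have 3: "s \<odot>\<^sub>?F ?x \<ominus>\<^sub>?F s \<odot>\<^sub>?F x : N" using submoduleD(4)[OF N s iN[OF x]] by (simp only:)
  have "j (p s) \<odot>\<^sub>?F ?x \<ominus>\<^sub>?F s \<odot>\<^sub>?F x : N"
   using submoduleD(3)[OF N 2 3] F.M.diff_trans[OF F.smult_closed[OF jp(1) x'] F.smult_closed[OF s x'] F.smult_closed[OF s x]] by (simp only:)
  then show ?thesis unfolding M(5) using q F.smult_closed[OF jp(1) x'] F.smult_closed[OF s x] by blast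
 qed
 have ag: "abelian_group M"
 proof (rule abelian_groupI; unfold M(1,2))
  show "\<exists>y\<in>q ` $?F. y \<oplus>\<^sub>M x = q \<zero>\<^sub>?F" if hyp: "x : q ` $?F" for x
  proof -
   obtain z where z: "z : $?F" "x = q z" using hyp by blast
   have "q (\<ominus>\<^sub>?F z) \<oplus>\<^sub>M x = q \<zero>\<^sub>?F"
    unfolding z(2) add[OF F.M.a_inv_closed[OF z(1)] z(1)] F.M.l_neg[OF z(1)] by (rule refl)
   then show ?thesis using F.M.a_inv_closed[OF z(1)] by blast
  qed
  show "x \<oplus>\<^sub>M y \<oplus>\<^sub>M z = x \<oplus>\<^sub>M (y \<oplus>\<^sub>M z)" "x \<oplus>\<^sub>M y = y \<oplus>\<^sub>M x"
   if xyz: "x : q ` $?F" "y : q ` $?F" "z : q ` $?F" for x y z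
  proof -
   obtain a b c where a: "a : $?F" "x = q a" and b: "b : $?F" "y = q b" and c: "c : $?F" "z = q c" using xyz by blast
   show "x \<oplus>\<^sub>M y \<oplus>\<^sub>M z = x \<oplus>\<^sub>M (y \<oplus>\<^sub>M z)"
    unfolding a(2) b(2) c(2) add[OF a(1) b(1)] add[OF b(1) c(1)] add[OF F.M.a_closed[OF a(1) b(1)] c(1)]
     add[OF a(1) F.M.a_closed[OF b(1) c(1)]] F.M.a_assoc[OF a(1) b(1) c(1)] by (rule refl)
   show "x \<oplus>\<^sub>M y = y \<oplus>\<^sub>M x" unfolding a(2) b(2) add[OF a(1) b(1)] add[OF b(1) a(1)] F.M.a_comm[OF a(1) b(1)] by (rule refl)
  qed
  show "x \<oplus>\<^sub>M y : q ` $?F" if hyp: "x : q ` $?F" "y : q ` $?F" for x y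
  proof -
   obtain a b where a: "a : $?F" "x = q a" and b: "b : $?F" "y = q b" using hyp by blast
   show ?thesis unfolding a(2) b(2) add[OF a(1) b(1)] by (rule imageI) (rule F.M.a_closed[OF a(1) b(1)])
  qed
  show "q \<zero>\<^sub>?F \<oplus>\<^sub>M x = x" if xq: "x : q ` $?F" for x
  proof -
   obtain a where a: "a : $?F" "x = q a" using xq by blast
   show ?thesis unfolding a(2) add[OF F.M.zero_closed a(1)] F.M.l_zero[OF a(1)] by (rule refl)
  qed
 qed (rule imageI, rule F.M.zero_closed)
 interpret M: abelian_group M by (rule ag)
 \<comment> \<open>Components are well defined on cosets because \<open>N\<close> contains the
   components of its elements.\<close>
 have \<pi>: "q (hc ?F (i (q x)) n) = q (hc ?F x n)" if x: "x : $?F" for x n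
 proof -
  have z: "i (q x) \<ominus>\<^sub>?F x : $?F" by (rule Nc[OF iN[OF x]])
  have "hc ?F ((i (q x) \<ominus>\<^sub>?F x) \<oplus>\<^sub>?F x) n = hc ?F (i (q x) \<ominus>\<^sub>?F x) n \<oplus>\<^sub>?F hc ?F x n"
   by (rule F.Mg.hc_add[OF z x])
  moreover have "(i (q x) \<ominus>\<^sub>?F x) \<oplus>\<^sub>?F x = i (q x)" by (rule F.M.minus_add_cancel[OF i(1)[OF x] x])
  ultimately have e: "hc ?F (i (q x)) n \<ominus>\<^sub>?F hc ?F x n = hc ?F (i (q x) \<ominus>\<^sub>?F x) n"
   using F.M.add_diff_cancel[OF F.Mg.hc_closed[OF z] F.Mg.hc_closed[OF x]] by (simp only:)
  show ?thesis unfolding q[OF F.Mg.hc_closed[OF i(1)[OF x]] F.Mg.hc_closed[OF x]] e by (rule gr[OF iN[OF x]])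
 qed
 have "gmodule A M"
 proof
  note hom = ring_hom_add[OF p_hom, symmetric] ring_hom_mult[OF p_hom, symmetric]
  have S: "\<exists>s\<in>$S. \<alpha> = p s" if "\<alpha> : $A" for \<alpha> using that unfolding p_surj[symmetric] by blast
  show "a \<odot>\<^sub>M x : $M" if hyp: "a : $A" "x : $M" for a x
  proof -
   obtain s y where s: "s : $S" "a = p s" and y: "y : $?F" "x = q y" using S[OF hyp(1)] hyp(2) unfolding M(1) by blast
   show ?thesis unfolding s(2) y(2) smult[OF s(1) y(1)] M(1) by (rule imageI) (rule F.smult_closed[OF s(1) y(1)])
  qed
  show "(a \<oplus>\<^sub>A b) \<odot>\<^sub>M x = a \<odot>\<^sub>M x \<oplus>\<^sub>M b \<odot>\<^sub>M x" if hyp: "a : $A" "b : $A" "x : $M" for a b x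
  proof -
   obtain s t y where s: "s : $S" "a = p s" and t: "t : $S" "b = p t" and y: "y : $?F" "x = q y"
    using S[OF hyp(1)] S[OF hyp(2)] hyp(3) unfolding M(1) by blast
   show ?thesis unfolding s(2) t(2) y(2) hom(1)[OF s(1) t(1)] smult[OF s(1) y(1)] smult[OF t(1) y(1)]
     smult[OF a_closed[OF s(1) t(1)] y(1)] add[OF F.smult_closed[OF s(1) y(1)] F.smult_closed[OF t(1) y(1)]]
     F.smult_l_distr[OF s(1) t(1) y(1)] by (rule refl)
  qed
  show "a \<odot>\<^sub>M (x \<oplus>\<^sub>M y) = a \<odot>\<^sub>M x \<oplus>\<^sub>M a \<odot>\<^sub>M y" if hyp: "a : $A" "x : $M" "y : $M" for a x y
  proof -
   obtain s z w where s: "s : $S" "a = p s" and z: "z : $?F" "x = q z" and w: "w : $?F" "y = q w"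
    using S[OF hyp(1)] hyp(2,3) unfolding M(1) by blast
   show ?thesis unfolding s(2) z(2) w(2) add[OF z(1) w(1)] smult[OF s(1) z(1)] smult[OF s(1) w(1)]
     smult[OF s(1) F.M.a_closed[OF z(1) w(1)]] add[OF F.smult_closed[OF s(1) z(1)] F.smult_closed[OF s(1) w(1)]]
     F.smult_r_distr[OF s(1) z(1) w(1)] by (rule refl)
  qed
  show "(a \<otimes>\<^sub>A b) \<odot>\<^sub>M x = b \<odot>\<^sub>M (a \<odot>\<^sub>M x)" if hyp: "a : $A" "b : $A" "x : $M" for a b x
  proof -
   obtain s t y where s: "s : $S" "a = p s" and t: "t : $S" "b = p t" and y: "y : $?F" "x = q y"
    using S[OF hyp(1)] S[OF hyp(2)] hyp(3) unfolding M(1) by blast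
   show ?thesis unfolding s(2) t(2) y(2) hom(2)[OF s(1) t(1)] smult[OF s(1) y(1)]
     smult[OF m_closed[OF s(1) t(1)] y(1)] smult[OF t(1) F.smult_closed[OF s(1) y(1)]]
     F.smult_assoc[OF s(1) t(1) y(1)] by (rule refl)
  qed
  show "\<one>\<^sub>A \<odot>\<^sub>M x = x" if hyp: "x : $M" for x
  proof -
   obtain y where y: "y : $?F" "x = q y" using hyp unfolding M(1) by blast
   show ?thesis unfolding y(2) ring_hom_one[OF p_hom, symmetric] smult[OF one_closed y(1)] F.smult_one[OF y(1)] by (rule refl)
  qed
  show "a \<odot>\<^sub>M x : part M (n + int k)" if hyp: "x : part M n" "a : part A k" for x n a k
  proof -
   obtain s y where sy: "s : part S k" "a = p s" "y : part ?F n" "x = q y" using hyp unfolding M(3) A_simps(6) by blast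
   then have "a \<odot>\<^sub>M x = q (s \<odot>\<^sub>?F y)" using smult Sg.part_closed F.Mg.part_closed by blast
   then show ?thesis using F.smult_part[OF sy(3,1)] unfolding M(3) by blast
  qed
  show "internally_graded M"
  proof (rule internally_gradedI(1)[OF ag, of "%n x. q (hc ?F (i x) n)"])
   show "subgroup (part M n) (add_monoid M)" for n
   proof (rule M.add.subgroupI)
    show "part M n \<subseteq> $M" unfolding M(1,3) using F.Mg.part_closed by blast
    show "part M n ~= {}" unfolding M(3) using F.Mg.part_zero by blast
    show "\<ominus>\<^sub>M x : part M n" if hyp: "x : part M n" for x
    proof -
     obtain y where y: "y : part ?F n" "x = q y" using hyp unfolding M(3) by blast
     have yc: "y : $?F" by (rule F.Mg.part_closed[OF y(1)])
     have "q (\<ominus>\<^sub>?F y) = \<ominus>\<^sub>M (q y)" by (rule additive_minus[OF F.M.abelian_group_axioms ag _ _ yc]) (use add M(1) in auto)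
     then show ?thesis using y F.Mg.part_neg[OF y(1)] unfolding M(3) by (metis imageI)
    qed
    show "x \<oplus>\<^sub>M y : part M n" if hyp: "x : part M n" "y : part M n" for x y
    proof -
     obtain z w where zw: "z : part ?F n" "x = q z" "w : part ?F n" "y = q w" using hyp unfolding M(3) by blast
     then have "x \<oplus>\<^sub>M y = q (z \<oplus>\<^sub>?F w)" using add F.Mg.part_closed by blast
     then show ?thesis using F.Mg.part_add[OF zw(1,3)] unfolding M(3) by blast
    qed
   qed
  next
   fix n x assume "x : $M"
   then obtain y where y: "y : $?F" "x = q y" unfolding M(1) by blast
   then show "q (hc ?F (i x) n) : part M n" unfolding M(3) using \<pi> F.Mg.hc_part by auto
  next
   fix x assume "x : $M"
   then obtain y where y: "y : $?F" "x = q y" unfolding M(1) by blast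
   let ?I = "{n. hc ?F y n ~= \<zero>\<^sub>?F}"
   have "q (finsum ?F (hc ?F y) ?I) = finsum M (%n. q (hc ?F y n)) ?I"
    by (rule additive_finsum[OF F.M.abelian_group_axioms ag]) (use add M(1) F.Mg.hc_closed[OF y(1)] in auto)
   then have "x = finsum M (%n. q (hc ?F y n)) ?I" using F.Mg.hc_sum[OF y(1)] y(2) by simp
   then show "\<exists>I. finite I & (\<forall>n. n \<notin> I \<longrightarrow> q (hc ?F (i x) n) = \<zero>\<^sub>M) & x = finsum M (%n. q (hc ?F (i x) n)) I"
    using F.Mg.hc_finite[OF y(1)] \<pi>[OF y(1)] y(2) M(2) by (intro exI[of _ ?I]) auto
  next
   fix n x y assume "x : $M" "y : $M"
   then obtain z w where zw: "z : $?F" "x = q z" "w : $?F" "y = q w" unfolding M(1) by blast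
   show "q (hc ?F (i (x \<oplus>\<^sub>M y)) n) = q (hc ?F (i x) n) \<oplus>\<^sub>M q (hc ?F (i y) n)"
    unfolding zw(2,4) add[OF zw(1,3)] \<pi>[OF zw(1)] \<pi>[OF zw(3)] \<pi>[OF F.M.a_closed[OF zw(1,3)]]
     F.Mg.hc_add[OF zw(1,3)] by (rule add[OF F.Mg.hc_closed[OF zw(1)] F.Mg.hc_closed[OF zw(3)], symmetric])
  next
   fix n k x assume "x : part M n"
   then obtain y where y: "y : part ?F n" "x = q y" unfolding M(3) by blast
   show "q (hc ?F (i x) k) = (if k = n then x else \<zero>\<^sub>M)"
    unfolding y(2) \<pi>[OF F.Mg.part_closed[OF y(1)]] F.Mg.hc_homogeneous[OF y(1)] M(2) by simp
  qed
 qed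
 moreover have "cover m M q" using add smult M(1,3) unfolding cover_def ghom_def rlin_def by simp
 moreover have "q x = \<zero>\<^sub>M \<longleftrightarrow> x : N" if "x : $(Fl m)" for x
 proof -
  have x: "x : $?F" using that by simp
  show ?thesis unfolding M(2) q[OF x F.M.zero_closed] F.M.diff_zero[OF x] by (rule refl)
 qed
 ultimately show thesis by (rule that)
qed

end

section \<open>The categories of graded modules and of matrix factorizations\<close>

lemma ghom_sum: "gmodule R N ==> ghom R M N g ==> ghom R M N h ==> ghom R M N (%x. g x \<oplus>\<^sub>N h x)"
proof -
 assume a: "gmodule R N" "ghom R M N g" "ghom R M N h"
 then interpret gmodule R N by simp
 show ?thesis using a rlin_sum[OF rmodule_axioms, of M g h] Mg.part_add by (simp add: ghom_def)
qed

lemma ghom_neg: "gmodule R N ==> ghom R M N g ==> ghom R M N (%x. \<ominus>\<^sub>N g x)"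
proof -
 assume a: "gmodule R N" "ghom R M N g"
 then interpret gmodule R N by simp
 show ?thesis using a rlin_neg[OF rmodule_axioms, of M g] Mg.part_neg by (simp add: ghom_def)
qed

lemma ghom_zero: "gmodule R N ==> ghom R M N (%x. \<zero>\<^sub>N)"
proof -
 assume a: "gmodule R N"
 then interpret gmodule R N by simp
 show ?thesis using rlin_const_zero[OF rmodule_axioms] by (simp add: ghom_def)
qed

lemma grmod_simps [simp]:
 "Obj (grmod R) = {M. gmodule R M & finitely_generated R M}"
 "$(Hom (grmod R) M N) = graded_hom R M N"
 "g \<otimes>\<^bsub>Hom (grmod R) M N\<^esub> h = (\<lambda>x\<in>$M. g x \<oplus>\<^sub>N h x)"
 "\<one>\<^bsub>Hom (grmod R) M N\<^esub> = (\<lambda>x\<in>$M. \<zero>\<^sub>N)"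
 "Comp (grmod R) L M N g h = compose ($L) g h"
 "Ident (grmod R) M = (\<lambda>x\<in>$M. x)" by (simp_all add: grmod_def hom_group_def gmodule_iff)

lemma graded_hom_restrict: "h : graded_hom R M N ==> restrict h ($M) = h" by (simp add: graded_hom_iff extensional_restrict)

lemma graded_hom_closed: "h : graded_hom R M N ==> x : $M ==> h x : $N"
 unfolding graded_hom_iff using ghomD(1) rlin_closed by metis

lemma graded_hom_add:
 "h : graded_hom R M N ==> x : $M ==> y : $M ==> h (x \<oplus>\<^sub>M y) = h x \<oplus>\<^sub>N h y"
 unfolding graded_hom_iff using ghomD(1) rlin_add by metis

lemma graded_hom_comp:
 assumes "gmodule R L" "g : graded_hom R M N" "h : graded_hom R L M" shows "compose ($L) g h : graded_hom R L N" unfolding compose_def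
 by (rule restrict_graded_hom[OF assms(1) ghom_comp]) (use assms in \<open>auto simp: graded_hom_iff\<close>)

lemma graded_hom_id: "gmodule R M ==> (\<lambda>x\<in>$M. x) : graded_hom R M M" by (rule restrict_graded_hom[OF _ ghom_id])

lemma graded_hom_sum:
 assumes "gmodule R M" "gmodule R N" "g : graded_hom R M N" "h : graded_hom R M N"
 shows "(\<lambda>x\<in>$M. g x \<oplus>\<^sub>N h x) : graded_hom R M N"
 by (rule restrict_graded_hom[OF assms(1) ghom_sum[OF assms(2)]]) (use assms in \<open>auto simp: graded_hom_iff\<close>)

lemma grmod_preadditive:
 "preadditive_category (grmod R :: (('a, 'm, int) graded_module, 'm => 'm) precategory)" unfolding preadditive_category_def
proof (intro conjI ballI)
 fix M N :: "('a, 'm, int) graded_module" assume "M : Obj (grmod R)" "N : Obj (grmod R)"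
 then have M: "gmodule R M" and N: "gmodule R N" by simp_all
 interpret N: gmodule R N by (rule N)
 show "comm_group (Hom (grmod R) M N)"
 proof (rule comm_groupI)
  show "\<one>\<^bsub>Hom (grmod R) M N\<^esub> : $(Hom (grmod R) M N)" by (simp add: restrict_graded_hom[OF M ghom_zero[OF N]])
  show "\<exists>h\<in>$(Hom (grmod R) M N). h \<otimes>\<^bsub>Hom (grmod R) M N\<^esub> g = \<one>\<^bsub>Hom (grmod R) M N\<^esub>"
   if "g : $(Hom (grmod R) M N)" for g using that restrict_graded_hom[OF M ghom_neg[OF N], of g] N.M.l_neg graded_hom_closed[of g R M N]
   by (intro bexI[of _ "\<lambda>x\<in>$M. \<ominus>\<^sub>N g x"] ext) (simp_all add: graded_hom_iff restrict_def)
  show "\<one>\<^bsub>Hom (grmod R) M N\<^esub> \<otimes>\<^bsub>Hom (grmod R) M N\<^esub> g = g" if "g : $(Hom (grmod R) M N)" for g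
   using that by (intro trans[OF _ graded_hom_restrict[of g R M N]]) (auto simp: graded_hom_closed[of g R M N] intro!: restrict_ext)
 qed (auto simp: graded_hom_sum[OF M N] N.M.a_ac graded_hom_closed[of _ R M N] intro!: restrict_ext)
next
 fix L M N :: "('a, 'm, int) graded_module" and g g' h h' assume o: "L : Obj (grmod R)" "M : Obj (grmod R)" "N : Obj (grmod R)"
  and g: "g : $(Hom (grmod R) M N)" "g' : $(Hom (grmod R) M N)"
  and h: "h : $(Hom (grmod R) L M)" "h' : $(Hom (grmod R) L M)"
 then show "Comp (grmod R) L M N (g \<otimes>\<^bsub>Hom (grmod R) M N\<^esub> g') h
   = Comp (grmod R) L M N g h \<otimes>\<^bsub>Hom (grmod R) L N\<^esub> Comp (grmod R) L M N g' h"
  by (auto simp: compose_def graded_hom_closed[of h R L M] intro!: restrict_ext)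
 show "Comp (grmod R) L M N g (h \<otimes>\<^bsub>Hom (grmod R) L M\<^esub> h')
   = Comp (grmod R) L M N g h \<otimes>\<^bsub>Hom (grmod R) L N\<^esub> Comp (grmod R) L M N g h'"
  using g h by (auto simp: compose_def graded_hom_closed[of _ R L M] graded_hom_add[of g R M N] intro!: restrict_ext)
next
 fix M N :: "('a, 'm, int) graded_module" and h assume "M : Obj (grmod R)" "N : Obj (grmod R)" "h : $(Hom (grmod R) M N)"
 then have M: "gmodule R M" and N: "gmodule R N" and h: "h : graded_hom R M N" by simp_all
 show "Comp (grmod R) M M N h (Ident (grmod R) M) = h" by (rule trans[OF _ graded_hom_restrict[OF h]]) (auto simp: compose_def intro!: restrict_ext)
 show "Comp (grmod R) M N N (Ident (grmod R) N) h = h"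
  by (rule trans[OF _ graded_hom_restrict[OF h]]) (auto simp: compose_def graded_hom_closed[OF h] intro!: restrict_ext)
next
 fix K L M N :: "('a, 'm, int) graded_module" and k g h assume "h : $(Hom (grmod R) K L)"
 then show "Comp (grmod R) K M N k (Comp (grmod R) K L M g h) = Comp (grmod R) K L N (Comp (grmod R) L M N k g) h"
  by (auto simp: compose_def graded_hom_closed[of h R K L] intro!: restrict_ext)
qed (auto simp: graded_hom_id graded_hom_comp)

lemma preadditive_full_subcategory:
 assumes "preadditive_category C" shows "preadditive_category (full_subcategory C \<X>)"
 using assms unfolding preadditive_category_def full_subcategory_def by simp

section \<open>Matrix factorizations and their morphisms\<close>

definition rk :: "'s factorization => nat" where "rk X = length (gen_degs X 0)"

context graded_hypersurface
begin

text \<open>All terms of a factorization have the same underlying free module and differ only in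
  their gradings.\<close>

abbreviation Fk where "Fk X \<equiv> Fr (rk X)"
abbreviation obj where "obj X \<equiv> is_factorization S f d X"
abbreviation NN where "NN \<equiv> NMF S f d"

lemma left_mult_lmul: "x : $(Fr r) ==> left_mult S f r x = lmul r x" by (simp add: left_mult_def lmul_def free_finite)

lemma left_mult_ext: "left_mult S f r : extensional ($(Fr r))" by (simp add: left_mult_def free_finite)

lemma obj_iff: "obj X \<longleftrightarrow> (\<forall>i. length (gen_degs X i) = rk X & gen_degs X (i + 2) = up (gen_degs X i) &
  ghom S (mf_term S X (i + 1)) (mf_term S X i) (diff X i) & diff X i : extensional ($(Fk X)) &
  (\<forall>x\<in>$(Fk X). diff X i (diff X (i + 1) x) = lmul (rk X) x))" (is "_ \<longleftrightarrow> ?R")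
proof
 assume "obj X"
 then obtain r where r: "!!i. length (gen_degs X i) = r" "!!i. gen_degs X (i + 2) = up (gen_degs X i)"
  "!!i. diff X i : graded_hom S (mf_term S X (i + 1)) (mf_term S X i)"
  "!!i. compose ($(mf_term S X (i + 2))) (diff X i) (diff X (i + 1)) = left_mult S f r" unfolding is_factorization_def by blast
 have rk: "rk X = r" using r(1) by (simp add: rk_def)
 have "diff X i (diff X (i + 1) x) = lmul r x" if "x : $(Fr r)" for i x
  using fun_cong[OF r(4)[of i], of x] that left_mult_lmul[OF that] by (simp add: compose_def r(1))
 then show ?R using r by (simp add: rk graded_hom_iff)
next
 assume R: ?R
 have "compose ($(mf_term S X (i + 2))) (diff X i) (diff X (i + 1)) = left_mult S f (rk X)" for i
  using R by (intro extensionalityI[of _ "$(Fk X)"] left_mult_ext) (auto simp: compose_def left_mult_lmul extensional_def)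
 then show "obj X" using R unfolding is_factorization_def by (intro exI[of _ "rk X"]) (simp add: graded_hom_iff)
qed

lemma obj_len: "obj X ==> length (gen_degs X i) = rk X"
 and obj_up: "obj X ==> gen_degs X (i + 2) = up (gen_degs X i)"
 and obj_ghom: "obj X ==> ghom S (mf_term S X (i + 1)) (mf_term S X i) (diff X i)"
 and obj_diff: "obj X ==> x : $(Fk X) ==> diff X i (diff X (i + 1) x) = lmul (rk X) x" unfolding obj_iff by simp_all

lemma obj_rlin: "obj X ==> rlin S (Fk X) (Fk X) (diff X i)" using ghomD(1)[OF obj_ghom, of X i] by (simp add: obj_len)

lemma obj_closed: "obj X ==> x : $(Fk X) ==> diff X i x : $(Fk X)" by (rule rlin_closed[OF obj_rlin])

lemma obj_mf: "obj X ==> matrix_factorization S A p f (rk X) (diff X)" by unfold_locales (auto simp: obj_rlin obj_diff)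

definition nhom where
 "nhom X Y h \<longleftrightarrow> (\<forall>i. ghom S (mf_term S X i) (mf_term S Y i) (h i)) &
   (\<forall>i. \<forall>x\<in>$(Fk X). h i (diff X i x) = diff Y i (h (i + 1) x))"

lemma nhom_ghom: "nhom X Y h ==> ghom S (mf_term S X i) (mf_term S Y i) (h i)"
 and nhom_diff: "nhom X Y h ==> x : $(Fk X) ==> h i (diff X i x) = diff Y i (h (i + 1) x)" by (simp_all add: nhom_def)

lemma nhom_rlin: "obj X ==> obj Y ==> nhom X Y h ==> rlin S (Fk X) (Fk Y) (h i)"
 using ghomD(1)[OF nhom_ghom, of X Y h i] by (simp add: obj_len)

lemma nhom_closed: "obj X ==> obj Y ==> nhom X Y h ==> x : $(Fk X) ==> h i x : $(Fk Y)"
 by (rule rlin_closed[OF nhom_rlin])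

lemma NMF_simps [simp]:
 "Obj NN = {X. obj X}"
 "Comp NN X Y Z g h = (%i. compose ($(mf_term S X i)) (g i) (h i))"
 "Ident NN X = (%i. \<lambda>x\<in>$(mf_term S X i). x)"
 "g \<otimes>\<^bsub>Hom NN X Y\<^esub> h = (%i. \<lambda>x\<in>$(mf_term S X i). g i x \<oplus>\<^bsub>mf_term S Y i\<^esub> h i x)"
 "\<one>\<^bsub>Hom NN X Y\<^esub> = (%i. \<lambda>x\<in>$(mf_term S X i). \<zero>\<^bsub>mf_term S Y i\<^esub>)"
 by (simp_all add: NMF_def hom_group_def)

lemma Hom_iff:
 assumes X: "obj X" and Y: "obj Y"
 shows "h : $(Hom NN X Y) \<longleftrightarrow> nhom X Y h & (\<forall>i. h i : extensional ($(Fk X)))"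
proof -
 have "compose ($(mf_term S X (i + 1))) (h i) (diff X i) = compose ($(mf_term S X (i + 1))) (diff Y i) (h (i + 1)) \<longleftrightarrow>
   (\<forall>x\<in>$(Fk X). h i (diff X i x) = diff Y i (h (i + 1) x))" for i
  unfolding compose_def using obj_len[OF X, of "i + 1"] by (auto simp: restrict_def fun_eq_iff)
 then show ?thesis by (auto simp: NMF_def nhom_def graded_hom_iff obj_len[OF X])
qed

lemma restrict_nhom:
 assumes X: "obj X" and Y: "obj Y" and h: "nhom X Y h" shows "(%i. restrict (h i) ($(Fk X))) : $(Hom NN X Y)"
proof -
 have "ghom S (mf_term S X i) (mf_term S Y i) (restrict (h i) ($(Fk X)))" for i
  using nhom_ghom[OF h, of i] ghom_cong[OF gmodule_free, of "gen_degs X i" "restrict (h i) ($(Fk X))" "h i"] by (simp add: obj_len[OF X])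
 then show ?thesis unfolding Hom_iff[OF X Y] using nhom_diff[OF h] obj_closed[OF X] by (auto simp: nhom_def)
qed

lemma Hom_eqI:
 assumes "obj X" "obj Y" "g : $(Hom NN X Y)" "h : $(Hom NN X Y)"
  and "!!i x. x : $(Fk X) ==> g i x = h i x" shows "g = h"
 using assms(3-5) unfolding Hom_iff[OF assms(1,2)] by (intro ext[of g h] extensionalityI[of "_ _" "$(Fk X)"]) auto

lemma nhom_comp: "obj X ==> obj Y ==> nhom Y Z g ==> nhom X Y h ==> nhom X Z (%i x. g i (h i x))"
 using nhom_diff[of X Y h] nhom_diff[of Y Z g] nhom_closed[of X Y h] ghom_comp[OF nhom_ghom[of X Y h] nhom_ghom[of Y Z g]] by (simp add: nhom_def)

lemma nhom_id: "nhom X X (%i x. x)" by (simp add: nhom_def ghom_id)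

lemma nhom_sum:
 assumes X: "obj X" and Y: "obj Y" and g: "nhom X Y g" and h: "nhom X Y h" shows "nhom X Y (%i x. g i x \<oplus>\<^bsub>Fk Y\<^esub> h i x)"
proof -
 have "ghom S (mf_term S X i) (mf_term S Y i) (%x. g i x \<oplus>\<^bsub>Fk Y\<^esub> h i x)" for i
  using ghom_sum[OF gmodule_free nhom_ghom[OF g, of i] nhom_ghom[OF h, of i]] by (simp add: obj_len[OF Y])
 then show ?thesis using nhom_diff[OF g] nhom_diff[OF h] rlin_add[OF obj_rlin[OF Y]] nhom_closed[OF X Y g] nhom_closed[OF X Y h]
  by (simp add: nhom_def)
qed

text \<open>Written as multiplication by -1, the negative uses the operations of \<open>Fk Y\<close>
  at every index, whereas a minus sign would refer to the graded module at index
  \<open>i\<close>.\<close>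

lemma nhom_neg:
 assumes X: "obj X" and Y: "obj Y" and g: "nhom X Y g" shows "nhom X Y (%i x. (\<ominus> \<one>) \<odot>\<^bsub>Fk Y\<^esub> g i x)"
proof -
 have "ghom S (mf_term S X i) (mf_term S Y i) (%x. (\<ominus> \<one>) \<odot>\<^bsub>Fk Y\<^esub> g i x)" for i
 proof -
  interpret F: gmodule S "mf_term S Y i" by (rule gmodule_free)
  interpret G: rmodule S "Fk Y" by (rule rmodule_Fr)
  have 1: "ghom S (mf_term S X i) (mf_term S Y i) (%x. \<ominus>\<^bsub>mf_term S Y i\<^esub> g i x)"
   by (rule ghom_neg[OF gmodule_free nhom_ghom[OF g]])
  have 2: "(\<ominus> \<one>) \<odot>\<^bsub>Fk Y\<^esub> g i x = \<ominus>\<^bsub>mf_term S Y i\<^esub> g i x" if "x : $(mf_term S X i)" for x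
   using F.smult_l_minus[of \<one> "g i x"] rlin_closed[OF ghomD(1)[OF nhom_ghom[OF g, of i]] that] by (simp add: obj_len[OF Y] G.smult_one)
  show ?thesis by (rule iffD2[OF ghom_cong[OF gmodule_free 2] 1])
 qed
 then show ?thesis using nhom_diff[OF g] rlin_smult[OF obj_rlin[OF Y]] nhom_closed[OF X Y g] by (simp add: nhom_def)
qed

lemma nhom_zero:
 assumes "obj X" "obj Y" shows "nhom X Y (%i x. \<zero>\<^bsub>Fk Y\<^esub>)"
proof -
 have "ghom S (mf_term S X i) (mf_term S Y i) (%x. \<zero>\<^bsub>Fk Y\<^esub>)" for i
 proof -
  have "ghom S (mf_term S X i) (mf_term S Y i) (%x. \<zero>\<^bsub>mf_term S Y i\<^esub>)" by (rule ghom_zero[OF gmodule_free])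
  then show ?thesis by (simp add: obj_len assms)
 qed
 then show ?thesis using rlin_zero[OF rmodule_Fr rmodule_Fr obj_rlin[OF assms(2)]] by (simp add: nhom_def)
qed

lemma Hom_nhom: "obj X ==> obj Y ==> h : $(Hom NN X Y) ==> nhom X Y h" by (simp add: Hom_iff)

lemma NMF_preadditive: "preadditive_category NN" unfolding preadditive_category_def
proof (intro conjI ballI)
 fix X Y assume "X : Obj NN" "Y : Obj NN"
 then have X: "obj X" and Y: "obj Y" by simp_all
 note len = obj_len[OF X] obj_len[OF Y] and H = Hom_nhom[OF X Y]
 interpret F: rmodule S "Fk Y" by (rule rmodule_Fr)
 have c: "h i x : $(Fk Y)" if "h : $(Hom NN X Y)" "x : $(Fk X)" for h i x by (rule nhom_closed[OF X Y H[OF that(1)] that(2)])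
 have m: "g \<otimes>\<^bsub>Hom NN X Y\<^esub> h : $(Hom NN X Y)" if "g : $(Hom NN X Y)" "h : $(Hom NN X Y)" for g h
  using restrict_nhom[OF X Y nhom_sum[OF X Y H[OF that(1)] H[OF that(2)]]] by (simp add: len)
 have o: "\<one>\<^bsub>Hom NN X Y\<^esub> : $(Hom NN X Y)" using restrict_nhom[OF X Y nhom_zero[OF X Y]] by (simp add: len)
 show "comm_group (Hom NN X Y)"
 proof (rule comm_groupI)
  show "\<exists>h\<in>$(Hom NN X Y). h \<otimes>\<^bsub>Hom NN X Y\<^esub> g = \<one>\<^bsub>Hom NN X Y\<^esub>" if g: "g : $(Hom NN X Y)" for g
  proof -
   let ?h = "%i. restrict (%x. (\<ominus> \<one>) \<odot>\<^bsub>Fk Y\<^esub> g i x) ($(Fk X))"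
   have h: "?h : $(Hom NN X Y)" by (rule restrict_nhom[OF X Y nhom_neg[OF X Y H[OF g]]])
   have "?h \<otimes>\<^bsub>Hom NN X Y\<^esub> g = \<one>\<^bsub>Hom NN X Y\<^esub>" by (rule Hom_eqI[OF X Y m[OF h g] o])
     (simp add: len c[OF g] F.smult_l_minus F.M.l_neg)
   then show ?thesis using h by blast
  qed
  show "\<one>\<^bsub>Hom NN X Y\<^esub> \<otimes>\<^bsub>Hom NN X Y\<^esub> g = g" if g: "g : $(Hom NN X Y)" for g
   by (rule Hom_eqI[OF X Y m[OF o g] g]) (simp add: len c[OF g])
  show "g \<otimes>\<^bsub>Hom NN X Y\<^esub> h = h \<otimes>\<^bsub>Hom NN X Y\<^esub> g" if "g : $(Hom NN X Y)" "h : $(Hom NN X Y)" for g h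
   by (rule Hom_eqI[OF X Y m[OF that] m[OF that(2,1)]]) (simp add: len c[OF that(1)] c[OF that(2)] F.M.a_comm)
  show "g \<otimes>\<^bsub>Hom NN X Y\<^esub> h \<otimes>\<^bsub>Hom NN X Y\<^esub> k = g \<otimes>\<^bsub>Hom NN X Y\<^esub> (h \<otimes>\<^bsub>Hom NN X Y\<^esub> k)"
   if "g : $(Hom NN X Y)" "h : $(Hom NN X Y)" "k : $(Hom NN X Y)" for g h k
   by (rule Hom_eqI[OF X Y m[OF m[OF that(1,2)] that(3)] m[OF that(1) m[OF that(2,3)]]])
    (simp add: len c[OF that(1)] c[OF that(2)] c[OF that(3)] F.M.a_assoc)
 qed (rule m o; assumption)+
next
 fix X Y Z g h assume "X : Obj NN" "Y : Obj NN" "Z : Obj NN" "g : $(Hom NN Y Z)" "h : $(Hom NN X Y)"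
 then show "Comp NN X Y Z g h : $(Hom NN X Z)"
  using restrict_nhom[of X Z, OF _ _ nhom_comp[of X Y Z g h]] by (simp add: Hom_nhom compose_def obj_len)
next
 fix X assume "X : Obj NN"
 then show "Ident NN X : $(Hom NN X X)" using restrict_nhom[of X X, OF _ _ nhom_id] by (simp add: obj_len)
next
 fix X Y h assume a: "X : Obj NN" "Y : Obj NN" "h : $(Hom NN X Y)"
 then have X: "obj X" and Y: "obj Y" by simp_all
 note h = a(3)[unfolded Hom_iff[OF X Y]]
 have e: "restrict (h i) ($(Fk X)) = h i" for i using h by (simp add: extensional_restrict)
 let ?C = "$(Fk X)"
 have "restrict (%x. h i (restrict (%x. x) ?C x)) ?C = h i" for i by (rule trans[OF _ e]) (auto simp: restrict_def)
 then show "Comp NN X X Y h (Ident NN X) = h" by (simp add: compose_def obj_len[OF X])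
 have "restrict (%x. restrict (%x. x) ($(Fk Y)) (h i x)) ?C = h i" for i
  by (rule trans[OF _ e]) (use nhom_closed[OF X Y, of h] h in \<open>auto simp: restrict_def\<close>)
 then show "Comp NN X Y Y (Ident NN Y) h = h" by (simp add: compose_def obj_len[OF X] obj_len[OF Y])
next
 fix W X Y Z k g h assume "W : Obj NN" "X : Obj NN" "h : $(Hom NN W X)"
 then show "Comp NN W Y Z k (Comp NN W X Y g h) = Comp NN W X Z (Comp NN X Y Z k g) h"
  using nhom_closed[of W X h] by (simp add: compose_def obj_len Hom_nhom restrict_def fun_eq_iff)
next
 fix X Y Z g g' h h' assume a: "X : Obj NN" "Y : Obj NN" "Z : Obj NN" "g : $(Hom NN Y Z)" "g' : $(Hom NN Y Z)"
   "h : $(Hom NN X Y)" "h' : $(Hom NN X Y)"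
 then have X: "obj X" and Y: "obj Y" and Z: "obj Z" by simp_all
 note len = obj_len[OF X] obj_len[OF Y] obj_len[OF Z]
 note c = nhom_closed[OF X Y Hom_nhom[OF X Y a(6)]] nhom_closed[OF X Y Hom_nhom[OF X Y a(7)]]
 show "Comp NN X Y Z (g \<otimes>\<^bsub>Hom NN Y Z\<^esub> g') h = Comp NN X Y Z g h \<otimes>\<^bsub>Hom NN X Z\<^esub> Comp NN X Y Z g' h"
  using c by (simp add: compose_def len restrict_def fun_eq_iff)
 show "Comp NN X Y Z g (h \<otimes>\<^bsub>Hom NN X Y\<^esub> h') = Comp NN X Y Z g h \<otimes>\<^bsub>Hom NN X Z\<^esub> Comp NN X Y Z g h'"
  using c rlin_add[OF nhom_rlin[OF Y Z Hom_nhom[OF Y Z a(4)]]] by (simp add: compose_def len restrict_def fun_eq_iff)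
qed

end

section \<open>The cokernel functor\<close>

context graded_hypersurface
begin

lemma twist_ghom:
 assumes h: "ghom S (graded_free S m) (graded_free S n) h"
 obtains c where "ghom S (graded_free S (up m)) (graded_free S (up n)) c"
  "!!x. x : $(Fl m) ==> h (lml m x) = lml n (c x)"
proof -
 have h': "rlin S (Fl m) (Fl n) h" using h by (simp add: ghom_def)
 obtain c where c: "rlin S (Fl m) (Fl n) c"
  "!!x. x : $(Fl m) ==> h (lml m x) = lml n (c x)" by (rule twist[OF fmod_Fr fmod_Fr h']) (rule that; assumption)
 have "c x : part (graded_free S (up n)) i" if x: "x : part (graded_free S (up m)) i" for x i
 proof -
  have xc: "x : $(Fl m)" using part_graded_free_closed[OF x] by simp
  have "h (lml m x) : part (graded_free S n) i" using ghomD(2)[OF h] lmul_part[OF xc, of i] x by simp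
  then show ?thesis using lmul_part[OF rlin_closed[OF c(1) xc], of i] c(2)[OF xc] by simp
 qed
 then show thesis using c by (intro that[of c]) (auto simp: ghom_def)
qed

lemma untwist_ghom:
 assumes h: "ghom S (graded_free S (up m)) (graded_free S (up n)) h"
 obtains c where "ghom S (graded_free S m) (graded_free S n) c"
  "!!x. x : $(Fl m) ==> c (lml m x) = lml n (h x)"
proof -
 have h': "rlin S (Fl m) (Fl n) h" using h by (simp add: ghom_def)
 obtain c where c: "rlin S (Fl m) (Fl n) c"
  "!!x. x : $(Fl m) ==> c (lml m x) = lml n (h x)" by (rule untwist[OF fmod_Fr fmod_Fr h']) (rule that; assumption)
 have "c x : part (graded_free S n) i" if x: "x : part (graded_free S m) i" for x i
 proof -
  have xc: "x : $(Fl m)" by (rule part_graded_free_closed[OF x])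
  obtain z where z: "z : $(Fl m)" "f \<odot>\<^bsub>Fl m\<^esub> x = lml m z" by (rule fmod_swap[OF fmod_Fr xc])
  have "lml m z : part (graded_free S m) (i + int d)" using smult_f_part[OF xc, of i] x z(2) by simp
  then have "h z : part (graded_free S (up n)) (i + int d)" using lmul_part[OF z(1)] ghomD(2)[OF h] by blast
  then have "lml n (h z) : part (graded_free S n) (i + int d)" using lmul_part[OF rlin_closed[OF h' z(1)]] by blast
  moreover have "lml n (h z) = f \<odot>\<^bsub>Fl n\<^esub> c x" using c(2)[OF z(1)] z(2) rlin_smult[OF c(1) f_closed xc] by simp
  ultimately show ?thesis using smult_f_part[OF rlin_closed[OF c(1) xc], of i] by simp
 qed
 then show thesis using c by (intro that[of c]) (auto simp: ghom_def)
qed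

lemma extend_step:
 assumes X: "obj X" and Y: "obj Y" and a: "ghom S (mf_term S X i) (mf_term S Y i) a"
  and im: "!!x. x : $(Fk X) ==> a (diff X i x) : diff Y i ` $(Fk Y)"
 obtains b where "ghom S (mf_term S X (i + 1)) (mf_term S Y (i + 1)) b"
  "!!x. x : $(Fk X) ==> a (diff X i x) = diff Y i (b x)"
proof -
 obtain b where "ghom S (mf_term S X (i + 1)) (mf_term S Y (i + 1)) b"
  "!!x. x : $(mf_term S X (i + 1)) ==> diff Y i (b x) = a (diff X i x)"
  by (rule ghom_lift[OF gmodule_free gmodule_free obj_ghom[OF Y] ghom_comp[OF obj_ghom[OF X] a]])
   (use im in \<open>simp_all add: obj_len[OF X] obj_len[OF Y] \<close>, (rule that; assumption)?)
 then show thesis using that by (simp add: obj_len[OF X])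
qed

text \<open>Upwards, components are lifted through \<open>diff Y\<close>; the values are in its
  image because \<open>diff Y i\<close> sends them into \<open>f F\<close>. Downwards the component
  at \<open>i\<close> is the untwist of the one at \<open>i + 2\<close>, and compatibility with the
  differentials follows after composing with \<open>f\<close>.\<close>

lemma extend_hom:
 assumes X: "obj X" and Y: "obj Y" and h: "ghom S (mf_term S X 0) (mf_term S Y 0) h0"
  and im: "!!x. x : $(Fk X) ==> h0 (diff X 0 x) : diff Y 0 ` $(Fk Y)"
 obtains h where "h : $(Hom NN X Y)" "!!x. x : $(Fk X) ==> h 0 x = h0 x"
proof -
 interpret MX: matrix_factorization S A p f "rk X" "diff X" by (rule obj_mf[OF X])
 interpret MY: matrix_factorization S A p f "rk Y" "diff Y" by (rule obj_mf[OF Y])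
 have lin: "rlin S (Fk X) (Fk Y) a" if "ghom S (mf_term S X i) (mf_term S Y i) a" for a i
  using ghomD(1)[OF that] by (simp add: obj_len[OF X] obj_len[OF Y])
 \<comment> \<open>Pairs of consecutive components, since the step down to index \<open>i\<close>
   needs the component at \<open>i + 2\<close>.\<close>
 define P where "P i t \<longleftrightarrow> (case t of (a, b) => ghom S (mf_term S X i) (mf_term S Y i) a &
   ghom S (mf_term S X (i + 1)) (mf_term S Y (i + 1)) b & (\<forall>x\<in>$(Fk X). a (diff X i x) = diff Y i (b x)))" for i t
 obtain h1 where "ghom S (mf_term S X (0 + 1)) (mf_term S Y (0 + 1)) h1"
  "!!x. x : $(Fk X) ==> h0 (diff X 0 x) = diff Y 0 (h1 x)" using extend_step[OF X Y h im] by blast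
 then have P0: "P 0 (h0, h1)" using h by (simp add: P_def)
 have up: "\<exists>t'. P (i + 1) t' & snd t = fst t'" if hyp: "P i t" for i t
 proof -
  obtain a b where t: "t = (a, b)" by (cases t)
  have a: "ghom S (mf_term S X i) (mf_term S Y i) a" and b: "ghom S (mf_term S X (i + 1)) (mf_term S Y (i + 1)) b"
   and ab: "!!x. x : $(Fk X) ==> a (diff X i x) = diff Y i (b x)" using hyp by (auto simp: P_def t)
  have "b (diff X (i + 1) x) : diff Y (i + 1) ` $(Fk Y)" if x: "x : $(Fk X)" for x
  proof -
   have x1: "diff X (i + 1) x : $(Fk X)" by (rule obj_closed[OF X x])
   have "diff Y i (b (diff X (i + 1) x)) = a (lmul (rk X) x)" using ab[OF x1] obj_diff[OF X x] by simp
   also have "\<dots> : lmul (rk Y) ` $(Fk Y)" by (rule fmod_image[OF fmod_Fr rmodule_Fr fmod_Fr lin[OF a] x])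
   finally show ?thesis using MY.\<phi>_image_iff[OF rlin_closed[OF lin[OF b] x1]] by simp
  qed
  then obtain c where "ghom S (mf_term S X (i + 1 + 1)) (mf_term S Y (i + 1 + 1)) c"
   "!!x. x : $(Fk X) ==> b (diff X (i + 1) x) = diff Y (i + 1) (c x)" using extend_step[OF X Y b] by blast
  then have "P (i + 1) (b, c)" using b by (simp add: P_def)
  then show ?thesis using t by auto
 qed
 have down: "\<exists>t. P i t & snd t = fst t'" if hyp: "P (i + 1) t'" for i t'
 proof -
  obtain b c where t: "t' = (b, c)" by (cases t')
  have b: "ghom S (mf_term S X (i + 1)) (mf_term S Y (i + 1)) b" and c: "ghom S (mf_term S X (i + 2)) (mf_term S Y (i + 2)) c"
   and bc: "!!x. x : $(Fk X) ==> b (diff X (i + 1) x) = diff Y (i + 1) (c x)" using hyp by (auto simp: P_def t add.assoc)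
  have "ghom S (graded_free S (up (gen_degs X i))) (graded_free S (up (gen_degs Y i))) c" using c by (simp add: obj_up[OF X] obj_up[OF Y])
  then obtain a where a: "ghom S (mf_term S X i) (mf_term S Y i) a"
   "!!x. x : $(Fk X) ==> a (lmul (rk X) x) = lmul (rk Y) (c x)"
   using untwist_ghom[of "gen_degs X i" "gen_degs Y i" c] unfolding obj_len[OF X] obj_len[OF Y] by blast
  have "a (diff X i x) = diff Y i (b x)" if x: "x : $(Fk X)" for x
  proof (rule fmod_right_cancel[OF fmod_Fr fmod_Fr _ _ _ x])
   show "rlin S (Fk X) (Fk Y) (%x. a (diff X i x))" by (rule rlin_comp[OF obj_rlin[OF X] lin[OF a(1)]])
   show "rlin S (Fk X) (Fk Y) (%x. diff Y i (b x))" by (rule rlin_comp[OF lin[OF b] obj_rlin[OF Y]])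
   fix y assume y: "y : $(Fk X)"
   let ?y = "diff X (i + 2) y"
   have y2: "?y : $(Fk X)" by (rule obj_closed[OF X y])
   have e: "lmul (rk X) y = diff X (i + 1) ?y" using obj_diff[OF X y, of "i + 1"] by (simp add: add.assoc)
   have "a (diff X i (lmul (rk X) y)) = a (lmul (rk X) ?y)" unfolding e obj_diff[OF X y2] by (rule refl)
   also have "\<dots> = diff Y i (diff Y (i + 1) (c ?y))" using a(2)[OF y2] obj_diff[OF Y rlin_closed[OF lin[OF c] y2]] by simp
   also have "\<dots> = diff Y i (b (lmul (rk X) y))" unfolding e bc[OF y2] by (rule refl)
   finally show "a (diff X i (lmul (rk X) y)) = diff Y i (b (lmul (rk X) y))" .
  qed
  then have "P i (a, b)" using a(1) b by (simp add: P_def)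
  then show ?thesis using t by auto
 qed
 obtain t where t: "t 0 = (h0, h1)" "!!i. P i (t i)" "!!i. snd (t i) = fst (t (i + 1))"
  using int_chain[of P "(h0, h1)" "%_ t t'. snd t = fst t'"] P0 up down by metis
 have "nhom X Y (%i. fst (t i))" unfolding nhom_def
 proof (intro conjI allI ballI)
  fix i x
  show "ghom S (mf_term S X i) (mf_term S Y i) (fst (t i))" using t(2)[of i] by (simp add: P_def case_prod_beta)
  assume "x : $(Fk X)"
  then show "fst (t i) (diff X i x) = diff Y i (fst (t (i + 1)) x)" using t(2)[of i] t(3)[of i] by (simp add: P_def case_prod_beta)
 qed
 from restrict_nhom[OF X Y this] show thesis by (rule that) (simp add: t(1))
qed

text \<open>Upwards because \<open>diff Y\<close> is injective. Downwards two components agree on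
  \<open>f F\<close>, as \<open>f x\<close> lies in the image of \<open>diff X\<close>, and
  \<open>f\<close> can be cancelled on the right.\<close>

lemma Hom_determined:
 assumes X: "obj X" and Y: "obj Y" and g: "g : $(Hom NN X Y)" and h: "h : $(Hom NN X Y)"
  and e: "!!x. x : $(Fk X) ==> g 0 x = h 0 x" shows "g = h"
proof (rule Hom_eqI[OF X Y g h])
 interpret MY: matrix_factorization S A p f "rk Y" "diff Y" by (rule obj_mf[OF Y])
 note g' = Hom_nhom[OF X Y g] and h' = Hom_nhom[OF X Y h]
 fix i x
 have "\<forall>x\<in>$(Fk X). g i x = h i x"
 proof (induction i rule: int_induct[of _ 0])
  case (step1 i)
  then show ?case using nhom_diff[OF g', of _ i] nhom_diff[OF h', of _ i] obj_closed[OF X, of _ i]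
    MY.\<phi>_inj[OF nhom_closed[OF X Y g'] nhom_closed[OF X Y h'], of _ _ i] by metis
 next
  case (step2 i)
  show ?case
  proof
   fix x assume x: "x : $(Fk X)"
   show "g (i - 1) x = h (i - 1) x"
   proof (rule fmod_right_cancel[OF fmod_Fr fmod_Fr nhom_rlin[OF X Y g'] nhom_rlin[OF X Y h'] _ x])
    fix y assume y: "y : $(Fk X)"
    have yc: "diff X i y : $(Fk X)" by (rule obj_closed[OF X y])
    have "lmul (rk X) y = diff X (i - 1) (diff X i y)" using obj_diff[OF X y, of "i - 1"] by simp
    then show "g (i - 1) (lmul (rk X) y) = h (i - 1) (lmul (rk X) y)"
     using nhom_diff[OF g' yc, of "i - 1"] nhom_diff[OF h' yc, of "i - 1"] step2.IH yc by simp
   qed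
  qed
 qed (use e in blast)
 then show "x : $(Fk X) ==> g i x = h i x" by blast
qed

lemma TR_simps [simp]:
 fixes M N :: "('s set, 'm, int) graded_module"
 shows "Obj (TR S f) = {M :: ('s set, 'm, int) graded_module. gmodule A M & finitely_generated A M &
   totally_reflexive A M & projective_dim S (res p M) < \<infinity>}"
  and "Hom (TR S f) M N = Hom (grmod A) M N"
  and "Comp (TR S f) L M N g h = Comp (grmod A) L M N g h" and "Ident (TR S f) M = Ident (grmod A) M" by (auto simp: TR_def full_subcategory_def)

definition presents :: "'s factorization => ('s set, 'm, int) graded_module => ((nat => 's) => 'm) => bool" where
 "presents X M q \<longleftrightarrow> gmodule A M & cover (gen_degs X 0) M q &
   (\<forall>x\<in>$(Fk X). q x = \<zero>\<^sub>M \<longleftrightarrow> x : diff X 0 ` $(Fk X))"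

lemma presents_exists:
 fixes u :: "'s list => 'm"
 assumes u: "inj u" and X: "obj X"
 obtains M :: "('s set, 'm, int) graded_module" and q where "presents X M q"
proof -
 interpret MX: matrix_factorization S A p f "rk X" "diff X" by (rule obj_mf[OF X])
 let ?F = "mf_term S X 0" and ?G = "mf_term S X (0 + 1)"
 interpret F: gmodule S ?F by (rule gmodule_free)
 interpret G: gmodule S ?G by (rule gmodule_free)
 let ?N = "diff X 0 ` $?G"
 note gh = obj_ghom[OF X, of 0]
 have N: "submodule ?N S ?F" by (rule submodule_image[OF G.rmodule_axioms F.rmodule_axioms ghomD(1)[OF gh]])
 have gr: "hc ?F x i : ?N" if xN: "x : ?N" for x i
 proof -
  obtain y where y: "y : $?G" "x = diff X 0 y" using xN by blast
  have "hc ?F (diff X 0 y) i = diff X 0 (hc ?G y i)"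
   by (rule hc_hom[OF G.Mg.graded_group_axioms F.Mg.graded_group_axioms _ rlin_add[OF ghomD(1)[OF gh]] ghomD(2)[OF gh] y(1)])
    (use rlin_closed[OF ghomD(1)[OF gh]] in auto)
  then show ?thesis using G.Mg.hc_closed[OF y(1)] y(2) by blast
 qed
 have lm: "lmul (rk X) x : ?N" if "x : $(Fk X)" for x
  using imageI[OF obj_closed[OF X that, of "0 + 1"], of "diff X 0"] unfolding obj_diff[OF X that, of 0] by (simp add: obj_len[OF X])
 have "lmul (length (gen_degs X 0)) x : ?N" if "x : $(Fr (length (gen_degs X 0)))" for x using lm that unfolding obj_len[OF X] by blast
 from realize[OF u N gr this] obtain M :: "('s set, 'm, int) graded_module" and q where
  M: "gmodule A M" "cover (gen_degs X 0) M q"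
  "!!x. x : $(Fr (length (gen_degs X 0))) ==> q x = \<zero>\<^sub>M \<longleftrightarrow> x : ?N" by blast
 then have "presents X M q" by (simp add: presents_def obj_len[OF X])
 then show thesis by (rule that)
qed

lemma presents_coker_map:
 assumes X: "obj X" and M: "presents X M q" shows "matrix_factorization.coker_map S p (rk X) (diff X) M q"
proof -
 interpret MX: matrix_factorization S A p f "rk X" "diff X" by (rule obj_mf[OF X])
 show ?thesis using M cover_rlin[of "gen_degs X 0" M q] cover_surj[of "gen_degs X 0" M q]
  unfolding MX.coker_map_def by (simp add: presents_def obj_len[OF X])
qed

text \<open>As \<open>diff X 0\<close> is injective, the presentation is already a free resolution
  of length one over \<open>S\<close>.\<close>

lemma presents_projective_dim:
 fixes M :: "('s set, 'm, int) graded_module"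
 assumes X: "obj X" and M: "presents X M q" shows "projective_dim S (res p M) < \<infinity>"
proof -
 interpret MX: matrix_factorization S A p f "rk X" "diff X" by (rule obj_mf[OF X])
 interpret M: gmodule A M using M by (simp add: presents_def)
 interpret Fr: rmodule S "Fr r" for r by (rule rmodule_Fr)
 note q = presents_coker_map[OF X M, unfolded MX.coker_map_def]
 define k :: "nat => nat" where "k n = (if n \<le> 1 then rk X else 0)" for n
 define e where "e n = (if n = 0 then diff X 0 else (%x. \<zero>\<^bsub>Fr (k n)\<^esub>))" for n :: nat
 have "resol S (res p M) (%n. Fr (k n)) e q" unfolding resol_def
 proof (intro conjI allI ballI)
  fix n :: nat
  show "projective_module S (Fr (k n))" by (rule projective_free[OF ring_axioms])
  show "rlin S (Fr (k (Suc n))) (Fr (k n)) (e n)"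
  proof (cases "n = 0")
   case True
   then show ?thesis using obj_rlin[OF X] by (simp add: e_def k_def)
  next
   case False
   then show ?thesis unfolding e_def by simp (rule rlin_const_zero[OF rmodule_Fr])
  qed
  have z: "$(free S ({} :: nat set)) = {\<zero>\<^bsub>free S {}\<^esub>}" by (simp add: free_finite free_simps(2) restrict_def)
  show "e n x = \<zero>\<^bsub>Fr (k n)\<^esub> \<longleftrightarrow> x : e (Suc n) ` $(Fr (k (Suc (Suc n))))" if x: "x : $(Fr (k (Suc n)))" for x
  proof (cases n)
   case 0
   have "diff X 0 x = \<zero>\<^bsub>Fk X\<^esub> \<longleftrightarrow> x = \<zero>\<^bsub>Fk X\<^esub>"
    using MX.\<phi>_inj[of x "\<zero>\<^bsub>Fk X\<^esub>" 0] x 0 rlin_zero[OF rmodule_Fr rmodule_Fr obj_rlin[OF X]] by (simp add: k_def)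
   then show ?thesis using 0 z by (simp add: e_def k_def)
  next
   case (Suc m)
   then show ?thesis using x z by (simp add: e_def k_def)
  qed
 qed (use q in \<open>auto simp: k_def e_def\<close>)
 from finite_free_resolution[OF rmodule_res[OF M.rmodule_axioms] this]
 obtain P :: "nat => ('s, ('s, 'm) resolution_elem) module" and d' e' where
  P: "projective_resolution S (res p M) P d' e'" "!!n. k n = 0 ==> $(P n) = {\<zero>\<^bsub>P n\<^esub>}" by blast
 have "\<forall>i>1. $(P i) = {\<zero>\<^bsub>P i\<^esub>}" using P(2) by (simp add: k_def)
 then have "projective_dim S (res p M) \<le> enat 1" unfolding projective_dim_def using P(1) by (intro Inf_lower) blast
 then show ?thesis using enat_ord_simps(4) le_less_trans by blast
qed

lemma presents_TR:
 assumes X: "obj X" and M: "presents X M q" shows "M : Obj (TR S f)"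
proof -
 interpret MX: matrix_factorization S A p f "rk X" "diff X" by (rule obj_mf[OF X])
 interpret M: gmodule A M using M by (simp add: presents_def)
 show ?thesis using M.gmodule_axioms cover_fg[OF M.gmodule_axioms, of "gen_degs X 0" q] presents_projective_dim[OF X M]
   MX.coker_totally_reflexive[OF M.rmodule_axioms presents_coker_map[OF X M]] M by (simp add: presents_def)
qed

end

section \<open>The trivial factorizations\<close>

context graded_hypersurface
begin

text \<open>Covers both kinds at once: \<open>b\<close> tells whether the identities sit at the even
  or at the odd indices.\<close>

lemma trivial_obj:
 assumes len: "!!i. length (gen_degs X i) = r"
  and 1: "!!i. (even i \<longleftrightarrow> b) ==> gen_degs X (i + 1) = gen_degs X i & diff X i = (\<lambda>x\<in>$(Fr r). x)"
  and 2: "!!i. \<not> (even i \<longleftrightarrow> b) ==> gen_degs X (i + 1) = up (gen_degs X i) & diff X i = left_mult S f r"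
 shows "obj X" unfolding obj_iff
proof (intro allI conjI ballI)
 fix i
 have rk: "rk X = r" using len by (simp add: rk_def)
 then show "length (gen_degs X i) = rk X" using len by simp
 have d: "diff X i x = (if even i \<longleftrightarrow> b then x else lmul r x)" if "x : $(Fr r)" for i x
  using 1[of i] 2[of i] that left_mult_lmul[OF that] by auto
 show "gen_degs X (i + 2) = up (gen_degs X i)"
  using 1[of i] 2[of i] 1[of "i + 1"] 2[of "i + 1"] by (cases "even i \<longleftrightarrow> b") (auto simp: add.assoc)
 show "diff X i : extensional ($(Fk X))" using 1[of i] 2[of i] left_mult_ext rk by (cases "even i \<longleftrightarrow> b") auto
 show "diff X i (diff X (i + 1) x) = lmul (rk X) x" if "x : $(Fk X)" for x
  using that rlin_closed[OF lmul_rlin, of x r] unfolding rk by (auto simp: d)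
 show "ghom S (mf_term S X (i + 1)) (mf_term S X i) (diff X i)"
 proof -
  have c: "$(mf_term S X (i + 1)) = $(Fr r)" using len[of "i + 1"] by simp
  have "ghom S (mf_term S X (i + 1)) (mf_term S X i) (%x. if even i \<longleftrightarrow> b then x else lmul r x)"
  proof (cases "even i \<longleftrightarrow> b")
   case True
   then show ?thesis using 1[of i] by (simp add: ghom_id)
  next
   case False
   then show ?thesis using 2[of i] len[of i] lmul_rlin[of r] lmul_part[OF part_graded_free_closed[of _ "up (gen_degs X i)", simplified]]
    by (simp add: ghom_def)
  qed
  moreover have "diff X i x = (if even i \<longleftrightarrow> b then x else lmul r x)" if "x : $(mf_term S X (i + 1))" for x
   using d that c by simp
  ultimately show ?thesis by (rule iffD2[OF ghom_cong[OF gmodule_free], rotated])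
 qed
qed

lemma phi_left_simps: "obj (phi_left S f d m)" "rk (phi_left S f d m) = length m" "gen_degs (phi_left S f d m) 0 = m"
 "x : $(Fl m) ==> diff (phi_left S f d m) 0 x = x"
proof -
 show "obj (phi_left S f d m)"
 proof (rule trivial_obj[of _ "length m" True])
  fix i :: int
  show "gen_degs (phi_left S f d m) (i + 1) = gen_degs (phi_left S f d m) i &
    diff (phi_left S f d m) i = (\<lambda>x\<in>$(Fl m). x)" if "even i \<longleftrightarrow> True"
  proof -
   have "(i + 1) div 2 = i div 2" using that by presburger
   then show ?thesis using that by (simp add: phi_left_def)
  qed
  show "gen_degs (phi_left S f d m) (i + 1) = up (gen_degs (phi_left S f d m) i) &
    diff (phi_left S f d m) i = left_mult S f (length m)" if "\<not> (even i \<longleftrightarrow> True)"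
  proof -
   have "(i + 1) div 2 = i div 2 + 1" using that by presburger
   then show ?thesis using that by (simp add: phi_left_def distrib_right add.assoc)
  qed
 qed (simp add: phi_left_def)
qed (auto simp: phi_left_def rk_def)

lemma phi_right_simps: "obj (phi_right S f d m)" "rk (phi_right S f d m) = length m" "gen_degs (phi_right S f d m) 0 = m"
 "x : $(Fl m) ==> diff (phi_right S f d m) 0 x = lml m x"
proof -
 show "obj (phi_right S f d m)"
 proof (rule trivial_obj[of _ "length m" False])
  fix i :: int
  show "gen_degs (phi_right S f d m) (i + 1) = gen_degs (phi_right S f d m) i &
    diff (phi_right S f d m) i = (\<lambda>x\<in>$(Fl m). x)" if "even i \<longleftrightarrow> False"
  proof -
   have "(i + 1 + 1) div 2 = (i + 1) div 2" using that by presburger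
   then show ?thesis using that by (simp add: phi_right_def)
  qed
  show "gen_degs (phi_right S f d m) (i + 1) = up (gen_degs (phi_right S f d m) i) &
    diff (phi_right S f d m) i = left_mult S f (length m)" if "\<not> (even i \<longleftrightarrow> False)"
  proof -
   have "(i + 1 + 1) div 2 = (i + 1) div 2 + 1" using that by presburger
   then show ?thesis using that by (simp add: phi_right_def distrib_right add.assoc)
  qed
 qed (simp add: phi_right_def)
qed (auto simp: phi_right_def rk_def left_mult_lmul)

end

text \<open>The injection \<open>u\<close> guarantees that every cokernel has a copy with elements
  in \<open>'m\<close>.\<close>

locale hypersurface_modules = graded_hypersurface S f d
 for S :: "('k, 's, nat) graded_module" (structure) and f d +
 fixes u :: "'s list => 'm"
 assumes u: "inj u"
begin

abbreviation TT :: "(('s set, 'm, int) graded_module, 'm => 'm) precategory" where "TT \<equiv> TR S f"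

definition cok :: "'s factorization => ('s set, 'm, int) graded_module" where
 "cok X = (SOME M. \<exists>q. presents X M q)"

definition cq :: "'s factorization => (nat => 's) => 'm" where
 "cq X = (SOME q. presents X (cok X) q)"

definition cokmap :: "'s factorization => 's factorization => (int => (nat => 's) => nat => 's) => 'm => 'm" where
 "cokmap X Y h = (THE k. k : graded_hom A (cok X) (cok Y) & (\<forall>x\<in>$(Fk X). k (cq X x) = cq Y (h 0 x)))"

lemma presents_cok:
 assumes "obj X" shows "presents X (cok X) (cq X)"
proof -
 have "\<exists>M :: ('s set, 'm, int) graded_module. \<exists>q. presents X M q" using presents_exists[OF u assms] by blast
 then have "\<exists>q. presents X (cok X) q" unfolding cok_def by (rule someI_ex)
 then show ?thesis unfolding cq_def by (rule someI_ex)
qed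

lemma cok_gmodule: "obj X ==> gmodule A (cok X)"
 and cok_cover: "obj X ==> cover (gen_degs X 0) (cok X) (cq X)"
 and cq_zero_iff: "obj X ==> x : $(Fk X) ==> cq X x = \<zero>\<^bsub>cok X\<^esub> \<longleftrightarrow> x : diff X 0 ` $(Fk X)"
 using presents_cok by (auto simp: presents_def)

lemma cq_closed: "obj X ==> x : $(Fk X) ==> cq X x : $(cok X)"
 using cover_surj[OF cok_cover, of X] by (auto simp: rk_def)

lemma cq_add: "obj X ==> x : $(Fk X) ==> y : $(Fk X) ==>
  cq X (x \<oplus>\<^bsub>Fk X\<^esub> y) = cq X x \<oplus>\<^bsub>cok X\<^esub> cq X y"
 using rlin_add[OF cover_rlin[OF cok_cover]] by (simp add: obj_len)

lemma cokmap_eqI: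
 assumes X: "obj X" and k: "k : graded_hom A (cok X) (cok Y)"
  and e: "!!x. x : $(Fk X) ==> k (cq X x) = cq Y (h 0 x)" shows "cokmap X Y h = k" unfolding cokmap_def
proof (rule the_equality)
 fix k' assume k': "k' : graded_hom A (cok X) (cok Y) & (\<forall>x\<in>$(Fk X). k' (cq X x) = cq Y (h 0 x))"
 show "k' = k" by (rule cover_eqI[OF cok_cover[OF X]]) (use k k' e in \<open>auto simp: graded_hom_iff obj_len[OF X]\<close>)
qed (use k e in blast)

lemma cokmap:
 assumes X: "obj X" and Y: "obj Y" and h: "h : $(Hom NN X Y)" shows "cokmap X Y h : graded_hom A (cok X) (cok Y)"
  and "x : $(Fk X) ==> cokmap X Y h (cq X x) = cq Y (h 0 x)"
proof -
 note h' = Hom_nhom[OF X Y h]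
 have g: "ghom S (mf_term S X 0) (gres p (cok Y)) (%x. cq Y (h 0 x))"
  using ghom_comp[OF nhom_ghom[OF h']] cok_cover[OF Y] unfolding cover_def by blast
 have ker: "cq Y (h 0 x) = \<zero>\<^bsub>cok Y\<^esub>" if x: "x : $(Fr (length (gen_degs X 0)))" "cq X x = \<zero>\<^bsub>cok X\<^esub>" for x
 proof -
  obtain y where y: "y : $(Fk X)" "x = diff X 0 y" using cq_zero_iff[OF X, of x] x by (auto simp: rk_def)
  have "h 0 x = diff Y 0 (h (0 + 1) y)" unfolding y(2) by (rule nhom_diff[OF h' y(1)])
  then show ?thesis using cq_zero_iff[OF Y] nhom_closed[OF X Y h' y(1), of "0 + 1"] obj_closed[OF Y] by simp
 qed
 obtain k where k: "k : graded_hom A (cok X) (cok Y)" "!!x. x : $(Fr (length (gen_degs X 0))) ==> k (cq X x) = cq Y (h 0 x)"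
  using cover_descend[OF cok_gmodule[OF X] cok_gmodule[OF Y] cok_cover[OF X] g ker] by blast
 then have k': "!!x. x : $(Fk X) ==> k (cq X x) = cq Y (h 0 x)" by (simp add: rk_def)
 have "cokmap X Y h = k" by (rule cokmap_eqI[where h = h, OF X k(1) k'])
 then show "cokmap X Y h : graded_hom A (cok X) (cok Y)"
  and "x : $(Fk X) ==> cokmap X Y h (cq X x) = cq Y (h 0 x)" using k(1) k' by simp_all
qed

lemma cok_additive_functor: "additive_functor NN TT cok cokmap" unfolding additive_functor_def is_functor_def
proof (intro conjI ballI)
 fix X assume "X : Obj NN"
 then have X: "obj X" by simp
 show "cok X : Obj TT" by (rule presents_TR[OF X presents_cok[OF X]])
 show "cokmap X X (Ident NN X) = Ident TT (cok X)"
  by (rule cokmap_eqI[OF X]) (auto simp: graded_hom_id[OF cok_gmodule[OF X]] cq_closed[OF X] obj_len[OF X])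
next
 fix X Y h assume "X : Obj NN" "Y : Obj NN" "h : $(Hom NN X Y)"
 then show "cokmap X Y h : $(Hom TT (cok X) (cok Y))" using cokmap(1) by simp
next
 fix X Y Z g h assume a: "X : Obj NN" "Y : Obj NN" "Z : Obj NN" "g : $(Hom NN Y Z)" "h : $(Hom NN X Y)"
 then have X: "obj X" and Y: "obj Y" and Z: "obj Z" by simp_all
 note g = cokmap[OF Y Z a(4)] and h = cokmap[OF X Y a(5)]
 have "cokmap X Z (Comp NN X Y Z g h) = compose ($(cok X)) (cokmap Y Z g) (cokmap X Y h)"
  by (rule cokmap_eqI[OF X graded_hom_comp[OF cok_gmodule[OF X] g(1) h(1)]])
   (simp add: compose_def cq_closed[OF X] h(2) g(2) nhom_closed[OF X Y Hom_nhom[OF X Y a(5)]] obj_len[OF X])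
 then show "cokmap X Z (Comp NN X Y Z g h) = Comp TT (cok X) (cok Y) (cok Z) (cokmap Y Z g) (cokmap X Y h)" by simp
next
 fix X Y g h assume a: "X : Obj NN" "Y : Obj NN" "g : $(Hom NN X Y)" "h : $(Hom NN X Y)"
 then have X: "obj X" and Y: "obj Y" by simp_all
 note g = cokmap[OF X Y a(3)] and h = cokmap[OF X Y a(4)]
 have "cokmap X Y (g \<otimes>\<^bsub>Hom NN X Y\<^esub> h) = (\<lambda>x\<in>$(cok X). cokmap X Y g x \<oplus>\<^bsub>cok Y\<^esub> cokmap X Y h x)"
  by (rule cokmap_eqI[OF X graded_hom_sum[OF cok_gmodule[OF X] cok_gmodule[OF Y] g(1) h(1)]])
   (simp add: cq_closed[OF X] h(2) g(2) nhom_closed[OF X Y Hom_nhom[OF X Y a(3)]] nhom_closed[OF X Y Hom_nhom[OF X Y a(4)]]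
    obj_len[OF X] obj_len[OF Y] cq_add[OF Y])
 then show "cokmap X Y (g \<otimes>\<^bsub>Hom NN X Y\<^esub> h) = cokmap X Y g \<otimes>\<^bsub>Hom TT (cok X) (cok Y)\<^esub> cokmap X Y h" by simp
qed

lemma cok_full:
 assumes X: "obj X" and Y: "obj Y" and k: "k : graded_hom A (cok X) (cok Y)"
 obtains h where "h : $(Hom NN X Y)" "cokmap X Y h = k"
proof -
 have "ghom A (cok X) (cok Y) k" using k by (simp add: graded_hom_iff)
 then obtain h0 where h0: "ghom S (mf_term S X 0) (mf_term S Y 0) h0"
  "!!x. x : $(Fr (length (gen_degs X 0))) ==> cq Y (h0 x) = k (cq X x)"
  using cover_lift[OF cok_gmodule[OF Y] cok_cover[OF X] cok_cover[OF Y]] by blast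
 interpret CX: gmodule A "cok X" by (rule cok_gmodule[OF X])
 interpret CY: gmodule A "cok Y" by (rule cok_gmodule[OF Y])
 have im: "h0 (diff X 0 x) : diff Y 0 ` $(Fk Y)" if x: "x : $(Fk X)" for x
 proof -
  have d: "diff X 0 x : $(Fk X)" by (rule obj_closed[OF X x])
  have "cq X (diff X 0 x) = \<zero>\<^bsub>cok X\<^esub>" using cq_zero_iff[OF X d] x by blast
  then have "cq Y (h0 (diff X 0 x)) = \<zero>\<^bsub>cok Y\<^esub>"
   using h0(2)[of "diff X 0 x"] d rlin_zero[OF CX.rmodule_axioms CY.rmodule_axioms, of k] k by (simp add: rk_def graded_hom_iff ghom_def)
  moreover have "h0 (diff X 0 x) : $(Fk Y)" using rlin_closed[OF ghomD(1)[OF h0(1)]] d by (simp add: obj_len[OF X] obj_len[OF Y])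
  ultimately show ?thesis using cq_zero_iff[OF Y] by blast
 qed
 obtain h where h: "h : $(Hom NN X Y)" "!!x. x : $(Fk X) ==> h 0 x = h0 x" using extend_hom[OF X Y h0(1) im] by blast
 have "cokmap X Y h = k" by (rule cokmap_eqI[OF X k]) (use h h0(2) in \<open>simp add: rk_def\<close>)
 with h(1) show thesis by (rule that)
qed

lemma cokmap_zero_iff:
 assumes X: "obj X" and Y: "obj Y" and h: "h : $(Hom NN X Y)"
 shows "cokmap X Y h = \<one>\<^bsub>Hom TT (cok X) (cok Y)\<^esub> \<longleftrightarrow> (\<forall>x\<in>$(Fk X). h 0 x : diff Y 0 ` $(Fk Y))"
proof -
 note hc = nhom_closed[OF X Y Hom_nhom[OF X Y h]]
 have z: "(\<lambda>x\<in>$(cok X). \<zero>\<^bsub>cok Y\<^esub>) : graded_hom A (cok X) (cok Y)"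
  by (rule restrict_graded_hom[OF cok_gmodule[OF X] ghom_zero[OF cok_gmodule[OF Y]]])
 have "cokmap X Y h = (\<lambda>x\<in>$(cok X). \<zero>\<^bsub>cok Y\<^esub>) \<longleftrightarrow> (\<forall>x\<in>$(Fk X). cq Y (h 0 x) = \<zero>\<^bsub>cok Y\<^esub>)"
  using cokmap_eqI[OF X z, of h] cokmap(2)[OF X Y h] cq_closed[OF X] by (metis (no_types, lifting) restrict_apply')
 then show ?thesis using cq_zero_iff[OF Y hc] by simp
qed

text \<open>At index 0 the differential of \<open>phi_left\<close> is the identity, so a morphism
  through it has its component at 0 inside the image of \<open>diff Y 0\<close>. Conversely lift
  \<open>h 0\<close> to \<open>diff Y 0 t\<close> and take for \<open>F\<close> the term of
  \<open>X\<close> at 0: then \<open>k 0 = id\<close> and \<open>g 0 = h 0\<close> extend to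
  morphisms, whose composite is \<open>h\<close> because it has the same component at 0.\<close>

lemma factoring_calF:
 assumes X: "obj X" and Y: "obj Y"
 shows "factoring_morphisms NN (calF S f d) X Y = {h : $(Hom NN X Y). cokmap X Y h = \<one>\<^bsub>Hom TT (cok X) (cok Y)\<^esub>}"
proof (intro equalityI subsetI)
 interpret C: precat NN by unfold_locales (rule NMF_preadditive)
 {
  fix h assume "h : factoring_morphisms NN (calF S f d) X Y"
  then obtain m g k where g: "g : $(Hom NN (phi_left S f d m) Y)" and k: "k : $(Hom NN X (phi_left S f d m))"
   and h: "h = Comp NN X (phi_left S f d m) Y g k" unfolding factoring_morphisms_def calF_def by blast
  note Z = phi_left_simps[where m = m]
  have hH: "h : $(Hom NN X Y)" unfolding h using C.comp_closed[of X "phi_left S f d m" Y g k] X Y Z(1) g k by simp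
  have "h 0 x : diff Y 0 ` $(Fk Y)" if x: "x : $(Fk X)" for x
  proof -
   have c: "k 0 x : $(Fl m)" using nhom_closed[OF X Z(1) Hom_nhom[OF X Z(1) k] x] Z(2) by simp
   have "h 0 x = g 0 (diff (phi_left S f d m) 0 (k 0 x))" using x c Z(4) by (simp add: h compose_def obj_len[OF X])
   also have "\<dots> = diff Y 0 (g (0 + 1) (k 0 x))" by (rule nhom_diff[OF Hom_nhom[OF Z(1) Y g]]) (use c Z(2) in simp)
   finally show ?thesis using nhom_closed[OF Z(1) Y Hom_nhom[OF Z(1) Y g], of "k 0 x" "0 + 1"] c Z(2) by simp
  qed
  then show "h : {h : $(Hom NN X Y). cokmap X Y h = \<one>\<^bsub>Hom TT (cok X) (cok Y)\<^esub>}"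
   using hH cokmap_zero_iff[OF X Y hH] by blast
 next
  fix h assume "h : {h : $(Hom NN X Y). cokmap X Y h = \<one>\<^bsub>Hom TT (cok X) (cok Y)\<^esub>}"
  then have h: "h : $(Hom NN X Y)" and im: "!!x. x : $(Fk X) ==> h 0 x : diff Y 0 ` $(Fk Y)"
   using cokmap_zero_iff[OF X Y] by blast+
  note h' = Hom_nhom[OF X Y h]
  obtain t where t: "ghom S (mf_term S X 0) (mf_term S Y (0 + 1)) t" "!!x. x : $(mf_term S X 0) ==> diff Y 0 (t x) = h 0 x"
   using ghom_lift[OF gmodule_free gmodule_free obj_ghom[OF Y, of 0] nhom_ghom[OF h', of 0]] im
   by (simp add: obj_len[OF X] obj_len[OF Y]) blast
  have tc: "t x : $(Fk Y)" if "x : $(Fk X)" for x using rlin_closed[OF ghomD(1)[OF t(1)]] that by (simp add: obj_len[OF X] obj_len[OF Y])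
  let ?Z = "phi_left S f d (gen_degs X 0)"
  note Z = phi_left_simps[where m = "gen_degs X 0", unfolded obj_len[OF X]]
  have 1: "ghom S (mf_term S X 0) (mf_term S ?Z 0) (%x. x)" by (simp add: Z(3) ghom_id)
  have 2: "diff X 0 x : diff ?Z 0 ` $(Fr (rk ?Z))" if "x : $(Fk X)" for x using obj_closed[OF X that, of 0] Z by (metis imageI)
  obtain k where k: "k : $(Hom NN X ?Z)" "!!x. x : $(Fk X) ==> k 0 x = x" using extend_hom[OF X Z(1) 1 2] by blast
  have 3: "ghom S (mf_term S ?Z 0) (mf_term S Y 0) (%x. diff Y 0 (t x))" unfolding Z(3) by (rule ghom_comp[OF t(1) obj_ghom[OF Y]])
  have 4: "diff Y 0 (t (diff ?Z 0 x)) : diff Y 0 ` $(Fk Y)" if "x : $(Fr (rk ?Z))" for x using tc that Z by simp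
  obtain g where g: "g : $(Hom NN ?Z Y)" "!!x. x : $(Fr (rk ?Z)) ==> g 0 x = diff Y 0 (t x)"
   using extend_hom[OF Z(1) Y 3 4] by blast
  have "h = Comp NN X ?Z Y g k"
  proof (rule Hom_determined[OF X Y h])
   show "Comp NN X ?Z Y g k : $(Hom NN X Y)" using C.comp_closed[of X ?Z Y g k] X Y Z(1) g k by simp
   show "h 0 x = Comp NN X ?Z Y g k 0 x" if "x : $(Fk X)" for x using that k(2) g(2) t(2) Z(2) by (simp add: compose_def obj_len[OF X])
  qed
  then show "h : factoring_morphisms NN (calF S f d) X Y" unfolding factoring_morphisms_def calF_def using g(1) k(1) by blast
 }
qed

end

section \<open>Every module in TR is a cokernel\<close>

context graded_hypersurface
begin

text \<open>The two given maps become the differentials at 0 and 1. All others are forced, being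
  their iterated twists upwards and untwists downwards.\<close>

lemma build_factorization:
 assumes len: "length m = length n"
  and g: "ghom S (graded_free S n) (graded_free S m) g" "!!x. x : $(Fl n) ==> g x = \<zero>\<^bsub>Fl m\<^esub> ==> x = \<zero>\<^bsub>Fl n\<^esub>"
  and h: "ghom S (graded_free S (up m)) (graded_free S n) h" "!!x. x : $(Fl m) ==> g (h x) = lml m x"
 obtains X where "obj X" "gen_degs X 0 = m" "!!x. x : $(Fl m) ==> diff X 0 x = g x"
proof -
 define r where "r = length m"
 let ?F = "Fr r" and ?l = "lmul r"
 interpret F: rmodule S ?F by (rule rmodule_Fr)
 define m' where "m' i = map (%j. j + (i div 2) * int d) (if even i then m else n)" for i :: int
 have len': "length (m' i) = r" for i using len by (simp add: m'_def r_def)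
 have m'_up: "m' (i + 2) = up (m' i)" for i by (simp add: m'_def distrib_right add.assoc)
 let ?G = "%i. graded_free S (m' i)"
 have lin: "rlin S ?F ?F a" if "ghom S (?G i) (?G j) a" for a i j using ghomD(1)[OF that] by (simp add: len')
 note cl = rlin_closed[OF lin] and l = rlin_closed[OF lmul_rlin, of _ r]
 have l0: "x = \<zero>\<^sub>?F" if "x : $?F" "?l x = \<zero>\<^sub>?F" for x
  using fmod_inj(1)[OF fmod_Fr that(1) F.M.zero_closed] that rlin_zero[OF rmodule_Fr rmodule_Fr lmul_rlin, of r] by simp
 \<comment> \<open>Consecutive differentials with \<open>a b = f\<close>, together with injectivity
   of \<open>a\<close>, which is used for cancelling on the left.\<close>
 define P where "P i t \<longleftrightarrow> (case t of (a, b) => ghom S (?G (i + 1)) (?G i) a & ghom S (?G (i + 2)) (?G (i + 1)) b &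
   (\<forall>x\<in>$?F. a x = \<zero>\<^sub>?F \<longrightarrow> x = \<zero>\<^sub>?F) & (\<forall>x\<in>$?F. a (b x) = ?l x))" for i t
 have inj: "b x = \<zero>\<^sub>?F ==> x = \<zero>\<^sub>?F" if "rlin S ?F ?F a" "!!x. x : $?F ==> a (b x) = ?l x" "x : $?F" for a b x
  using l0[OF that(3)] that(2)[OF that(3)] rlin_zero[OF rmodule_Fr rmodule_Fr that(1)] by simp
 have P0: "P 0 (g, h)" using g h len m'_up[of 0] by (simp add: P_def m'_def r_def)
 have step: "\<exists>t'. P (i + 1) t' & snd t = fst t'" if hyp: "P i t" for i t
 proof -
  obtain a b where t: "t = (a, b)" by (cases t)
  have a: "ghom S (?G (i + 1)) (?G i) a" and b: "ghom S (?G (i + 2)) (?G (i + 1)) b"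
   and a0: "!!x. x : $?F ==> a x = \<zero>\<^sub>?F ==> x = \<zero>\<^sub>?F" and ab: "!!x. x : $?F ==> a (b x) = ?l x"
   using hyp by (auto simp: P_def t)
  obtain c where c: "ghom S (?G (i + 1 + 2)) (?G (i + 2)) c" "!!x. x : $?F ==> a (?l x) = ?l (c x)"
   using twist_ghom[OF a] unfolding m'_up[symmetric] len' by blast
  \<comment> \<open>From \<open>a b c = f c = a f\<close>, because \<open>c\<close> is the twist of
    \<open>a\<close> and \<open>a\<close> is injective.\<close>
  have "b (c x) = ?l x" if x: "x : $?F" for x
  proof -
   have bc: "b (c x) : $?F" by (rule cl[OF b cl[OF c(1) x]])
   have "a (b (c x) \<ominus>\<^sub>?F ?l x) = \<zero>\<^sub>?F"
    using rlin_diff[OF rmodule_Fr rmodule_Fr lin[OF a] bc l[OF x]] ab[OF cl[OF c(1) x]] c(2)[OF x] l[OF cl[OF c(1) x]] by simp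
   then show ?thesis using a0[OF F.M.minus_closed[OF bc l[OF x]]] F.M.minus_zero_iff[OF bc l[OF x]] by blast
  qed
  then have "P (i + 1) (b, c)" using b c(1) inj[OF lin[OF a] ab] by (simp add: P_def add.assoc)
  then show ?thesis using t by auto
 qed
 have down: "\<exists>t. P i t & snd t = fst t'" if hyp: "P (i + 1) t'" for i t'
 proof -
  obtain b c where t: "t' = (b, c)" by (cases t')
  have b: "ghom S (?G (i + 2)) (?G (i + 1)) b" and c: "ghom S (?G (i + 1 + 2)) (?G (i + 2)) c"
   and b0: "!!x. x : $?F ==> b x = \<zero>\<^sub>?F ==> x = \<zero>\<^sub>?F" and bc: "!!x. x : $?F ==> b (c x) = ?l x"
   using hyp by (auto simp: P_def t add.assoc)
  \<comment> \<open>\<open>a\<close> is the untwist of \<open>c\<close>, and \<open>b'\<close> is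
    the twist of \<open>b\<close>. Injectivity of \<open>b\<close> turns
    \<open>b c b' = f b' = b f\<close> into \<open>c b' = f\<close>. Then
    \<open>a b f = a f b' = f c b' = f f\<close>, and \<open>f\<close> is cancelled on the
    right.\<close>
  obtain a where a: "ghom S (?G (i + 1)) (?G i) a" "!!x. x : $?F ==> a (?l x) = ?l (c x)"
   using untwist_ghom[OF c[unfolded m'_up]] unfolding len' by blast
  obtain b' where b': "rlin S ?F ?F b'" "!!x. x : $?F ==> b (?l x) = ?l (b' x)"
   by (rule twist[OF fmod_Fr fmod_Fr lin[OF b]]) (rule that; assumption)
  note b'c = rlin_closed[OF b'(1)]
  have cb: "c (b' y) = ?l y" if y: "y : $?F" for y
  proof -
   note yc = cl[OF c b'c[OF y]]
   have "b (c (b' y) \<ominus>\<^sub>?F ?l y) = \<zero>\<^sub>?F"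
    using rlin_diff[OF rmodule_Fr rmodule_Fr lin[OF b] yc l[OF y]] bc[OF b'c[OF y]] b'(2)[OF y] l[OF b'c[OF y]] by simp
   then show ?thesis using b0[OF F.M.minus_closed[OF yc l[OF y]]] F.M.minus_zero_iff[OF yc l[OF y]] by blast
  qed
  have ab: "a (b x) = ?l x" if x: "x : $?F" for x
   by (rule fmod_right_cancel[OF fmod_Fr fmod_Fr rlin_comp[OF lin[OF b] lin[OF a(1)]] lmul_rlin _ x])
    (simp add: b'(2) b'c a(2) cb)
  \<comment> \<open>Write \<open>x f = f z\<close>. From \<open>a x = 0\<close> follows
    \<open>f c z = a f z = 0\<close>, and \<open>c\<close> is injective since \<open>b c = f\<close>
    is.\<close>
  have "x = \<zero>\<^sub>?F" if x: "x : $?F" "a x = \<zero>\<^sub>?F" for x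
  proof -
   obtain z where z: "z : $?F" "f \<odot>\<^sub>?F x = ?l z" by (rule fmod_swap[OF fmod_Fr x(1)])
   have "?l (c z) = \<zero>\<^sub>?F" using a(2)[OF z(1)] rlin_smult[OF lin[OF a(1)] f_closed x(1)] z(2) x(2) by simp
   then have "z = \<zero>\<^sub>?F" using inj[OF lin[OF b] bc z(1)] l0[OF cl[OF c z(1)]] by blast
   then have "f \<odot>\<^sub>?F x = f \<odot>\<^sub>?F \<zero>\<^sub>?F" using z(2) rlin_zero[OF rmodule_Fr rmodule_Fr lmul_rlin, of r] by simp
   then show ?thesis using fmod_inj(2)[OF fmod_Fr x(1) F.M.zero_closed] by simp
  qed
  then have "P i (a, b)" using a(1) b ab by (simp add: P_def)
  then show ?thesis using t by auto
 qed
 obtain t where t: "t 0 = (g, h)" "!!i. P i (t i)" "!!i. snd (t i) = fst (t (i + 1))"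
  using int_chain[of P "(g, h)" "%_ t t'. snd t = fst t'"] P0 step down by metis
 define X where "X = \<lparr>gen_degs = m', diff = %i. restrict (fst (t i)) ($?F)\<rparr>"
 have X: "gen_degs X = m'" "diff X i = restrict (fst (t i)) ($?F)" "rk X = r" for i by (simp_all add: X_def rk_def len')
 have "obj X" unfolding obj_iff X
 proof (intro allI conjI ballI)
  fix i x
  have a: "ghom S (?G (i + 1)) (?G i) (fst (t i))" and b: "ghom S (?G (i + 1 + 1)) (?G (i + 1)) (fst (t (i + 1)))" for i
   using t(2)[of i] t(2)[of "i + 1"] by (auto simp: P_def)
  show "ghom S (?G (i + 1)) (?G i) (restrict (fst (t i)) ($?F))" by (rule iffD2[OF ghom_cong[OF gmodule_free] a]) (simp add: len')
  assume x: "x : $?F"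
  show "restrict (fst (t i)) ($?F) (restrict (fst (t (i + 1))) ($?F) x) = ?l x"
   using t(2)[of i] t(3)[of i] x cl[OF b x] by (simp add: P_def case_prod_beta)
 qed (auto simp: len' m'_up)
 moreover have "gen_degs X 0 = m" by (simp add: X m'_def)
 ultimately show thesis by (rule that) (simp add: X t(1) r_def)
qed

text \<open>The map \<open>g\<close> is given by minimal homogeneous generators of the kernel of a
  free cover. Projectivity of that kernel makes \<open>g\<close> injective, and since the kernel
  contains \<open>f F\<close>, left multiplication by \<open>f\<close> lifts through
  \<open>g\<close>.\<close>

lemma TR_presented:
 fixes M :: "('s set, 'm, int) graded_module"
 assumes M: "M : Obj (TR S f)"
 obtains X q where "obj X" "presents X M q"
\<comment> \<open>Over the zero ring ranks are not invariants. There \<open>M\<close> is zero and a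
  factorization of rank zero presents it.\<close>
proof (cases "\<one> = \<zero>")
 case True
 interpret M: gmodule A M using M by simp
 have "$M = {\<zero>\<^sub>M}"
 proof -
  have "x = \<zero>\<^sub>M" if "x : $M" for x using M.smult_one[OF that] M.smult_l_null[OF that] True ring_hom_one[OF p_hom] p_zero by metis
  then show ?thesis by blast
 qed
 moreover have "$(Fr 0) = {\<zero>\<^bsub>Fr 0\<^esub>}" by (simp add: free_finite free_simps(2) restrict_def)
 ultimately have "presents (phi_left S f d []) M (%_. \<zero>\<^sub>M)"
  using phi_left_simps(2-4)[where m = "[]"] ghom_zero[OF gmodule_gres[OF M.gmodule_axioms], of "graded_free S []"] M.gmodule_axioms
  by (simp add: presents_def cover_def)
 then show thesis by (rule that[OF phi_left_simps(1)])
next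
 case False
 interpret M: gmodule A M using M by simp
 note MA = M.gmodule_axioms
 interpret G: gmodule S "gres p M" by (rule gmodule_gres[OF MA])
 obtain m q where q: "cover m M q" using cover_exists[OF MA] M by auto
 let ?F = "graded_free S m"
 interpret F: gmodule S ?F by (rule gmodule_free)
 have gq: "ghom S ?F (gres p M) q" using q by (simp add: cover_def)
 define N where "N = {x : $?F. q x = \<zero>\<^sub>M}"
 have N: "submodule N S ?F" unfolding N_def using submodule_kernel[OF F.rmodule_axioms G.rmodule_axioms ghomD(1)[OF gq]] by simp
 have gr: "hc ?F x i : N" if xN: "x : N" for x i
 proof -
  have x: "x : $?F" "q x = \<zero>\<^bsub>gres p M\<^esub>" using xN by (auto simp: N_def)
  have "hc (gres p M) (q x) i = q (hc ?F x i)"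
   by (rule hc_hom[OF F.Mg.graded_group_axioms G.Mg.graded_group_axioms _ rlin_add[OF ghomD(1)[OF gq]] ghomD(2)[OF gq] x(1)])
    (use rlin_closed[OF ghomD(1)[OF gq]] in auto)
  then show ?thesis using F.Mg.hc_closed[OF x(1)] unfolding x(2) G.Mg.hc_zero by (simp add: N_def)
 qed
 have "submodule N S (Fl m)" using N unfolding submodule_def submodule_axioms_def subgroup_def by (simp add: m_inv_def)
 then obtain l :: nat and e where e: "rlin S (Fr l) (Fl m) e" "e ` $(Fr l) = N" using noethD[OF noetherian] by blast
 have "submodule_span S ?F ((%i. e (unitv S {..<l} i)) ` {..<l}) = N" using free_image_span[OF F.rmodule_axioms, of l e] e by simp
 then obtain n v where v: "!!i. i < length n ==> v i : part ?F (n ! i)"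
  "lcomb S ?F {..<length n} v ` $(Fl n) = N"
  "!!i. i < length n ==> v i \<notin> submodule_span S ?F (v ` ({..<length n} - {i}))"
  using F.minimal_generators[OF N gr] by (metis finite_imageI finite_lessThan)
 define g where "g = lcomb S ?F {..<length n} v"
 have vc: "v : {..<length n} \<rightarrow> $?F" using v(1) F.Mg.part_closed by blast
 have g: "ghom S (graded_free S n) ?F g" unfolding ghom_def g_def using F.lcomb_rlin[OF vc] F.lcomb_graded[of n v] v(1) by simp
 have g': "rlin S (Fl n) (Fl m) g" using ghomD(1)[OF g] by simp
 have gN: "g ` $(Fl n) = N" using v(2) by (simp add: g_def)
 have ker: "q x = \<zero>\<^sub>M \<longleftrightarrow> x : g ` $(Fl n)" if "x : $(Fl m)" for x using that unfolding gN by (simp add: N_def)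
 have tr: "totally_reflexive A M" "projective_dim S (res p M) < \<infinity>" using M by simp_all
 obtain c where c: "rlin S (Fl n) (Fl n) c" "!!x. x : $(Fl n) ==> g (c x) = g x"
  "!!x. x : $(Fl n) ==> g x = \<zero>\<^bsub>Fl m\<^esub> ==> c x = \<zero>\<^bsub>Fl n\<^esub>"
  by (rule syzygy_projective[OF noetherian M.rmodule_axioms cover_rlin[OF q] cover_surj[OF q] g' ker _ tr(2)])
   (use tr(1) in \<open>(simp add: totally_reflexive_def; fail) | (assumption | (rule that; assumption))\<close>)+
 have inj: "x = \<zero>\<^bsub>Fl n\<^esub>" if "x : $(Fl n)" "g x = \<zero>\<^bsub>Fl m\<^esub>" for x
  by (rule minimal_projective_injective[OF gmodule_free v(1,3) S0_units c(1)])
   (use c(2,3) that in \<open>simp_all add: g_def\<close>)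
 have lg: "ghom S (graded_free S (up m)) ?F (lml m)"
  using lmul_rlin lmul_part[OF part_graded_free_closed[of _ "up m", simplified]] by (simp add: ghom_def)
 have "lml m x : g ` $(graded_free S n)" if "x : $(graded_free S (up m))" for x
  using rlin_res_lmul[OF M.rmodule_axioms cover_rlin[OF q], of "lml m x"] that
   ker[OF rlin_closed[OF lmul_rlin, of x]] by simp
 then obtain h where h: "ghom S (graded_free S (up m)) (graded_free S n) h"
  "!!x. x : $(graded_free S (up m)) ==> g (h x) = lml m x"
  using ghom_lift[OF gmodule_free gmodule_free g lg] by blast
 have h': "rlin S (Fl m) (Fl n) h" using ghomD(1)[OF h(1)] by simp
 have gh: "g (h x) = lml m x" if "x : $(Fl m)" for x using h(2) that by simp
 interpret Fm: rmodule S "Fl m" by (rule rmodule_Fr)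
 \<comment> \<open>Equality of the ranks: \<open>g\<close> is injective, and so is \<open>h\<close>
   because \<open>g h = f\<close> is.\<close>
 have "length n \<le> length m" by (rule noeth_rank[OF ring_axioms False noetherian g' inj])
 moreover have "length m \<le> length n"
 proof (rule noeth_rank[OF ring_axioms False noetherian h'])
  fix x assume x: "x : $(Fl m)" "h x = \<zero>\<^bsub>Fl n\<^esub>"
  have "lml m x = lml m \<zero>\<^bsub>Fl m\<^esub>"
   using gh[OF x(1)] x(2) rlin_zero[OF rmodule_Fr rmodule_Fr g'] rlin_zero[OF rmodule_Fr rmodule_Fr lmul_rlin, of "length m"] by simp
  then show "x = \<zero>\<^bsub>Fl m\<^esub>" using fmod_inj(1)[OF fmod_Fr x(1) Fm.M.zero_closed] by simp
 qed
 ultimately have len: "length m = length n" by simp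
 obtain X where X: "obj X" "gen_degs X 0 = m" "!!x. x : $(Fl m) ==> diff X 0 x = g x"
  using build_factorization[OF len g inj h(1) gh] by blast
 have "diff X 0 ` $(Fl m) = g ` $(Fl n)" using X(3) len by simp
 then have "presents X M q" using MA q ker by (simp add: presents_def X(2) rk_def)
 then show thesis by (rule that[OF X(1)])
qed

end

text \<open>Two modules covered by the same free module with the same kernel are isomorphic.\<close>

lemma (in hypersurface_modules) cok_dense:
 assumes M: "M : Obj TT"
 obtains X where "obj X" "isomorphisms TT (cok X) M ~= {}"
proof -
 obtain X q where X: "obj X" and q: "presents X M q" using TR_presented[OF M] by blast
 have M': "gmodule A M" using M by simp
 obtain k k' where k: "k : graded_hom A (cok X) M" "k' : graded_hom A M (cok X)"
  "!!y. y : $(cok X) ==> k' (k y) = y" "!!y. y : $M ==> k (k' y) = y"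
  using cover_iso[OF cok_gmodule[OF X] M' cok_cover[OF X], of q] q cq_zero_iff[OF X]
  unfolding presents_def obj_len[OF X] by (metis (no_types, lifting))
 have "k : isomorphisms TT (cok X) M" unfolding isomorphisms_def using k by (auto simp: compose_def intro!: restrict_ext bexI[of _ k'])
 then show thesis using that[OF X] by blast
qed

section \<open>Free modules and split factorizations\<close>

text \<open>The hypothesis provides a precover \<open>e\<close> of every \<open>N\<close>. The
  factoring morphisms from \<open>M\<close> to \<open>N\<close> are then the image of composition
  with \<open>e\<close>, a homomorphism of hom-groups, and therefore a subgroup.\<close>

lemma factor_dataI:
 assumes C: "preadditive_category C" and sub: "\<X> \<subseteq> Obj C"
  and cov: "!!N. N : Obj C ==> \<exists>P\<in>\<X>. \<exists>e\<in>$(Hom C P N). \<forall>Q\<in>\<X>. \<forall>g\<in>$(Hom C Q N).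
   \<exists>k\<in>$(Hom C Q P). g = Comp C Q P N e k" shows "factor_data C \<X>"
proof -
 interpret precat C by unfold_locales (rule C)
 show ?thesis
 proof (rule factor_data.intro[OF precat_axioms], rule factor_data_axioms.intro)
  fix M N assume M: "M : Obj C" and N: "N : Obj C"
  obtain P e where P: "P : \<X>" and e: "e : $(Hom C P N)"
   and l: "!!Q g. Q : \<X> ==> g : $(Hom C Q N) ==> \<exists>k\<in>$(Hom C Q P). g = Comp C Q P N e k"
   using cov[OF N] by blast
  have PO: "P : Obj C" using P sub by blast
  interpret group_hom "Hom C M P" "Hom C M N" "Comp C M P N e"
   using hom_is_group[OF M PO] hom_is_group[OF M N] comp_closed[OF M PO N e] comp_mult_right[OF M PO N e]
   by (auto simp: group_hom_def group_hom_axioms_def hom_def)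
  have eq: "factoring_morphisms C \<X> M N = Comp C M P N e ` $(Hom C M P)"
  proof
   show "Comp C M P N e ` $(Hom C M P) \<subseteq> factoring_morphisms C \<X> M N" unfolding factoring_morphisms_def using P e by blast
   show "factoring_morphisms C \<X> M N \<subseteq> Comp C M P N e ` $(Hom C M P)"
   proof
    fix t assume "t : factoring_morphisms C \<X> M N"
    then obtain Q g h where Q: "Q : \<X>" and h: "h : $(Hom C M Q)" and g: "g : $(Hom C Q N)" "t = Comp C M Q N g h"
     unfolding factoring_morphisms_def by blast
    obtain k where k: "k : $(Hom C Q P)" "g = Comp C Q P N e k" using l[OF Q g(1)] by blast
    have QO: "Q : Obj C" using Q sub by blast
    have "t = Comp C M P N e (Comp C M Q P k h)" unfolding g(2) k(2) by (rule assoc[OF M QO PO N e k(1) h, symmetric])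
    then show "t : Comp C M P N e ` $(Hom C M P)" using comp_closed[OF M QO PO k(1) h] by blast
   qed
  qed
  show "subgroup (factoring_morphisms C \<X> M N) (Hom C M N)" unfolding eq by (rule img_is_subgroup)
 next
  show "Comp C X Y Z g h : factoring_morphisms C \<X> X Z"
   if o: "X : Obj C" "Y : Obj C" "Z : Obj C" and g: "g : factoring_morphisms C \<X> Y Z" and h: "h : $(Hom C X Y)" for X Y Z g h
  proof -
   obtain P a b where P: "P : \<X>" and b: "b : $(Hom C Y P)" and a: "a : $(Hom C P Z)" "g = Comp C Y P Z a b"
    using g unfolding factoring_morphisms_def by blast
   have PO: "P : Obj C" using P sub by blast
   have "Comp C X Y Z g h = Comp C X P Z a (Comp C X Y P b h)" unfolding a(2) by (rule assoc[OF o(1,2) PO o(3) a(1) b h, symmetric])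
   then show ?thesis unfolding factoring_morphisms_def using P a(1) comp_closed[OF o(1,2) PO b h] by blast
  qed
  show "Comp C X Y Z g h : factoring_morphisms C \<X> X Z"
   if o: "X : Obj C" "Y : Obj C" "Z : Obj C" and g: "g : $(Hom C Y Z)" and h: "h : factoring_morphisms C \<X> X Y" for X Y Z g h
  proof -
   obtain P a b where P: "P : \<X>" and b: "b : $(Hom C X P)" and a: "a : $(Hom C P Y)" "h = Comp C X P Y a b"
    using h unfolding factoring_morphisms_def by blast
   have PO: "P : Obj C" using P sub by blast
   have "Comp C X Y Z g h = Comp C X P Z (Comp C P Y Z g a) b" unfolding a(2) by (rule assoc[OF o(1) PO o(2,3) g a(1) b])
   then show ?thesis unfolding factoring_morphisms_def using P b comp_closed[OF PO o(2,3) g a(1)] by blast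
  qed
 qed
qed

text \<open>\<open>factoring_morphisms\<close> refers to the given set of objects and to hom-groups
  and composition, none of which changes when objects are removed from the category.\<close>

lemma factor_data_full_subcategory: "factor_data C \<X> ==> factor_data (full_subcategory C \<Y>) \<X>"
 using preadditive_full_subcategory[of C \<Y>] unfolding factor_data_def precat_def factor_data_axioms_def factoring_morphisms_def
 by (simp add: full_subcategory_def)

section \<open>Free modules over \<open>A\<close> and direct sums of factorizations\<close>

definition fst_part :: "nat => (nat => 's) => nat => 's" where "fst_part r x = (\<lambda>t\<in>{..<r}. x t)"
definition snd_part :: "nat => nat => (nat => 's) => nat => 's" where "snd_part r q x = (\<lambda>t\<in>{..<q}. x (r + t))"
definition join :: "nat => nat => (nat => 's) => (nat => 's) => nat => 's" where
 "join r q a b = (\<lambda>s\<in>{..<r + q}. if s < r then a s else b (s - r))"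

context graded_hypersurface
begin

text \<open>Free modules over \<open>A\<close> are recognised by a cover over \<open>S\<close> whose
  kernel is exactly \<open>f F\<close>; \<open>free_objectsD\<close> is the converse. In this form
  they can be compared with cokernels.\<close>

lemma free_objectsI:
 assumes P: "gmodule A P" "finitely_generated A P" and q: "cover n P q"
  and ker: "!!x. x : $(Fl n) ==> q x = \<zero>\<^sub>P \<longleftrightarrow> x : lml n ` $(Fl n)"
 shows "P : free_objects A"
proof -
 interpret P: gmodule A P by fact
 interpret F: rmodule S "Fl n" by (rule rmodule_Fr)
 obtain g where g: "rlin A (FA (length n)) P g" "!!x. x : $(Fl n) ==> g (proj (length n) x) = q x"
  by (rule proj_descend[OF P.rmodule_axioms cover_rlin[OF q]]) (assumption | (rule that; assumption))+
 let ?g = "restrict g ($(graded_free A n))"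
 have "g y : part P i" if y: "y : part (graded_free A n) i" for y i
 proof -
  obtain x where x: "x : part (graded_free S n) i" "y = proj (length n) x" using y unfolding proj_part by blast
  then show ?thesis using g(2)[OF part_graded_free_closed[OF x(1)]] q by (simp add: cover_def ghom_def)
 qed
 moreover have "rlin A (graded_free A n) P ?g"
  using rlin_cong[OF rmodule_graded_free[OF A.ring_axioms], where h = ?g and g = g and N = P] g(1) by simp
 moreover have "y : $(graded_free A n)" if "y : part (graded_free A n) i" for y i using that by (simp add: part_graded_free)
 ultimately have "?g : graded_hom A (graded_free A n) P" by (simp add: graded_hom_iff ghom_def)
 moreover have "bij_betw ?g ($(graded_free A n)) ($P)"
 proof (rule bij_betw_imageI)
  show "inj_on ?g ($(graded_free A n))"
  proof (rule inj_onI)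
   fix y z assume yz: "y : $(graded_free A n)" "z : $(graded_free A n)" "?g y = ?g z"
   then have "y : proj (length n) ` $(Fl n)" "z : proj (length n) ` $(Fl n)" by (simp_all add: proj_surj)
   then obtain a b where a: "a : $(Fl n)" "y = proj (length n) a" and b: "b : $(Fl n)" "z = proj (length n) b" by blast
   interpret FA: rmodule A "FA (length n)" by (rule rmodule_FA)
   have "q a = q b" using yz a b g(2) by simp
   then have "q (a \<ominus>\<^bsub>Fl n\<^esub> b) = \<zero>\<^sub>P"
    using rlin_diff[OF rmodule_Fr rmodule_res[OF P.rmodule_axioms] cover_rlin[OF q] a(1) b(1)]
     rmodule_res[OF P.rmodule_axioms] rlin_closed[OF cover_rlin[OF q] b(1)] abelian_group.diff_self[of "res p P" "q b"] by (simp add: rmodule_def)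
   then have e: "proj (length n) (a \<ominus>\<^bsub>Fl n\<^esub> b) = \<zero>\<^bsub>FA (length n)\<^esub>"
    using ker proj_zero_iff F.M.minus_closed[OF a(1) b(1)] by blast
   have "p (a s) = p (b s)" if "s < length n" for s
   proof -
    have c: "a s : $S" "b s : $S" using free_coord[OF a(1)] free_coord[OF b(1)] that by auto
    have "p ((a \<ominus>\<^bsub>Fl n\<^esub> b) s) = \<zero>\<^sub>A" using fun_cong[OF e, of s] that by (simp add: proj_def free_simps(2))
    then show ?thesis using free_module_diff[OF ring_axioms a(1) b(1), of s] that p_minus[OF c]
      A.minus_zero_iff[OF ring_hom_closed[OF p_hom c(1)] ring_hom_closed[OF p_hom c(2)]] by simp
   qed
   then show "y = z" unfolding a(2) b(2) proj_def by (intro restrict_ext) simp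
  qed
  show "?g ` $(graded_free A n) = $P"
  proof -
   have "g ` $(FA (length n)) = q ` $(Fl n)" unfolding proj_surj[symmetric] image_image using g(2) by (intro image_cong) auto
   then show ?thesis using cover_surj[OF q] by simp
  qed
 qed
 ultimately show ?thesis using P unfolding free_objects_def graded_isomorphic_def by (auto intro!: exI[of _ n] bexI[of _ ?g])
qed

lemma free_objectsD:
 assumes "P : free_objects A"
 obtains n q where "gmodule A P" "finitely_generated A P" "cover n P q"
  "!!x. x : $(Fl n) ==> q x = \<zero>\<^sub>P \<longleftrightarrow> x : lml n ` $(Fl n)"
proof -
 obtain n h where P: "gmodule A P" "finitely_generated A P" and h: "h : graded_hom A (graded_free A n) P"
  and bij: "bij_betw h ($(graded_free A n)) ($P)" using assms unfolding free_objects_def graded_isomorphic_def by auto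
 interpret P: gmodule A P by fact
 interpret FA: rmodule A "FA (length n)" by (rule rmodule_FA)
 let ?q = "%x. h (proj (length n) x)"
 have h': "rlin A (FA (length n)) P h" using h by (simp add: graded_hom_iff ghom_def)
 have "rlin S (Fl n) (res p P) ?q" by (rule rlin_comp[OF proj_rlin rlin_res[OF p_hom h']])
 moreover have "?q x : part P i" if "x : part (graded_free S n) i" for x i using that proj_part h unfolding graded_hom_iff ghom_def by blast
 moreover have "?q ` $(Fl n) = $P" using bij proj_surj[of "length n"] unfolding bij_betw_def by (simp flip: image_image)
 ultimately have q: "cover n P ?q" by (simp add: cover_def ghom_def)
 have "?q x = \<zero>\<^sub>P \<longleftrightarrow> x : lml n ` $(Fl n)" if "x : $(Fl n)" for x
  using inj_on_eq_iff[OF bij_betw_imp_inj_on[OF bij], of "proj (length n) x" "\<zero>\<^bsub>FA (length n)\<^esub>"] proj_closed[OF that] proj_zero_iff[OF that]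
   rlin_zero[OF rmodule_FA P.rmodule_axioms h'] by simp
 with P q show thesis by (rule that)
qed

lemma lift_through_free:
 assumes P: "gmodule A P" and N: "gmodule A N" and q: "cover n P q"
  and ker: "!!x. x : $(Fl n) ==> q x = \<zero>\<^sub>P ==> x : lml n ` $(Fl n)"
  and h: "ghom S (graded_free S n) (gres p N) h"
 obtains k where "k : graded_hom A P N" "!!x. x : $(Fl n) ==> k (q x) = h x"
proof -
 interpret N: gmodule A N by fact
 have "rlin S (Fl n) (res p N) h" using h by (simp add: ghom_def)
 note z = rlin_res_lmul[OF N.rmodule_axioms this]
 show thesis by (rule cover_descend[OF P N q h]) (use z ker in blast, (rule that; assumption))
qed

text \<open>The projections and inclusions of a biproduct. Those identities are recorded that
  decompose a morphism into or out of the sum.\<close>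

lemma sum_obj:
 assumes X: "obj X" and Y: "obj Y"
 defines "Z \<equiv> factorization_sum S X Y" and "r \<equiv> rk X" and "q \<equiv> rk Y" shows "obj Z" and "rk Z = r + q"
  and "nhom Z X (%_. fst_part r)" and "nhom Z Y (%_. snd_part r q)"
  and "nhom X Z (%_ a. join r q a \<zero>\<^bsub>Fr q\<^esub>)" and "nhom Y Z (%_ b. join r q \<zero>\<^bsub>Fr r\<^esub> b)"
  and "!!x. x : $(Fr (r + q)) ==> x = join r q (fst_part r x) \<zero>\<^bsub>Fr q\<^esub> \<oplus>\<^bsub>Fr (r + q)\<^esub> join r q \<zero>\<^bsub>Fr r\<^esub> (snd_part r q x)"
  and "!!a. a : $(Fr r) ==> fst_part r (join r q a \<zero>\<^bsub>Fr q\<^esub>) = a & snd_part r q (join r q a \<zero>\<^bsub>Fr q\<^esub>) = \<zero>\<^bsub>Fr q\<^esub>"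
  and "!!b. b : $(Fr q) ==> fst_part r (join r q \<zero>\<^bsub>Fr r\<^esub> b) = \<zero>\<^bsub>Fr r\<^esub> & snd_part r q (join r q \<zero>\<^bsub>Fr r\<^esub> b) = b"
proof -
 note len = obj_len[OF X, folded r_def] obj_len[OF Y, folded q_def]
 have Z: "gen_degs Z i = gen_degs X i @ gen_degs Y i" "diff Z i = (\<lambda>x\<in>$(Fr (r + q)).
   join r q (diff X i (fst_part r x)) (diff Y i (snd_part r q x)))" for i
  by (simp_all add: Z_def factorization_sum_def Let_def len join_def fst_part_def snd_part_def)
 show rk: "rk Z = r + q" by (simp add: rk_def[of Z] Z len)
 interpret Fr: rmodule S "Fr k" for k by (rule rmodule_Fr)
 note co = free_coord
 have fc: "fst_part r x : $(Fr r)" "snd_part r q x : $(Fr q)" if "x : $(Fr (r + q))" for x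
  using co[OF that] by (auto simp: fst_part_def snd_part_def free_finite)
 have jc: "join r q a b : $(Fr (r + q))" if "a : $(Fr r)" "b : $(Fr q)" for a b
  using co[OF that(1)] co[OF that(2)] by (auto simp: join_def free_finite)
 have fj: "fst_part r (join r q a b) = a" "snd_part r q (join r q a b) = b" if "a : $(Fr r)" "b : $(Fr q)" for a b
  using fc[OF jc[OF that]] that by (auto intro!: free_eqI[of _ S] simp: fst_part_def snd_part_def join_def)
 have jf: "join r q (fst_part r x) (snd_part r q x) = x" if "x : $(Fr (r + q))" for x
  by (rule free_eqI[OF jc[OF fc[OF that]] that]) (auto simp: fst_part_def snd_part_def join_def)
 have gj: "ghom S L (mf_term S Z i) (%x. join r q (a x) (b x))"
  if "ghom S L (mf_term S X i) a" "ghom S L (mf_term S Y i) b" for L :: "('s, 'n, int) graded_module" and a b i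
 proof -
  have ab: "a x : $(Fr r)" "b x : $(Fr q)" if "x : $L" for x
   using rlin_closed[OF ghomD(1)[OF \<open>ghom S L (mf_term S X i) a\<close>] that] rlin_closed[OF ghomD(1)[OF \<open>ghom S L (mf_term S Y i) b\<close>] that]
   by (simp_all add: len)
  show ?thesis unfolding ghom_def
  proof (intro conjI allI ballI)
   show "rlin S L (mf_term S Z i) (%x. join r q (a x) (b x))" using ghomD(1)[OF that(1)] ghomD(1)[OF that(2)] jc[OF ab] unfolding rlin_def
    by (auto simp: Z len free_simps(3,4) join_def intro!: restrict_ext)
   fix j x assume x: "x : part L j"
   have "a x : part (mf_term S X i) j" by (rule ghomD(2)[OF that(1) x])
   moreover have "b x : part (mf_term S Y i) j" by (rule ghomD(2)[OF that(2) x])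
   ultimately show "join r q (a x) (b x) : part (mf_term S Z i) j"
    using jc[of "a x" "b x"] unfolding part_graded_free Z by (auto simp: len join_def nth_append)
  qed
 qed
 have gf: "ghom S (mf_term S Z i) (mf_term S X i) (fst_part r)" for i using fc(1) unfolding ghom_def rlin_def part_graded_free Z
  by (auto simp: len free_simps(3,4) fst_part_def nth_append intro!: restrict_ext)
 have gs: "ghom S (mf_term S Z i) (mf_term S Y i) (snd_part r q)" for i using fc(2) unfolding ghom_def rlin_def part_graded_free Z
  by (auto simp: len free_simps(3,4) snd_part_def nth_append intro!: restrict_ext) (metis add_diff_cancel_left' add_less_cancel_left not_add_less1)
 have gd: "ghom S (mf_term S Z (i + 1)) (mf_term S Z i) (%x. join r q (diff X i (fst_part r x)) (diff Y i (snd_part r q x)))" for i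
  by (rule gj[OF ghom_comp[OF gf obj_ghom[OF X]] ghom_comp[OF gs obj_ghom[OF Y]]])
 note oc = obj_closed[OF X, folded r_def] obj_closed[OF Y, folded q_def]
 have D: "diff Z i x = join r q (diff X i (fst_part r x)) (diff Y i (snd_part r q x))" if "x : $(Fr (r + q))" for i x using that by (simp add: Z)
 have lm: "join r q (lmul r (fst_part r x)) (lmul q (snd_part r q x)) = lmul (r + q) x" for x
  by (auto simp: join_def lmul_def fst_part_def snd_part_def intro!: restrict_ext)
 show oZ: "obj Z" unfolding obj_iff rk
 proof (intro allI conjI ballI)
  fix i x
  show "ghom S (mf_term S Z (i + 1)) (mf_term S Z i) (diff Z i)" by (rule iffD2[OF ghom_cong[OF gmodule_free] gd]) (simp add: Z len)
  show "gen_degs Z (i + 2) = up (gen_degs Z i)" using obj_up[OF X] obj_up[OF Y] by (simp add: Z)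
  assume x: "x : $(Fr (r + q))"
  note f = fc[OF x]
  show "diff Z i (diff Z (i + 1) x) = lmul (r + q) x" using obj_diff[OF X, folded r_def, OF f(1)] obj_diff[OF Y, folded q_def, OF f(2)]
   unfolding D[OF x] D[OF jc[OF oc(1)[OF f(1)] oc(2)[OF f(2)]]] fj[OF oc(1)[OF f(1)] oc(2)[OF f(2)]] by (simp add: lm)
 qed (auto simp: Z len)
 show "nhom Z X (%_. fst_part r)" "nhom Z Y (%_. snd_part r q)" using gf gs D fj oc fc unfolding nhom_def rk by auto
 have z: "\<zero>\<^bsub>Fr k\<^esub> : $(Fr k)" for k by (rule Fr.M.zero_closed)
 have dz: "diff X i \<zero>\<^bsub>Fr r\<^esub> = \<zero>\<^bsub>Fr r\<^esub>" "diff Y i \<zero>\<^bsub>Fr q\<^esub> = \<zero>\<^bsub>Fr q\<^esub>" for i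
  using rlin_zero[OF rmodule_Fr rmodule_Fr obj_rlin[OF X]] rlin_zero[OF rmodule_Fr rmodule_Fr obj_rlin[OF Y]] by (simp_all add: r_def q_def)
 have gz: "ghom S L (mf_term S X i) (%_. \<zero>\<^bsub>Fr r\<^esub>)" "ghom S L (mf_term S Y i) (%_. \<zero>\<^bsub>Fr q\<^esub>)" for L :: "('s, 'n, int) graded_module" and i
 proof -
  have "ghom S L (mf_term S X i) (%_. \<zero>\<^bsub>mf_term S X i\<^esub>)" "ghom S L (mf_term S Y i) (%_. \<zero>\<^bsub>mf_term S Y i\<^esub>)"
   by (rule ghom_zero[OF gmodule_free])+
  then show "ghom S L (mf_term S X i) (%_. \<zero>\<^bsub>Fr r\<^esub>)" "ghom S L (mf_term S Y i) (%_. \<zero>\<^bsub>Fr q\<^esub>)" by (simp_all add: len)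
 qed
 show "nhom X Z (%_ a. join r q a \<zero>\<^bsub>Fr q\<^esub>)" "nhom Y Z (%_ b. join r q \<zero>\<^bsub>Fr r\<^esub> b)"
  using gj[OF ghom_id gz(2)] gj[OF gz(1) ghom_id] D[OF jc] fj z dz oc unfolding nhom_def by (auto simp flip: r_def q_def)
 show "x = join r q (fst_part r x) \<zero>\<^bsub>Fr q\<^esub> \<oplus>\<^bsub>Fr (r + q)\<^esub> join r q \<zero>\<^bsub>Fr r\<^esub> (snd_part r q x)" if x: "x : $(Fr (r + q))" for x
  by (rule free_eqI[OF x Fr.M.a_closed[OF jc[OF fc(1)[OF x] z] jc[OF z fc(2)[OF x]]]])
   (use co[OF x] in \<open>auto simp: free_simps(2,3) join_def fst_part_def snd_part_def\<close>)
 show "fst_part r (join r q a \<zero>\<^bsub>Fr q\<^esub>) = a & snd_part r q (join r q a \<zero>\<^bsub>Fr q\<^esub>) = \<zero>\<^bsub>Fr q\<^esub>" if "a : $(Fr r)" for a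
  using fj[OF that z] by simp
 show "fst_part r (join r q \<zero>\<^bsub>Fr r\<^esub> b) = \<zero>\<^bsub>Fr r\<^esub> & snd_part r q (join r q \<zero>\<^bsub>Fr r\<^esub> b) = b" if "b : $(Fr q)" for b
  using fj[OF z that] by simp
qed

end

context graded_hypersurface
begin

text \<open>A morphism through the sum splits along the projections and inclusions, and two
  morphisms through the summands can be paired. This reduces \<open>calG\<close> to
  \<open>phi_left\<close> and \<open>phi_right\<close> separately.\<close>

lemma sum_factoring:
 assumes X: "obj X" and Y: "obj Y" and W: "obj W" and V: "obj V"
 defines "Z \<equiv> factorization_sum S X Y"
 shows "H : $(Hom NN W Z) ==> G : $(Hom NN Z V) ==> \<exists>k\<in>$(Hom NN W X). \<exists>g\<in>$(Hom NN X V).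
   \<exists>h\<in>$(Hom NN W Y). \<exists>e\<in>$(Hom NN Y V).
    Comp NN W Z V G H = Comp NN W X V g k \<otimes>\<^bsub>Hom NN W V\<^esub> Comp NN W Y V e h"
  and "k : $(Hom NN W X) ==> g : $(Hom NN X V) ==> h : $(Hom NN W Y) ==> e : $(Hom NN Y V) ==>
   \<exists>H\<in>$(Hom NN W Z). \<exists>G\<in>$(Hom NN Z V).
    Comp NN W Z V G H = Comp NN W X V g k \<otimes>\<^bsub>Hom NN W V\<^esub> Comp NN W Y V e h"
proof -
 interpret C: precat NN by unfold_locales (rule NMF_preadditive)
 interpret WV: comm_group "Hom NN W V" by (rule C.hom_group) (use W V in simp_all)
 interpret Fr: rmodule S "Fr n" for n by (rule rmodule_Fr)
 let ?r = "rk X" and ?q = "rk Y"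
 let ?in1 = "%a. join ?r ?q a \<zero>\<^bsub>Fr ?q\<^esub>" and ?in2 = "%b. join ?r ?q \<zero>\<^bsub>Fr ?r\<^esub> b"
 note s = sum_obj[OF X Y, folded Z_def]
 note Z = s(1)
 let ?R = "%W h i. restrict (h i) ($(Fk W))"
 have cc: "Comp NN W U V b a : $(Hom NN W V)" if "obj U" "a : $(Hom NN W U)" "b : $(Hom NN U V)" for U a b
  using C.comp_closed[of W U V b a] that W V by simp
 note len = obj_len[OF W]
 note Vl = obj_len[OF V]
 {
  assume H: "H : $(Hom NN W Z)" and G: "G : $(Hom NN Z V)"
  note H' = Hom_nhom[OF W Z H] and G' = Hom_nhom[OF Z V G]
  note k = restrict_nhom[OF W X nhom_comp[OF W Z s(3) H']] and h = restrict_nhom[OF W Y nhom_comp[OF W Z s(4) H']]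
  note g = restrict_nhom[OF X V nhom_comp[OF X Z G' s(5)]] and e = restrict_nhom[OF Y V nhom_comp[OF Y Z G' s(6)]]
  have "Comp NN W Z V G H = Comp NN W X V (?R X (%i x. G i (?in1 x))) (?R W (%i x. fst_part ?r (H i x)))
    \<otimes>\<^bsub>Hom NN W V\<^esub> Comp NN W Y V (?R Y (%i x. G i (?in2 x))) (?R W (%i x. snd_part ?r ?q (H i x)))"
  proof (rule Hom_eqI[OF W V cc[OF Z H G] WV.m_closed[OF cc[OF X k g] cc[OF Y h e]]])
   fix i x assume x: "x : $(Fk W)"
   have y: "H i x : $(Fk Z)" by (rule nhom_closed[OF W Z H' x])
   have f: "fst_part ?r (H i x) : $(Fr ?r)" "snd_part ?r ?q (H i x) : $(Fr ?q)"
    by (rule nhom_closed[OF Z X s(3) y] nhom_closed[OF Z Y s(4) y])+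
   have "H i x = ?in1 (fst_part ?r (H i x)) \<oplus>\<^bsub>Fk Z\<^esub> ?in2 (snd_part ?r ?q (H i x))" using s(7)[of "H i x"] y s(2) by simp
   from arg_cong[OF this, of "G i"]
   have "G i (H i x) = G i (?in1 (fst_part ?r (H i x))) \<oplus>\<^bsub>Fk V\<^esub> G i (?in2 (snd_part ?r ?q (H i x)))"
    using rlin_add[OF nhom_rlin[OF Z V G', of i] nhom_closed[OF X Z s(5) f(1)] nhom_closed[OF Y Z s(6) f(2)]] by simp
   then show "Comp NN W Z V G H i x = (Comp NN W X V (?R X (%i x. G i (?in1 x))) (?R W (%i x. fst_part ?r (H i x)))
     \<otimes>\<^bsub>Hom NN W V\<^esub> Comp NN W Y V (?R Y (%i x. G i (?in2 x))) (?R W (%i x. snd_part ?r ?q (H i x)))) i x"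
    using x f by (simp add: compose_def len Vl)
  qed
  then show "\<exists>k\<in>$(Hom NN W X). \<exists>g\<in>$(Hom NN X V). \<exists>h\<in>$(Hom NN W Y). \<exists>e\<in>$(Hom NN Y V).
    Comp NN W Z V G H = Comp NN W X V g k \<otimes>\<^bsub>Hom NN W V\<^esub> Comp NN W Y V e h" using k g h e by blast
 next
  assume k: "k : $(Hom NN W X)" and g: "g : $(Hom NN X V)" and h: "h : $(Hom NN W Y)" and e: "e : $(Hom NN Y V)"
  note k' = Hom_nhom[OF W X k] and g' = Hom_nhom[OF X V g] and h' = Hom_nhom[OF W Y h] and e' = Hom_nhom[OF Y V e]
  let ?H = "%i x. ?in1 (k i x) \<oplus>\<^bsub>Fk Z\<^esub> ?in2 (h i x)" and ?G = "%i x. g i (fst_part ?r x) \<oplus>\<^bsub>Fk V\<^esub> e i (snd_part ?r ?q x)"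
  have H: "nhom W Z ?H" by (rule nhom_sum[OF W Z nhom_comp[OF W X s(5) k'] nhom_comp[OF W Y s(6) h']])
  have G: "nhom Z V ?G" by (rule nhom_sum[OF Z V nhom_comp[OF Z X g' s(3)] nhom_comp[OF Z Y e' s(4)]])
  note RH = restrict_nhom[OF W Z H] and RG = restrict_nhom[OF Z V G]
  have "Comp NN W Z V (?R Z ?G) (?R W ?H) = Comp NN W X V g k \<otimes>\<^bsub>Hom NN W V\<^esub> Comp NN W Y V e h"
  proof (rule Hom_eqI[OF W V cc[OF Z RH RG] WV.m_closed[OF cc[OF X k g] cc[OF Y h e]]])
   fix i x assume x: "x : $(Fk W)"
   have kx: "k i x : $(Fr ?r)" and hx: "h i x : $(Fr ?q)" by (rule nhom_closed[OF W X k' x] nhom_closed[OF W Y h' x])+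
   have in1: "?in1 (k i x) : $(Fk Z)" and in2: "?in2 (h i x) : $(Fk Z)" by (rule nhom_closed[OF X Z s(5) kx] nhom_closed[OF Y Z s(6) hx])+
   have "fst_part ?r (?H i x) = k i x" "snd_part ?r ?q (?H i x) = h i x"
    using rlin_add[OF nhom_rlin[OF Z X s(3)] in1 in2] rlin_add[OF nhom_rlin[OF Z Y s(4)] in1 in2] s(8)[OF kx] s(9)[OF hx] kx hx
    by (simp_all add: Fr.M.r_zero Fr.M.l_zero)
   then show "Comp NN W Z V (?R Z ?G) (?R W ?H) i x = (Comp NN W X V g k \<otimes>\<^bsub>Hom NN W V\<^esub> Comp NN W Y V e h) i x"
    using x nhom_closed[OF W Z H x, of i] by (simp add: compose_def len Vl)
  qed
  then show "\<exists>H\<in>$(Hom NN W Z). \<exists>G\<in>$(Hom NN Z V).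
    Comp NN W Z V G H = Comp NN W X V g k \<otimes>\<^bsub>Hom NN W V\<^esub> Comp NN W Y V e h" using RH RG by blast
 }
qed

end

context hypersurface_modules
begin

lemma cok_phi_right: "cok (phi_right S f d n) : free_objects A"
 and cq_phi_right: "cover n (cok (phi_right S f d n)) (cq (phi_right S f d n))"
 and cq_phi_right_zero: "x : $(Fl n) ==>
  cq (phi_right S f d n) x = \<zero>\<^bsub>cok (phi_right S f d n)\<^esub> \<longleftrightarrow> x : lml n ` $(Fl n)"
proof -
 note Z = phi_right_simps[where m = n]
 show c: "cover n (cok (phi_right S f d n)) (cq (phi_right S f d n))" using cok_cover[OF Z(1)] Z(3) by simp
 have z: "cq (phi_right S f d n) x = \<zero>\<^bsub>cok (phi_right S f d n)\<^esub> \<longleftrightarrow> x : lml n ` $(Fl n)"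
  if "x : $(Fl n)" for x using cq_zero_iff[OF Z(1), of x] that Z(2,4) by (simp add: image_cong[OF refl Z(4)])
 then show "x : $(Fl n) ==>
  cq (phi_right S f d n) x = \<zero>\<^bsub>cok (phi_right S f d n)\<^esub> \<longleftrightarrow> x : lml n ` $(Fl n)" .
 show "cok (phi_right S f d n) : free_objects A"
  by (rule free_objectsI[OF cok_gmodule[OF Z(1)] cover_fg[OF cok_gmodule[OF Z(1)] c] c z])
qed

text \<open>The precover of \<open>N\<close> is the free \<open>A\<close>-module \<open>F/fF\<close>
  obtained from a cover of \<open>N\<close> by \<open>F\<close>. A map from another free module
  lifts to the covers over \<open>S\<close> and descends again.\<close>

lemma free_factor_data: "factor_data TT (free_objects A)" unfolding TR_def
proof (rule factor_data_full_subcategory, rule factor_dataI[OF grmod_preadditive])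
 show "free_objects A \<subseteq> Obj (grmod A :: (('s set, 'm, int) graded_module, 'm => 'm) precategory)" by (auto simp: free_objects_def)
 fix N :: "('s set, 'm, int) graded_module" assume "N : Obj (grmod A)"
 then have N: "gmodule A N" "finitely_generated A N" by simp_all
 obtain n r where r: "cover n N r" using cover_exists[OF N] by blast
 let ?P = "cok (phi_right S f d n)" and ?c = "cq (phi_right S f d n)"
 note P = cok_gmodule[OF phi_right_simps(1)[where m = n]]
 have "ghom S (graded_free S n) (gres p N) r" using r by (simp add: cover_def)
 then obtain e where e: "e : graded_hom A ?P N" "!!x. x : $(Fl n) ==> e (?c x) = r x"
  using lift_through_free[OF P N(1) cq_phi_right] cq_phi_right_zero by (metis (no_types, lifting))
 have "\<exists>k\<in>graded_hom A Q ?P. g = compose ($Q) e k" if Q: "Q : free_objects A" and g: "g : graded_hom A Q N" for Q g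
 proof -
  obtain m q where QA: "gmodule A Q" and q: "cover m Q q"
   and ker: "!!x. x : $(Fl m) ==> q x = \<zero>\<^sub>Q \<longleftrightarrow> x : lml m ` $(Fl m)"
   by (rule free_objectsD[OF Q]) (rule that; assumption)
  have "ghom A Q N g" using g by (simp add: graded_hom_iff)
  then obtain t where t: "ghom S (graded_free S m) (graded_free S n) t" "!!x. x : $(Fl m) ==> r (t x) = g (q x)"
   using cover_lift[OF N(1) q r] by blast
  have "ghom S (graded_free S m) (gres p ?P) (%x. ?c (t x))" using ghom_comp[OF t(1)] cq_phi_right unfolding cover_def by blast
  then obtain k where k: "k : graded_hom A Q ?P" "!!x. x : $(Fl m) ==> k (q x) = ?c (t x)"
   using lift_through_free[OF QA P q] ker by (metis (no_types, lifting))
  have tc: "t x : $(Fl n)" if "x : $(Fl m)" for x using rlin_closed[OF ghomD(1)[OF t(1)]] that by simp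
  have "g = compose ($Q) e k"
   by (rule cover_eqI[OF q]) (use g in \<open>simp_all add: graded_hom_iff compose_def k(2) e(2) tc t(2) rlin_closed[OF cover_rlin[OF q], simplified]\<close>)
  with k(1) show ?thesis by blast
 qed
 then show "\<exists>P\<in>free_objects A. \<exists>e\<in>$(Hom (grmod A) P N). \<forall>Q\<in>free_objects A. \<forall>g\<in>$(Hom (grmod A) Q N).
   \<exists>k\<in>$(Hom (grmod A) Q P). g = Comp (grmod A) Q P N e k" using e(1) cok_phi_right by (intro bexI[of _ ?P] bexI[of _ e]) auto
qed

text \<open>The \<open>phi_left\<close> part of a morphism vanishes under the cokernel functor, and
  the \<open>phi_right\<close> part passes through a free module. Conversely, if the map of
  cokernels factors through a free module, fullness lifts both factors to a composite
  \<open>t\<close> through some \<open>phi_right\<close>. The cokernel map of \<open>h - t\<close>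
  is zero, so \<open>h - t\<close> passes through some \<open>phi_left\<close>, and
  \<open>h = (h - t) + t\<close> through the sum.\<close>

lemma factoring_calG:
 assumes X: "obj X" and Y: "obj Y" shows "factoring_morphisms NN (calG S f d) X Y =
  {h : $(Hom NN X Y). cokmap X Y h : factoring_morphisms TT (free_objects A) (cok X) (cok Y)}"
proof (intro equalityI subsetI)
 interpret C: precat NN by unfold_locales (rule NMF_preadditive)
 interpret D: factor_data TT "free_objects A" by (rule free_factor_data)
 have F: "is_functor NN TT cok cokmap" and
  add: "cokmap X Y (g \<otimes>\<^bsub>Hom NN X Y\<^esub> h) = cokmap X Y g \<otimes>\<^bsub>Hom TT (cok X) (cok Y)\<^esub> cokmap X Y h"
  if "g : $(Hom NN X Y)" "h : $(Hom NN X Y)" for g h using cok_additive_functor X Y that unfolding additive_functor_def by auto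
 have O: "cok X : Obj TT" "cok Y : Obj TT" using presents_TR[OF _ presents_cok] X Y by blast+
 interpret XY: comm_group "Hom NN X Y" by (rule C.hom_group) (use X Y in simp_all)
 interpret DXY: comm_group "Hom TT (cok X) (cok Y)" by (rule D.hom_group[OF O])
 have cc: "Comp NN X Z Y g k : $(Hom NN X Y)" if "obj Z" "k : $(Hom NN X Z)" "g : $(Hom NN Z Y)" for Z g k
  using C.comp_closed[of X Z Y g k] that X Y by simp
 have FC: "cokmap X Y (Comp NN X Z Y g k) = Comp TT (cok X) (cok Z) (cok Y) (cokmap Z Y g) (cokmap X Z k)"
  if "obj Z" "k : $(Hom NN X Z)" "g : $(Hom NN Z Y)" for Z g k
  using cok_additive_functor that X Y unfolding additive_functor_def is_functor_def by simp
 {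
  fix h assume "h : factoring_morphisms NN (calG S f d) X Y"
  then obtain m n where "\<exists>G H. H : $(Hom NN X (factorization_sum S (phi_left S f d m) (phi_right S f d n))) &
    G : $(Hom NN (factorization_sum S (phi_left S f d m) (phi_right S f d n)) Y) &
    h = Comp NN X (factorization_sum S (phi_left S f d m) (phi_right S f d n)) Y G H" unfolding factoring_morphisms_def calG_def by blast
  then obtain k g l e where k: "k : $(Hom NN X (phi_left S f d m))" "g : $(Hom NN (phi_left S f d m) Y)"
   and l: "l : $(Hom NN X (phi_right S f d n))" "e : $(Hom NN (phi_right S f d n) Y)"
   and h: "h = Comp NN X (phi_left S f d m) Y g k \<otimes>\<^bsub>Hom NN X Y\<^esub> Comp NN X (phi_right S f d n) Y e l"
   using sum_factoring(1)[OF phi_left_simps(1) phi_right_simps(1) X Y] by (metis (no_types, lifting))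
  note gk = cc[OF phi_left_simps(1) k] and el = cc[OF phi_right_simps(1) l]
  have "Comp NN X (phi_left S f d m) Y g k : factoring_morphisms NN (calF S f d) X Y"
   unfolding factoring_morphisms_def calF_def using k by blast
  then have 1: "cokmap X Y (Comp NN X (phi_left S f d m) Y g k) = \<one>\<^bsub>Hom TT (cok X) (cok Y)\<^esub>"
   unfolding factoring_calF[OF X Y] by blast
  have 2: "cokmap X Y (Comp NN X (phi_right S f d n) Y e l) : factoring_morphisms TT (free_objects A) (cok X) (cok Y)"
   unfolding FC[OF phi_right_simps(1) l] factoring_morphisms_def
   using cok_phi_right cokmap(1)[OF X phi_right_simps(1) l(1)] cokmap(1)[OF phi_right_simps(1) Y l(2)] by auto
  have "cokmap X Y h = cokmap X Y (Comp NN X (phi_right S f d n) Y e l)"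
   unfolding h add[OF gk el] 1 by (rule DXY.l_one) (use cokmap(1)[OF X Y el] in simp)
  moreover have "h : $(Hom NN X Y)" unfolding h by (rule XY.m_closed[OF gk el])
  ultimately show "h : {h : $(Hom NN X Y). cokmap X Y h : factoring_morphisms TT (free_objects A) (cok X) (cok Y)}" using 2 by simp
 next
  fix h assume "h : {h : $(Hom NN X Y). cokmap X Y h : factoring_morphisms TT (free_objects A) (cok X) (cok Y)}"
  then have h: "h : $(Hom NN X Y)" and "\<exists>(P :: ('s set, 'm, int) graded_module) b a. cokmap X Y h = compose ($(cok X)) b a &
    P : free_objects A & a : graded_hom A (cok X) P & b : graded_hom A P (cok Y)" by (simp_all add: factoring_morphisms_def)
  then obtain P :: "('s set, 'm, int) graded_module" and b a where P: "P : free_objects A"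
   and a: "a : graded_hom A (cok X) P" and b: "b : graded_hom A P (cok Y)" and ba: "cokmap X Y h = compose ($(cok X)) b a" by blast
  obtain n q where PA: "gmodule A P" and q: "cover n P q"
   and ker: "!!x. x : $(Fl n) ==> q x = \<zero>\<^sub>P \<longleftrightarrow> x : lml n ` $(Fl n)"
   by (rule free_objectsD[OF P]) (rule that; assumption)
  let ?Z = "phi_right S f d n"
  note Z = phi_right_simps(1)[where m = n]
  have "q x = \<zero>\<^sub>P \<longleftrightarrow> cq ?Z x = \<zero>\<^bsub>cok ?Z\<^esub>" if "x : $(Fl n)" for x
   using ker cq_phi_right_zero that by blast
  \<comment> \<open>The given free module is replaced by an isomorphic cokernel of some
    \<open>phi_right\<close>, since fullness lifts only maps between chosen cokernels.\<close>
  from cover_iso[OF PA cok_gmodule[OF Z] q cq_phi_right this]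
  obtain i j where i: "i : graded_hom A P (cok ?Z)" and j: "j : graded_hom A (cok ?Z) P" and ji: "!!y. y : $P ==> j (i y) = y"
   by (metis (no_types, lifting))
  obtain \<alpha> where \<alpha>: "\<alpha> : $(Hom NN X ?Z)" "cokmap X ?Z \<alpha> = compose ($(cok X)) i a"
   by (rule cok_full[OF X Z graded_hom_comp[OF cok_gmodule[OF X] i a]])
  obtain \<beta> where \<beta>: "\<beta> : $(Hom NN ?Z Y)" "cokmap ?Z Y \<beta> = compose ($(cok ?Z)) b j"
   by (rule cok_full[OF Z Y graded_hom_comp[OF cok_gmodule[OF Z] b j]])
  let ?t = "Comp NN X ?Z Y \<beta> \<alpha>"
  note t = cc[OF Z \<alpha>(1) \<beta>(1)]
  have Ft: "cokmap X Y ?t = cokmap X Y h"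
   unfolding FC[OF Z \<alpha>(1) \<beta>(1)] \<alpha>(2) \<beta>(2) ba using graded_hom_closed[OF a] graded_hom_closed[OF i] ji
   by (auto simp: compose_def intro!: restrict_ext)
  define \<nu> where "\<nu> = h \<otimes>\<^bsub>Hom NN X Y\<^esub> inv\<^bsub>Hom NN X Y\<^esub> ?t"
  have \<nu>: "\<nu> : $(Hom NN X Y)" unfolding \<nu>_def by (rule XY.m_closed[OF h XY.inv_closed[OF t]])
  have h\<nu>: "h = \<nu> \<otimes>\<^bsub>Hom NN X Y\<^esub> ?t" unfolding \<nu>_def
   using XY.m_assoc[OF h XY.inv_closed[OF t] t] XY.l_inv[OF t] XY.r_one[OF h] by (simp only:)
  have "cokmap X Y \<nu> \<otimes>\<^bsub>Hom TT (cok X) (cok Y)\<^esub> cokmap X Y h = cokmap X Y h"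
   using add[OF \<nu> t] unfolding h\<nu>[symmetric] Ft by simp
  moreover have "cokmap X Y \<nu> : $(Hom TT (cok X) (cok Y))" "cokmap X Y h : $(Hom TT (cok X) (cok Y))"
   using cokmap(1)[OF X Y] \<nu> h by simp_all
  ultimately have "cokmap X Y \<nu> = \<one>\<^bsub>Hom TT (cok X) (cok Y)\<^esub>" using DXY.l_cancel_one[of "cokmap X Y h" "cokmap X Y \<nu>"] DXY.r_cancel_one[of "cokmap X Y h" "cokmap X Y \<nu>"] by (simp only:)
  then have "\<nu> : factoring_morphisms NN (calF S f d) X Y" unfolding factoring_calF[OF X Y] by (intro CollectI conjI \<nu>)
  then obtain m g k where k: "k : $(Hom NN X (phi_left S f d m))" "g : $(Hom NN (phi_left S f d m) Y)"
   and \<nu>gk: "\<nu> = Comp NN X (phi_left S f d m) Y g k" unfolding factoring_morphisms_def calF_def by blast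
  have "\<exists>H\<in>$(Hom NN X (factorization_sum S (phi_left S f d m) ?Z)). \<exists>G\<in>$(Hom NN (factorization_sum S (phi_left S f d m) ?Z) Y).
    Comp NN X (factorization_sum S (phi_left S f d m) ?Z) Y G H = h"
   using sum_factoring(2)[OF phi_left_simps(1) Z X Y k \<alpha>(1) \<beta>(1)] unfolding \<nu>gk[symmetric] h\<nu>[symmetric] .
  then show "h : factoring_morphisms NN (calG S f d) X Y" unfolding factoring_morphisms_def calG_def by blast
 }
qed

lemma equivalences:
 "equivalent_categories (factor_category NN (calF S f d)) TT &
  equivalent_categories (factor_category NN (calG S f d)) (factor_category TT (free_objects A))"
proof
 have T: "preadditive_category TT" unfolding TR_def by (rule preadditive_full_subcategory[OF grmod_preadditive])
 have full: "\<exists>h\<in>$(Hom NN X Y). cokmap X Y h = k"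
  if "X : Obj NN" "Y : Obj NN" "k : $(Hom TT (cok X) (cok Y))" for X Y k using cok_full[of X Y k] that by auto
 have ess: "\<exists>X\<in>Obj NN. isomorphisms TT (cok X) M ~= {}" if "M : Obj TT" for M
  using cok_dense[OF that] unfolding NMF_simps(1) by blast
 show "equivalent_categories (factor_category NN (calF S f d)) TT"
  by (rule factor_category_equivalence[OF NMF_preadditive T cok_additive_functor full ess])
   (use factoring_calF in \<open>unfold NMF_simps(1), blast+\<close>)
 show "equivalent_categories (factor_category NN (calG S f d)) (factor_category TT (free_objects A))"
  by (rule factor_category_equivalence'[OF NMF_preadditive free_factor_data cok_additive_functor full ess])
   (use factoring_calG in \<open>unfold NMF_simps(1), blast+\<close>)
qed

end

text \<open>A preimage of \<open>c\<close> can be replaced by its component of degree zero, which is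
  a scalar because \<open>T\<close> is connected. A nonzero scalar has an inverse in the
  field.\<close>

lemma graded_image_units:
 assumes T: "connected_graded_algebra K T" and S: "graded_algebra K S"
  and \<pi>: "\<pi> : graded_algebra_hom K T S" "\<pi> ` $T = $S" and c: "c : part S 0" "c ~= \<zero>\<^sub>S"
 shows "\<exists>b\<in>$S. c \<otimes>\<^sub>S b = \<one>\<^sub>S"
proof -
 have Tg: "graded_algebra K T" using T by (simp add: connected_graded_algebra_def)
 interpret K: Ring.field K using S by (simp add: graded_algebra_def)
 interpret S: graded_ring S by (rule graded_algebra_ring[OF S])
 interpret T: graded_ring T by (rule graded_algebra_ring[OF Tg])
 interpret SM: Module.module K S using S by (simp add: graded_algebra_def)
 have hom: "\<pi> : ring_hom T S" and sm: "!!a x. a : $K ==> x : $T ==> \<pi> (a \<odot>\<^sub>T x) = a \<odot>\<^sub>S \<pi> x"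
  and pt: "!!i x. x : part T i ==> \<pi> x : part S i"
  using \<pi>(1) by (auto simp: graded_algebra_hom_def image_subset_iff)
 obtain t where t: "t : $T" "c = \<pi> t" using S.Sg.part_closed[OF c(1)] unfolding \<pi>(2)[symmetric] by blast
 have "hc S (\<pi> t) 0 = \<pi> (hc T t 0)" by (rule hc_hom[OF T.Sg.graded_group_axioms S.Sg.graded_group_axioms _ _ pt t(1)])
   (use ring_hom_closed[OF hom] ring_hom_add[OF hom] in auto)
 then have ct: "c = \<pi> (hc T t 0)" using S.Sg.hc_homogeneous[OF c(1), of 0] t(2) by simp
 have "hc T t 0 : (%a. a \<odot>\<^sub>T \<one>\<^sub>T) ` $K"
  using T T.Sg.hc_part[OF t(1), of 0] by (simp add: connected_graded_algebra_def bij_betw_def)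
 then obtain a where a: "a : $K" "hc T t 0 = a \<odot>\<^sub>T \<one>\<^sub>T" by blast
 have ca: "c = a \<odot>\<^sub>S \<one>\<^sub>S" using ct a sm[OF a(1) T.one_closed] ring_hom_one[OF hom] by simp
 have "a ~= \<zero>\<^sub>K" using c(2) ca SM.smult_l_null[OF S.one_closed] by auto
 then have ia: "inv\<^bsub>K\<^esub> a : $K" "a \<otimes>\<^sub>K inv\<^bsub>K\<^esub> a = \<one>\<^sub>K" using a(1) K.field_Units K.Units_inv_closed K.Units_r_inv by auto
 have "c \<otimes>\<^sub>S (inv\<^bsub>K\<^esub> a \<odot>\<^sub>S \<one>\<^sub>S) = a \<odot>\<^sub>S (inv\<^bsub>K\<^esub> a \<odot>\<^sub>S \<one>\<^sub>S)"
 proof -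
  have "(a \<odot>\<^sub>S \<one>\<^sub>S) \<otimes>\<^sub>S y = a \<odot>\<^sub>S (\<one>\<^sub>S \<otimes>\<^sub>S y)" if "y : $S" for y
   using S a(1) that unfolding graded_algebra_def by simp
  then show ?thesis unfolding ca using SM.smult_closed[OF ia(1) S.one_closed] by simp
 qed
 also have "\<dots> = \<one>\<^sub>S" using SM.smult_assoc1[OF a(1) ia(1) S.one_closed] ia(2) SM.smult_one[OF S.one_closed] by simp
 finally show ?thesis using SM.smult_closed[OF ia(1) S.one_closed] by blast
qed

theorem theorem1p3:
  fixes K :: "('k, 'x) ring_scheme"
    and T :: "('k, 't, nat) graded_module"
    and S :: "('k, 's, nat) graded_module"
    and \<pi> :: "'t \<Rightarrow> 's"
    and f :: 's and d :: nat
    and u :: "'s list \<Rightarrow> 'm"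
  assumes "Ring.field K"
    and "connected_graded_algebra K T" and "right_noetherian T" and "right_global_dim T < \<infinity>"
    and "graded_algebra K S" and "\<pi> \<in> graded_algebra_hom K T S" and "\<pi> ` carrier T = carrier S"
    and "d \<ge> 1" and "f \<in> part S d" and "regular_element S f" and "normal_element S f"
    and "inj u"
  shows "equivalent_categories
           (factor_category (NMF S f d) (calF S f d))
           (TR S f :: (('s set, 'm, int) graded_module, 'm \<Rightarrow> 'm) precategory) \<and>
         equivalent_categories
           (factor_category (NMF S f d) (calG S f d))
           (factor_category (TR S f :: (('s set, 'm, int) graded_module, 'm \<Rightarrow> 'm) precategory)
              (free_objects (hypersurface S f)))"
proof -
 interpret S: graded_ring S by (rule graded_algebra_ring) fact
 have "\<pi> : ring_hom T S" using assms(6) by (simp add: graded_algebra_hom_def)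
 then have "noeth S" using right_noetherian_noeth right_noetherian_image[OF assms(3) S.ring_axioms _ assms(7)] by blast
 then interpret hypersurface_modules S f d u using assms(8-12) graded_image_units[OF assms(2,5,6,7)] by unfold_locales auto
 show ?thesis by (rule equivalences)
qed

end
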